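(* Let $b,\sigma:\mathbb{R}\times\mathcal{P}_2(\mathbb{R})\to\mathbb{R}$ satisfy, for some constant $L>0$, $|b(x,\mu)-b(y,\nu)|+|\sigma(x,\mu)-\sigma(y,\nu)|\le L(|x-y|+\mathcal{W}_2(\mu,\nu))$ for all $x,y\in\mathbb{R}$, $\mu,\nu\in\mathcal{P}_2(\mathbb{R})$; let $h:\mathbb{R}\to\mathbb{R}$ be increasing with $m|x-y|\le|h(x)-h(y)|\le M|x-y|$ for all $x,y$, for some $0<m\le M$; and let $\xi$ be an $\mathcal{F}_0$-measurable random variable with $\mathbb{E}[\xi^2]<\infty$ and $\mathbb{E}[h(\xi)]\ge0$. Let $(X,K)$ be the unique deterministic flat solution of the mean reflected McKean-Vlasov SDE with data $(\xi,b,\sigma,h)$, and let $T>0$. Then: (i) For all $p$, there exists a positive constant $C_p$, depending on $T,b,\sigma$ and $h$, such that $\mathbb{E}[\sup_{t\le T}|X_t|^p]\le C_p(1+\mathbb{E}[|\xi|^p])$. (ii) There exists a positive constant $C$, depending on $T,b,\sigma$ and $h$, such that $|K_t-K_s|\le C|t-s|^{1/2}$ for all $0\le s\le t\le T$. (iii) For all $p\ge1$ such that $\xi\in L^p$, there is a constant $C$ such that $\mathbb{E}[|X_t-X_s|^p]\le C|t-s|^{p/2}$ for all $0\le s\le t\le T$.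
   Context: $(\Omega,\mathcal{F},\{\mathcal{F}_t\},\mathbb{P})$ is a complete filtered probability space with a standard one-dimensional $\{\mathcal{F}_t\}$-Brownian motion $B$; $\mathcal{L}_Z$ is the law of $Z$; $\mathcal{P}_2(\mathbb{R})$ is the set of probability measures on $\mathbb{R}$ with finite second moment, $\mathcal{W}_2$ the 2-Wasserstein distance. The mean reflected McKean-Vlasov SDE with data $(\xi,b,\sigma,h)$ is $$X_t=\xi+\int_0^tb(X_s,\mathcal{L}_{X_s})ds+\int_0^t\sigma(X_s,\mathcal{L}_{X_s})dB_s+K_t,\quad \mathbb{E}[h(X_t)]\ge0,\quad\int_0^t\mathbb{E}[h(X_s)]dK_s=0,\quad t\ge0.$$ A deterministic flat solution is a pair $(X,K)$ satisfying it, with $X$ continuous adapted and $K$ a non-decreasing continuous deterministic function, $K_0=0$. Under the stated assumptions it exists and is unique.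
   Formalization: In (i) for 0<p<2 and in (ii), the constant may also depend on a bound for E[ξ²] (independence of ξ is false there); for p≥2 in (i) it is independent of ξ. "For all p" in (i) is read as p>0. *)

theory Defs
  imports "HOL-Probability.Probability"
begin

section \<open>Probability measures with finite second moment\<close>

definition P2 :: "real measure set" where
  "P2 = {\<mu>. prob_space \<mu> \<and> sets \<mu> = sets borel \<and> integrable \<mu> (\<lambda>x. x\<^sup>2)}"

definition couplings :: "real measure \<Rightarrow> real measure \<Rightarrow> (real \<times> real) measure set" where
  "couplings \<mu> \<nu> = {\<pi>. prob_space \<pi> \<and> sets \<pi> = sets (borel \<Otimes>\<^sub>M borel)
     \<and> distr \<pi> borel fst = \<mu> \<and> distr \<pi> borel snd = \<nu>}"

text \<open>Meaningful on \<^const>\<open>P2\<close> only: there the product measure is a coupling and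
  every coupling has finite quadratic cost.\<close>

definition W2 :: "real measure \<Rightarrow> real measure \<Rightarrow> real" where
  "W2 \<mu> \<nu> = sqrt (INF \<pi>\<in>couplings \<mu> \<nu>. \<integral>z. (fst z - snd z)\<^sup>2 \<partial>\<pi>)"

definition law :: "'a measure \<Rightarrow> ('a \<Rightarrow> real) \<Rightarrow> real measure" where
  "law P Z = distr P borel Z"


section \<open>Filtered probability spaces and Brownian motion\<close>

text \<open>Time is \<open>[0,\<infinity>)\<close> inside \<^typ>\<open>real\<close>. Only the sigma-algebras \<open>F t\<close> with \<open>t \<ge> 0\<close> matter;
  a filtration on \<open>[0,\<infinity>)\<close> extends by \<open>F t = F 0\<close> for \<open>t < 0\<close>.\<close>

locale complete_filtered_prob_space =
  prob_space P + complete_measure P + filtration "space P" F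
  for P :: "'a measure" and F :: "real \<Rightarrow> 'a measure" +
  assumes subalgebra_F: "subalgebra P (F t)"
    and null_sets_F: "null_sets P \<subseteq> sets (F 0)"

definition adapted :: "(real \<Rightarrow> 'a measure) \<Rightarrow> (real \<Rightarrow> 'a \<Rightarrow> real) \<Rightarrow> bool" where
  "adapted F X \<longleftrightarrow> (\<forall>t\<ge>0. X t \<in> borel_measurable (F t))"

definition continuous_paths :: "'a measure \<Rightarrow> (real \<Rightarrow> 'a \<Rightarrow> real) \<Rightarrow> bool" where
  "continuous_paths P X \<longleftrightarrow> (AE \<omega> in P. continuous_on {0..} (\<lambda>t. X t \<omega>))"

definition progressively_measurable ::
    "(real \<Rightarrow> 'a measure) \<Rightarrow> (real \<Rightarrow> 'a \<Rightarrow> real) \<Rightarrow> bool" where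
  "progressively_measurable F H \<longleftrightarrow>
     (\<forall>t\<ge>0. (\<lambda>(s, \<omega>). H s \<omega>) \<in> borel_measurable (restrict_space borel {0..t} \<Otimes>\<^sub>M F t))"

definition brownian_motion ::
    "'a measure \<Rightarrow> (real \<Rightarrow> 'a measure) \<Rightarrow> (real \<Rightarrow> 'a \<Rightarrow> real) \<Rightarrow> bool" where
  "brownian_motion P F B \<longleftrightarrow>
     adapted F B \<and> continuous_paths P B \<and> (AE \<omega> in P. B 0 \<omega> = 0) \<and>
     (\<forall>s t. 0 \<le> s \<longrightarrow> s < t \<longrightarrow>
        distributed P lborel (\<lambda>\<omega>. B t \<omega> - B s \<omega>) (normal_density 0 (sqrt (t - s))) \<and>
        prob_space.indep_set P (sets (F s))
          (sets (vimage_algebra (space P) (\<lambda>\<omega>. B t \<omega> - B s \<omega>) borel)))"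


section \<open>The Ito integral\<close>

text \<open>A simple integrand is \<open>\<Sum>i<n. \<eta> i * 1\<^bsub>(\<tau> i, \<tau> (i+1)]\<^esub>\<close> with deterministic times and bounded
  \<open>F (\<tau> i)\<close>-measurable \<open>\<eta> i\<close>.\<close>

definition simple_integrand ::
    "'a measure \<Rightarrow> (real \<Rightarrow> 'a measure) \<Rightarrow> nat \<Rightarrow> (nat \<Rightarrow> real) \<Rightarrow> (nat \<Rightarrow> 'a \<Rightarrow> real) \<Rightarrow> bool" where
  "simple_integrand P F n \<tau> \<eta> \<longleftrightarrow>
     0 \<le> \<tau> 0 \<and> (\<forall>i<n. \<tau> i \<le> \<tau> (Suc i)) \<and>
     (\<forall>i<n. \<eta> i \<in> borel_measurable (F (\<tau> i)) \<and> (\<exists>c. \<forall>\<omega>\<in>space P. \<bar>\<eta> i \<omega>\<bar> \<le> c))"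

definition simple_process ::
    "nat \<Rightarrow> (nat \<Rightarrow> real) \<Rightarrow> (nat \<Rightarrow> 'a \<Rightarrow> real) \<Rightarrow> real \<Rightarrow> 'a \<Rightarrow> real" where
  "simple_process n \<tau> \<eta> s \<omega> = (\<Sum>i<n. \<eta> i \<omega> * indicator {\<tau> i<..\<tau> (Suc i)} s)"

definition simple_ito_integral ::
    "(real \<Rightarrow> 'a \<Rightarrow> real) \<Rightarrow> nat \<Rightarrow> (nat \<Rightarrow> real) \<Rightarrow> (nat \<Rightarrow> 'a \<Rightarrow> real) \<Rightarrow> real \<Rightarrow> 'a \<Rightarrow> real" where
  "simple_ito_integral B n \<tau> \<eta> t \<omega> =
     (\<Sum>i<n. \<eta> i \<omega> * (B (min t (\<tau> (Suc i))) \<omega> - B (min t (\<tau> i)) \<omega>))"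

definition null_in_probability :: "'a measure \<Rightarrow> (nat \<Rightarrow> 'a \<Rightarrow> ennreal) \<Rightarrow> bool" where
  "null_in_probability P Y \<longleftrightarrow>
     (\<forall>\<epsilon>>0. (\<lambda>k. measure P {\<omega>\<in>space P. ennreal \<epsilon> < Y k \<omega>}) \<longlonglongrightarrow> 0)"

text \<open>\<open>I\<close> is a version of the process \<open>\<integral>\<^sub>0\<^sup>t H\<^sub>s dB\<^sub>s\<close> for a progressively measurable \<open>H\<close> whose square
  is almost surely locally integrable: \<open>I\<close> is the continuous adapted process with
  \<open>\<integral>\<^sub>0\<^sup>t H\<^sup>k\<^sub>s dB\<^sub>s \<longlonglongrightarrow> I\<^sub>t\<close> in probability along simple \<open>H\<^sup>k\<close> with \<open>\<integral>\<^sub>0\<^sup>t \<bar>H\<^sup>k\<^sub>s - H\<^sub>s\<bar>\<^sup>2 ds \<longlonglongrightarrow> 0\<close> in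
  probability. Such \<open>H\<^sup>k\<close> always exist, and \<open>I\<close> does not depend on their choice, up to
  indistinguishability. It is a relation rather than a function as \<open>I\<close> is determined only up to
  indistinguishability.\<close>

definition has_ito_integral ::
    "'a measure \<Rightarrow> (real \<Rightarrow> 'a measure) \<Rightarrow> (real \<Rightarrow> 'a \<Rightarrow> real) \<Rightarrow>
     (real \<Rightarrow> 'a \<Rightarrow> real) \<Rightarrow> (real \<Rightarrow> 'a \<Rightarrow> real) \<Rightarrow> bool" where
  "has_ito_integral P F B H I \<longleftrightarrow>
     progressively_measurable F H \<and>
     (\<forall>t\<ge>0. AE \<omega> in P. (\<integral>\<^sup>+s\<in>{0..t}. ennreal ((H s \<omega>)\<^sup>2) \<partial>lborel) < \<infinity>) \<and>
     adapted F I \<and> continuous_paths P I \<and>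
     (\<exists>n \<tau> \<eta>.
        (\<forall>k. simple_integrand P F (n k) (\<tau> k) (\<eta> k)) \<and>
        (\<forall>t\<ge>0.
           null_in_probability P (\<lambda>k \<omega>.
             \<integral>\<^sup>+s\<in>{0..t}. ennreal ((simple_process (n k) (\<tau> k) (\<eta> k) s \<omega> - H s \<omega>)\<^sup>2) \<partial>lborel) \<and>
           null_in_probability P (\<lambda>k \<omega>.
             ennreal \<bar>simple_ito_integral B (n k) (\<tau> k) (\<eta> k) t \<omega> - I t \<omega>\<bar>)))"


section \<open>The mean reflected McKean-Vlasov equation\<close>

definition lipschitz_coefficients ::
    "real \<Rightarrow> (real \<Rightarrow> real measure \<Rightarrow> real) \<Rightarrow> (real \<Rightarrow> real measure \<Rightarrow> real) \<Rightarrow> bool" where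
  "lipschitz_coefficients L b \<sigma> \<longleftrightarrow>
     (\<forall>x y. \<forall>\<mu>\<in>P2. \<forall>\<nu>\<in>P2. \<bar>b x \<mu> - b y \<nu>\<bar> + \<bar>\<sigma> x \<mu> - \<sigma> y \<nu>\<bar> \<le> L * (\<bar>x - y\<bar> + W2 \<mu> \<nu>))"

definition admissible_initial ::
    "'a measure \<Rightarrow> (real \<Rightarrow> 'a measure) \<Rightarrow> (real \<Rightarrow> real) \<Rightarrow> ('a \<Rightarrow> real) \<Rightarrow> bool" where
  "admissible_initial P F h \<xi> \<longleftrightarrow>
     \<xi> \<in> borel_measurable (F 0) \<and> integrable P (\<lambda>\<omega>. (\<xi> \<omega>)\<^sup>2) \<and> 0 \<le> (\<integral>\<omega>. h (\<xi> \<omega>) \<partial>P)"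

text \<open>The Lebesgue-Stieltjes measure \<open>dK\<close> on \<open>[0,\<infinity>)\<close>. As \<^const>\<open>interval_measure\<close> needs a function
  on the whole line, \<open>K\<close> is extended by \<open>K 0\<close> to the left of \<open>0\<close>.\<close>

definition stieltjes_measure :: "(real \<Rightarrow> real) \<Rightarrow> real measure" where
  "stieltjes_measure K = interval_measure (\<lambda>s. K (max 0 s))"

text \<open>The condition \<open>law P (X t) \<in> P2\<close> and the integrability conditions say that the coefficients and
  the integrals in the equation are defined. Without them, the Bochner integral could be the default
  value \<open>0\<close>.\<close>

definition deterministic_flat_solution ::
    "'a measure \<Rightarrow> (real \<Rightarrow> 'a measure) \<Rightarrow> (real \<Rightarrow> 'a \<Rightarrow> real) \<Rightarrow>
     ('a \<Rightarrow> real) \<Rightarrow> (real \<Rightarrow> real measure \<Rightarrow> real) \<Rightarrow> (real \<Rightarrow> real measure \<Rightarrow> real) \<Rightarrow>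
     (real \<Rightarrow> real) \<Rightarrow> (real \<Rightarrow> 'a \<Rightarrow> real) \<Rightarrow> (real \<Rightarrow> real) \<Rightarrow> bool" where
  "deterministic_flat_solution P F B \<xi> b \<sigma> h X K \<longleftrightarrow>
     adapted F X \<and> continuous_paths P X \<and> (\<forall>t\<ge>0. law P (X t) \<in> P2) \<and>
     mono_on {0..} K \<and> continuous_on {0..} K \<and> K 0 = 0 \<and>
     (AE \<omega> in P. \<forall>t\<ge>0. set_integrable lborel {0..t} (\<lambda>s. b (X s \<omega>) (law P (X s)))) \<and>
     (\<exists>I. has_ito_integral P F B (\<lambda>s \<omega>. \<sigma> (X s \<omega>) (law P (X s))) I \<and>
        (AE \<omega> in P. \<forall>t\<ge>0.
           X t \<omega> = \<xi> \<omega> + (LINT s:{0..t}|lborel. b (X s \<omega>) (law P (X s))) + I t \<omega> + K t)) \<and>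
     (\<forall>t\<ge>0. 0 \<le> (\<integral>\<omega>. h (X t \<omega>) \<partial>P)) \<and>
     (\<forall>t\<ge>0. set_integrable (stieltjes_measure K) {0..t} (\<lambda>s. \<integral>\<omega>. h (X s \<omega>) \<partial>P) \<and>
        (LINT s:{0..t}|stieltjes_measure K. (\<integral>\<omega>. h (X s \<omega>) \<partial>P)) = 0)"

end

theory Submission
  imports Defs
begin

text \<open>Write \<open>U\<close> for the solution without the reflection term, so that \<open>X = U + K\<close>. On an interval
  \<open>[s,t]\<close> on which \<open>K\<close> grows there is a point \<open>r\<close> of the support of \<open>dK\<close> with \<open>K r = K t\<close>; there
  \<open>E h(X r) = 0 \<le> E h(X s)\<close> and the bi-Lipschitz bounds on \<open>h\<close> give
  \<open>K t - K s \<le> M/m sup\<^bsub>r\<in>[s,t]\<^esub> E \<bar>U r - U s\<bar>\<close>. With this, the reflection term is controlled by the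
  drift and the stochastic integral. Gronwall's lemma yields the second moments, these bound the
  coefficients by deterministic constants plus \<open>L \<bar>X\<bar>\<close>, and a second Gronwall argument, up to the time
  at which \<open>\<bar>X\<bar>\<close> exceeds a level \<open>N\<close>, yields the \<open>p\<close>-th moments.

  The stochastic input is \<open>E sup\<^bsub>t\<le>T\<^esub> \<bar>I t\<bar>\<^sup>p \<le> C T\<^bsup>p/2-1\<^esup> \<integral>\<^sub>0\<^sup>T E \<bar>H s\<bar>\<^sup>p ds\<close> for the Ito integral \<open>I\<close> of \<open>H\<close>.
  For simple \<open>H\<close> it follows from a Taylor expansion of \<open>\<bar>x\<bar>\<^sup>p\<close> along the Gaussian increments and
  Doob's inequality. It passes to the limit in probability by truncating the simple integrands and
  controlling the error with Lenglart's inequality.\<close>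

text \<open>Little is known of a solution in advance. The mean of (X t)^2 is finite for each t, but
  not known to be bounded in t; the integrand of I is square integrable in time only path by path;
  and I is merely a limit in probability. So there is no isometry to start from, and no finite
  moment of a supremum to put into Gronwall's lemma. This shapes the proof in three ways. The bound
  for Ito integrals carries a decreasing family of events, so that it applies to a process cut off
  before it gets large, and both of its sides are integrals with values in \<open>ennreal\<close>,
  so that it can be stated before anything is known to be finite. The law of X, which enters the
  coefficients, is handled in two passes: a comparison argument yields some finite bound, and only
  then does a second pass produce the explicit constant. Constants that must not depend on \<xi> are
  written out as definitions, since they have to be fixed before the solution is introduced.\<close>

section \<open>Elementary inequalities for real powers, and an abstract Gronwall argument\<close>

lemma powr_add_le:
  fixes a b p :: real
  assumes "0 \<le> a" "0 \<le> b" "0 \<le> p"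
  shows "(a + b) powr p \<le> 2 powr p * (a powr p + b powr p)"
proof -
  have "(a + b) powr p \<le> (2 * max a b) powr p"
    by (rule powr_mono2) (use assms in auto)
  also have "\<dots> = 2 powr p * max a b powr p"
    using assms by (simp add: powr_mult)
  also have "max a b powr p \<le> a powr p + b powr p"
    by (auto simp: max_def)
  finally show ?thesis by simp
qed

text \<open>Taylor's formula to second order: for \<bar>u\<bar> \<le> 1/2 the second derivative of
  the left side is at most p (p - 1) 2^(p - 2), so the difference \<phi> of the two sides is convex.
  It lies above its tangent at 0, which is the zero function.\<close>

lemma one_plus_powr_le:
  fixes p :: real
  assumes p: "2 \<le> p" and u: "\<bar>u\<bar> \<le> 1/2"
  shows "(1 + u) powr p \<le> 1 + p * u + p * (p - 1) * 2 powr (p - 2) * u\<^sup>2"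
proof -
  define c where "c = p * (p - 1) * 2 powr (p - 2)"
  define \<phi> where "\<phi> v = 1 + p * v + c * v\<^sup>2 - (1 + v) powr p" for v :: real
  have d1: "(\<phi> has_real_derivative p + 2 * c * v - p * (1 + v) powr (p - 1)) (at v)"
    if "v \<in> {-1/2..1/2}" for v
    unfolding \<phi>_def using that by (auto intro!: derivative_eq_intros)
  have d2: "((\<lambda>v. p + 2 * c * v - p * (1 + v) powr (p - 1)) has_real_derivative
      2 * c - p * ((p - 1) * (1 + v) powr (p - 2))) (at v)"
    if "v \<in> {-1/2..1/2}" for v
    using that by (auto intro!: derivative_eq_intros)
  have nn: "0 \<le> 2 * c - p * ((p - 1) * (1 + v) powr (p - 2))" if v: "v \<in> {-1/2..1/2}" for v
  proof -
    have "(1 + v) powr (p - 2) \<le> 2 powr (p - 2)"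
      by (rule powr_mono2) (use v p in auto)
    hence "p * (p - 1) * (1 + v) powr (p - 2) \<le> p * (p - 1) * 2 powr (p - 2)"
      using p by (intro mult_left_mono) auto
    moreover have "0 \<le> c" unfolding c_def using p by simp
    ultimately show ?thesis by (simp add: c_def mult.assoc)
  qed
  have cv: "convex_on {-1/2..1/2} \<phi>"
    by (rule f''_ge0_imp_convex[OF _ d1 d2 nn]) auto
  have d0: "(\<phi> has_real_derivative p + 2 * c * 0 - p * (1 + 0) powr (p - 1)) (at 0 within {-1/2..1/2})"
    by (rule has_field_derivative_at_within[OF d1]) simp
  have "\<phi> u - \<phi> 0 \<ge> (p + 2 * c * 0 - p * (1 + 0) powr (p - 1)) * (u - 0)"
  proof (rule convex_on_imp_above_tangent[OF cv _ _ _ d0])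
    show "u \<in> {-1/2..1/2}" using u by (auto simp: abs_le_iff)
    show "0 \<in> interior {-1/2..1/2::real}" by (simp add: interior_atLeastAtMost_real)
  qed (rule connected_Icc)
  thus ?thesis by (simp add: \<phi>_def c_def)
qed

text \<open>Sum of the constants from the two cases of \<open>abs_add_powr_le\<close>: the first
  summand serves small increments y, the other two large ones.\<close>

definition taylor_const :: "real \<Rightarrow> real" where
  "taylor_const p = p * (p - 1) * 2 powr (p - 2) + 3 powr p + p * 2 powr (p - 1)"

lemma taylor_const_pos: "2 \<le> p \<Longrightarrow> 0 < taylor_const p"
  unfolding taylor_const_def by (intro add_nonneg_pos add_pos_nonneg) auto

text \<open>Takes the place of Ito's formula for the p-th power. When y is a centred increment with
  a factor known from the past, the linear term has mean zero and only the two nonnegative error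
  terms remain. If y is at most half as large as x, Taylor's formula applies to the ratio y / x;
  otherwise everything is of the order of the p-th power of y.\<close>

lemma abs_add_powr_le:
  fixes p x y :: real
  assumes p: "2 \<le> p"
  shows "\<bar>x + y\<bar> powr p \<le> \<bar>x\<bar> powr p + p * \<bar>x\<bar> powr (p - 1) * sgn x * y +
    taylor_const p * (\<bar>x\<bar> powr (p - 2) * y\<^sup>2 + \<bar>y\<bar> powr p)"
proof -
  define c1 where "c1 = p * (p - 1) * 2 powr (p - 2)"
  define c where "c = taylor_const p"
  have c1: "0 \<le> c1" using p by (simp add: c1_def)
  have c: "0 < c" using taylor_const_pos[OF p] by (simp add: c_def)
  note c_def = c_def taylor_const_def c1_def[symmetric]
  have "\<bar>x + y\<bar> powr p \<le>
    \<bar>x\<bar> powr p + p * \<bar>x\<bar> powr (p - 1) * sgn x * y + c * (\<bar>x\<bar> powr (p - 2) * y\<^sup>2 + \<bar>y\<bar> powr p)"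
  proof (cases "\<bar>y\<bar> \<le> \<bar>x\<bar> / 2 \<and> x \<noteq> 0")
    case True
    define u where "u = y / x"
    have u: "\<bar>u\<bar> \<le> 1/2" using True by (auto simp: u_def field_simps)
    have "x + y = x * (1 + u)" using True by (simp add: u_def field_simps)
    hence "\<bar>x + y\<bar> powr p = \<bar>x\<bar> powr p * (1 + u) powr p"
      using u by (simp add: abs_mult powr_mult)
    also have "\<dots> \<le> \<bar>x\<bar> powr p * (1 + p * u + c1 * u\<^sup>2)"
      using one_plus_powr_le[OF p u] by (intro mult_left_mono) (auto simp: c1_def)
    also have "\<dots> = \<bar>x\<bar> powr p + p * (\<bar>x\<bar> powr p * u) + c1 * (\<bar>x\<bar> powr p * u\<^sup>2)"
      by (simp add: algebra_simps)
    also have "\<bar>x\<bar> powr p * u = \<bar>x\<bar> powr (p - 1) * sgn x * y"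
    proof -
      have "\<bar>x\<bar> powr p = \<bar>x\<bar> powr (p - 1) * \<bar>x\<bar>"
        using True powr_add[of "\<bar>x\<bar>" "p - 1" 1] by simp
      thus ?thesis using True by (auto simp: u_def sgn_if field_simps)
    qed
    also have "\<bar>x\<bar> powr p * u\<^sup>2 = \<bar>x\<bar> powr (p - 2) * y\<^sup>2"
    proof -
      have "\<bar>x\<bar> powr p = \<bar>x\<bar> powr (p - 2) * x\<^sup>2"
        using True powr_add[of "\<bar>x\<bar>" "p - 2" 2] by simp
      thus ?thesis using True by (auto simp: u_def power2_eq_square field_simps)
    qed
    also have "c1 * (\<bar>x\<bar> powr (p - 2) * y\<^sup>2) \<le> c * (\<bar>x\<bar> powr (p - 2) * y\<^sup>2 + \<bar>y\<bar> powr p)"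
      using p c1 by (intro mult_mono) (auto simp: c_def)
    finally show ?thesis by (simp add: mult.assoc)
  next
    case False
    hence xy: "\<bar>x\<bar> \<le> 2 * \<bar>y\<bar>" by auto
    have "\<bar>x + y\<bar> powr p \<le> (3 * \<bar>y\<bar>) powr p"
      by (rule powr_mono2) (use p xy in auto)
    hence 1: "\<bar>x + y\<bar> powr p \<le> 3 powr p * \<bar>y\<bar> powr p" by (simp add: powr_mult)
    have "\<bar>x\<bar> powr (p - 1) \<le> (2 * \<bar>y\<bar>) powr (p - 1)"
      by (rule powr_mono2) (use p xy in auto)
    hence "\<bar>x\<bar> powr (p - 1) * \<bar>y\<bar> \<le> 2 powr (p - 1) * \<bar>y\<bar> powr (p - 1) * \<bar>y\<bar>"
      by (intro mult_right_mono) (auto simp: powr_mult)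
    also have "\<dots> = 2 powr (p - 1) * \<bar>y\<bar> powr p"
      using powr_add[of "\<bar>y\<bar>" "p - 1" 1] by (cases "y = 0") auto
    finally have "\<bar>p * \<bar>x\<bar> powr (p - 1) * sgn x * y\<bar> \<le> p * (2 powr (p - 1) * \<bar>y\<bar> powr p)"
      using p by (auto simp: abs_mult abs_sgn_eq mult.assoc intro!: mult_left_mono)
    hence 2: "- (p * \<bar>x\<bar> powr (p - 1) * sgn x * y) \<le> p * 2 powr (p - 1) * \<bar>y\<bar> powr p"
      by (simp add: mult.assoc abs_le_iff)
    have "c * (\<bar>x\<bar> powr (p - 2) * y\<^sup>2 + \<bar>y\<bar> powr p) \<ge> (3 powr p + p * 2 powr (p - 1)) * \<bar>y\<bar> powr p"
      using p c1 c by (intro mult_mono) (auto simp: c_def)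
    moreover have "3 powr p * \<bar>y\<bar> powr p + p * 2 powr (p - 1) * \<bar>y\<bar> powr p = (3 powr p + p * 2 powr (p - 1)) * \<bar>y\<bar> powr p"
      by (simp add: algebra_simps)
    ultimately show ?thesis using 1 2 powr_ge_zero[of "\<bar>x\<bar>" p] by linarith
  qed
  thus ?thesis by (simp add: c_def(1))
qed

text \<open>Whichever of a^2 and t z^2 is larger decides which term on the right dominates. The
  parameter t will be the length of the whole time interval: the factor 1/t makes the coefficients
  of a^p summable over a partition.\<close>

lemma powr_mult_square_le:
  fixes a z p t :: real
  assumes p: "2 \<le> p" and t: "0 < t" and a: "0 \<le> a"
  shows "a powr (p - 2) * z\<^sup>2 \<le> a powr p / t + t powr (p/2 - 1) * \<bar>z\<bar> powr p"
proof (cases "a\<^sup>2 \<le> t * z\<^sup>2")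
  case True
  have "a powr (p - 2) = (a\<^sup>2) powr (p/2 - 1)"
    using a powr_powr[of a 2 "p/2 - 1"] by (auto simp: algebra_simps)
  also have "\<dots> \<le> (t * z\<^sup>2) powr (p/2 - 1)"
    by (rule powr_mono2) (use True p in auto)
  also have "\<dots> = t powr (p/2 - 1) * \<bar>z\<bar> powr (p - 2)"
    using t powr_powr[of "\<bar>z\<bar>" 2 "p/2 - 1"] by (simp add: powr_mult algebra_simps)
  finally have "a powr (p - 2) * z\<^sup>2 \<le> t powr (p/2 - 1) * \<bar>z\<bar> powr (p - 2) * z\<^sup>2"
    by (intro mult_right_mono) auto
  also have "\<dots> = t powr (p/2 - 1) * \<bar>z\<bar> powr p"
    using powr_add[of "\<bar>z\<bar>" "p - 2" 2] by (cases "z = 0") (auto simp: mult.assoc)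
  finally show ?thesis using t by (simp add: add_increasing)
next
  case False
  hence z: "z\<^sup>2 \<le> a\<^sup>2 / t" and a0: "a \<noteq> 0" using t by (auto simp: field_simps)
  have "a powr (p - 2) * z\<^sup>2 \<le> a powr (p - 2) * (a\<^sup>2 / t)"
    using z by (intro mult_left_mono) auto
  also have "\<dots> = a powr p / t"
    using powr_add[of a "p - 2" 2] a a0 by auto
  finally show ?thesis by (simp add: add_increasing2)
qed

lemma young_powr:
  fixes a b p :: real
  assumes p: "1 < p" and a: "0 \<le> a" and b: "0 \<le> b"
  shows "a * b powr (p - 1) \<le> a powr p / p + (p - 1) / p * b powr p"
proof -
  have "a * b powr (p - 1) \<le> a powr p / p + (b powr (p - 1)) powr (p / (p - 1)) / (p / (p - 1))"
    by (rule Youngs_inequality) (use assms in \<open>auto simp: field_simps\<close>)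
  thus ?thesis using p by (simp add: powr_powr mult.commute)
qed

text \<open>Pathwise form of Doob's \<open>L\<^sup>p\<close> inequality, by summation by parts: the sum has nonnegative
  expectation when \<open>s\<close> is a submartingale.\<close>

lemma pathwise_doob:
  fixes s :: "nat \<Rightarrow> real" and p :: real
  assumes p: "1 < p" and s: "\<And>i. 0 \<le> s i"
  defines "m \<equiv> \<lambda>n. Max (s ` {..n})"
  shows "(p - 1) / p * m n powr p + (\<Sum>i<n. m i powr (p - 1) * (s (Suc i) - s i)) \<le> m n powr (p - 1) * s n"
proof (induction n)
  case 0
  have "m 0 = s 0" by (simp add: m_def)
  moreover have "s 0 powr (p - 1) * s 0 = s 0 powr p"
    using s[of 0] p powr_add[of "s 0" "p - 1" 1] by (cases "s 0 = 0") auto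
  moreover have "(p - 1) / p * s 0 powr p \<le> 1 * s 0 powr p"
    by (rule mult_right_mono) (use p in \<open>auto simp: field_simps\<close>)
  ultimately show ?case by simp
next
  case (Suc n)
  have mSuc: "m (Suc n) = max (s (Suc n)) (m n)"
    unfolding m_def by (simp add: atMost_Suc)
  have "s n \<le> m n" unfolding m_def by (rule Max_ge) auto
  hence mn: "0 \<le> m n" using s[of n] by linarith
  \<comment> \<open>If a new maximum y is reached, this is Young's inequality y m^(p-1) \<le> y^p /
    p + (p-1)/p m^p. Otherwise both sides agree.\<close>
  have mm: "(p - 1) / p * m (Suc n) powr p + m n powr (p - 1) * s (Suc n)
        \<le> (p - 1) / p * m n powr p + m (Suc n) powr (p - 1) * s (Suc n)"
  proof (cases "m n \<le> s (Suc n)")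
    case True
    define y where "y = s (Suc n)"
    have y: "0 \<le> y" "m (Suc n) = y" using s True by (auto simp: y_def mSuc)
    have "y powr (p - 1) * y = y powr p"
      using y powr_add[of y "p - 1" 1] p by (cases "y = 0") auto
    moreover have "y * m n powr (p - 1) \<le> y powr p / p + (p - 1) / p * m n powr p"
      by (rule young_powr) (use p y mn in auto)
    moreover have "(p - 1) / p * y powr p + y powr p / p = y powr p"
      using p by (simp add: field_simps)
    ultimately show ?thesis using y by (simp add: y_def[symmetric] mult.commute)
  qed (simp add: mSuc)
  show ?case using Suc.IH mm by (simp add: algebra_simps)
qed

lemma weighted_gronwall:
  fixes y :: "'i \<Rightarrow> ennreal" and w :: "'i \<Rightarrow> real"
  assumes bdd: "\<And>t. t \<in> I \<Longrightarrow> y t \<le> ennreal (\<phi>\<^sub>0 * w t)" and \<phi>0: "0 \<le> \<phi>\<^sub>0"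
    and a: "0 \<le> a" and w: "\<And>t. t \<in> I \<Longrightarrow> 0 \<le> w t"
    and step: "\<And>\<phi> t. 0 \<le> \<phi> \<Longrightarrow> (\<And>s. s \<in> I \<Longrightarrow> y s \<le> ennreal (\<phi> * w s)) \<Longrightarrow> t \<in> I \<Longrightarrow>
      y t \<le> ennreal ((a + \<phi> / 2) * w t)"
    and t: "t \<in> I"
  shows "y t \<le> ennreal (2 * a * w t)"
proof -
  define \<phi> where "\<phi> k = 2 * a + \<phi>\<^sub>0 / 2 ^ k" for k :: nat
  have *: "\<forall>t\<in>I. y t \<le> ennreal (\<phi> k * w t)" for k
  proof (induction k)
    case 0
    show ?case
    proof
      fix t assume t: "t \<in> I"
      have "\<phi>\<^sub>0 * w t \<le> \<phi> 0 * w t" using a w[OF t] by (simp add: \<phi>_def algebra_simps)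
      thus "y t \<le> ennreal (\<phi> 0 * w t)" using bdd[OF t] by (meson ennreal_leI order_trans)
    qed
  next
    case (Suc k)
    have "a + \<phi> k / 2 = \<phi> (Suc k)" by (simp add: \<phi>_def field_simps)
    moreover have "0 \<le> \<phi> k" using a \<phi>0 by (simp add: \<phi>_def)
    ultimately show ?case using step[of "\<phi> k"] Suc by auto
  qed
  have "(\<lambda>k. 2 * a + \<phi>\<^sub>0 * (1/2) ^ k) \<longlonglongrightarrow> 2 * a + \<phi>\<^sub>0 * 0"
    by (intro tendsto_intros LIMSEQ_power_zero) auto
  hence "\<phi> \<longlonglongrightarrow> 2 * a"
    by (simp add: \<phi>_def[abs_def] power_divide)
  hence "(\<lambda>k. ennreal (\<phi> k * w t)) \<longlonglongrightarrow> ennreal (2 * a * w t)"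
    by (intro tendsto_ennrealI tendsto_intros)
  thus ?thesis by (rule LIMSEQ_le_const) (use * t in auto)
qed

section \<open>Transforms of Gaussian increments\<close>

text \<open>Asking for all orders at once makes the class closed under products, because a product
  of order q is bounded by moments of order 2 q. Integrability in the discrete part then follows by
  structural rules.\<close>

definition (in prob_space) finite_moments :: "('a \<Rightarrow> real) \<Rightarrow> bool" where
  "finite_moments Y \<longleftrightarrow> Y \<in> borel_measurable M \<and> (\<forall>q>0. integrable M (\<lambda>\<omega>. \<bar>Y \<omega>\<bar> powr q))"

context prob_space
begin

lemma finite_moments_measurable [measurable_dest]: "finite_moments Y \<Longrightarrow> Y \<in> borel_measurable M"
  by (simp add: finite_moments_def)

lemma finite_moments_integrable_powr:
  "finite_moments Y \<Longrightarrow> 0 < q \<Longrightarrow> integrable M (\<lambda>\<omega>. \<bar>Y \<omega>\<bar> powr q)"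
  by (simp add: finite_moments_def)

lemma finite_moments_integrable: "finite_moments Y \<Longrightarrow> integrable M Y"
  using finite_moments_integrable_powr[of Y 1] finite_moments_measurable[of Y]
  by (subst integrable_abs_iff[symmetric]) simp_all

lemma finite_moments_mono:
  assumes Y: "finite_moments Y" and [measurable]: "X \<in> borel_measurable M"
    and le: "\<And>\<omega>. \<omega> \<in> space M \<Longrightarrow> \<bar>X \<omega>\<bar> \<le> \<bar>Y \<omega>\<bar>"
  shows "finite_moments X"
  unfolding finite_moments_def
proof (intro conjI allI impI)
  fix q :: real assume q: "0 < q"
  show "integrable M (\<lambda>\<omega>. \<bar>X \<omega>\<bar> powr q)"
    by (rule Bochner_Integration.integrable_bound[OF finite_moments_integrable_powr[OF Y q]])
       (use q le in \<open>auto intro!: AE_I2 powr_mono2\<close>)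
qed simp

lemma finite_moments_bounded:
  assumes [measurable]: "Y \<in> borel_measurable M" and c: "\<And>\<omega>. \<omega> \<in> space M \<Longrightarrow> \<bar>Y \<omega>\<bar> \<le> c"
  shows "finite_moments Y"
proof (rule finite_moments_mono[of "\<lambda>_. c"])
  show "finite_moments (\<lambda>_. c)" by (simp add: finite_moments_def)
qed (use c in force)+

lemma finite_moments_abs: "finite_moments Y \<Longrightarrow> finite_moments (\<lambda>\<omega>. \<bar>Y \<omega>\<bar>)"
  by (rule finite_moments_mono[of Y]) auto

lemma finite_moments_powr:
  assumes "finite_moments Y" and q: "0 < q"
  shows "finite_moments (\<lambda>\<omega>. \<bar>Y \<omega>\<bar> powr q)"
  using assms finite_moments_measurable[OF assms(1)]
  by (auto simp: finite_moments_def powr_powr)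

lemma finite_moments_powr_nonneg:
  assumes Y: "finite_moments Y" and q: "0 \<le> q"
  shows "finite_moments (\<lambda>\<omega>. \<bar>Y \<omega>\<bar> powr q)"
proof (cases "q = 0")
  case True
  show ?thesis
    by (rule finite_moments_bounded[of _ 1]) (use finite_moments_measurable[OF Y] True in auto)
qed (use assms finite_moments_powr in auto)

lemma finite_moments_mult:
  assumes X: "finite_moments X" and Y: "finite_moments Y"
  shows "finite_moments (\<lambda>\<omega>. X \<omega> * Y \<omega>)"
  unfolding finite_moments_def
proof (intro conjI allI impI)
  have [measurable]: "X \<in> borel_measurable M" "Y \<in> borel_measurable M"
    using X Y by (auto simp: finite_moments_def)
  show "(\<lambda>\<omega>. X \<omega> * Y \<omega>) \<in> borel_measurable M" by simp
  fix q :: real assume q: "0 < q"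
  show "integrable M (\<lambda>\<omega>. \<bar>X \<omega> * Y \<omega>\<bar> powr q)"
  proof (rule Bochner_Integration.integrable_bound)
    show "integrable M (\<lambda>\<omega>. \<bar>X \<omega>\<bar> powr (2 * q) + \<bar>Y \<omega>\<bar> powr (2 * q))"
      using q by (intro Bochner_Integration.integrable_add finite_moments_integrable_powr X Y) auto
    show "AE \<omega> in M. norm (\<bar>X \<omega> * Y \<omega>\<bar> powr q) \<le> norm (\<bar>X \<omega>\<bar> powr (2 * q) + \<bar>Y \<omega>\<bar> powr (2 * q))"
    proof (rule AE_I2)
      fix \<omega>
      define a b where "a = \<bar>X \<omega>\<bar> powr q" and "b = \<bar>Y \<omega>\<bar> powr q"
      have "a * b \<le> a\<^sup>2 + b\<^sup>2"
      proof -
        have "2 * (a * b) \<le> a\<^sup>2 + b\<^sup>2" using sum_squares_bound[of a b] by (simp add: mult.assoc)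
        moreover have "0 \<le> a * b" by (simp add: a_def b_def)
        ultimately show ?thesis by linarith
      qed
      moreover have "\<bar>X \<omega>\<bar> powr (2 * q) = a\<^sup>2" "\<bar>Y \<omega>\<bar> powr (2 * q) = b\<^sup>2"
        unfolding a_def b_def power2_eq_square mult_2 powr_add by (rule refl)+
      ultimately show "norm (\<bar>X \<omega> * Y \<omega>\<bar> powr q) \<le> norm (\<bar>X \<omega>\<bar> powr (2 * q) + \<bar>Y \<omega>\<bar> powr (2 * q))"
        by (simp add: abs_mult powr_mult a_def b_def)
    qed
  qed simp
qed

lemma finite_moments_add:
  assumes X: "finite_moments X" and Y: "finite_moments Y"
  shows "finite_moments (\<lambda>\<omega>. X \<omega> + Y \<omega>)"
  unfolding finite_moments_def
proof (intro conjI allI impI)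
  have [measurable]: "X \<in> borel_measurable M" "Y \<in> borel_measurable M"
    using X Y by (auto simp: finite_moments_def)
  show "(\<lambda>\<omega>. X \<omega> + Y \<omega>) \<in> borel_measurable M" by simp
  fix q :: real assume q: "0 < q"
  show "integrable M (\<lambda>\<omega>. \<bar>X \<omega> + Y \<omega>\<bar> powr q)"
  proof (rule Bochner_Integration.integrable_bound)
    show "integrable M (\<lambda>\<omega>. 2 powr q * (\<bar>X \<omega>\<bar> powr q + \<bar>Y \<omega>\<bar> powr q))"
      using q by (intro integrable_mult_right Bochner_Integration.integrable_add finite_moments_integrable_powr X Y) auto
    show "AE \<omega> in M. norm (\<bar>X \<omega> + Y \<omega>\<bar> powr q) \<le> norm (2 powr q * (\<bar>X \<omega>\<bar> powr q + \<bar>Y \<omega>\<bar> powr q))"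
    proof (rule AE_I2)
      fix \<omega>
      have "\<bar>X \<omega> + Y \<omega>\<bar> powr q \<le> (\<bar>X \<omega>\<bar> + \<bar>Y \<omega>\<bar>) powr q"
        by (rule powr_mono2) (use q in auto)
      also have "\<dots> \<le> 2 powr q * (\<bar>X \<omega>\<bar> powr q + \<bar>Y \<omega>\<bar> powr q)"
        by (rule powr_add_le) (use q in auto)
      finally show "norm (\<bar>X \<omega> + Y \<omega>\<bar> powr q) \<le> norm (2 powr q * (\<bar>X \<omega>\<bar> powr q + \<bar>Y \<omega>\<bar> powr q))"
        by simp
    qed
  qed simp
qed

lemma finite_moments_sum:
  "finite J \<Longrightarrow> (\<And>i. i \<in> J \<Longrightarrow> finite_moments (X i)) \<Longrightarrow> finite_moments (\<lambda>\<omega>. \<Sum>i\<in>J. X i \<omega>)"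
proof (induction J rule: finite_induct)
  case empty
  show ?case by (rule finite_moments_bounded[of _ 0]) auto
next
  case (insert i J)
  have "finite_moments (\<lambda>\<omega>. X i \<omega> + (\<Sum>i\<in>J. X i \<omega>))"
    by (rule finite_moments_add) (use insert in auto)
  thus ?case using insert.hyps by simp
qed

text \<open>Brownian increments are independent of the past as sigma-algebras. This turns that into
  independence of random variables, for every g known at the start of the increment.\<close>

lemma indep_var_of_indep_set_vimage:
  assumes sub: "subalgebra M G" and g: "g \<in> borel_measurable G" and Z: "Z \<in> borel_measurable M"
    and ind: "indep_set (sets G) (sets (vimage_algebra (space M) Z borel))"
  shows "indep_var borel g borel Z"
  unfolding indep_var_eq
proof (intro conjI)
  show "g \<in> borel_measurable M" using measurable_from_subalg[OF sub g] .
  show "Z \<in> borel_measurable M" by fact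
  have G: "space G = space M" using sub by (simp add: subalgebra_def)
  have 1: "sigma_sets (space M) {g -` A \<inter> space M |A. A \<in> sets borel} \<subseteq> sets G"
    unfolding G[symmetric] by (rule sets.sigma_sets_subset) (use measurable_sets[OF g] in auto)
  have 2: "sets (vimage_algebra (space M) Z borel) = sigma_sets (space M) {Z -` A \<inter> space M |A. A \<in> sets borel}"
    by (rule sets_vimage_algebra)
  show "indep_set (sigma_sets (space M) {g -` A \<inter> space M |A. A \<in> sets borel})
      (sigma_sets (space M) {Z -` A \<inter> space M |A. A \<in> sets borel})"
    using ind unfolding indep_set_def 2
    by (rule indep_sets_mono_sets) (use 1 in \<open>auto split: bool.split\<close>)
qed

end

definition gauss_moment :: "real \<Rightarrow> real" where
  "gauss_moment q = (\<integral>x. std_normal_density x * \<bar>x\<bar> powr q \<partial>lborel)"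

lemma integrable_gauss_moment:
  assumes "0 \<le> q"
  shows "integrable lborel (\<lambda>x. std_normal_density x * \<bar>x\<bar> powr q)"
proof (rule Bochner_Integration.integrable_bound)
  define k where "k = nat \<lceil>q\<rceil>"
  show "integrable lborel (\<lambda>x. std_normal_density x * \<bar>x\<bar> ^ 0 + std_normal_density x * \<bar>x\<bar> ^ k)"
    by (intro Bochner_Integration.integrable_add integrable_std_normal_moment_abs)
  have "\<bar>x\<bar> powr q \<le> 1 + \<bar>x\<bar> ^ k" for x :: real
  proof (cases "\<bar>x\<bar> \<le> 1")
    case True
    have "\<bar>x\<bar> powr q \<le> 1" using powr_mono2[of q "\<bar>x\<bar>" 1] True assms by simp
    thus ?thesis by (simp add: add_increasing2)
  next
    case False
    have "\<bar>x\<bar> powr q \<le> \<bar>x\<bar> powr (real k)"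
      by (rule powr_mono) (use False assms in \<open>auto simp: k_def\<close>)
    also have "\<dots> = \<bar>x\<bar> ^ k" using False by (simp add: powr_realpow)
    finally show ?thesis by simp
  qed
  hence "std_normal_density x * \<bar>x\<bar> powr q \<le> std_normal_density x * (1 + \<bar>x\<bar> ^ k)" for x
    by (intro mult_left_mono) auto
  thus "AE x in lborel. norm (std_normal_density x * \<bar>x\<bar> powr q) \<le>
      norm (std_normal_density x * \<bar>x\<bar> ^ 0 + std_normal_density x * \<bar>x\<bar> ^ k)"
    by (intro AE_I2) (simp add: distrib_left)
qed simp

lemma gauss_moment_nonneg: "0 \<le> gauss_moment q"
  unfolding gauss_moment_def by (rule integral_nonneg_AE) simp

context prob_space
begin

lemma normal_abs_moment:
  assumes Z: "distributed M lborel Z (normal_density 0 \<sigma>)" and \<sigma>: "0 < \<sigma>" and q: "0 \<le> q"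
  shows "integrable M (\<lambda>\<omega>. \<bar>Z \<omega>\<bar> powr q)"
    and "(\<integral>\<omega>. \<bar>Z \<omega>\<bar> powr q \<partial>M) = \<sigma> powr q * gauss_moment q"
proof -
  have D: "distributed M lborel (\<lambda>\<omega>. Z \<omega> / \<sigma>) std_normal_density"
    using normal_standard_normal_convert[OF \<sigma>, of Z 0] Z by simp
  have eq: "\<bar>Z \<omega>\<bar> powr q = \<sigma> powr q * \<bar>Z \<omega> / \<sigma>\<bar> powr q" for \<omega>
    using \<sigma> by (simp add: powr_mult[symmetric] abs_divide)
  have "integrable M (\<lambda>\<omega>. \<bar>Z \<omega> / \<sigma>\<bar> powr q)"
    using distributed_integrable[OF D, of "\<lambda>x. \<bar>x\<bar> powr q"] integrable_gauss_moment[OF q] by simp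
  thus "integrable M (\<lambda>\<omega>. \<bar>Z \<omega>\<bar> powr q)"
    unfolding eq by (rule integrable_mult_right)
  have "(\<integral>\<omega>. \<bar>Z \<omega> / \<sigma>\<bar> powr q \<partial>M) = gauss_moment q"
    using distributed_integral[OF D, of "\<lambda>x. \<bar>x\<bar> powr q"] by (simp add: gauss_moment_def)
  thus "(\<integral>\<omega>. \<bar>Z \<omega>\<bar> powr q \<partial>M) = \<sigma> powr q * gauss_moment q"
    unfolding eq by simp
qed

end

text \<open>Brownian motion seen along a deterministic grid: \<open>d i\<close> is the length of
  cell i and \<open>G i\<close> the information at its left end point, so that \<open>Z i\<close> is
  independent of \<open>G i\<close> but known only at time i + 1.\<close>

locale gaussian_increments = prob_space M for M :: "'a measure" +
  fixes G :: "nat \<Rightarrow> 'a measure" and Z :: "nat \<Rightarrow> 'a \<Rightarrow> real" and d :: "nat \<Rightarrow> real"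
  assumes subalg: "subalgebra M (G i)"
    and G_mono: "sets (G i) \<subseteq> sets (G (Suc i))"
    and Z_measurable: "Z i \<in> borel_measurable (G (Suc i))"
    and d_pos: "0 < d i"
    and Z_distr: "distributed M lborel (Z i) (normal_density 0 (sqrt (d i)))"
    and Z_indep: "indep_set (sets (G i)) (sets (vimage_algebra (space M) (Z i) borel))"
begin

lemma subalg_G: "i \<le> j \<Longrightarrow> subalgebra (G j) (G i)"
  using lift_Suc_mono_le[of "\<lambda>i. sets (G i)", OF G_mono] subalg
  by (auto simp: subalgebra_def)

lemmas measurable_G_M = measurable_from_subalg[OF subalg]
lemmas measurable_G_G = measurable_from_subalg[OF subalg_G]

lemma Z_measurable_M: "Z i \<in> borel_measurable M"
  by (rule measurable_G_M[OF Z_measurable])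

lemma finite_moments_Z: "finite_moments (Z i)"
  unfolding finite_moments_def
  using Z_measurable_M normal_abs_moment(1)[OF Z_distr] d_pos[of i] by auto

lemma Z_mean: "(\<integral>\<omega>. Z i \<omega> \<partial>M) = 0"
  using normal_distributed_expectation[OF _ Z_distr] d_pos[of i] by simp

text \<open>The martingale property of transforms, in the form in which it is applied: independence
  is used on the product directly, without conditional expectations.\<close>

lemma integral_mult_Z_0:
  assumes "g \<in> borel_measurable (G i)" "integrable M g"
  shows "(\<integral>\<omega>. g \<omega> * Z i \<omega> \<partial>M) = 0"
  using indep_var_lebesgue_integral[OF indep_var_of_indep_set_vimage[OF subalg assms(1) Z_measurable_M Z_indep]
      assms(2) finite_moments_integrable[OF finite_moments_Z]] Z_mean by simp

lemma integral_mult_Z_powr: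
  assumes g: "g \<in> borel_measurable (G i)" "integrable M g" and q: "0 < q"
  shows "(\<integral>\<omega>. g \<omega> * \<bar>Z i \<omega>\<bar> powr q \<partial>M) = (\<integral>\<omega>. g \<omega> \<partial>M) * (d i powr (q / 2) * gauss_moment q)"
proof -
  have "indep_var borel ((\<lambda>x. x) \<circ> g) borel ((\<lambda>x. \<bar>x\<bar> powr q) \<circ> Z i)"
    by (rule indep_var_compose[OF indep_var_of_indep_set_vimage[OF subalg g(1) Z_measurable_M Z_indep]]) auto
  hence "(\<integral>\<omega>. g \<omega> * \<bar>Z i \<omega>\<bar> powr q \<partial>M) = (\<integral>\<omega>. g \<omega> \<partial>M) * (\<integral>\<omega>. \<bar>Z i \<omega>\<bar> powr q \<partial>M)"
    using indep_var_lebesgue_integral[of g "\<lambda>\<omega>. \<bar>Z i \<omega>\<bar> powr q"] g(2)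
      finite_moments_integrable_powr[OF finite_moments_Z q] by (simp add: comp_def)
  also have "(\<integral>\<omega>. \<bar>Z i \<omega>\<bar> powr q \<partial>M) = sqrt (d i) powr q * gauss_moment q"
    using normal_abs_moment(2)[OF Z_distr] d_pos q by simp
  also have "sqrt (d i) powr q = d i powr (q / 2)"
    using d_pos[of i] by (simp add: powr_half_sqrt[symmetric] powr_powr)
  finally show ?thesis .
qed

definition predictable :: "(nat \<Rightarrow> 'a \<Rightarrow> real) \<Rightarrow> bool" where
  "predictable \<eta> \<longleftrightarrow> (\<forall>i. \<eta> i \<in> borel_measurable (G i) \<and> (\<exists>c. \<forall>\<omega>\<in>space M. \<bar>\<eta> i \<omega>\<bar> \<le> c))"

definition transform :: "(nat \<Rightarrow> 'a \<Rightarrow> real) \<Rightarrow> nat \<Rightarrow> 'a \<Rightarrow> real" where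
  "transform \<eta> n \<omega> = (\<Sum>i<n. \<eta> i \<omega> * Z i \<omega>)"

definition max_transform :: "(nat \<Rightarrow> 'a \<Rightarrow> real) \<Rightarrow> nat \<Rightarrow> 'a \<Rightarrow> real" where
  "max_transform \<eta> n \<omega> = Max ((\<lambda>j. \<bar>transform \<eta> j \<omega>\<bar>) ` {..n})"

context
  fixes \<eta> assumes \<eta>: "predictable \<eta>"
begin

lemma predictable_measurable: "\<eta> i \<in> borel_measurable (G i)"
  using \<eta> by (simp add: predictable_def)

lemma finite_moments_predictable: "finite_moments (\<eta> i)"
proof -
  obtain c where "\<And>\<omega>. \<omega> \<in> space M \<Longrightarrow> \<bar>\<eta> i \<omega>\<bar> \<le> c" using \<eta> unfolding predictable_def by blast
  thus ?thesis by (rule finite_moments_bounded[OF measurable_G_M[OF predictable_measurable]])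
qed

lemma transform_measurable_G: "transform \<eta> n \<in> borel_measurable (G n)"
  unfolding transform_def[abs_def]
  by (intro borel_measurable_sum borel_measurable_times
      measurable_G_G[OF _ predictable_measurable] measurable_G_G[OF _ Z_measurable]) auto

lemma finite_moments_transform: "finite_moments (transform \<eta> n)"
  unfolding transform_def[abs_def]
  by (intro finite_moments_sum finite_moments_mult finite_moments_predictable finite_moments_Z) auto

lemma max_transform_measurable_G: "max_transform \<eta> n \<in> borel_measurable (G n)"
  unfolding max_transform_def[abs_def]
  by (intro borel_measurable_Max borel_measurable_abs measurable_G_G[OF _ transform_measurable_G]) auto

lemma transform_le_max: "j \<le> n \<Longrightarrow> \<bar>transform \<eta> j \<omega>\<bar> \<le> max_transform \<eta> n \<omega>"
  unfolding max_transform_def by (rule Max_ge) auto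

lemma max_transform_nonneg: "0 \<le> max_transform \<eta> n \<omega>"
  using transform_le_max[of 0 n \<omega>] by linarith

lemma finite_moments_max_transform: "finite_moments (max_transform \<eta> n)"
proof (rule finite_moments_mono)
  show "finite_moments (\<lambda>\<omega>. \<Sum>j\<le>n. \<bar>transform \<eta> j \<omega>\<bar>)"
    by (intro finite_moments_sum finite_moments_abs finite_moments_transform) auto
  show "max_transform \<eta> n \<in> borel_measurable M"
    by (rule measurable_G_M[OF max_transform_measurable_G])
  fix \<omega>
  have "max_transform \<eta> n \<omega> \<le> (\<Sum>j\<le>n. \<bar>transform \<eta> j \<omega>\<bar>)"
    unfolding max_transform_def
    by (rule Max.boundedI) (auto intro!: member_le_sum)
  thus "\<bar>max_transform \<eta> n \<omega>\<bar> \<le> \<bar>\<Sum>j\<le>n. \<bar>transform \<eta> j \<omega>\<bar>\<bar>"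
    using max_transform_nonneg[of n \<omega>] by linarith
qed

text \<open>\<open>pathwise_doob\<close> is integrated for the absolute value of the transform S.
  Its increments dominate sgn S times those of S, and the weighted sum of the latter is again a
  transform and has mean zero. The right side m^(p-1) \<bar>S\<bar> is absorbed by distinguishing
  whether \<bar>S\<bar> is below m/4, at the price of a constant larger than the sharp one.\<close>

lemma doob_transform:
  assumes p: "2 \<le> p"
  shows "(\<integral>\<omega>. max_transform \<eta> n \<omega> powr p \<partial>M) \<le> 4 powr p * (\<integral>\<omega>. \<bar>transform \<eta> n \<omega>\<bar> powr p \<partial>M)"
proof -
  define m where "m = max_transform \<eta>"
  define S where "S = transform \<eta>"
  have m0: "0 \<le> m n \<omega>" for n \<omega> unfolding m_def by (rule max_transform_nonneg)
  have fm: "finite_moments (\<lambda>\<omega>. m n \<omega> powr q)" if "0 < q" for n q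
    using finite_moments_powr[OF finite_moments_max_transform that] m0 by (simp add: m_def)
  define w where "w i \<omega> = m i \<omega> powr (p - 1) * sgn (S i \<omega>) * \<eta> i \<omega>" for i \<omega>
  have wG: "w i \<in> borel_measurable (G i)" for i
    unfolding w_def[abs_def] m_def S_def
    using max_transform_measurable_G transform_measurable_G predictable_measurable by measurable
  have fw: "finite_moments (w i)" for i
  proof (rule finite_moments_mono)
    show "finite_moments (\<lambda>\<omega>. m i \<omega> powr (p - 1) * \<eta> i \<omega>)"
      by (intro finite_moments_mult fm finite_moments_predictable) (use p in auto)
    show "w i \<in> borel_measurable M" by (rule measurable_G_M[OF wG])
  qed (auto simp: w_def abs_mult abs_sgn_eq)
  have path: "1 / 4 * m n \<omega> powr p + (\<Sum>i<n. w i \<omega> * Z i \<omega>) \<le> 4 powr (p - 1) * \<bar>S n \<omega>\<bar> powr p" for \<omega>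
  proof -
    have "(p - 1) / p * m n \<omega> powr p + (\<Sum>i<n. m i \<omega> powr (p - 1) * (\<bar>S (Suc i) \<omega>\<bar> - \<bar>S i \<omega>\<bar>))
        \<le> m n \<omega> powr (p - 1) * \<bar>S n \<omega>\<bar>"
      using pathwise_doob[of p "\<lambda>i. \<bar>S i \<omega>\<bar>" n] p
      by (simp add: m_def S_def max_transform_def image_image)
    moreover have "(\<Sum>i<n. w i \<omega> * Z i \<omega>) \<le> (\<Sum>i<n. m i \<omega> powr (p - 1) * (\<bar>S (Suc i) \<omega>\<bar> - \<bar>S i \<omega>\<bar>))"
    proof (rule sum_mono)
      fix i
      have "sgn (S i \<omega>) * (S (Suc i) \<omega> - S i \<omega>) \<le> \<bar>S (Suc i) \<omega>\<bar> - \<bar>S i \<omega>\<bar>"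
        by (auto simp: sgn_if)
      moreover have "S (Suc i) \<omega> - S i \<omega> = \<eta> i \<omega> * Z i \<omega>" by (simp add: S_def transform_def)
      ultimately have "sgn (S i \<omega>) * (\<eta> i \<omega> * Z i \<omega>) \<le> \<bar>S (Suc i) \<omega>\<bar> - \<bar>S i \<omega>\<bar>" by simp
      hence "m i \<omega> powr (p - 1) * (sgn (S i \<omega>) * (\<eta> i \<omega> * Z i \<omega>))
          \<le> m i \<omega> powr (p - 1) * (\<bar>S (Suc i) \<omega>\<bar> - \<bar>S i \<omega>\<bar>)"
        by (rule mult_left_mono) simp
      thus "w i \<omega> * Z i \<omega> \<le> m i \<omega> powr (p - 1) * (\<bar>S (Suc i) \<omega>\<bar> - \<bar>S i \<omega>\<bar>)"
        by (simp add: w_def mult.assoc)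
    qed
    \<comment> \<open>As p \<ge> 2, half of m^p is available on the left; a quarter remains after
      the absorption, and 4 * 4^(p-1) = 4^p.\<close>
    moreover have "1/2 * m n \<omega> powr p \<le> (p - 1) / p * m n \<omega> powr p"
      by (rule mult_right_mono) (use p in \<open>auto simp: field_simps\<close>)
    moreover have "m n \<omega> powr (p - 1) * \<bar>S n \<omega>\<bar> \<le> 1/4 * m n \<omega> powr p + 4 powr (p - 1) * \<bar>S n \<omega>\<bar> powr p"
    proof (cases "\<bar>S n \<omega>\<bar> \<le> m n \<omega> / 4")
      case True
      have "m n \<omega> powr (p - 1) * \<bar>S n \<omega>\<bar> \<le> m n \<omega> powr (p - 1) * (m n \<omega> / 4)"
        using True by (rule mult_left_mono) simp
      also have "\<dots> = 1/4 * m n \<omega> powr p"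
        using m0[of n \<omega>] powr_add[of "m n \<omega>" "p - 1" 1] p by (cases "m n \<omega> = 0") auto
      finally show ?thesis by (simp add: add_increasing2)
    next
      case False
      have "m n \<omega> powr (p - 1) \<le> (4 * \<bar>S n \<omega>\<bar>) powr (p - 1)"
        by (rule powr_mono2) (use False p m0 in auto)
      hence "m n \<omega> powr (p - 1) * \<bar>S n \<omega>\<bar> \<le> (4 * \<bar>S n \<omega>\<bar>) powr (p - 1) * \<bar>S n \<omega>\<bar>"
        by (rule mult_right_mono) simp
      also have "\<dots> = 4 powr (p - 1) * \<bar>S n \<omega>\<bar> powr p"
        using powr_add[of "\<bar>S n \<omega>\<bar>" "p - 1" 1] p by (cases "S n \<omega> = 0") (auto simp: powr_mult)
      finally show ?thesis by (simp add: add_increasing)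
    qed
    ultimately show ?thesis by linarith
  qed
  have i1: "integrable M (\<lambda>\<omega>. m n \<omega> powr p)"
    using fm[of p n] p by (intro finite_moments_integrable) auto
  have i2: "integrable M (\<lambda>\<omega>. w i \<omega> * Z i \<omega>)" for i
    by (intro finite_moments_integrable finite_moments_mult fw finite_moments_Z)
  have i3: "integrable M (\<lambda>\<omega>. \<bar>S n \<omega>\<bar> powr p)"
    unfolding S_def using p by (intro finite_moments_integrable_powr finite_moments_transform) auto
  have "(\<integral>\<omega>. 1/4 * m n \<omega> powr p + (\<Sum>i<n. w i \<omega> * Z i \<omega>) \<partial>M) \<le> (\<integral>\<omega>. 4 powr (p - 1) * \<bar>S n \<omega>\<bar> powr p \<partial>M)"
    using path i1 i2 i3
    by (intro integral_mono Bochner_Integration.integrable_add Bochner_Integration.integrable_sum integrable_mult_right) auto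
  also have "(\<integral>\<omega>. 1/4 * m n \<omega> powr p + (\<Sum>i<n. w i \<omega> * Z i \<omega>) \<partial>M)
      = 1/4 * (\<integral>\<omega>. m n \<omega> powr p \<partial>M) + (\<Sum>i<n. \<integral>\<omega>. w i \<omega> * Z i \<omega> \<partial>M)"
    using i1 i2 by (subst Bochner_Integration.integral_add) (auto intro!: Bochner_Integration.integrable_sum)
  also have "(\<Sum>i<n. \<integral>\<omega>. w i \<omega> * Z i \<omega> \<partial>M) = 0"
    by (intro sum.neutral ballI integral_mult_Z_0 wG finite_moments_integrable fw)
  finally show ?thesis
    using powr_add[of 4 "p - 1" 1] by (simp add: m_def S_def)
qed

text \<open>In the expansion of the p-th power of S + \<eta> Z the linear term integrates to zero,
  and independence turns the other terms into moments of S and \<eta> times d and d^(p/2). The mixed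
  term is split by \<open>powr_mult_square_le\<close> with the whole horizon t, so that a step
  multiplies the moment by 1 plus a multiple of d/t only.\<close>

lemma transform_moment_step:
  assumes p: "2 \<le> p" and t: "0 < t" and dn: "d n \<le> t"
  shows "(\<integral>\<omega>. \<bar>transform \<eta> (Suc n) \<omega>\<bar> powr p \<partial>M) \<le>
    (1 + taylor_const p * gauss_moment 2 * (d n / t)) * (\<integral>\<omega>. \<bar>transform \<eta> n \<omega>\<bar> powr p \<partial>M) +
    taylor_const p * (gauss_moment 2 + gauss_moment p) * t powr (p / 2 - 1) * (d n * (\<integral>\<omega>. \<bar>\<eta> n \<omega>\<bar> powr p \<partial>M))"
proof -
  define S where "S = transform \<eta> n"
  define c where "c = taylor_const p"
  have c: "0 < c" using taylor_const_pos[OF p] by (simp add: c_def)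
  define g1 where "g1 \<omega> = p * \<bar>S \<omega>\<bar> powr (p - 1) * sgn (S \<omega>) * \<eta> n \<omega>" for \<omega>
  define g2 where "g2 \<omega> = \<bar>S \<omega>\<bar> powr (p - 2) * (\<eta> n \<omega>)\<^sup>2" for \<omega>
  define g3 where "g3 \<omega> = \<bar>\<eta> n \<omega>\<bar> powr p" for \<omega>
  note mS [measurable] = transform_measurable_G[of n, folded S_def] predictable_measurable[of n]
  have gG: "g1 \<in> borel_measurable (G n)" "g2 \<in> borel_measurable (G n)" "g3 \<in> borel_measurable (G n)"
    unfolding g1_def[abs_def] g2_def[abs_def] g3_def[abs_def] by measurable
  have fS: "finite_moments S" unfolding S_def by (rule finite_moments_transform)
  have f3: "finite_moments g3"
    unfolding g3_def[abs_def] using p by (intro finite_moments_powr finite_moments_predictable) auto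
  have f2: "finite_moments g2"
    unfolding g2_def[abs_def] power2_eq_square using p
    by (intro finite_moments_mult finite_moments_powr_nonneg fS finite_moments_predictable) auto
  have f1: "finite_moments g1"
  proof (rule finite_moments_mono)
    show "finite_moments (\<lambda>\<omega>. p * (\<bar>S \<omega>\<bar> powr (p - 1) * \<eta> n \<omega>))"
      using p by (intro finite_moments_mult finite_moments_bounded[of "\<lambda>_. p" p]
          finite_moments_powr fS finite_moments_predictable) auto
  qed (use measurable_G_M[OF gG(1)] in \<open>auto simp: g1_def abs_mult abs_sgn_eq\<close>)
  have fZ: "finite_moments (\<lambda>\<omega>. \<bar>Z n \<omega>\<bar> powr q)" if "0 < q" for q
    by (rule finite_moments_powr[OF finite_moments_Z that])
  have path: "\<bar>transform \<eta> (Suc n) \<omega>\<bar> powr p \<le>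
      \<bar>S \<omega>\<bar> powr p + g1 \<omega> * Z n \<omega> + c * (g2 \<omega> * \<bar>Z n \<omega>\<bar> powr 2 + g3 \<omega> * \<bar>Z n \<omega>\<bar> powr p)" for \<omega>
  proof -
    have "transform \<eta> (Suc n) \<omega> = S \<omega> + \<eta> n \<omega> * Z n \<omega>" by (simp add: S_def transform_def)
    thus ?thesis
      using abs_add_powr_le[OF p, of "S \<omega>" "\<eta> n \<omega> * Z n \<omega>"]
      by (simp add: g1_def g2_def g3_def c_def abs_mult powr_mult power_mult_distrib mult.assoc)
  qed
  have p0: "0 < p" using p by simp
  have I: "integrable M (\<lambda>\<omega>. \<bar>S \<omega>\<bar> powr p)" "integrable M (\<lambda>\<omega>. g1 \<omega> * Z n \<omega>)"
     "integrable M (\<lambda>\<omega>. g2 \<omega> * \<bar>Z n \<omega>\<bar> powr 2)" "integrable M (\<lambda>\<omega>. g3 \<omega> * \<bar>Z n \<omega>\<bar> powr p)"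
     "integrable M (\<lambda>\<omega>. \<bar>transform \<eta> (Suc n) \<omega>\<bar> powr p)"
    by (rule finite_moments_integrable_powr[OF fS p0]
        finite_moments_integrable[OF finite_moments_mult[OF f1 finite_moments_Z]]
        finite_moments_integrable[OF finite_moments_mult[OF f2 fZ[of 2]]]
        finite_moments_integrable[OF finite_moments_mult[OF f3 fZ[OF p0]]]
        finite_moments_integrable_powr[OF finite_moments_transform p0] zero_less_numeral)+
  have "(\<integral>\<omega>. \<bar>transform \<eta> (Suc n) \<omega>\<bar> powr p \<partial>M) \<le>
      (\<integral>\<omega>. \<bar>S \<omega>\<bar> powr p + g1 \<omega> * Z n \<omega> + c * (g2 \<omega> * \<bar>Z n \<omega>\<bar> powr 2 + g3 \<omega> * \<bar>Z n \<omega>\<bar> powr p) \<partial>M)"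
    using path I by (intro integral_mono Bochner_Integration.integrable_add integrable_mult_right)
  also have "\<dots> = (\<integral>\<omega>. \<bar>S \<omega>\<bar> powr p \<partial>M) + (\<integral>\<omega>. g1 \<omega> * Z n \<omega> \<partial>M) +
      c * ((\<integral>\<omega>. g2 \<omega> * \<bar>Z n \<omega>\<bar> powr 2 \<partial>M) + (\<integral>\<omega>. g3 \<omega> * \<bar>Z n \<omega>\<bar> powr p \<partial>M))"
    using I(1-4) by (simp del: powr_numeral)
  also have "(\<integral>\<omega>. g1 \<omega> * Z n \<omega> \<partial>M) = 0"
    by (rule integral_mult_Z_0[OF gG(1) finite_moments_integrable[OF f1]])
  also have "(\<integral>\<omega>. g2 \<omega> * \<bar>Z n \<omega>\<bar> powr 2 \<partial>M) = (\<integral>\<omega>. g2 \<omega> \<partial>M) * (d n powr (2 / 2) * gauss_moment 2)"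
    by (rule integral_mult_Z_powr[OF gG(2) finite_moments_integrable[OF f2]]) simp
  also have "(\<integral>\<omega>. g3 \<omega> * \<bar>Z n \<omega>\<bar> powr p \<partial>M) = (\<integral>\<omega>. g3 \<omega> \<partial>M) * (d n powr (p / 2) * gauss_moment p)"
    by (rule integral_mult_Z_powr[OF gG(3) finite_moments_integrable[OF f3]]) (use p in simp)
  finally have main: "(\<integral>\<omega>. \<bar>transform \<eta> (Suc n) \<omega>\<bar> powr p \<partial>M) \<le>
     (\<integral>\<omega>. \<bar>S \<omega>\<bar> powr p \<partial>M) + c * ((\<integral>\<omega>. g2 \<omega> \<partial>M) * (d n * gauss_moment 2) +
        (\<integral>\<omega>. g3 \<omega> \<partial>M) * (d n powr (p / 2) * gauss_moment p))"
    using d_pos[of n] by simp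
  have "(\<integral>\<omega>. g2 \<omega> \<partial>M) \<le> (\<integral>\<omega>. \<bar>S \<omega>\<bar> powr p / t + t powr (p/2 - 1) * g3 \<omega> \<partial>M)"
    using I(1) powr_mult_square_le[OF p t, of "\<bar>S _\<bar>"]
    by (intro integral_mono finite_moments_integrable[OF f2] Bochner_Integration.integrable_add
          integrable_mult_right finite_moments_integrable[OF f3]) (auto simp: g2_def g3_def)
  also have "\<dots> = (\<integral>\<omega>. \<bar>S \<omega>\<bar> powr p \<partial>M) / t + t powr (p/2 - 1) * (\<integral>\<omega>. g3 \<omega> \<partial>M)"
    using I(1) finite_moments_integrable[OF f3] by simp
  finally have A: "(\<integral>\<omega>. g2 \<omega> \<partial>M) * (d n * gauss_moment 2) \<le>
     ((\<integral>\<omega>. \<bar>S \<omega>\<bar> powr p \<partial>M) / t + t powr (p/2 - 1) * (\<integral>\<omega>. g3 \<omega> \<partial>M)) * (d n * gauss_moment 2)"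
    by (rule mult_right_mono) (use d_pos[of n] gauss_moment_nonneg in auto)
  have "d n powr (p / 2) \<le> d n * t powr (p/2 - 1)"
  proof -
    have "d n powr (p / 2) = d n * d n powr (p / 2 - 1)"
      using d_pos[of n] powr_add[of "d n" 1 "p / 2 - 1"] by simp
    also have "\<dots> \<le> d n * t powr (p / 2 - 1)"
      using d_pos[of n] dn p by (intro mult_left_mono powr_mono2) auto
    finally show ?thesis .
  qed
  hence B: "(\<integral>\<omega>. g3 \<omega> \<partial>M) * (d n powr (p / 2) * gauss_moment p) \<le>
      (\<integral>\<omega>. g3 \<omega> \<partial>M) * ((d n * t powr (p/2 - 1)) * gauss_moment p)"
    by (intro mult_left_mono mult_right_mono gauss_moment_nonneg integral_nonneg_AE) (auto simp: g3_def)
  have "c * ((\<integral>\<omega>. g2 \<omega> \<partial>M) * (d n * gauss_moment 2) +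
        (\<integral>\<omega>. g3 \<omega> \<partial>M) * (d n powr (p / 2) * gauss_moment p)) \<le>
     c * (((\<integral>\<omega>. \<bar>S \<omega>\<bar> powr p \<partial>M) / t + t powr (p/2 - 1) * (\<integral>\<omega>. g3 \<omega> \<partial>M)) * (d n * gauss_moment 2) +
       (\<integral>\<omega>. g3 \<omega> \<partial>M) * ((d n * t powr (p/2 - 1)) * gauss_moment p))"
    by (rule mult_left_mono[OF add_mono[OF A B]]) (use c in simp)
  also have "\<dots> = c * gauss_moment 2 * (d n / t) * (\<integral>\<omega>. \<bar>S \<omega>\<bar> powr p \<partial>M) +
      c * (gauss_moment 2 + gauss_moment p) * t powr (p / 2 - 1) * (d n * (\<integral>\<omega>. g3 \<omega> \<partial>M))"
    by (simp add: algebra_simps)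
  finally show ?thesis using main by (simp add: S_def c_def g3_def algebra_simps)
qed

text \<open>Discrete Gronwall: the factors 1 + \<alpha> d/t multiply to at most exp \<alpha>,
  because the cells together have length at most t. Hence the constant does not depend on the number
  of cells.\<close>

lemma transform_moment:
  assumes p: "2 \<le> p" and t: "0 < t" and dn: "(\<Sum>i<n. d i) \<le> t"
  shows "(\<integral>\<omega>. \<bar>transform \<eta> n \<omega>\<bar> powr p \<partial>M) \<le> exp (taylor_const p * gauss_moment 2) *
    (taylor_const p * (gauss_moment 2 + gauss_moment p) * t powr (p / 2 - 1) *
      (\<Sum>i<n. d i * (\<integral>\<omega>. \<bar>\<eta> i \<omega>\<bar> powr p \<partial>M)))"
proof -
  define \<alpha> where "\<alpha> = taylor_const p * gauss_moment 2"
  define \<beta> where "\<beta> = taylor_const p * (gauss_moment 2 + gauss_moment p) * t powr (p / 2 - 1)"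
  define e where "e i = (\<integral>\<omega>. \<bar>\<eta> i \<omega>\<bar> powr p \<partial>M)" for i
  have \<alpha>: "0 \<le> \<alpha>" and \<beta>: "0 \<le> \<beta>"
    using taylor_const_pos[OF p] gauss_moment_nonneg by (auto simp: \<alpha>_def \<beta>_def)
  have e: "0 \<le> e i" for i by (simp add: e_def)
  have *: "(\<Sum>i<k. d i) \<le> t \<Longrightarrow> (\<integral>\<omega>. \<bar>transform \<eta> k \<omega>\<bar> powr p \<partial>M) \<le>
      exp (\<alpha> * ((\<Sum>i<k. d i) / t)) * (\<beta> * (\<Sum>i<k. d i * e i))" for k
  proof (induction k)
    case 0
    show ?case using p by (simp add: transform_def)
  next
    case (Suc k)
    have s0: "0 \<le> (\<Sum>i<k. d i)" by (intro sum_nonneg) (use d_pos less_imp_le in auto)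
    have sk: "(\<Sum>i<k. d i) \<le> t" and dk: "d k \<le> t" using Suc.prems s0 d_pos[of k] by auto
    have dt: "0 \<le> \<alpha> * (d k / t)" using \<alpha> d_pos[of k] t by simp
    define E where "E = exp (\<alpha> * ((\<Sum>i<k. d i) / t))"
    define R where "R = \<beta> * (\<Sum>i<k. d i * e i)"
    have E1: "1 \<le> E" unfolding E_def using \<alpha> s0 t by simp
    have R: "0 \<le> R" unfolding R_def using \<beta> e d_pos less_imp_le by (intro mult_nonneg_nonneg sum_nonneg) auto
    have b: "0 \<le> \<beta> * (d k * e k)" using \<beta> e d_pos[of k] by simp
    have "(\<integral>\<omega>. \<bar>transform \<eta> (Suc k) \<omega>\<bar> powr p \<partial>M) \<le>
       (1 + \<alpha> * (d k / t)) * (\<integral>\<omega>. \<bar>transform \<eta> k \<omega>\<bar> powr p \<partial>M) + \<beta> * (d k * e k)"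
      using transform_moment_step[OF p t dk] by (simp add: \<alpha>_def \<beta>_def e_def)
    also have "\<dots> \<le> exp (\<alpha> * (d k / t)) * (E * R) + (exp (\<alpha> * (d k / t)) * E) * (\<beta> * (d k * e k))"
    proof (rule add_mono)
      show "(1 + \<alpha> * (d k / t)) * (\<integral>\<omega>. \<bar>transform \<eta> k \<omega>\<bar> powr p \<partial>M) \<le> exp (\<alpha> * (d k / t)) * (E * R)"
        using Suc.IH[OF sk] dt by (intro mult_mono exp_ge_add_one_self) (auto simp: E_def R_def)
      have "1 \<le> exp (\<alpha> * (d k / t)) * E"
        using mult_mono[of 1 "exp (\<alpha> * (d k / t))" 1 E] E1 dt by simp
      thus "\<beta> * (d k * e k) \<le> (exp (\<alpha> * (d k / t)) * E) * (\<beta> * (d k * e k))"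
        using b by (metis mult_1 mult_right_mono)
    qed
    also have "\<dots> = (exp (\<alpha> * (d k / t)) * E) * (R + \<beta> * (d k * e k))"
      by (simp add: algebra_simps)
    also have "exp (\<alpha> * (d k / t)) * E = exp (\<alpha> * ((\<Sum>i<Suc k. d i) / t))"
      unfolding E_def exp_add[symmetric] by (simp add: add_divide_distrib algebra_simps)
    also have "R + \<beta> * (d k * e k) = \<beta> * (\<Sum>i<Suc k. d i * e i)"
      by (simp add: R_def algebra_simps)
    finally show ?case .
  qed
  have "exp (\<alpha> * ((\<Sum>i<n. d i) / t)) \<le> exp (\<alpha> * 1)"
    using \<alpha> dn t by (subst exp_le_cancel_iff, intro mult_left_mono) auto
  hence "exp (\<alpha> * ((\<Sum>i<n. d i) / t)) * (\<beta> * (\<Sum>i<n. d i * e i)) \<le> exp \<alpha> * (\<beta> * (\<Sum>i<n. d i * e i))"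
    using \<beta> e d_pos less_imp_le by (intro mult_right_mono mult_nonneg_nonneg sum_nonneg) auto
  with *[OF dn] show ?thesis by (simp add: \<alpha>_def \<beta>_def e_def)
qed

end

end

text \<open>Doob's constant times the one of \<open>transform_moment\<close>. It depends on p alone,
  so estimates with it survive the refinement of the grid.\<close>

definition bdg_const :: "real \<Rightarrow> real" where
  "bdg_const p = 4 powr p * exp (taylor_const p * gauss_moment 2) *
     (taylor_const p * (gauss_moment 2 + gauss_moment p))"

lemma bdg_const_nonneg: "2 \<le> p \<Longrightarrow> 0 \<le> bdg_const p"
  using taylor_const_pos[of p] gauss_moment_nonneg by (simp add: bdg_const_def)

context gaussian_increments
begin

lemma max_transform_moment:
  assumes \<eta>: "predictable \<eta>" and p: "2 \<le> p" and t: "0 < t" and dn: "(\<Sum>i<n. d i) \<le> t"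
  shows "(\<integral>\<omega>. max_transform \<eta> n \<omega> powr p \<partial>M) \<le>
    bdg_const p * t powr (p / 2 - 1) * (\<Sum>i<n. d i * (\<integral>\<omega>. \<bar>\<eta> i \<omega>\<bar> powr p \<partial>M))"
proof -
  have "(\<integral>\<omega>. max_transform \<eta> n \<omega> powr p \<partial>M) \<le> 4 powr p * (\<integral>\<omega>. \<bar>transform \<eta> n \<omega>\<bar> powr p \<partial>M)"
    by (rule doob_transform[OF \<eta> p])
  also have "\<dots> \<le> 4 powr p * (exp (taylor_const p * gauss_moment 2) *
    (taylor_const p * (gauss_moment 2 + gauss_moment p) * t powr (p / 2 - 1) *
      (\<Sum>i<n. d i * (\<integral>\<omega>. \<bar>\<eta> i \<omega>\<bar> powr p \<partial>M))))"
    by (intro mult_left_mono transform_moment[OF \<eta> p t dn]) simp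
  finally show ?thesis by (simp add: bdg_const_def mult.assoc)
qed

text \<open>Stopping just before the quadratic variation exceeds \<open>a\<close> keeps the
  integrand predictable, because the contribution of step \<open>i\<close> is known at time \<open>i\<close>.\<close>

lemma lenglart_transform:
  assumes \<eta>: "predictable \<eta>" and l: "0 < l" and a: "0 \<le> a"
  shows "measure M {\<omega>\<in>space M. l < max_transform \<eta> n \<omega> \<and> (\<Sum>i<n. d i * (\<eta> i \<omega>)\<^sup>2) \<le> a} \<le> bdg_const 2 * a / l\<^sup>2"
proof (cases "n = 0")
  case True
  have "{\<omega>\<in>space M. l < max_transform \<eta> n \<omega> \<and> (\<Sum>i<n. d i * (\<eta> i \<omega>)\<^sup>2) \<le> a} = {}"
    using l True by (auto simp: max_transform_def transform_def)
  hence "measure M {\<omega>\<in>space M. l < max_transform \<eta> n \<omega> \<and> (\<Sum>i<n. d i * (\<eta> i \<omega>)\<^sup>2) \<le> a} = 0"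
    by (metis measure_empty)
  thus ?thesis using a bdg_const_nonneg[of 2] by simp
next
  case False
  define q where "q i \<omega> = (\<Sum>j\<le>i. d j * (\<eta> j \<omega>)\<^sup>2)" for i \<omega>
  define \<eta>' where "\<eta>' i \<omega> = (if q i \<omega> \<le> a then \<eta> i \<omega> else 0)" for i \<omega>
  have [measurable]: "q i \<in> borel_measurable (G i)" for i
    unfolding q_def[abs_def]
    by (intro borel_measurable_sum borel_measurable_times borel_measurable_power
        measurable_G_G[OF _ predictable_measurable[OF \<eta>]]) auto
  have \<eta>': "predictable \<eta>'"
    unfolding predictable_def
  proof (intro allI conjI)
    fix i
    have [measurable]: "\<eta> i \<in> borel_measurable (G i)" by (rule predictable_measurable[OF \<eta>])
    show "\<eta>' i \<in> borel_measurable (G i)" unfolding \<eta>'_def[abs_def] by measurable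
    obtain c where c: "\<forall>\<omega>\<in>space M. \<bar>\<eta> i \<omega>\<bar> \<le> c" using \<eta> unfolding predictable_def by blast
    have "\<forall>\<omega>\<in>space M. \<bar>\<eta>' i \<omega>\<bar> \<le> max c 0" using c by (auto simp: \<eta>'_def le_max_iff_disj)
    thus "\<exists>c. \<forall>\<omega>\<in>space M. \<bar>\<eta>' i \<omega>\<bar> \<le> c" ..
  qed
  have qv: "(\<Sum>i<k. d i * (\<eta>' i \<omega>)\<^sup>2) \<le> a" for k \<omega>
  proof (induction k)
    case (Suc k)
    show ?case
    proof (cases "q k \<omega> \<le> a")
      case True
      have "(\<Sum>i<Suc k. d i * (\<eta>' i \<omega>)\<^sup>2) \<le> (\<Sum>i<Suc k. d i * (\<eta> i \<omega>)\<^sup>2)"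
        using d_pos less_imp_le by (intro sum_mono mult_left_mono) (auto simp: \<eta>'_def)
      thus ?thesis using True by (simp add: q_def lessThan_Suc_atMost)
    qed (use Suc in \<open>simp add: \<eta>'_def\<close>)
  qed (use a in simp)
  define t where "t = (\<Sum>i<n. d i)"
  have t: "0 < t" unfolding t_def using False d_pos by (intro sum_pos) auto
  have i2: "integrable M (\<lambda>\<omega>. \<bar>\<eta>' i \<omega>\<bar> powr 2)" for i
    by (rule finite_moments_integrable_powr[OF finite_moments_predictable[OF \<eta>']]) simp
  have "(\<integral>\<omega>. max_transform \<eta>' n \<omega> powr 2 \<partial>M) \<le>
      bdg_const 2 * t powr (2 / 2 - 1) * (\<Sum>i<n. d i * (\<integral>\<omega>. \<bar>\<eta>' i \<omega>\<bar> powr 2 \<partial>M))"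
    by (rule max_transform_moment[OF \<eta>' _ t]) (auto simp: t_def)
  \<comment> \<open>For p = 2 the horizon enters with the power 0, so that only the quadratic
    variation is left, which the stopping keeps below a.\<close>
  also have "\<dots> = bdg_const 2 * (\<integral>\<omega>. (\<Sum>i<n. d i * (\<eta>' i \<omega>)\<^sup>2) \<partial>M)"
    using t i2 by (subst Bochner_Integration.integral_sum) auto
  also have "\<dots> \<le> bdg_const 2 * (\<integral>\<omega>. a \<partial>M)"
    using qv i2 by (intro mult_left_mono integral_mono bdg_const_nonneg) auto
  finally have E: "(\<integral>\<omega>. max_transform \<eta>' n \<omega> powr 2 \<partial>M) \<le> bdg_const 2 * a" by (simp add: prob_space)
  have [measurable]: "max_transform \<eta>' n \<in> borel_measurable M"
    by (rule measurable_G_M[OF max_transform_measurable_G[OF \<eta>']])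
  have "{\<omega>\<in>space M. l < max_transform \<eta> n \<omega> \<and> (\<Sum>i<n. d i * (\<eta> i \<omega>)\<^sup>2) \<le> a} \<subseteq>
      {\<omega>\<in>space M. max_transform \<eta>' n \<omega> powr 2 \<ge> l\<^sup>2}"
  proof safe
    fix \<omega> assume \<omega>: "\<omega> \<in> space M" "l < max_transform \<eta> n \<omega>" "(\<Sum>i<n. d i * (\<eta> i \<omega>)\<^sup>2) \<le> a"
    \<comment> \<open>On the event in question the stopping rule never acts before n, and the two
      transforms agree.\<close>
    have "q i \<omega> \<le> a" if "i < n" for i
    proof -
      have "q i \<omega> \<le> (\<Sum>i<n. d i * (\<eta> i \<omega>)\<^sup>2)"
        unfolding q_def using that d_pos by (intro sum_mono2) (auto simp: less_imp_le)
      thus ?thesis using \<omega> by simp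
    qed
    hence "transform \<eta>' j \<omega> = transform \<eta> j \<omega>" if "j \<le> n" for j
      unfolding transform_def using that by (intro sum.cong) (auto simp: \<eta>'_def)
    hence "max_transform \<eta>' n \<omega> = max_transform \<eta> n \<omega>"
      unfolding max_transform_def by (intro arg_cong[where f=Max] image_cong) auto
    thus "l\<^sup>2 \<le> max_transform \<eta>' n \<omega> powr 2"
      using \<omega> l by (simp add: power_mono)
  qed
  hence "measure M {\<omega>\<in>space M. l < max_transform \<eta> n \<omega> \<and> (\<Sum>i<n. d i * (\<eta> i \<omega>)\<^sup>2) \<le> a} \<le>
      measure M {\<omega>\<in>space M. max_transform \<eta>' n \<omega> powr 2 \<ge> l\<^sup>2}"
    by (intro finite_measure_mono) auto
  also have "\<dots> \<le> (\<integral>\<omega>. max_transform \<eta>' n \<omega> powr 2 \<partial>M) / l\<^sup>2"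
  proof (rule integral_Markov_inequality_measure[where A="{}"])
    show "integrable M (\<lambda>\<omega>. max_transform \<eta>' n \<omega> powr 2)"
      using finite_moments_integrable_powr[OF finite_moments_max_transform[OF \<eta>', of n], of 2]
      unfolding abs_of_nonneg[OF max_transform_nonneg[OF \<eta>']] by simp
  qed (use l in auto)
  also have "\<dots> \<le> bdg_const 2 * a / l\<^sup>2"
    using E by (intro divide_right_mono) auto
  finally show ?thesis .
qed

end

section \<open>Moments of Ito integrals\<close>

text \<open>Beyond the largest point of A the enumeration goes on in unit steps, because
  \<open>gaussian_increments\<close> asks for an infinite grid with cells of positive
  length.\<close>

lemma strict_mono_enumeration:
  fixes A :: "real set"
  assumes "finite A" "A \<noteq> {}"
  obtains g :: "nat \<Rightarrow> real" and N where "strict_mono g" "g ` {..N} = A"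
proof -
  have "\<exists>g N. strict_mono g \<and> g ` {..N::nat} = A"
    using assms
  proof (induction A rule: finite_linorder_max_induct)
    case (insert b A)
    show ?case
    proof (cases "A = {}")
      case True
      have "strict_mono (\<lambda>i. b + real i)" by (auto intro!: strict_monoI)
      moreover have "(\<lambda>i. b + real i) ` {..0} = insert b A" using True by simp
      ultimately show ?thesis by blast
    next
      case False
      then obtain g N where g: "strict_mono g" "g ` {..N::nat} = A" using insert by blast
      define g' where "g' i = (if i \<le> N then g i else b + (real i - real N - 1))" for i
      have "g i < b" if "i \<le> N" for i using g(2) insert.hyps(2) that by auto
      hence "g' i < g' (Suc i)" for i
        using strict_monoD[OF g(1), of i "Suc i"] by (cases i N rule: linorder_cases) (auto simp: g'_def)
      hence "strict_mono g'" by (simp add: strict_mono_Suc_iff)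
      moreover have "g' ` {..Suc N} = insert b A"
        unfolding atMost_Suc image_insert using g(2) by (auto simp: g'_def image_def)
      ultimately show ?thesis by blast
    qed
  qed simp
  thus ?thesis using that by blast
qed

text \<open>A common refinement of three sets: the jump times A of a simple integrand, the times Q
  at which its integral is observed, and a mesh of width \<delta>. The mesh limits the delay with
  which the grid notices a stopping event.\<close>

lemma grid_exists:
  fixes s T \<delta> :: real
  assumes st: "s < T" and A: "finite A" and Q: "finite Q" "Q \<subseteq> {s..T}" and \<delta>: "0 < \<delta>"
  obtains g :: "nat \<Rightarrow> real" and N where "strict_mono g" "g 0 = s" "g N = T" "Q \<subseteq> g ` {..N}"
    "\<And>i x. i < N \<Longrightarrow> x \<in> A \<Longrightarrow> \<not> (g i < x \<and> x < g (Suc i))"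
    "\<And>i. i < N \<Longrightarrow> g (Suc i) - g i \<le> \<delta>"
proof -
  define m where "m = nat \<lceil>(T - s) / \<delta>\<rceil>"
  define U where "U = (\<lambda>k. s + real k * \<delta>) ` {..m} \<inter> {s..T}"
  define E where "E = insert s (insert T (Q \<union> (A \<inter> {s..T}) \<union> U))"
  have "finite E" "E \<noteq> {}" using A Q by (auto simp: E_def U_def)
  then obtain g N where g: "strict_mono g" "g ` {..N::nat} = E" by (rule strict_mono_enumeration)
  have E: "E \<subseteq> {s..T}" using st Q by (auto simp: E_def U_def)
  note less = strict_mono_less[OF g(1)] and less_eq = strict_mono_less_eq[OF g(1)]
  have mem: "g i \<in> E" if "i \<le> N" for i using g(2) that by blast
  have in_st: "s \<le> g i \<and> g i \<le> T" if "i \<le> N" for i using mem[OF that] E by auto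
  obtain i where i: "i \<le> N" "s = g i" using g(2) by (metis E_def atMost_iff imageE insertI1)
  have g0: "g 0 = s" using in_st[of 0] less_eq[of 0 i] i by simp
  obtain j where j: "j \<le> N" "T = g j" using g(2) by (metis E_def atMost_iff imageE insertI1 insertI2)
  have gN: "g N = T" using in_st[of N] less_eq[of j N] j by simp
  have gap: "\<not> (g i < x \<and> x < g (Suc i))" if x: "x \<in> E" for i x
  proof -
    obtain j where "x = g j" using x g(2) by blast
    thus ?thesis using less[of i j] less[of j "Suc i"] by auto
  qed
  show ?thesis
  proof (rule that[OF g(1) g0 gN])
    show "Q \<subseteq> g ` {..N}" unfolding g(2) by (auto simp: E_def)
    show "\<not> (g i < x \<and> x < g (Suc i))" if "i < N" "x \<in> A" for i x
    proof
      assume x: "g i < x \<and> x < g (Suc i)"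
      hence "x \<in> {s..T}" using in_st[of i] in_st[of "Suc i"] that by auto
      hence "x \<in> E" using that by (auto simp: E_def)
      thus False using gap x by blast
    qed
    show "g (Suc i) - g i \<le> \<delta>" if i: "i < N" for i
    proof (rule ccontr)
      assume *: "\<not> g (Suc i) - g i \<le> \<delta>"
      \<comment> \<open>The first mesh point strictly to the right of \<open>g i\<close>. It is at
        most \<delta> away, so a longer cell would contain it in its interior.\<close>
      define k where "k = nat (\<lfloor>(g i - s) / \<delta>\<rfloor> + 1)"
      define x where "x = s + real k * \<delta>"
      have gi: "s \<le> g i" "g (Suc i) \<le> T" using in_st[of i] in_st[of "Suc i"] i by auto
      have f0: "0 \<le> \<lfloor>(g i - s) / \<delta>\<rfloor>" using gi \<delta> by simp
      have k: "real k = of_int \<lfloor>(g i - s) / \<delta>\<rfloor> + 1" using f0 by (simp add: k_def)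
      have lo: "(g i - s) / \<delta> < real k" and hi: "real k \<le> (g i - s) / \<delta> + 1"
        unfolding k by linarith+
      have "g i < x" using lo \<delta> by (simp add: x_def field_simps)
      moreover have "x \<le> g i + \<delta>" using hi \<delta> by (simp add: x_def field_simps)
      hence "x < g (Suc i)" using * by linarith
      moreover have "x \<in> E"
      proof -
        have "x \<le> T" "s \<le> x" using \<open>x < g (Suc i)\<close> gi \<open>g i < x\<close> by linarith+
        moreover from this have "real k \<le> (T - s) / \<delta>" using \<delta> by (simp add: x_def field_simps)
        hence "k \<le> m" unfolding m_def by linarith
        ultimately show ?thesis by (auto simp: E_def U_def x_def)
      qed
      ultimately show False using gap by blast
    qed
  qed
qed

text \<open>Compares discrete sums with time integrals: the \<open>c i\<close> are the values of a
  step function below f. The cells are open on the left, like the intervals on which simple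
  processes are constant.\<close>

lemma cell_sum_le:
  fixes g :: "nat \<Rightarrow> real" and f :: "real \<Rightarrow> ennreal"
  assumes g: "strict_mono g" and c: "\<And>i. i < N \<Longrightarrow> 0 \<le> c i"
    and le: "\<And>i s. i < N \<Longrightarrow> g i < s \<Longrightarrow> s \<le> g (Suc i) \<Longrightarrow> ennreal (c i) \<le> f s"
  shows "ennreal (\<Sum>i<N. (g (Suc i) - g i) * c i) \<le> (\<integral>\<^sup>+s\<in>{g 0..g N}. f s \<partial>lborel)"
proof -
  note less = strict_mono_less[OF g] and less_eq = strict_mono_less_eq[OF g]
  have d: "0 < g (Suc i) - g i" for i using less[of i "Suc i"] by simp
  have "ennreal (\<Sum>i<N. (g (Suc i) - g i) * c i) = (\<Sum>i<N. ennreal ((g (Suc i) - g i) * c i))"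
    using c d by (subst sum_ennreal) (auto simp: less_imp_le)
  also have "\<dots> = (\<Sum>i<N. \<integral>\<^sup>+s. ennreal (c i) * indicator {g i<..g (Suc i)} s \<partial>lborel)"
    using c d less_imp_le[OF d]
    by (intro sum.cong refl) (simp add: nn_integral_cmult_indicator ennreal_mult mult.commute)
  also have "\<dots> = (\<integral>\<^sup>+s. (\<Sum>i<N. ennreal (c i) * indicator {g i<..g (Suc i)} s) \<partial>lborel)"
    by (rule nn_integral_sum[symmetric]) auto
  also have "\<dots> \<le> (\<integral>\<^sup>+s\<in>{g 0..g N}. f s \<partial>lborel)"
  proof (rule nn_integral_mono)
    fix s
    show "(\<Sum>i<N. ennreal (c i) * indicator {g i<..g (Suc i)} s) \<le> f s * indicator {g 0..g N} s"
    proof (cases "\<exists>i<N. g i < s \<and> s \<le> g (Suc i)")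
      case True
      then obtain i where i: "i < N" "g i < s" "s \<le> g (Suc i)" by blast
      have uniq: "j = i" if "g j < s" "s \<le> g (Suc j)" for j
      proof -
        have "g j < g (Suc i)" "g i < g (Suc j)" using that i by linarith+
        thus ?thesis using less[of j "Suc i"] less[of i "Suc j"] by simp
      qed
      have "(\<Sum>j<N. ennreal (c j) * indicator {g j<..g (Suc j)} s) = (\<Sum>j<N. if j = i then ennreal (c i) else 0)"
      proof (rule sum.cong[OF refl])
        fix j
        show "ennreal (c j) * indicator {g j<..g (Suc j)} s = (if j = i then ennreal (c i) else 0)"
          using uniq[of j] i by (cases "j = i") (auto simp: indicator_def)
      qed
      also have "\<dots> = ennreal (c i)" using i by simp
      also have "\<dots> \<le> f s" by (rule le) (use i in auto)
      also have "f s = f s * indicator {g 0..g N} s"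
        using i less_eq[of 0 i] less_eq[of "Suc i" N] by (auto simp: indicator_def)
      finally show ?thesis .
    next
      case False
      hence "(\<Sum>i<N. ennreal (c i) * indicator {g i<..g (Suc i)} s) = 0"
        by (intro sum.neutral) (auto simp: indicator_def)
      thus ?thesis by simp
    qed
  qed
  finally show ?thesis .
qed

definition trunc :: "real \<Rightarrow> real \<Rightarrow> real" where
  "trunc R x = max (- R) (min R x)"

lemma trunc_measurable [measurable]: "trunc R \<in> borel_measurable borel"
  unfolding trunc_def[abs_def] by measurable

lemma abs_trunc_le: "0 \<le> R \<Longrightarrow> \<bar>trunc R x\<bar> \<le> R"
  by (auto simp: trunc_def)

lemma abs_trunc_le_abs: "0 \<le> R \<Longrightarrow> \<bar>trunc R x\<bar> \<le> \<bar>x\<bar>"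
  by (auto simp: trunc_def)

lemma trunc_lipschitz: "\<bar>trunc R x - trunc R y\<bar> \<le> \<bar>x - y\<bar>"
  by (auto simp: trunc_def)

lemma trunc_eq: "\<bar>x\<bar> \<le> R \<Longrightarrow> trunc R x = x"
  by (auto simp: trunc_def)

text \<open>The left side is the distance of x from the interval [-R, R], which is 1-Lipschitz in
  x.\<close>

lemma abs_diff_trunc_le: "0 \<le> R \<Longrightarrow> \<bar>x - trunc R x\<bar> \<le> \<bar>x - y\<bar> + \<bar>y - trunc R y\<bar>"
  by (auto simp: trunc_def)

text \<open>The events \<open>D t\<close> play the role of \<open>{t \<le> \<tau>}\<close> for a stopping time \<open>\<tau>\<close>.\<close>

definition stopping_events :: "'a measure \<Rightarrow> (real \<Rightarrow> 'a measure) \<Rightarrow> (real \<Rightarrow> 'a set) \<Rightarrow> bool" where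
  "stopping_events P F D \<longleftrightarrow>
     (\<forall>t\<ge>0. D t \<in> sets (F t)) \<and> (\<forall>s t. s \<le> t \<longrightarrow> D t \<subseteq> D s) \<and>
     (\<forall>t>0. \<forall>\<omega>. (\<forall>s<t. \<omega> \<in> D s) \<longrightarrow> \<omega> \<in> D t) \<and>
     Measurable.pred (borel \<Otimes>\<^sub>M P) (\<lambda>(t, \<omega>). \<omega> \<in> D t)"

section \<open>Simple integrands with respect to Brownian motion\<close>

locale brownian_setting = complete_filtered_prob_space P F
  for P :: "'a measure" and F :: "real \<Rightarrow> 'a measure" +
  fixes B :: "real \<Rightarrow> 'a \<Rightarrow> real"
  assumes brownian: "brownian_motion P F B"
begin

lemma subalg_F_F: "s \<le> t \<Longrightarrow> subalgebra (F t) (F s)"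
  using sets_F_mono[of s t] by (simp add: subalgebra_def space_F)

lemmas measurable_F_P = measurable_from_subalg[OF subalgebra_F]
lemmas measurable_F_F = measurable_from_subalg[OF subalg_F_F]

lemma sets_F_P: "A \<in> sets (F t) \<Longrightarrow> A \<in> sets P"
  using subalgebra_F by (auto simp: subalgebra_def)

lemma B_measurable: "0 \<le> t \<Longrightarrow> B t \<in> borel_measurable (F t)"
  using brownian by (auto simp: brownian_motion_def adapted_def)

lemma gaussian_increments_B:
  assumes g: "strict_mono g" "0 \<le> g 0"
  shows "gaussian_increments P (\<lambda>i. F (g i)) (\<lambda>i \<omega>. B (g (Suc i)) \<omega> - B (g i) \<omega>) (\<lambda>i. g (Suc i) - g i)"
proof
  fix i
  have g0: "0 \<le> g i" for i using strict_mono_less_eq[OF g(1), of 0 i] g(2) by simp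
  have gS: "g i < g (Suc i)" using strict_monoD[OF g(1)] by simp
  show "subalgebra P (F (g i))" by (rule subalgebra_F)
  show "sets (F (g i)) \<subseteq> sets (F (g (Suc i)))" using gS by (intro sets_F_mono) simp
  show "(\<lambda>\<omega>. B (g (Suc i)) \<omega> - B (g i) \<omega>) \<in> borel_measurable (F (g (Suc i)))"
    using gS g0 by (intro borel_measurable_diff B_measurable measurable_F_F[OF _ B_measurable]) auto
  show "0 < g (Suc i) - g i" using gS by simp
  show "distributed P lborel (\<lambda>\<omega>. B (g (Suc i)) \<omega> - B (g i) \<omega>)
      (\<lambda>x. ennreal (normal_density 0 (sqrt (g (Suc i) - g i)) x))"
    and "indep_set (sets (F (g i))) (sets (vimage_algebra (space P) (\<lambda>\<omega>. B (g (Suc i)) \<omega> - B (g i) \<omega>) borel))"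
    using brownian g0 gS by (auto simp: brownian_motion_def)
qed

text \<open>On a cell without jump times inside, the process has its value at the right end point v,
  yet this value is already known at the left end point u. That is what makes the sampled integrand
  predictable.\<close>

lemma simple_process_on_cell:
  assumes S: "simple_integrand P F n \<tau> \<eta>" and uv: "u < v"
    and gap: "\<And>j. j \<le> n \<Longrightarrow> \<not> (u < \<tau> j \<and> \<tau> j < v)"
  shows "simple_process n \<tau> \<eta> v \<in> borel_measurable (F u)"
    and "\<exists>c. \<forall>\<omega>\<in>space P. \<bar>simple_process n \<tau> \<eta> v \<omega>\<bar> \<le> c"
    and "u < s \<Longrightarrow> s \<le> v \<Longrightarrow> simple_process n \<tau> \<eta> s \<omega> = simple_process n \<tau> \<eta> v \<omega>"
    and "simple_ito_integral B n \<tau> \<eta> v \<omega> - simple_ito_integral B n \<tau> \<eta> u \<omega> =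
      simple_process n \<tau> \<eta> v \<omega> * (B v \<omega> - B u \<omega>)"
proof -
  have le: "\<tau> i \<le> \<tau> (Suc i)" and m: "\<eta> i \<in> borel_measurable (F (\<tau> i))"
    and bd: "\<exists>c. \<forall>\<omega>\<in>space P. \<bar>\<eta> i \<omega>\<bar> \<le> c" if "i < n" for i
    using S that by (auto simp: simple_integrand_def)
  have i1: "u < v" "\<not> (u < \<tau> i \<and> \<tau> i < v)" "\<not> (u < \<tau> (Suc i) \<and> \<tau> (Suc i) < v)" if "i < n" for i
    using gap[of i] gap[of "Suc i"] that uv by auto
  show "simple_process n \<tau> \<eta> v \<in> borel_measurable (F u)"
    unfolding simple_process_def[abs_def]
  proof (rule borel_measurable_sum)
    fix i assume "i \<in> {..<n}"
    hence i: "i < n" by simp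
    show "(\<lambda>\<omega>. \<eta> i \<omega> * indicator {\<tau> i<..\<tau> (Suc i)} v) \<in> borel_measurable (F u)"
    proof (cases "\<tau> i < v")
      case True
      hence "\<tau> i \<le> u" using i1[OF i] by auto
      from measurable_F_F[OF this m[OF i]] show ?thesis by measurable
    qed simp
  qed
  show "\<exists>c. \<forall>\<omega>\<in>space P. \<bar>simple_process n \<tau> \<eta> v \<omega>\<bar> \<le> c"
  proof -
    obtain c where c: "\<And>i \<omega>. i < n \<Longrightarrow> \<omega> \<in> space P \<Longrightarrow> \<bar>\<eta> i \<omega>\<bar> \<le> c i" using bd by metis
    have "\<bar>simple_process n \<tau> \<eta> v \<omega>\<bar> \<le> (\<Sum>i<n. c i)" if "\<omega> \<in> space P" for \<omega>
      unfolding simple_process_def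
    proof (rule order_trans[OF sum_abs sum_mono])
      fix i assume "i \<in> {..<n}"
      thus "\<bar>\<eta> i \<omega> * indicator {\<tau> i<..\<tau> (Suc i)} v\<bar> \<le> c i"
        using c[of i \<omega>] that by (auto simp: indicator_def)
    qed
    thus ?thesis by blast
  qed
  show "simple_process n \<tau> \<eta> s \<omega> = simple_process n \<tau> \<eta> v \<omega>" if s: "u < s" "s \<le> v"
    unfolding simple_process_def
  proof (rule sum.cong[OF refl])
    fix i assume "i \<in> {..<n}"
    hence "indicator {\<tau> i<..\<tau> (Suc i)} s = (indicator {\<tau> i<..\<tau> (Suc i)} v :: real)"
      using i1[of i] s by (auto simp: indicator_def)
    thus "\<eta> i \<omega> * indicator {\<tau> i<..\<tau> (Suc i)} s = \<eta> i \<omega> * indicator {\<tau> i<..\<tau> (Suc i)} v" by simp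
  qed
  show "simple_ito_integral B n \<tau> \<eta> v \<omega> - simple_ito_integral B n \<tau> \<eta> u \<omega> =
      simple_process n \<tau> \<eta> v \<omega> * (B v \<omega> - B u \<omega>)"
    unfolding simple_ito_integral_def simple_process_def sum_distrib_right sum_subtractf[symmetric]
  proof (rule sum.cong[OF refl])
    fix i assume "i \<in> {..<n}"
    hence i: "i < n" by simp
    have "(B (min v (\<tau> (Suc i))) \<omega> - B (min v (\<tau> i)) \<omega>) - (B (min u (\<tau> (Suc i))) \<omega> - B (min u (\<tau> i)) \<omega>)
       = indicator {\<tau> i<..\<tau> (Suc i)} v * (B v \<omega> - B u \<omega>)"
      using i1[OF i] le[OF i] by (auto simp: indicator_def min_def)
    thus "\<eta> i \<omega> * (B (min v (\<tau> (Suc i))) \<omega> - B (min v (\<tau> i)) \<omega>) - \<eta> i \<omega> * (B (min u (\<tau> (Suc i))) \<omega> - B (min u (\<tau> i)) \<omega>)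
       = \<eta> i \<omega> * indicator {\<tau> i<..\<tau> (Suc i)} v * (B v \<omega> - B u \<omega>)"
      by (simp add: right_diff_distrib[symmetric] mult.assoc)
  qed
qed

text \<open>The integrand is split into a truncated and stopped part \<open>e'\<close> and a
  remainder \<open>f\<close>. The first carries the moment bound, through its maximal transform Z.
  The remainder is estimated by \<open>lenglart_transform\<close>, only in probability, which
  produces the exceptional set A. The truncation is needed because convergence in probability of
  simple integrands gives no control of their p-th moments.\<close>

lemma simple_ito_estimate:
  assumes S: "simple_integrand P F n \<tau> \<eta>" and D: "stopping_events P F D"
    and s: "0 \<le> s" "s < T" and R: "0 \<le> R" and \<delta>: "0 < \<delta>" and p: "2 \<le> p"
    and Q: "finite Q" "Q \<subseteq> {s..T}"
  obtains Z where "Z \<in> borel_measurable P" "\<And>\<omega>. 0 \<le> Z \<omega>"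
    "(\<integral>\<^sup>+\<omega>. ennreal (Z \<omega> powr p) \<partial>P) \<le> ennreal (bdg_const p * (T - s) powr (p / 2 - 1)) *
       (\<integral>\<^sup>+u\<in>{s..T}. (\<integral>\<^sup>+\<omega>. ennreal (\<bar>trunc R (simple_process n \<tau> \<eta> u \<omega>)\<bar> powr p) *
          indicator (D (max s (u - \<delta>))) \<omega> \<partial>P) \<partial>lborel)"
    "\<And>l a. 0 < l \<Longrightarrow> 0 \<le> a \<Longrightarrow> \<exists>A\<in>sets P. measure P A \<le> bdg_const 2 * a / l\<^sup>2 \<and>
       (\<forall>\<omega>\<in>D T. (\<integral>\<^sup>+u\<in>{s..T}. ennreal ((simple_process n \<tau> \<eta> u \<omega> - trunc R (simple_process n \<tau> \<eta> u \<omega>))\<^sup>2) \<partial>lborel) \<le> ennreal a \<longrightarrow>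
         (\<exists>t\<in>Q. Z \<omega> + l < \<bar>simple_ito_integral B n \<tau> \<eta> t \<omega> - simple_ito_integral B n \<tau> \<eta> s \<omega>\<bar>) \<longrightarrow> \<omega> \<in> A)"
proof -
  have "finite (\<tau> ` {..n})" by simp
  from grid_exists[OF s(2) this Q \<delta>] obtain g N where g: "strict_mono g" "g 0 = s" "g N = T"
    "Q \<subseteq> g ` {..N}" "\<And>i x. i < N \<Longrightarrow> x \<in> \<tau> ` {..n} \<Longrightarrow> \<not> (g i < x \<and> x < g (Suc i))"
    "\<And>i. i < N \<Longrightarrow> g (Suc i) - g i \<le> \<delta>" by metis
  define d where "d i = g (Suc i) - g i" for i
  define DB where "DB i \<omega> = B (g (Suc i)) \<omega> - B (g i) \<omega>" for i \<omega>
  interpret gi: gaussian_increments P "\<lambda>i. F (g i)" DB d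
    unfolding DB_def[abs_def] d_def[abs_def] by (rule gaussian_increments_B[OF g(1)]) (use s g in simp)
  define H where "H = simple_process n \<tau> \<eta>"
  define J where "J = simple_ito_integral B n \<tau> \<eta>"
  have gS: "g i < g (Suc i)" for i using strict_monoD[OF g(1)] by simp
  have gs: "s \<le> g i" for i using strict_mono_less_eq[OF g(1), of 0 i] g(2) by simp
  have gT: "g i \<le> T" if "i \<le> N" for i using strict_mono_less_eq[OF g(1), of i N] g(3) that by simp
  have gap: "\<not> (g i < \<tau> j \<and> \<tau> j < g (Suc i))" if "i < N" "j \<le> n" for i j
    using g(5)[OF that(1), of "\<tau> j"] that(2) by auto
  note cell = simple_process_on_cell[OF S gS gap, folded H_def J_def]
  define e where "e i \<omega> = (if i < N then H (g (Suc i)) \<omega> else 0)" for i \<omega>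
  \<comment> \<open>The event is taken at the left end point of the cell. This keeps
    \<open>e'\<close> predictable, at the cost of a delay of at most the mesh width.\<close>
  define e' where "e' i \<omega> = trunc R (e i \<omega>) * indicator (D (g i)) \<omega>" for i \<omega>
  have DF: "D t \<in> sets (F t)" if "0 \<le> t" for t using D that by (simp add: stopping_events_def)
  have Dmono: "D t \<subseteq> D s" if "s \<le> t" for s t using D that by (simp add: stopping_events_def)
  have eG: "e i \<in> borel_measurable (F (g i))" for i
    unfolding e_def[abs_def] using cell(1)[of i] by (cases "i < N") auto
  have e: "gi.predictable e"
    unfolding gi.predictable_def
  proof (intro allI conjI eG)
    fix i
    show "\<exists>c. \<forall>\<omega>\<in>space P. \<bar>e i \<omega>\<bar> \<le> c"
      unfolding e_def using cell(2)[of i] by (cases "i < N") auto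
  qed
  have e'G: "e' i \<in> borel_measurable (F (g i))" for i
  proof -
    have [measurable]: "D (g i) \<in> sets (F (g i))" using DF gs[of i] s by simp
    have [measurable]: "e i \<in> borel_measurable (F (g i))" by (rule eG)
    show ?thesis unfolding e'_def[abs_def] by measurable
  qed
  have e'_le: "\<bar>e' i \<omega>\<bar> \<le> R" for i \<omega>
    using abs_trunc_le[OF R, of "e i \<omega>"] R by (auto simp: e'_def indicator_def)
  have e': "gi.predictable e'"
    unfolding gi.predictable_def using e'G e'_le by blast
  define f where "f i \<omega> = e i \<omega> - e' i \<omega>" for i \<omega>
  have f: "gi.predictable f"
    unfolding gi.predictable_def
  proof (intro allI conjI)
    fix i
    show "f i \<in> borel_measurable (F (g i))"
      unfolding f_def[abs_def] by (intro borel_measurable_diff eG e'G)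
    obtain c where "\<forall>\<omega>\<in>space P. \<bar>e i \<omega>\<bar> \<le> c" using e unfolding gi.predictable_def by blast
    hence "\<forall>\<omega>\<in>space P. \<bar>f i \<omega>\<bar> \<le> c + R" unfolding f_def using e'_le[of i] by (smt (verit))
    thus "\<exists>c. \<forall>\<omega>\<in>space P. \<bar>f i \<omega>\<bar> \<le> c" ..
  qed
  define Z where "Z = gi.max_transform e' N"
  have sum_d: "(\<Sum>i<N. d i) = T - s"
    unfolding d_def using sum_lessThan_telescope[of g N] g by simp
  show ?thesis
  proof (rule that[of Z])
    show "Z \<in> borel_measurable P"
      unfolding Z_def by (rule measurable_F_P[OF gi.max_transform_measurable_G[OF e']])
    show Z0: "0 \<le> Z \<omega>" for \<omega> unfolding Z_def by (rule gi.max_transform_nonneg[OF e'])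
    have iZ: "integrable P (\<lambda>\<omega>. Z \<omega> powr p)"
      using finite_moments_integrable_powr[OF gi.finite_moments_max_transform[OF e'], of p N] p Z0
      by (simp add: Z_def[symmetric])
    have ie: "integrable P (\<lambda>\<omega>. \<bar>e' i \<omega>\<bar> powr p)" for i
      using finite_moments_integrable_powr[OF gi.finite_moments_predictable[OF e']] p by simp
    have "(\<integral>\<^sup>+\<omega>. ennreal (Z \<omega> powr p) \<partial>P) = ennreal (\<integral>\<omega>. Z \<omega> powr p \<partial>P)"
      by (rule nn_integral_eq_integral[OF iZ]) simp
    also have "\<dots> \<le> ennreal (bdg_const p * (T - s) powr (p / 2 - 1) * (\<Sum>i<N. d i * (\<integral>\<omega>. \<bar>e' i \<omega>\<bar> powr p \<partial>P)))"
      unfolding Z_def by (intro ennreal_leI gi.max_transform_moment[OF e' p]) (use s sum_d in auto)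
    also have "\<dots> = ennreal (bdg_const p * (T - s) powr (p / 2 - 1)) *
        ennreal (\<Sum>i<N. (g (Suc i) - g i) * (\<integral>\<omega>. \<bar>e' i \<omega>\<bar> powr p \<partial>P))"
      unfolding d_def[symmetric] using bdg_const_nonneg[OF p] by (intro ennreal_mult' mult_nonneg_nonneg) auto
    also have "\<dots> \<le> ennreal (bdg_const p * (T - s) powr (p / 2 - 1)) *
       (\<integral>\<^sup>+u\<in>{g 0..g N}. (\<integral>\<^sup>+\<omega>. ennreal (\<bar>trunc R (simple_process n \<tau> \<eta> u \<omega>)\<bar> powr p) *
          indicator (D (max s (u - \<delta>))) \<omega> \<partial>P) \<partial>lborel)"
    proof (intro mult_left_mono cell_sum_le[OF g(1)])
      fix i u assume i: "i < N" "g i < u" "u \<le> g (Suc i)"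
      have "ennreal (\<integral>\<omega>. \<bar>e' i \<omega>\<bar> powr p \<partial>P) = (\<integral>\<^sup>+\<omega>. ennreal (\<bar>e' i \<omega>\<bar> powr p) \<partial>P)"
        by (rule nn_integral_eq_integral[symmetric, OF ie]) simp
      also have "\<dots> \<le> (\<integral>\<^sup>+\<omega>. ennreal (\<bar>trunc R (simple_process n \<tau> \<eta> u \<omega>)\<bar> powr p) *
          indicator (D (max s (u - \<delta>))) \<omega> \<partial>P)"
      proof (rule nn_integral_mono)
        fix \<omega>
        have "max s (u - \<delta>) \<le> g i" using gs[of i] g(6)[OF i(1)] i by auto
        hence sub: "D (g i) \<subseteq> D (max s (u - \<delta>))" by (rule Dmono)
        have "H u \<omega> = e i \<omega>" using cell(3)[of i u \<omega>] i by (simp add: e_def)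
        thus "ennreal (\<bar>e' i \<omega>\<bar> powr p) \<le> ennreal (\<bar>trunc R (simple_process n \<tau> \<eta> u \<omega>)\<bar> powr p) *
          indicator (D (max s (u - \<delta>))) \<omega>"
          using sub p by (auto simp: e'_def H_def[symmetric] indicator_def)
      qed
      finally show "ennreal (\<integral>\<omega>. \<bar>e' i \<omega>\<bar> powr p \<partial>P) \<le> (\<integral>\<^sup>+\<omega>. ennreal (\<bar>trunc R (simple_process n \<tau> \<eta> u \<omega>)\<bar> powr p) *
          indicator (D (max s (u - \<delta>))) \<omega> \<partial>P)" .
    qed auto
    finally show "(\<integral>\<^sup>+\<omega>. ennreal (Z \<omega> powr p) \<partial>P) \<le> ennreal (bdg_const p * (T - s) powr (p / 2 - 1)) *
       (\<integral>\<^sup>+u\<in>{s..T}. (\<integral>\<^sup>+\<omega>. ennreal (\<bar>trunc R (simple_process n \<tau> \<eta> u \<omega>)\<bar> powr p) *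
          indicator (D (max s (u - \<delta>))) \<omega> \<partial>P) \<partial>lborel)"
      using g by simp
    fix l a :: real assume l: "0 < l" and a: "0 \<le> a"
    define A where "A = {\<omega>\<in>space P. l < gi.max_transform f N \<omega> \<and> (\<Sum>i<N. d i * (f i \<omega>)\<^sup>2) \<le> a}"
    have [measurable]: "gi.max_transform f N \<in> borel_measurable P"
      by (rule measurable_F_P[OF gi.max_transform_measurable_G[OF f]])
    have [measurable]: "f i \<in> borel_measurable P" for i
      by (rule measurable_F_P[OF gi.predictable_measurable[OF f]])
    show "\<exists>A\<in>sets P. measure P A \<le> bdg_const 2 * a / l\<^sup>2 \<and>
       (\<forall>\<omega>\<in>D T. (\<integral>\<^sup>+u\<in>{s..T}. ennreal ((simple_process n \<tau> \<eta> u \<omega> - trunc R (simple_process n \<tau> \<eta> u \<omega>))\<^sup>2) \<partial>lborel) \<le> ennreal a \<longrightarrow>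
         (\<exists>t\<in>Q. Z \<omega> + l < \<bar>simple_ito_integral B n \<tau> \<eta> t \<omega> - simple_ito_integral B n \<tau> \<eta> s \<omega>\<bar>) \<longrightarrow> \<omega> \<in> A)"
    proof (intro bexI[of _ A] conjI ballI impI)
      show "A \<in> sets P" unfolding A_def by measurable
      show "measure P A \<le> bdg_const 2 * a / l\<^sup>2" unfolding A_def by (rule gi.lenglart_transform[OF f l a])
      fix \<omega> assume \<omega>: "\<omega> \<in> D T"
        and qv: "(\<integral>\<^sup>+u\<in>{s..T}. ennreal ((simple_process n \<tau> \<eta> u \<omega> - trunc R (simple_process n \<tau> \<eta> u \<omega>))\<^sup>2) \<partial>lborel) \<le> ennreal a"
        and ex: "\<exists>t\<in>Q. Z \<omega> + l < \<bar>simple_ito_integral B n \<tau> \<eta> t \<omega> - simple_ito_integral B n \<tau> \<eta> s \<omega>\<bar>"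
      \<comment> \<open>On \<open>D T\<close> all earlier events occur as well, so stopping changes
        nothing and only the truncation distinguishes \<open>e'\<close> from
        \<open>e\<close>.\<close>
      have e'_eq: "e' i \<omega> = trunc R (e i \<omega>)" if "i \<le> N" for i
        using Dmono[OF gT[OF that]] \<omega> by (auto simp: e'_def)
      have "ennreal (\<Sum>i<N. (g (Suc i) - g i) * (f i \<omega>)\<^sup>2) \<le>
         (\<integral>\<^sup>+u\<in>{g 0..g N}. ennreal ((H u \<omega> - trunc R (H u \<omega>))\<^sup>2) \<partial>lborel)"
      proof (rule cell_sum_le[OF g(1)])
        fix i u assume i: "i < N" "g i < u" "u \<le> g (Suc i)"
        have "H u \<omega> = e i \<omega>" using cell(3)[of i u \<omega>] i by (simp add: e_def)
        thus "ennreal ((f i \<omega>)\<^sup>2) \<le> ennreal ((H u \<omega> - trunc R (H u \<omega>))\<^sup>2)"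
          using e'_eq[of i] i by (simp add: f_def)
      qed simp
      also have "\<dots> \<le> ennreal a" using qv g by (simp add: H_def)
      finally have sum_le: "(\<Sum>i<N. d i * (f i \<omega>)\<^sup>2) \<le> a" using a by (simp add: d_def)
      have tr: "J (g j) \<omega> - J s \<omega> = gi.transform e j \<omega>" if "j \<le> N" for j
        using that
      proof (induction j)
        case 0
        show ?case using g(2) by (simp add: gi.transform_def)
      next
        case (Suc j)
        have "J (g (Suc j)) \<omega> - J (g j) \<omega> = e j \<omega> * DB j \<omega>"
          using cell(4)[of j \<omega>] Suc.prems by (simp add: e_def DB_def)
        thus ?case using Suc by (simp add: gi.transform_def)
      qed
      obtain j where j: "j \<le> N" "Z \<omega> + l < \<bar>J (g j) \<omega> - J s \<omega>\<bar>"
        using ex g(4) by (auto simp: J_def)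
      have "gi.transform e j \<omega> = gi.transform e' j \<omega> + gi.transform f j \<omega>"
        by (simp add: gi.transform_def f_def sum.distrib[symmetric] left_diff_distrib)
      hence "\<bar>J (g j) \<omega> - J s \<omega>\<bar> \<le> \<bar>gi.transform e' j \<omega>\<bar> + \<bar>gi.transform f j \<omega>\<bar>"
        using tr[OF j(1)] by linarith
      also have "\<dots> \<le> Z \<omega> + gi.max_transform f N \<omega>"
        unfolding Z_def by (intro add_mono gi.transform_le_max e' f j)
      finally have "l < gi.max_transform f N \<omega>" using j by linarith
      moreover have "\<omega> \<in> space P" using DF[of T] \<omega> s sets.sets_into_space[OF sets_F_P] by force
      ultimately show "\<omega> \<in> A" using sum_le by (simp add: A_def)
    qed
  qed
qed

end

section \<open>Passage from simple integrands to the limit in probability\<close>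

text \<open>For x and y closer than d this is uniform continuity on [-R, R]; otherwise the quadratic
  term pays for the trivial bound R^p. An error quadratic in x - y fits the approximation of
  integrands, which is in mean square over time.\<close>

lemma abs_trunc_powr_le:
  fixes p R \<epsilon> :: real
  assumes p: "0 < p" and R: "0 \<le> R" and \<epsilon>: "0 < \<epsilon>"
  obtains c where "0 \<le> c" "\<And>x y. \<bar>trunc R x\<bar> powr p \<le> \<bar>trunc R y\<bar> powr p + \<epsilon> + c * (x - y)\<^sup>2"
proof -
  have "uniformly_continuous_on {-R..R} (\<lambda>x. \<bar>x\<bar> powr p)"
    using p by (intro compact_uniformly_continuous continuous_on_powr') (auto intro!: continuous_intros)
  from uniformly_continuous_onE[OF this \<epsilon>] obtain d where d: "0 < d"
    "\<And>x y. x \<in> {-R..R} \<Longrightarrow> y \<in> {-R..R} \<Longrightarrow> dist y x < d \<Longrightarrow> dist (\<bar>y\<bar> powr p) (\<bar>x\<bar> powr p) < \<epsilon>"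
    by metis
  show ?thesis
  proof (rule that)
    show "0 \<le> R powr p / d\<^sup>2" by simp
    fix x y
    have xy: "trunc R x \<in> {-R..R}" "trunc R y \<in> {-R..R}"
      using abs_trunc_le[OF R, of x] abs_trunc_le[OF R, of y] by auto
    show "\<bar>trunc R x\<bar> powr p \<le> \<bar>trunc R y\<bar> powr p + \<epsilon> + R powr p / d\<^sup>2 * (x - y)\<^sup>2"
    proof (cases "\<bar>x - y\<bar> < d")
      case True
      hence "dist (trunc R x) (trunc R y) < d" using trunc_lipschitz[of R x y] by (simp add: dist_real_def)
      from d(2)[OF xy(2,1) this] have "\<bar>trunc R x\<bar> powr p \<le> \<bar>trunc R y\<bar> powr p + \<epsilon>"
        by (simp add: dist_real_def)
      moreover have "0 \<le> R powr p / d\<^sup>2 * (x - y)\<^sup>2" by simp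
      ultimately show ?thesis by linarith
    next
      case False
      have "\<bar>trunc R x\<bar> powr p \<le> R powr p"
        using p abs_trunc_le[OF R, of x] by (intro powr_mono2) auto
      also have "R powr p = R powr p / d\<^sup>2 * d\<^sup>2" using d(1) by simp
      also have "\<dots> \<le> R powr p / d\<^sup>2 * (x - y)\<^sup>2"
        using False d(1) by (intro mult_left_mono abs_le_square_iff[THEN iffD1]) auto
      finally show ?thesis using \<epsilon> powr_ge_zero[of "\<bar>trunc R y\<bar>" p] by linarith
    qed
  qed
qed

lemma (in prob_space) AE_tendsto_0_imp_prob:
  fixes Y :: "nat \<Rightarrow> 'a \<Rightarrow> ennreal"
  assumes [measurable]: "\<And>n. Y n \<in> borel_measurable M" and Y: "AE \<omega> in M. (\<lambda>n. Y n \<omega>) \<longlonglongrightarrow> 0" and a: "0 < a"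
  shows "(\<lambda>n. measure M {\<omega>\<in>space M. ennreal a < Y n \<omega>}) \<longlonglongrightarrow> 0"
proof -
  have "(\<lambda>n. \<integral>\<omega>. indicator {\<omega>\<in>space M. ennreal a < Y n \<omega>} \<omega> \<partial>M) \<longlonglongrightarrow> (\<integral>\<omega>. (0::real) \<partial>M)"
  proof (rule integral_dominated_convergence[where w="\<lambda>_. 1"])
    show "AE \<omega> in M. (\<lambda>n. indicator {\<omega>\<in>space M. ennreal a < Y n \<omega>} \<omega> :: real) \<longlonglongrightarrow> 0"
      using Y
    proof eventually_elim
      case (elim \<omega>)
      hence "\<forall>\<^sub>F n in sequentially. Y n \<omega> < ennreal a" using a by (intro order_tendstoD(2)) auto
      thus ?case by (intro tendsto_eventually) (auto elim!: eventually_mono simp: indicator_def)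
    qed
  qed auto
  thus ?thesis by simp
qed

context brownian_setting
begin

lemma pair_sigma_finite_lborel: "pair_sigma_finite lborel P"
  by (intro pair_sigma_finite.intro sigma_finite_lborel) unfold_locales

lemma borel_measurable_lborel_pair: "borel_measurable (borel \<Otimes>\<^sub>M P) = borel_measurable (lborel \<Otimes>\<^sub>M P)"
  by (intro measurable_cong_sets sets_pair_measure_cong) auto

lemma nn_fubini:
  fixes f :: "real \<times> 'a \<Rightarrow> ennreal"
  assumes "f \<in> borel_measurable (borel \<Otimes>\<^sub>M P)"
  shows "(\<integral>\<^sup>+u. (\<integral>\<^sup>+\<omega>. f (u, \<omega>) \<partial>P) \<partial>lborel) = (\<integral>\<^sup>+\<omega>. (\<integral>\<^sup>+u. f (u, \<omega>) \<partial>lborel) \<partial>P)"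
  using pair_sigma_finite.Fubini'[OF pair_sigma_finite_lborel, of "\<lambda>u \<omega>. f (u, \<omega>)"] assms
  by (simp add: borel_measurable_lborel_pair)

lemma nn_integral_space_measurable:
  fixes f :: "real \<times> 'a \<Rightarrow> ennreal"
  assumes "f \<in> borel_measurable (borel \<Otimes>\<^sub>M P)"
  shows "(\<lambda>u. \<integral>\<^sup>+\<omega>. f (u, \<omega>) \<partial>P) \<in> borel_measurable borel"
  using assms by (intro borel_measurable_nn_integral) simp

lemma nn_integral_time_measurable:
  fixes f :: "real \<times> 'a \<Rightarrow> ennreal"
  assumes "f \<in> borel_measurable (borel \<Otimes>\<^sub>M P)"
  shows "(\<lambda>\<omega>. \<integral>\<^sup>+u. f (u, \<omega>) \<partial>lborel) \<in> borel_measurable P"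
proof -
  have "(\<lambda>x. f (snd x, fst x)) \<in> borel_measurable (P \<Otimes>\<^sub>M borel)"
    using assms by measurable
  also have "borel_measurable (P \<Otimes>\<^sub>M borel) = borel_measurable (P \<Otimes>\<^sub>M lborel)"
    by (intro measurable_cong_sets sets_pair_measure_cong) auto
  finally show ?thesis
    by (intro lborel.borel_measurable_nn_integral) (simp add: case_prod_beta')
qed

text \<open>Progressive measurability speaks of [0, T] only. Projecting the time axis onto [0, T]
  gives a process that is jointly measurable on the whole line and equals H on [0, T], so that
  Fubini's theorem applies.\<close>

lemma progressively_measurable_joint:
  assumes H: "progressively_measurable F H" and T: "0 \<le> T"
  shows "(\<lambda>x. H (max 0 (min T (fst x))) (snd x)) \<in> borel_measurable (borel \<Otimes>\<^sub>M P)"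
proof -
  have H': "(\<lambda>(s, \<omega>). H s \<omega>) \<in> borel_measurable (restrict_space borel {0..T} \<Otimes>\<^sub>M F T)"
    using H T by (simp add: progressively_measurable_def)
  have 1: "(\<lambda>x. max 0 (min T (fst x))) \<in> (borel \<Otimes>\<^sub>M P) \<rightarrow>\<^sub>M restrict_space borel {0..T}"
    using T by (intro measurable_restrict_space2) auto
  have 2: "snd \<in> (borel \<Otimes>\<^sub>M P) \<rightarrow>\<^sub>M F T"
    using measurable_compose[OF measurable_snd[of borel P] measurable_F_P[OF measurable_ident[of "F T"]]]
    by simp
  have "(\<lambda>x. (max 0 (min T (fst x)), snd x)) \<in> (borel \<Otimes>\<^sub>M P) \<rightarrow>\<^sub>M (restrict_space borel {0..T} \<Otimes>\<^sub>M F T)"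
    by (intro measurable_Pair 1 2)
  from measurable_compose[OF this H'] show ?thesis by simp
qed

lemma simple_process_joint:
  assumes S: "simple_integrand P F n \<tau> \<eta>"
  shows "(\<lambda>x. simple_process n \<tau> \<eta> (fst x) (snd x)) \<in> borel_measurable (borel \<Otimes>\<^sub>M P)"
  unfolding simple_process_def
proof (rule borel_measurable_sum)
  fix i assume "i \<in> {..<n}"
  hence [measurable]: "\<eta> i \<in> borel_measurable P"
    using S by (auto simp: simple_integrand_def intro: measurable_F_P)
  show "(\<lambda>x. \<eta> i (snd x) * indicator {\<tau> i<..\<tau> (Suc i)} (fst x)) \<in> borel_measurable (borel \<Otimes>\<^sub>M P)"
    by measurable
qed

lemma simple_ito_integral_measurable:
  assumes S: "simple_integrand P F n \<tau> \<eta>" and t: "0 \<le> t"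
  shows "simple_ito_integral B n \<tau> \<eta> t \<in> borel_measurable P"
  unfolding simple_ito_integral_def[abs_def]
proof (rule borel_measurable_sum)
  fix i assume i: "i \<in> {..<n}"
  hence \<eta>: "\<eta> i \<in> borel_measurable P"
    using S by (auto simp: simple_integrand_def intro: measurable_F_P)
  have \<tau>: "0 \<le> \<tau> j" if "j \<le> n" for j
    using that
  proof (induction j)
    case (Suc j)
    thus ?case using S unfolding simple_integrand_def by (meson Suc_leD Suc_le_lessD order_trans)
  qed (use S in \<open>simp add: simple_integrand_def\<close>)
  have "0 \<le> \<tau> i" "0 \<le> \<tau> (Suc i)" using \<tau> i by auto
  thus "(\<lambda>\<omega>. \<eta> i \<omega> * (B (min t (\<tau> (Suc i))) \<omega> - B (min t (\<tau> i)) \<omega>)) \<in> borel_measurable P"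
    using t by (intro borel_measurable_times borel_measurable_diff \<eta> measurable_F_P[OF B_measurable]) auto
qed

lemma stopping_events_joint:
  assumes D: "stopping_events P F D" and [measurable]: "f \<in> borel_measurable borel"
  shows "(\<lambda>x. indicator (D (f (fst x))) (snd x) :: ennreal) \<in> borel_measurable (borel \<Otimes>\<^sub>M P)"
proof -
  have [measurable]: "Measurable.pred (borel \<Otimes>\<^sub>M P) (\<lambda>(t, \<omega>). \<omega> \<in> D t)"
    using D by (simp add: stopping_events_def)
  have "(\<lambda>x. (f (fst x), snd x)) \<in> (borel \<Otimes>\<^sub>M P) \<rightarrow>\<^sub>M (borel \<Otimes>\<^sub>M P)" by measurable
  from measurable_compose[OF this, of "\<lambda>(t, \<omega>). \<omega> \<in> D t" "count_space UNIV"]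
  have [measurable]: "Measurable.pred (borel \<Otimes>\<^sub>M P) (\<lambda>x. snd x \<in> D (f (fst x)))"
    by simp
  have "(\<lambda>x. if snd x \<in> D (f (fst x)) then 1 else 0 :: ennreal) \<in> borel_measurable (borel \<Otimes>\<^sub>M P)"
    by measurable
  thus ?thesis by (simp add: indicator_def of_bool_def)
qed

text \<open>Left-continuity of the events in time, which follows from the closure condition in
  \<open>stopping_events\<close>. At u = s the maximum makes the sequence constant.\<close>

lemma delayed_stopping_events_tendsto:
  assumes D: "stopping_events P F D" and s: "0 \<le> s" "s \<le> u"
  shows "(\<lambda>m. indicator (D (max s (u - 1 / real (Suc m)))) \<omega> :: ennreal) \<longlonglongrightarrow> indicator (D u) \<omega>"
proof (cases "u = s \<or> \<omega> \<in> D u")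
  case True
  have "indicator (D (max s (u - 1 / real (Suc m)))) \<omega> = (indicator (D u) \<omega> :: ennreal)" for m
  proof (cases "u = s")
    case False
    have "max s (u - 1 / real (Suc m)) \<le> u" using s by auto
    hence "D u \<subseteq> D (max s (u - 1 / real (Suc m)))" using D by (simp only: stopping_events_def)
    thus ?thesis using True False by (auto simp: indicator_def)
  qed (auto simp: max_def)
  thus ?thesis by simp
next
  case False
  hence su: "s < u" and \<omega>: "\<omega> \<notin> D u" using s by auto
  then obtain r where r: "r < u" "\<omega> \<notin> D r"
    using D s unfolding stopping_events_def by (metis order_le_less_trans)
  have "\<forall>\<^sub>F m in sequentially. 1 / real (Suc m) < u - r"
    using LIMSEQ_inverse_real_of_nat r by (intro order_tendstoD(2)) (auto simp: inverse_eq_divide)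
  hence "\<forall>\<^sub>F m in sequentially. indicator (D (max s (u - 1 / real (Suc m)))) \<omega> = (0 :: ennreal)"
  proof eventually_elim
    case (elim m)
    hence "r \<le> max s (u - 1 / real (Suc m))" by auto
    hence "D (max s (u - 1 / real (Suc m))) \<subseteq> D r" using D by (simp only: stopping_events_def)
    thus ?case using r by (auto simp: indicator_def)
  qed
  thus ?thesis using \<omega> by (intro tendsto_eventually) simp
qed

lemma truncated_moment_delay:
  assumes H: "(\<lambda>x. H (fst x) (snd x)) \<in> borel_measurable (borel \<Otimes>\<^sub>M P)"
    and D: "stopping_events P F D" and s: "0 \<le> s" "s < T" and R: "0 \<le> R" and p: "0 < p" and \<epsilon>: "0 < \<epsilon>"
  obtains \<delta> where "0 < \<delta>"
    "(\<integral>\<^sup>+u\<in>{s..T}. (\<integral>\<^sup>+\<omega>. ennreal (\<bar>trunc R (H u \<omega>)\<bar> powr p) * indicator (D (max s (u - \<delta>))) \<omega> \<partial>P) \<partial>lborel)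
     \<le> (\<integral>\<^sup>+u\<in>{s..T}. (\<integral>\<^sup>+\<omega>. ennreal (\<bar>H u \<omega>\<bar> powr p) * indicator (D u) \<omega> \<partial>P) \<partial>lborel) + ennreal \<epsilon>"
proof -
  note [measurable] = H
  define k where "k u \<omega> = ennreal (\<bar>trunc R (H u \<omega>)\<bar> powr p)" for u \<omega>
  have k_le: "k u \<omega> \<le> ennreal (R powr p)" for u \<omega>
    unfolding k_def using abs_trunc_le[OF R] p by (intro ennreal_leI powr_mono2) auto
  have [measurable]: "(\<lambda>x. k (fst x) (snd x)) \<in> borel_measurable (borel \<Otimes>\<^sub>M P)"
    unfolding k_def by measurable
  define \<delta> where "\<delta> m = 1 / real (Suc m)" for m
  define h where "h m u = (\<integral>\<^sup>+\<omega>. k u \<omega> * indicator (D (max s (u - \<delta> m))) \<omega> \<partial>P)" for m u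
  define h' where "h' u = (\<integral>\<^sup>+\<omega>. k u \<omega> * indicator (D u) \<omega> \<partial>P)" for u
  have km [measurable]: "k u \<in> borel_measurable P" for u
    using measurable_compose[OF measurable_Pair1'[of u borel P], of "\<lambda>x. k (fst x) (snd x)"] by simp
  have Dm [measurable]: "D t \<in> sets P" if "0 \<le> t" for t
    using D that sets_F_P by (auto simp: stopping_events_def)
  have h_le: "h m u \<le> ennreal (R powr p)" for m u
  proof -
    have "h m u \<le> (\<integral>\<^sup>+\<omega>. ennreal (R powr p) \<partial>P)"
      unfolding h_def using k_le by (intro nn_integral_mono) (auto simp: indicator_def)
    thus ?thesis by (simp add: emeasure_space_1)
  qed
  have hm: "h m \<in> borel_measurable borel" for m
    unfolding h_def
    using nn_integral_space_measurable[of "\<lambda>x. k (fst x) (snd x) * indicator (D (max s (fst x - \<delta> m))) (snd x)"]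
      stopping_events_joint[OF D, of "\<lambda>u. max s (u - \<delta> m)"] by simp
  have hm': "h' \<in> borel_measurable borel"
    unfolding h'_def
    using nn_integral_space_measurable[of "\<lambda>x. k (fst x) (snd x) * indicator (D (fst x)) (snd x)"]
      stopping_events_joint[OF D, of "\<lambda>u. u"] by simp
  have lim1: "(\<lambda>m. h m u) \<longlonglongrightarrow> h' u" if u: "u \<in> {s..T}" for u
    unfolding h_def h'_def
  proof (rule nn_integral_dominated_convergence[where w="\<lambda>_. ennreal (R powr p)"])
    have u0: "0 \<le> u" using u s by simp
    show "(\<lambda>\<omega>. k u \<omega> * indicator (D (max s (u - \<delta> m))) \<omega>) \<in> borel_measurable P" for m
    proof -
      have [measurable]: "D (max s (u - \<delta> m)) \<in> sets P" using s by (intro Dm) auto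
      show ?thesis by measurable
    qed
    show "(\<lambda>\<omega>. k u \<omega> * indicator (D u) \<omega>) \<in> borel_measurable P"
      using Dm[OF u0] by measurable
    show "AE \<omega> in P. k u \<omega> * indicator (D (max s (u - \<delta> m))) \<omega> \<le> ennreal (R powr p)" for m
      using k_le by (auto simp: indicator_def)
    show "AE \<omega> in P. (\<lambda>m. k u \<omega> * indicator (D (max s (u - \<delta> m))) \<omega>) \<longlonglongrightarrow> k u \<omega> * indicator (D u) \<omega>"
      unfolding \<delta>_def using u s
      by (intro AE_I2 ennreal_tendsto_cmult delayed_stopping_events_tendsto D) (auto simp: k_def)
  qed (auto simp: emeasure_space_1)
  have "(\<lambda>m. \<integral>\<^sup>+u. h m u * indicator {s..T} u \<partial>lborel) \<longlonglongrightarrow> (\<integral>\<^sup>+u. h' u * indicator {s..T} u \<partial>lborel)"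
  proof (rule nn_integral_dominated_convergence[where w="\<lambda>u. ennreal (R powr p) * indicator {s..T} u"])
    show "AE u in lborel. h m u * indicator {s..T} u \<le> ennreal (R powr p) * indicator {s..T} u" for m
      using h_le by (intro AE_I2 mult_right_mono) auto
    show "AE u in lborel. (\<lambda>m. h m u * indicator {s..T} u) \<longlonglongrightarrow> h' u * indicator {s..T} u"
      using lim1 by (intro AE_I2) (auto simp: indicator_def)
    have "(\<integral>\<^sup>+u. ennreal (R powr p) * indicator {s..T} u \<partial>lborel) = ennreal (R powr p) * ennreal (T - s)"
      using s by (subst nn_integral_cmult_indicator) auto
    thus "(\<integral>\<^sup>+u. ennreal (R powr p) * indicator {s..T} u \<partial>lborel) < \<infinity>"
      by (simp add: ennreal_mult[symmetric] ennreal_mult_less_top)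
  qed (use hm hm' in auto)
  moreover have fin: "(\<integral>\<^sup>+u. h' u * indicator {s..T} u \<partial>lborel) < \<infinity>"
  proof -
    have "h' u \<le> ennreal (R powr p)" for u
    proof -
      have "h' u \<le> (\<integral>\<^sup>+\<omega>. ennreal (R powr p) \<partial>P)"
        unfolding h'_def using k_le by (intro nn_integral_mono) (auto simp: indicator_def)
      thus ?thesis by (simp add: emeasure_space_1)
    qed
    hence "(\<integral>\<^sup>+u. h' u * indicator {s..T} u \<partial>lborel) \<le> (\<integral>\<^sup>+u. ennreal (R powr p) * indicator {s..T} u \<partial>lborel)"
      by (intro nn_integral_mono mult_right_mono) auto
    also have "\<dots> = ennreal (R powr p) * ennreal (T - s)"
      using s by (subst nn_integral_cmult_indicator) auto
    also have "\<dots> < \<infinity>" by (simp add: ennreal_mult_less_top)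
    finally show ?thesis .
  qed
  moreover have "x < x + ennreal \<epsilon>" if "x < \<infinity>" for x
    using that \<epsilon> by (cases x) (auto simp flip: ennreal_plus simp: ennreal_less_iff)
  ultimately have "\<forall>\<^sub>F m in sequentially. (\<integral>\<^sup>+u. h m u * indicator {s..T} u \<partial>lborel) <
      (\<integral>\<^sup>+u. h' u * indicator {s..T} u \<partial>lborel) + ennreal \<epsilon>"
    by (intro order_tendstoD(2)) auto
  then obtain m where m: "(\<integral>\<^sup>+u. h m u * indicator {s..T} u \<partial>lborel) <
      (\<integral>\<^sup>+u. h' u * indicator {s..T} u \<partial>lborel) + ennreal \<epsilon>"
    by (auto simp: eventually_sequentially)
  show ?thesis
  proof (rule that)
    show "0 < \<delta> m" by (simp add: \<delta>_def)
    have "(\<integral>\<^sup>+u. h' u * indicator {s..T} u \<partial>lborel) \<le>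
       (\<integral>\<^sup>+u\<in>{s..T}. (\<integral>\<^sup>+\<omega>. ennreal (\<bar>H u \<omega>\<bar> powr p) * indicator (D u) \<omega> \<partial>P) \<partial>lborel)"
      unfolding h'_def k_def using p abs_trunc_le_abs[OF R]
      by (intro nn_integral_mono mult_right_mono ennreal_leI powr_mono2) auto
    hence "(\<integral>\<^sup>+u. h' u * indicator {s..T} u \<partial>lborel) + ennreal \<epsilon> \<le>
       (\<integral>\<^sup>+u\<in>{s..T}. (\<integral>\<^sup>+\<omega>. ennreal (\<bar>H u \<omega>\<bar> powr p) * indicator (D u) \<omega> \<partial>P) \<partial>lborel) + ennreal \<epsilon>"
      by (rule add_right_mono)
    from order_trans[OF less_imp_le[OF m] this]
    show "(\<integral>\<^sup>+u\<in>{s..T}. (\<integral>\<^sup>+\<omega>. ennreal (\<bar>trunc R (H u \<omega>)\<bar> powr p) * indicator (D (max s (u - \<delta> m))) \<omega> \<partial>P) \<partial>lborel)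
     \<le> (\<integral>\<^sup>+u\<in>{s..T}. (\<integral>\<^sup>+\<omega>. ennreal (\<bar>H u \<omega>\<bar> powr p) * indicator (D u) \<omega> \<partial>P) \<partial>lborel) + ennreal \<epsilon>"
      by (simp only: h_def k_def)
  qed
qed


text \<open>Closeness in probability is enough to exchange integrands under a truncated moment.
  Where the squared distance over time is at most a, \<open>perturb\<close> is integrated; elsewhere
  the truncated integrand is at most R, which costs R^p (T - s) times the probability of that
  event.\<close>

lemma truncated_moment_perturb:
  assumes H1 [measurable]: "(\<lambda>x. H1 (fst x) (snd x)) \<in> borel_measurable (borel \<Otimes>\<^sub>M P)"
    and H2 [measurable]: "(\<lambda>x. H2 (fst x) (snd x)) \<in> borel_measurable (borel \<Otimes>\<^sub>M P)"
    and W [measurable]: "(\<lambda>x. W (fst x) (snd x)) \<in> borel_measurable (borel \<Otimes>\<^sub>M P)"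
    and W1: "\<And>u \<omega>. W u \<omega> \<le> (1 :: ennreal)"
    and sT: "s < T" and R: "0 \<le> R" and p: "0 < p" and a: "0 \<le> a" and c: "0 \<le> c" and e: "0 \<le> e"
    and perturb: "\<And>x y. \<bar>trunc R x\<bar> powr p \<le> \<bar>trunc R y\<bar> powr p + e + c * (x - y)\<^sup>2"
  shows "(\<integral>\<^sup>+u\<in>{s..T}. (\<integral>\<^sup>+\<omega>. ennreal (\<bar>trunc R (H1 u \<omega>)\<bar> powr p) * W u \<omega> \<partial>P) \<partial>lborel) \<le>
    (\<integral>\<^sup>+u\<in>{s..T}. (\<integral>\<^sup>+\<omega>. ennreal (\<bar>trunc R (H2 u \<omega>)\<bar> powr p) * W u \<omega> \<partial>P) \<partial>lborel) +
    ennreal (e * (T - s) + c * a + R powr p * (T - s) *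
      measure P {\<omega>\<in>space P. ennreal a < (\<integral>\<^sup>+u\<in>{s..T}. ennreal ((H1 u \<omega> - H2 u \<omega>)\<^sup>2) \<partial>lborel)})"
proof -
  define A where "A \<omega> = (\<integral>\<^sup>+u\<in>{s..T}. ennreal ((H1 u \<omega> - H2 u \<omega>)\<^sup>2) \<partial>lborel)" for \<omega>
  define X where "X H \<omega> = (\<integral>\<^sup>+u. ennreal (\<bar>trunc R (H u \<omega>)\<bar> powr p) * W u \<omega> * indicator {s..T} u \<partial>lborel)"
    for H :: "real \<Rightarrow> 'a \<Rightarrow> real" and \<omega>
  have len: "(\<integral>\<^sup>+u. ennreal r * indicator {s..T} u \<partial>lborel) = ennreal (r * (T - s))" if "0 \<le> r" for r
    using sT that by (subst nn_integral_cmult_indicator) (auto simp: ennreal_mult)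
  have swap: "(\<integral>\<^sup>+u\<in>{s..T}. (\<integral>\<^sup>+\<omega>. ennreal (\<bar>trunc R (H u \<omega>)\<bar> powr p) * W u \<omega> \<partial>P) \<partial>lborel) = (\<integral>\<^sup>+\<omega>. X H \<omega> \<partial>P)"
    if [measurable]: "(\<lambda>x. H (fst x) (snd x)) \<in> borel_measurable (borel \<Otimes>\<^sub>M P)" for H
  proof -
    have "(\<integral>\<^sup>+u\<in>{s..T}. (\<integral>\<^sup>+\<omega>. ennreal (\<bar>trunc R (H u \<omega>)\<bar> powr p) * W u \<omega> \<partial>P) \<partial>lborel)
       = (\<integral>\<^sup>+u. (\<integral>\<^sup>+\<omega>. ennreal (\<bar>trunc R (H u \<omega>)\<bar> powr p) * W u \<omega> * indicator {s..T} u \<partial>P) \<partial>lborel)"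
      by (intro nn_integral_cong) (auto simp: indicator_def)
    also have "\<dots> = (\<integral>\<^sup>+\<omega>. X H \<omega> \<partial>P)"
      unfolding X_def
      using nn_fubini[of "\<lambda>x. ennreal (\<bar>trunc R (H (fst x) (snd x))\<bar> powr p) * W (fst x) (snd x) * indicator {s..T} (fst x)"]
      by simp
    finally show ?thesis .
  qed
  have Am [measurable]: "A \<in> borel_measurable P"
    unfolding A_def[abs_def]
    using nn_integral_time_measurable[of "\<lambda>x. ennreal ((H1 (fst x) (snd x) - H2 (fst x) (snd x))\<^sup>2) * indicator {s..T} (fst x)"]
    by simp
  have X2m [measurable]: "X H2 \<in> borel_measurable P"
    unfolding X_def[abs_def]
    using nn_integral_time_measurable[of "\<lambda>x. ennreal (\<bar>trunc R (H2 (fst x) (snd x))\<bar> powr p) * W (fst x) (snd x) * indicator {s..T} (fst x)"]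
    by simp
  have sec: "(\<lambda>u. H u \<omega>) \<in> borel_measurable borel"
    if "(\<lambda>x. H (fst x) (snd x)) \<in> borel_measurable (borel \<Otimes>\<^sub>M P)" "\<omega> \<in> space P"
    for H :: "real \<Rightarrow> 'a \<Rightarrow> 'b::{second_countable_topology,t2_space}" and \<omega>
    using measurable_compose[OF measurable_Pair2'[OF that(2), of borel] that(1)] by simp
  have X_le: "X H1 \<omega> \<le> X H2 \<omega> + (ennreal (e * (T - s) + c * a) +
       ennreal (R powr p * (T - s)) * indicator {\<omega>\<in>space P. ennreal a < A \<omega>} \<omega>)" if \<omega>: "\<omega> \<in> space P" for \<omega>
  proof (cases "ennreal a < A \<omega>")
    case True
    have "X H1 \<omega> \<le> (\<integral>\<^sup>+u. ennreal (R powr p) * indicator {s..T} u \<partial>lborel)"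
      unfolding X_def
    proof (intro nn_integral_mono mult_right_mono)
      fix u
      have "ennreal (\<bar>trunc R (H1 u \<omega>)\<bar> powr p) * W u \<omega> \<le> ennreal (R powr p) * 1"
        using abs_trunc_le[OF R] p W1 by (intro mult_mono ennreal_leI powr_mono2) auto
      thus "ennreal (\<bar>trunc R (H1 u \<omega>)\<bar> powr p) * W u \<omega> \<le> ennreal (R powr p)" by simp
    qed simp
    also have "\<dots> = ennreal (R powr p * (T - s))" by (rule len) simp
    finally show ?thesis using True \<omega> by (simp add: add_increasing)
  next
    case False
    note [measurable] = sec[OF H1 \<omega>] sec[OF H2 \<omega>] sec[OF W \<omega>]
    have "X H1 \<omega> \<le> (\<integral>\<^sup>+u. ennreal (\<bar>trunc R (H2 u \<omega>)\<bar> powr p) * W u \<omega> * indicator {s..T} u +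
        (ennreal e * indicator {s..T} u + ennreal c * (ennreal ((H1 u \<omega> - H2 u \<omega>)\<^sup>2) * indicator {s..T} u)) \<partial>lborel)"
      unfolding X_def
    proof (rule nn_integral_mono)
      fix u
      have "ennreal (\<bar>trunc R (H1 u \<omega>)\<bar> powr p) * W u \<omega> \<le>
          ennreal (\<bar>trunc R (H2 u \<omega>)\<bar> powr p + e + c * (H1 u \<omega> - H2 u \<omega>)\<^sup>2) * W u \<omega>"
        by (intro mult_right_mono ennreal_leI perturb) simp
      also have "\<dots> = ennreal (\<bar>trunc R (H2 u \<omega>)\<bar> powr p) * W u \<omega> +
          (ennreal e + ennreal c * ennreal ((H1 u \<omega> - H2 u \<omega>)\<^sup>2)) * W u \<omega>"
        using c e by (simp add: ennreal_mult distrib_right add.assoc)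
      also have "\<dots> \<le> ennreal (\<bar>trunc R (H2 u \<omega>)\<bar> powr p) * W u \<omega> +
          (ennreal e + ennreal c * ennreal ((H1 u \<omega> - H2 u \<omega>)\<^sup>2)) * 1"
        by (intro add_left_mono mult_left_mono W1) simp
      finally show "ennreal (\<bar>trunc R (H1 u \<omega>)\<bar> powr p) * W u \<omega> * indicator {s..T} u \<le>
        ennreal (\<bar>trunc R (H2 u \<omega>)\<bar> powr p) * W u \<omega> * indicator {s..T} u +
        (ennreal e * indicator {s..T} u + ennreal c * (ennreal ((H1 u \<omega> - H2 u \<omega>)\<^sup>2) * indicator {s..T} u))"
        by (auto simp: indicator_def)
    qed
    also have "\<dots> = X H2 \<omega> + (ennreal (e * (T - s)) + ennreal c * A \<omega>)"
      unfolding X_def A_def by (simp add: nn_integral_add nn_integral_cmult len[OF e])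
    also have "\<dots> \<le> X H2 \<omega> + (ennreal (e * (T - s)) + ennreal c * ennreal a)"
      using False by (intro add_left_mono mult_left_mono) auto
    also have "ennreal (e * (T - s)) + ennreal c * ennreal a = ennreal (e * (T - s) + c * a)"
      using c a e sT by (simp add: ennreal_mult)
    finally show ?thesis using False by simp
  qed
  have "(\<integral>\<^sup>+u\<in>{s..T}. (\<integral>\<^sup>+\<omega>. ennreal (\<bar>trunc R (H1 u \<omega>)\<bar> powr p) * W u \<omega> \<partial>P) \<partial>lborel) = (\<integral>\<^sup>+\<omega>. X H1 \<omega> \<partial>P)"
    by (rule swap[OF H1])
  also have "\<dots> \<le> (\<integral>\<^sup>+\<omega>. X H2 \<omega> + (ennreal (e * (T - s) + c * a) +
       ennreal (R powr p * (T - s)) * indicator {\<omega>\<in>space P. ennreal a < A \<omega>} \<omega>) \<partial>P)"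
    by (rule nn_integral_mono) (rule X_le)
  also have "\<dots> = (\<integral>\<^sup>+\<omega>. X H2 \<omega> \<partial>P) + (ennreal (e * (T - s) + c * a) +
       ennreal (R powr p * (T - s)) * emeasure P {\<omega>\<in>space P. ennreal a < A \<omega>})"
    by (simp add: nn_integral_add nn_integral_cmult_indicator emeasure_space_1)
  also have "\<dots> = (\<integral>\<^sup>+\<omega>. X H2 \<omega> \<partial>P) + ennreal (e * (T - s) + c * a + R powr p * (T - s) *
      measure P {\<omega>\<in>space P. ennreal a < A \<omega>})"
    using e c a sT by (simp add: emeasure_eq_measure ennreal_mult)
  finally show ?thesis by (simp add: swap[OF H2] A_def)
qed

text \<open>Dominated convergence path by path, with the square of H as majorant; almost sure
  convergence then gives convergence in probability.\<close>

lemma truncation_error_small: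
  fixes H :: "real \<Rightarrow> 'a \<Rightarrow> real"
  assumes H [measurable]: "(\<lambda>x. H (fst x) (snd x)) \<in> borel_measurable (borel \<Otimes>\<^sub>M P)"
    and fin: "AE \<omega> in P. (\<integral>\<^sup>+u\<in>{s..T}. ennreal ((H u \<omega>)\<^sup>2) \<partial>lborel) < \<infinity>" and a: "0 < a"
  shows "(\<lambda>n. measure P {\<omega>\<in>space P. ennreal a < (\<integral>\<^sup>+u\<in>{s..T}. ennreal ((H u \<omega> - trunc (real n) (H u \<omega>))\<^sup>2) \<partial>lborel)}) \<longlonglongrightarrow> 0"
proof (rule AE_tendsto_0_imp_prob[OF _ _ a])
  show "(\<lambda>\<omega>. \<integral>\<^sup>+u\<in>{s..T}. ennreal ((H u \<omega> - trunc (real n) (H u \<omega>))\<^sup>2) \<partial>lborel) \<in> borel_measurable P" for n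
    using nn_integral_time_measurable[of "\<lambda>x. ennreal ((H (fst x) (snd x) - trunc (real n) (H (fst x) (snd x)))\<^sup>2) * indicator {s..T} (fst x)"]
    by simp
  have "(\<lambda>n. \<integral>\<^sup>+u\<in>{s..T}. ennreal ((H u \<omega> - trunc (real n) (H u \<omega>))\<^sup>2) \<partial>lborel) \<longlonglongrightarrow> 0"
    if \<omega>: "\<omega> \<in> space P" and f: "(\<integral>\<^sup>+u\<in>{s..T}. ennreal ((H u \<omega>)\<^sup>2) \<partial>lborel) < \<infinity>" for \<omega>
  proof -
    have [measurable]: "(\<lambda>u. H u \<omega>) \<in> borel_measurable borel"
      using measurable_compose[OF measurable_Pair2'[OF \<omega>, of borel] H] by simp
    have "(\<lambda>n. \<integral>\<^sup>+u\<in>{s..T}. ennreal ((H u \<omega> - trunc (real n) (H u \<omega>))\<^sup>2) \<partial>lborel) \<longlonglongrightarrow> (\<integral>\<^sup>+u. 0 \<partial>(lborel :: real measure))"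
    proof (rule nn_integral_dominated_convergence[where w="\<lambda>u. ennreal ((H u \<omega>)\<^sup>2) * indicator {s..T} u"])
      show "AE u in lborel. ennreal ((H u \<omega> - trunc (real n) (H u \<omega>))\<^sup>2) * indicator {s..T} u \<le> ennreal ((H u \<omega>)\<^sup>2) * indicator {s..T} u" for n
        by (intro AE_I2 mult_right_mono ennreal_leI abs_le_square_iff[THEN iffD1]) (auto simp: trunc_def)
      show "AE u in lborel. (\<lambda>n. ennreal ((H u \<omega> - trunc (real n) (H u \<omega>))\<^sup>2) * indicator {s..T} u) \<longlonglongrightarrow> 0"
      proof (intro AE_I2 tendsto_eventually)
        fix u
        obtain m where m: "\<bar>H u \<omega>\<bar> \<le> real m" using real_arch_simple by blast
        show "\<forall>\<^sub>F n in sequentially. ennreal ((H u \<omega> - trunc (real n) (H u \<omega>))\<^sup>2) * indicator {s..T} u = 0"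
          using eventually_ge_at_top[of m]
        proof eventually_elim
          case (elim n)
          hence "trunc (real n) (H u \<omega>) = H u \<omega>" using m by (intro trunc_eq) linarith
          thus ?case by simp
        qed
      qed
    qed (use f in auto)
    thus ?thesis by simp
  qed
  with fin show "AE \<omega> in P. (\<lambda>n. \<integral>\<^sup>+u\<in>{s..T}. ennreal ((H u \<omega> - trunc (real n) (H u \<omega>))\<^sup>2) \<partial>lborel) \<longlonglongrightarrow> 0"
    by auto
qed


text \<open>The order of the choices matters: \<open>R\<close> is fixed from the truncation error,
  then \<delta> and \<open>c\<close> for this \<open>R\<close>, and the index k of the simple
  integrand comes last. The exceptional set joins the Lenglart event \<open>A1\<close>, the events
  \<open>A2\<close> and \<open>A3\<close> on which approximation or truncation is poor in mean
  square over time, and the event \<open>A4\<close> on which the simple integral is far from I at an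
  observed time.\<close>

lemma ito_approx:
  assumes I: "has_ito_integral P F B H I" and D: "stopping_events P F D"
    and s: "0 \<le> s" "s < T" and p: "2 \<le> p" and Q: "finite Q" "Q \<subseteq> {s..T}" and \<epsilon>: "0 < \<epsilon>"
  obtains Z A where "Z \<in> borel_measurable P" "\<And>\<omega>. 0 \<le> Z \<omega>" "A \<in> sets P" "measure P A < \<epsilon>"
    "(\<integral>\<^sup>+\<omega>. ennreal (Z \<omega> powr p) \<partial>P) \<le> ennreal (bdg_const p * (T - s) powr (p / 2 - 1)) *
       ((\<integral>\<^sup>+u\<in>{s..T}. (\<integral>\<^sup>+\<omega>. ennreal (\<bar>H u \<omega>\<bar> powr p) * indicator (D u) \<omega> \<partial>P) \<partial>lborel) + ennreal \<epsilon>)"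
    "\<And>\<omega> t. \<omega> \<in> D T - A \<Longrightarrow> t \<in> Q \<Longrightarrow> \<bar>I t \<omega> - I s \<omega>\<bar> \<le> Z \<omega> + \<epsilon>"
proof -
  have T: "0 \<le> T" using s by simp
  have prog: "progressively_measurable F H"
    and fin: "AE \<omega> in P. (\<integral>\<^sup>+u\<in>{0..T}. ennreal ((H u \<omega>)\<^sup>2) \<partial>lborel) < \<infinity>"
    and Iad: "adapted F I"
    using I T by (auto simp: has_ito_integral_def)
  obtain n \<tau> \<eta> where S: "\<And>k. simple_integrand P F (n k) (\<tau> k) (\<eta> k)"
    and nullH: "\<And>t. 0 \<le> t \<Longrightarrow> null_in_probability P (\<lambda>k \<omega>. \<integral>\<^sup>+u\<in>{0..t}. ennreal ((simple_process (n k) (\<tau> k) (\<eta> k) u \<omega> - H u \<omega>)\<^sup>2) \<partial>lborel)"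
    and nullI: "\<And>t. 0 \<le> t \<Longrightarrow> null_in_probability P (\<lambda>k \<omega>. ennreal \<bar>simple_ito_integral B (n k) (\<tau> k) (\<eta> k) t \<omega> - I t \<omega>\<bar>)"
    using I unfolding has_ito_integral_def by blast
  define Hk where "Hk k = simple_process (n k) (\<tau> k) (\<eta> k)" for k
  define Jk where "Jk k = simple_ito_integral B (n k) (\<tau> k) (\<eta> k)" for k
  define Hc where "Hc u = H (max 0 (min T u))" for u
  have Hc: "Hc u = H u" if "u \<in> {0..T}" for u using that by (simp add: Hc_def)
  have Hcm [measurable]: "(\<lambda>x. Hc (fst x) (snd x)) \<in> borel_measurable (borel \<Otimes>\<^sub>M P)"
    unfolding Hc_def by (rule progressively_measurable_joint[OF prog T])
  have Hkm [measurable]: "(\<lambda>x. Hk k (fst x) (snd x)) \<in> borel_measurable (borel \<Otimes>\<^sub>M P)" for k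
    unfolding Hk_def by (rule simple_process_joint[OF S])
  have Im [measurable]: "I t \<in> borel_measurable P" if "0 \<le> t" for t
    using Iad that by (auto simp: adapted_def intro: measurable_F_P)
  have Jkm [measurable]: "Jk k t \<in> borel_measurable P" if "0 \<le> t" for k t
    unfolding Jk_def using S that by (rule simple_ito_integral_measurable)
  define V where "V k \<omega> = (\<integral>\<^sup>+u\<in>{s..T}. ennreal ((Hk k u \<omega> - Hc u \<omega>)\<^sup>2) \<partial>lborel)" for k \<omega>
  define Y where "Y R \<omega> = (\<integral>\<^sup>+u\<in>{s..T}. ennreal ((Hc u \<omega> - trunc R (Hc u \<omega>))\<^sup>2) \<partial>lborel)" for R \<omega>
  have Vm [measurable]: "V k \<in> borel_measurable P" for k
    unfolding V_def[abs_def]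
    using nn_integral_time_measurable[of "\<lambda>x. ennreal ((Hk k (fst x) (snd x) - Hc (fst x) (snd x))\<^sup>2) * indicator {s..T} (fst x)"]
    by simp
  have Ym [measurable]: "Y R \<in> borel_measurable P" for R
    unfolding Y_def[abs_def]
    using nn_integral_time_measurable[of "\<lambda>x. ennreal ((Hc (fst x) (snd x) - trunc R (Hc (fst x) (snd x)))\<^sup>2) * indicator {s..T} (fst x)"]
    by simp
  have Vlim: "(\<lambda>k. measure P {\<omega>\<in>space P. ennreal a < V k \<omega>}) \<longlonglongrightarrow> 0" if a: "0 < a" for a
  proof (rule tendsto_sandwich[OF _ _ tendsto_const])
    define V' where "V' k \<omega> = (\<integral>\<^sup>+u\<in>{0..T}. ennreal ((Hk k u \<omega> - H u \<omega>)\<^sup>2) \<partial>lborel)" for k \<omega>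
    have V'm [measurable]: "V' k \<in> borel_measurable P" for k
    proof -
      have "V' k = (\<lambda>\<omega>. \<integral>\<^sup>+u\<in>{0..T}. ennreal ((Hk k u \<omega> - Hc u \<omega>)\<^sup>2) \<partial>lborel)"
        unfolding V'_def by (intro ext nn_integral_cong) (auto simp: indicator_def Hc)
      thus ?thesis
        using nn_integral_time_measurable[of "\<lambda>x. ennreal ((Hk k (fst x) (snd x) - Hc (fst x) (snd x))\<^sup>2) * indicator {0..T} (fst x)"]
        by simp
    qed
    show "(\<lambda>k. measure P {\<omega>\<in>space P. ennreal a < V' k \<omega>}) \<longlonglongrightarrow> 0"
      using nullH[OF T] a by (simp add: null_in_probability_def V'_def Hk_def)
    have "V k \<omega> \<le> V' k \<omega>" for k \<omega>
      unfolding V_def V'_def using s by (intro nn_integral_mono) (auto simp: indicator_def Hc)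
    hence "{\<omega>\<in>space P. ennreal a < V k \<omega>} \<subseteq> {\<omega>\<in>space P. ennreal a < V' k \<omega>}" for k
      by (auto intro: less_le_trans)
    thus "\<forall>\<^sub>F k in sequentially. measure P {\<omega>\<in>space P. ennreal a < V k \<omega>} \<le> measure P {\<omega>\<in>space P. ennreal a < V' k \<omega>}"
      by (intro always_eventually allI finite_measure_mono) auto
  qed auto
  have Ylim: "(\<lambda>m. measure P {\<omega>\<in>space P. ennreal a < Y (real m) \<omega>}) \<longlonglongrightarrow> 0" if a: "0 < a" for a
    unfolding Y_def
  proof (rule truncation_error_small[OF Hcm _ a])
    show "AE \<omega> in P. (\<integral>\<^sup>+u\<in>{s..T}. ennreal ((Hc u \<omega>)\<^sup>2) \<partial>lborel) < \<infinity>"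
      using fin
    proof eventually_elim
      case (elim \<omega>)
      have "(\<integral>\<^sup>+u\<in>{s..T}. ennreal ((Hc u \<omega>)\<^sup>2) \<partial>lborel) \<le> (\<integral>\<^sup>+u\<in>{0..T}. ennreal ((H u \<omega>)\<^sup>2) \<partial>lborel)"
        using s by (intro nn_integral_mono) (auto simp: indicator_def Hc)
      thus ?case using elim by (rule le_less_trans)
    qed
  qed
  define l where "l = \<epsilon> / 2"
  have l: "0 < l" using \<epsilon> by (simp add: l_def)
  \<comment> \<open>Makes the Lenglart bound at level \<open>l\<close> at most \<epsilon>/8.\<close>
  define a where "a = l\<^sup>2 * \<epsilon> / (8 * (bdg_const 2 + 1))"
  have C2: "0 \<le> bdg_const 2" by (rule bdg_const_nonneg) simp
  have a: "0 < a" using l \<epsilon> C2 by (simp add: a_def)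
  have a_le: "bdg_const 2 * a / l\<^sup>2 \<le> \<epsilon> / 8"
  proof -
    have "bdg_const 2 * a / l\<^sup>2 = \<epsilon> / 8 * (bdg_const 2 / (bdg_const 2 + 1))"
    proof -
      have "bdg_const 2 * a / l\<^sup>2 = bdg_const 2 * (a / l\<^sup>2)" by simp
      also have "a / l\<^sup>2 = \<epsilon> / (8 * (bdg_const 2 + 1))" using l by (simp add: a_def)
      finally show ?thesis by (simp add: field_simps)
    qed
    also have "\<dots> \<le> \<epsilon> / 8 * 1" using \<epsilon> C2 by (intro mult_left_mono) auto
    finally show ?thesis by simp
  qed
  \<comment> \<open>A quarter of \<open>a\<close> for each of the two errors: the square of a sum
    costs a factor 2, and 2 a/4 + 2 a/4 = a.\<close>
  have "\<forall>\<^sub>F m in sequentially. measure P {\<omega>\<in>space P. ennreal (a/4) < Y (real m) \<omega>} < \<epsilon> / 8"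
    using Ylim[of "a/4"] a \<epsilon> by (intro order_tendstoD(2)) auto
  then obtain m where m: "measure P {\<omega>\<in>space P. ennreal (a/4) < Y (real m) \<omega>} < \<epsilon> / 8"
    by (auto simp: eventually_sequentially)
  define R where "R = real m"
  have R: "0 \<le> R" by (simp add: R_def)
  have p0: "0 < p" and \<epsilon>2: "0 < \<epsilon> / 2" using p \<epsilon> by auto
  obtain \<delta> where \<delta>: "0 < \<delta>"
    "(\<integral>\<^sup>+u\<in>{s..T}. (\<integral>\<^sup>+\<omega>. ennreal (\<bar>trunc R (Hc u \<omega>)\<bar> powr p) * indicator (D (max s (u - \<delta>))) \<omega> \<partial>P) \<partial>lborel)
     \<le> (\<integral>\<^sup>+u\<in>{s..T}. (\<integral>\<^sup>+\<omega>. ennreal (\<bar>Hc u \<omega>\<bar> powr p) * indicator (D u) \<omega> \<partial>P) \<partial>lborel) + ennreal (\<epsilon> / 2)"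
    by (rule truncated_moment_delay[OF Hcm D s R p0 \<epsilon>2])
  \<comment> \<open>Half of \<epsilon> was spent on the delay. The other half covers e (T - s), c a'
    and R^p (T - s) r, each of which is made at most \<epsilon>/8.\<close>
  define e where "e = \<epsilon> / 8 / (T - s)"
  have Ts: "T - s \<noteq> 0" using s by simp
  have e: "0 < e" using \<epsilon> s by (simp add: e_def)
  have eT: "e * (T - s) = \<epsilon> / 8" by (rule nonzero_eq_divide_eq[THEN iffD1, OF Ts e_def])
  obtain c where c: "0 \<le> c" "\<And>x y. \<bar>trunc R x\<bar> powr p \<le> \<bar>trunc R y\<bar> powr p + e + c * (x - y)\<^sup>2"
    by (rule abs_trunc_powr_le[OF p0 R e]) (rule that)
  define a' where "a' = \<epsilon> / (8 * (c + 1))"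
  have a': "0 < a'" using \<epsilon> c by (simp add: a'_def)
  have ca': "c * a' \<le> \<epsilon> / 8"
  proof -
    have "c * a' = \<epsilon> / 8 * (c / (c + 1))" by (simp add: a'_def field_simps)
    also have "\<dots> \<le> \<epsilon> / 8 * 1" using \<epsilon> c(1) by (intro mult_left_mono) auto
    finally show ?thesis by simp
  qed
  define r where "r = \<epsilon> / (8 * (R powr p * (T - s) + 1))"
  have RT: "0 \<le> R powr p * (T - s)" using s by simp
  have r: "0 < r" using RT \<epsilon> by (simp add: r_def)
  have Rr: "R powr p * (T - s) * r \<le> \<epsilon> / 8"
  proof -
    have "R powr p * (T - s) * r = \<epsilon> / 8 * ((R powr p * (T - s)) / (R powr p * (T - s) + 1))" by (simp add: r_def)
    also have "\<dots> \<le> \<epsilon> / 8 * 1" using \<epsilon> RT by (intro mult_left_mono) auto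
    finally show ?thesis by simp
  qed
  define q where "q = \<epsilon> / 8 / (real (card Q) + 1)"
  have q: "0 < q" using \<epsilon> by (simp add: q_def)
  \<comment> \<open>The base point s joins the observed times, as increments from s are estimated.
    This gives at most \<open>card Q + 1\<close> events, which explains the denominator of
    \<open>q\<close>.\<close>
  define Q' where "Q' = insert s Q"
  have Q': "finite Q'" "\<And>t. t \<in> Q' \<Longrightarrow> 0 \<le> t" using Q s by (auto simp: Q'_def)
  define N where "N k t = {\<omega>\<in>space P. \<epsilon> / 4 < \<bar>Jk k t \<omega> - I t \<omega>\<bar>}" for k t
  have Nlim: "(\<lambda>k. measure P (N k t)) \<longlonglongrightarrow> 0" if "t \<in> Q'" for t
    using nullI[OF Q'(2)[OF that]] \<epsilon> unfolding null_in_probability_def N_def Jk_def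
    by (auto simp: ennreal_less_iff dest!: spec[of _ "\<epsilon> / 4"])
  have "\<forall>\<^sub>F k in sequentially. measure P {\<omega>\<in>space P. ennreal (a/4) < V k \<omega>} < \<epsilon> / 8 \<and>
     measure P {\<omega>\<in>space P. ennreal a' < V k \<omega>} < r \<and> (\<forall>t\<in>Q'. measure P (N k t) < q)"
    using a a' r q \<epsilon>
    by (intro eventually_conj eventually_ball_finite Q' ballI order_tendstoD(2)[OF Vlim] order_tendstoD(2)[OF Nlim]) auto
  then obtain k where k: "measure P {\<omega>\<in>space P. ennreal (a/4) < V k \<omega>} < \<epsilon> / 8"
     "measure P {\<omega>\<in>space P. ennreal a' < V k \<omega>} < r" "\<And>t. t \<in> Q' \<Longrightarrow> measure P (N k t) < q"
    by (auto simp: eventually_sequentially)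
  define W where "W u \<omega> = (indicator (D (max s (u - \<delta>))) \<omega> :: ennreal)" for u \<omega>
  obtain Z where Z: "Z \<in> borel_measurable P" "\<And>\<omega>. 0 \<le> Z \<omega>"
    and Zp: "(\<integral>\<^sup>+\<omega>. ennreal (Z \<omega> powr p) \<partial>P) \<le> ennreal (bdg_const p * (T - s) powr (p / 2 - 1)) *
       (\<integral>\<^sup>+u\<in>{s..T}. (\<integral>\<^sup>+\<omega>. ennreal (\<bar>trunc R (Hk k u \<omega>)\<bar> powr p) * W u \<omega> \<partial>P) \<partial>lborel)"
    and Zl: "\<And>l a. 0 < l \<Longrightarrow> 0 \<le> a \<Longrightarrow> \<exists>A\<in>sets P. measure P A \<le> bdg_const 2 * a / l\<^sup>2 \<and>
       (\<forall>\<omega>\<in>D T. (\<integral>\<^sup>+u\<in>{s..T}. ennreal ((Hk k u \<omega> - trunc R (Hk k u \<omega>))\<^sup>2) \<partial>lborel) \<le> ennreal a \<longrightarrow>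
         (\<exists>t\<in>Q. Z \<omega> + l < \<bar>Jk k t \<omega> - Jk k s \<omega>\<bar>) \<longrightarrow> \<omega> \<in> A)"
    by (rule simple_ito_estimate[OF S[of k] D s R \<delta>(1) p Q, folded Hk_def Jk_def W_def]) (rule that)
  obtain A1 where A1: "A1 \<in> sets P" "measure P A1 \<le> bdg_const 2 * a / l\<^sup>2"
    "\<And>\<omega>. \<omega> \<in> D T \<Longrightarrow> (\<integral>\<^sup>+u\<in>{s..T}. ennreal ((Hk k u \<omega> - trunc R (Hk k u \<omega>))\<^sup>2) \<partial>lborel) \<le> ennreal a \<Longrightarrow>
         (\<exists>t\<in>Q. Z \<omega> + l < \<bar>Jk k t \<omega> - Jk k s \<omega>\<bar>) \<Longrightarrow> \<omega> \<in> A1"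
    using Zl[OF l less_imp_le[OF a]] by blast
  define A2 where "A2 = {\<omega>\<in>space P. ennreal (a/4) < V k \<omega>}"
  define A3 where "A3 = {\<omega>\<in>space P. ennreal (a/4) < Y R \<omega>}"
  define A4 where "A4 = (\<Union>t\<in>Q'. N k t)"
  have Nm [measurable]: "N k t \<in> sets P" if "t \<in> Q'" for t
    unfolding N_def using Im[OF Q'(2)[OF that]] Jkm[OF Q'(2)[OF that]] by measurable
  have sets: "A2 \<in> sets P" "A3 \<in> sets P" "A4 \<in> sets P"
    unfolding A2_def A3_def A4_def using Q' Nm by auto
  have mA4: "measure P A4 \<le> \<epsilon> / 8"
  proof -
    have "measure P A4 \<le> (\<Sum>t\<in>Q'. measure P (N k t))"
      unfolding A4_def by (rule finite_measure_subadditive_finite) (use Q' Nm in auto)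
    also have "\<dots> \<le> (\<Sum>t\<in>Q'. q)" using k(3) by (intro sum_mono) (simp add: less_imp_le)
    also have "\<dots> = real (card Q') * q" by simp
    also have "\<dots> \<le> (real (card Q) + 1) * q"
      using q card_insert_le_m1[of "card Q + 1" Q s] by (intro mult_right_mono) (auto simp: Q'_def)
    also have "\<dots> = \<epsilon> / 8"
    proof -
      have "real (card Q) + 1 \<noteq> 0" by linarith
      from nonzero_eq_divide_eq[THEN iffD1, OF this q_def] show ?thesis by (simp only: mult.commute)
    qed
    finally show ?thesis .
  qed
  show ?thesis
  proof (rule that[of Z "A1 \<union> A2 \<union> A3 \<union> A4"])
    show "Z \<in> borel_measurable P" "0 \<le> Z \<omega>" for \<omega> by fact+
    show "A1 \<union> A2 \<union> A3 \<union> A4 \<in> sets P" using A1 sets by auto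
    have "measure P (A1 \<union> A2 \<union> A3 \<union> A4) \<le> measure P A1 + measure P A2 + measure P A3 + measure P A4"
      by (intro order_trans[OF measure_Un_le] add_mono order_refl sets.Un A1(1) sets)
    also have "\<dots> < \<epsilon>"
      using A1(2) a_le k(1)[folded A2_def] m[folded R_def, folded A3_def] mA4 \<epsilon> by linarith
    finally show "measure P (A1 \<union> A2 \<union> A3 \<union> A4) < \<epsilon>" .
    have "(\<integral>\<^sup>+u\<in>{s..T}. (\<integral>\<^sup>+\<omega>. ennreal (\<bar>trunc R (Hk k u \<omega>)\<bar> powr p) * W u \<omega> \<partial>P) \<partial>lborel) \<le>
       (\<integral>\<^sup>+u\<in>{s..T}. (\<integral>\<^sup>+\<omega>. ennreal (\<bar>trunc R (Hc u \<omega>)\<bar> powr p) * W u \<omega> \<partial>P) \<partial>lborel) +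
       ennreal (e * (T - s) + c * a' + R powr p * (T - s) * measure P {\<omega>\<in>space P. ennreal a' < V k \<omega>})"
      unfolding V_def
    proof (rule truncated_moment_perturb[OF Hkm Hcm])
      show "(\<lambda>x. W (fst x) (snd x)) \<in> borel_measurable (borel \<Otimes>\<^sub>M P)"
        unfolding W_def by (rule stopping_events_joint[OF D]) simp
    qed (use s R p0 a' c e in \<open>auto simp: W_def indicator_def\<close>)
    also have "\<dots> \<le> ((\<integral>\<^sup>+u\<in>{s..T}. (\<integral>\<^sup>+\<omega>. ennreal (\<bar>Hc u \<omega>\<bar> powr p) * indicator (D u) \<omega> \<partial>P) \<partial>lborel) + ennreal (\<epsilon> / 2)) + ennreal (\<epsilon> / 2)"
    proof (intro add_mono ennreal_leI)
      have "R powr p * (T - s) * measure P {\<omega>\<in>space P. ennreal a' < V k \<omega>} \<le> R powr p * (T - s) * r"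
        using RT k(2) by (intro mult_left_mono) auto
      thus "e * (T - s) + c * a' + R powr p * (T - s) * measure P {\<omega>\<in>space P. ennreal a' < V k \<omega>} \<le> \<epsilon> / 2"
        using eT ca' Rr \<epsilon> by linarith
    qed (use \<delta>(2) in \<open>simp add: W_def\<close>)
    also have "\<dots> = (\<integral>\<^sup>+u\<in>{s..T}. (\<integral>\<^sup>+\<omega>. ennreal (\<bar>Hc u \<omega>\<bar> powr p) * indicator (D u) \<omega> \<partial>P) \<partial>lborel) + ennreal \<epsilon>"
      using \<epsilon> by (simp add: add.assoc flip: ennreal_plus)
    also have "(\<integral>\<^sup>+u\<in>{s..T}. (\<integral>\<^sup>+\<omega>. ennreal (\<bar>Hc u \<omega>\<bar> powr p) * indicator (D u) \<omega> \<partial>P) \<partial>lborel) =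
       (\<integral>\<^sup>+u\<in>{s..T}. (\<integral>\<^sup>+\<omega>. ennreal (\<bar>H u \<omega>\<bar> powr p) * indicator (D u) \<omega> \<partial>P) \<partial>lborel)"
      using s by (intro nn_integral_cong) (auto simp: indicator_def Hc)
    finally show "(\<integral>\<^sup>+\<omega>. ennreal (Z \<omega> powr p) \<partial>P) \<le> ennreal (bdg_const p * (T - s) powr (p / 2 - 1)) *
       ((\<integral>\<^sup>+u\<in>{s..T}. (\<integral>\<^sup>+\<omega>. ennreal (\<bar>H u \<omega>\<bar> powr p) * indicator (D u) \<omega> \<partial>P) \<partial>lborel) + ennreal \<epsilon>)"
      by (intro order_trans[OF Zp] mult_left_mono) auto
    fix \<omega> t assume \<omega>: "\<omega> \<in> D T - (A1 \<union> A2 \<union> A3 \<union> A4)" and t: "t \<in> Q"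
    have \<omega>P: "\<omega> \<in> space P"
      using D T \<omega> sets.sets_into_space[OF sets_F_P] unfolding stopping_events_def by blast
    have [measurable]: "(\<lambda>u. Hk k u \<omega>) \<in> borel_measurable borel" "(\<lambda>u. Hc u \<omega>) \<in> borel_measurable borel"
      using measurable_compose[OF measurable_Pair2'[OF \<omega>P, of borel] Hkm]
        measurable_compose[OF measurable_Pair2'[OF \<omega>P, of borel] Hcm] by simp_all
    have "(\<integral>\<^sup>+u\<in>{s..T}. ennreal ((Hk k u \<omega> - trunc R (Hk k u \<omega>))\<^sup>2) \<partial>lborel) \<le>
       (\<integral>\<^sup>+u. 2 * (ennreal ((Hk k u \<omega> - Hc u \<omega>)\<^sup>2) * indicator {s..T} u) +
           2 * (ennreal ((Hc u \<omega> - trunc R (Hc u \<omega>))\<^sup>2) * indicator {s..T} u) \<partial>lborel)"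
    proof (rule nn_integral_mono)
      fix u
      define x y where "x = \<bar>Hk k u \<omega> - Hc u \<omega>\<bar>" and "y = \<bar>Hc u \<omega> - trunc R (Hc u \<omega>)\<bar>"
      have "(Hk k u \<omega> - trunc R (Hk k u \<omega>))\<^sup>2 \<le> (x + y)\<^sup>2"
        using abs_diff_trunc_le[OF R, of "Hk k u \<omega>" "Hc u \<omega>"]
        unfolding abs_le_square_iff[symmetric] x_def y_def by linarith
      also have "\<dots> \<le> 2 * x\<^sup>2 + 2 * y\<^sup>2"
        using sum_squares_bound[of x y] by (simp add: power2_sum)
      finally have "ennreal ((Hk k u \<omega> - trunc R (Hk k u \<omega>))\<^sup>2) \<le> ennreal (2 * x\<^sup>2 + 2 * y\<^sup>2)"
        by (rule ennreal_leI)
      also have "\<dots> = 2 * ennreal ((Hk k u \<omega> - Hc u \<omega>)\<^sup>2) + 2 * ennreal ((Hc u \<omega> - trunc R (Hc u \<omega>))\<^sup>2)"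
        by (simp add: x_def y_def ennreal_mult)
      finally show "ennreal ((Hk k u \<omega> - trunc R (Hk k u \<omega>))\<^sup>2) * indicator {s..T} u \<le>
         2 * (ennreal ((Hk k u \<omega> - Hc u \<omega>)\<^sup>2) * indicator {s..T} u) +
           2 * (ennreal ((Hc u \<omega> - trunc R (Hc u \<omega>))\<^sup>2) * indicator {s..T} u)"
        by (auto simp: indicator_def)
    qed
    also have "\<dots> = 2 * V k \<omega> + 2 * Y R \<omega>"
      unfolding V_def Y_def by (simp add: nn_integral_add nn_integral_cmult)
    also have "\<dots> \<le> 2 * ennreal (a/4) + 2 * ennreal (a/4)"
      using \<omega> \<omega>P by (intro add_mono mult_left_mono) (auto simp: A2_def A3_def not_less)
    also have "\<dots> = ennreal a"
    proof -
      have "2 * ennreal (a/4) = ennreal (a/2)"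
        using a by (subst ennreal_numeral[symmetric], subst ennreal_mult[symmetric]) auto
      thus ?thesis using a by (simp flip: ennreal_plus)
    qed
    finally have "\<bar>Jk k t \<omega> - Jk k s \<omega>\<bar> \<le> Z \<omega> + l"
      using A1(3)[of \<omega>] \<omega> t by force
    moreover have "\<bar>Jk k t' \<omega> - I t' \<omega>\<bar> \<le> \<epsilon> / 4" if "t' \<in> Q'" for t'
      using \<omega> \<omega>P that by (auto simp: A4_def N_def not_less)
    hence "\<bar>Jk k t \<omega> - I t \<omega>\<bar> \<le> \<epsilon> / 4" "\<bar>Jk k s \<omega> - I s \<omega>\<bar> \<le> \<epsilon> / 4"
      using t by (auto simp: Q'_def)
    ultimately show "\<bar>I t \<omega> - I s \<omega>\<bar> \<le> Z \<omega> + \<epsilon>"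
      unfolding l_def by linarith
  qed
qed

text \<open>\<open>ito_approx\<close> is applied with \<epsilon> n = 2^(-n) and finite sets
  exhausting Q. The exceptional sets have summable probabilities, so by Borel-Cantelli almost every
  path leaves them eventually, and there \<bar>I t - I s\<bar> is at most the lower limit of the Z
  n. Fatou's lemma carries the moment bound over.\<close>

theorem ito_moment:
  assumes I: "has_ito_integral P F B H I" and D: "stopping_events P F D"
    and s: "0 \<le> s" "s < T" and p: "2 \<le> p" and Q: "countable Q" "Q \<subseteq> {s..T}"
  shows "(\<integral>\<^sup>+\<omega>. (SUP t\<in>Q. ennreal (\<bar>I t \<omega> - I s \<omega>\<bar> powr p)) * indicator (D T) \<omega> \<partial>P) \<le>
    ennreal (bdg_const p * (T - s) powr (p / 2 - 1)) *
    (\<integral>\<^sup>+u\<in>{s..T}. (\<integral>\<^sup>+\<omega>. ennreal (\<bar>H u \<omega>\<bar> powr p) * indicator (D u) \<omega> \<partial>P) \<partial>lborel)"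
    (is "_ \<le> ?C * ?J")
proof (cases "Q = {}")
  case False
  define \<epsilon> :: "nat \<Rightarrow> real" where "\<epsilon> n = (1/2) ^ n" for n
  define Qn where "Qn n = from_nat_into Q ` {..n}" for n :: nat
  have Qn: "finite (Qn n)" "Qn n \<subseteq> {s..T}" for n
    using Q from_nat_into[OF False] by (auto simp: Qn_def)
  define \<Phi> where "\<Phi> n Z A \<longleftrightarrow> Z \<in> borel_measurable P \<and> (\<forall>\<omega>. 0 \<le> Z \<omega>) \<and> A \<in> sets P \<and> measure P A < \<epsilon> n \<and>
    (\<integral>\<^sup>+\<omega>. ennreal (Z \<omega> powr p) \<partial>P) \<le> ?C * (?J + ennreal (\<epsilon> n)) \<and>
    (\<forall>\<omega> t. \<omega> \<in> D T - A \<longrightarrow> t \<in> Qn n \<longrightarrow> \<bar>I t \<omega> - I s \<omega>\<bar> \<le> Z \<omega> + \<epsilon> n)" for n Z A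
  have "\<exists>Z A. \<Phi> n Z A" for n
  proof -
    have "0 < \<epsilon> n" by (simp add: \<epsilon>_def)
    show ?thesis unfolding \<Phi>_def by (rule ito_approx[OF I D s p Qn[of n] \<open>0 < \<epsilon> n\<close>]) blast
  qed
  then obtain Z A where \<Phi>: "\<And>n. \<Phi> n (Z n) (A n)" by metis
  have Zm [measurable]: "Z n \<in> borel_measurable P" and Z0: "0 \<le> Z n \<omega>"
    and A: "A n \<in> sets P" "measure P (A n) < \<epsilon> n"
    and Zp: "(\<integral>\<^sup>+\<omega>. ennreal (Z n \<omega> powr p) \<partial>P) \<le> ?C * (?J + ennreal (\<epsilon> n))"
    and ZI: "\<omega> \<in> D T - A n \<Longrightarrow> t \<in> Qn n \<Longrightarrow> \<bar>I t \<omega> - I s \<omega>\<bar> \<le> Z n \<omega> + \<epsilon> n" for n \<omega> t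
    using \<Phi>[of n] unfolding \<Phi>_def by blast+
  have \<epsilon>lim: "\<epsilon> \<longlonglongrightarrow> 0" unfolding \<epsilon>_def by (rule LIMSEQ_power_zero) simp
  have "summable \<epsilon>" unfolding \<epsilon>_def by (rule summable_geometric) simp
  hence "AE \<omega> in P. \<forall>\<^sub>F n in sequentially. \<omega> \<in> space P - A n"
    using A by (intro borel_cantelli_AE1 summable_comparison_test[of "\<lambda>n. measure P (A n)" \<epsilon>])
      (auto simp: less_imp_le emeasure_eq_measure)
  hence "AE \<omega> in P. (SUP t\<in>Q. ennreal (\<bar>I t \<omega> - I s \<omega>\<bar> powr p)) * indicator (D T) \<omega> \<le>
      liminf (\<lambda>n. ennreal (Z n \<omega> powr p))"
  proof eventually_elim
    case (elim \<omega>)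
    show ?case
    proof (cases "\<omega> \<in> D T")
      case True
      have "ennreal (\<bar>I t \<omega> - I s \<omega>\<bar> powr p) \<le> liminf (\<lambda>n. ennreal (Z n \<omega> powr p))" if t: "t \<in> Q" for t
      proof -
        define x where "x = \<bar>I t \<omega> - I s \<omega>\<bar>"
        have "(\<lambda>n. max 0 (x - \<epsilon> n)) \<longlonglongrightarrow> max 0 (x - 0)"
          by (intro tendsto_intros \<epsilon>lim)
        hence "(\<lambda>n. max 0 (x - \<epsilon> n) powr p) \<longlonglongrightarrow> x powr p"
          using p by (intro tendsto_powr') (auto simp: x_def)
        hence "(\<lambda>n. ennreal (max 0 (x - \<epsilon> n) powr p)) \<longlonglongrightarrow> ennreal (x powr p)"
          by (rule tendsto_ennrealI)
        hence "ennreal (x powr p) = liminf (\<lambda>n. ennreal (max 0 (x - \<epsilon> n) powr p))"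
          by (rule lim_imp_Liminf[symmetric, rotated]) simp
        also have "\<dots> \<le> liminf (\<lambda>n. ennreal (Z n \<omega> powr p))"
        proof (rule Liminf_mono)
          obtain i where i: "t = from_nat_into Q i" using t from_nat_into_surj[OF Q(1)] by metis
          show "\<forall>\<^sub>F n in sequentially. ennreal (max 0 (x - \<epsilon> n) powr p) \<le> ennreal (Z n \<omega> powr p)"
            using elim eventually_ge_at_top[of i]
          proof eventually_elim
            case (elim n)
            have "x \<le> Z n \<omega> + \<epsilon> n"
              unfolding x_def using True elim i by (intro ZI) (auto simp: Qn_def)
            thus ?case using Z0[of n \<omega>] p by (intro ennreal_leI powr_mono2) auto
          qed
        qed
        finally show ?thesis by (simp add: x_def)
      qed
      thus ?thesis using True by (auto intro: SUP_least)
    qed simp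
  qed
  hence "(\<integral>\<^sup>+\<omega>. (SUP t\<in>Q. ennreal (\<bar>I t \<omega> - I s \<omega>\<bar> powr p)) * indicator (D T) \<omega> \<partial>P) \<le>
      (\<integral>\<^sup>+\<omega>. liminf (\<lambda>n. ennreal (Z n \<omega> powr p)) \<partial>P)"
    by (rule nn_integral_mono_AE)
  also have "\<dots> \<le> liminf (\<lambda>n. \<integral>\<^sup>+\<omega>. ennreal (Z n \<omega> powr p) \<partial>P)"
    by (rule nn_integral_liminf) simp
  also have "\<dots> \<le> liminf (\<lambda>n. ?C * (?J + ennreal (\<epsilon> n)))"
    by (intro Liminf_mono always_eventually allI Zp)
  also have "\<dots> = ?C * ?J"
  proof (rule lim_imp_Liminf)
    have "(\<lambda>n. ?J + ennreal (\<epsilon> n)) \<longlonglongrightarrow> ?J + ennreal 0"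
      by (intro tendsto_add tendsto_const tendsto_ennrealI \<epsilon>lim)
    thus "(\<lambda>n. ?C * (?J + ennreal (\<epsilon> n))) \<longlonglongrightarrow> ?C * ?J"
      by (intro ennreal_tendsto_cmult) auto
  qed simp
  finally show ?thesis .
qed (simp add: bot_ennreal)

end

section \<open>Gronwall bounds for moments\<close>

text \<open>The supremum over \<open>[0,t)\<close>, taken over rational times so that it is measurable for every
  process; for continuous paths it bounds the values on \<open>[0,t]\<close>.\<close>

definition running_sup :: "(real \<Rightarrow> 'a \<Rightarrow> ennreal) \<Rightarrow> real \<Rightarrow> 'a \<Rightarrow> ennreal" where
  "running_sup Y t \<omega> = (SUP r\<in>\<rat> \<inter> {0..}. Y r \<omega> * indicator {r<..} t)"

lemma running_sup_upper: "r \<in> \<rat> \<Longrightarrow> 0 \<le> r \<Longrightarrow> r < t \<Longrightarrow> Y r \<omega> \<le> running_sup Y t \<omega>"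
  unfolding running_sup_def by (rule SUP_upper2[of r]) auto

lemma running_sup_least:
  assumes "\<And>r. r \<in> \<rat> \<Longrightarrow> 0 \<le> r \<Longrightarrow> r < t \<Longrightarrow> Y r \<omega> \<le> c"
  shows "running_sup Y t \<omega> \<le> c"
  unfolding running_sup_def by (rule SUP_least) (use assms in \<open>auto simp: indicator_def\<close>)

lemma running_sup_eq: "running_sup Y t \<omega> = (SUP r\<in>\<rat> \<inter> {0..<t}. Y r \<omega>)"
  by (intro antisym running_sup_least SUP_least SUP_upper running_sup_upper) auto

lemma running_sup_mono: "s \<le> t \<Longrightarrow> running_sup Y s \<omega> \<le> running_sup Y t \<omega>"
  by (intro running_sup_least running_sup_upper) auto

text \<open>The rationals in (0, t) are dense in [0, t], so continuity recovers all values,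
  including the one at the end point t that the supremum leaves out.\<close>

lemma running_sup_continuous:
  assumes f: "continuous_on {0..} f" and st: "0 \<le> s" "s \<le> t" "0 < t"
    and Y: "\<And>r. 0 \<le> r \<Longrightarrow> Y r \<omega> = ennreal (f r)"
  shows "ennreal (f s) \<le> running_sup Y t \<omega>"
proof -
  \<comment> \<open>In dimension one a vector of rational coordinates is a function on the basis
    {1}, that is, a rational number.\<close>
  have "(\<exists>f\<in>{1::real} \<rightarrow> \<rat>. x = f 1) \<longleftrightarrow> x \<in> \<rat>" for x :: real
    by (auto intro: bexI[of _ "\<lambda>_. x"])
  hence "closure ({0<..<t} \<inter> \<rat>) = closure {0<..<t}"
    using closure_rationals_in_convex_set[of "{0<..<t}"] st by (simp add: interior_open Int_def)
  hence "s \<in> closure ({0<..<t} \<inter> \<rat>)" using st by (simp add: closure_greaterThanLessThan)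
  then obtain x where x: "\<And>n. x n \<in> {0<..<t} \<inter> \<rat>" "x \<longlonglongrightarrow> s" unfolding closure_sequential by auto
  have "(\<lambda>n. f (x n)) \<longlonglongrightarrow> f s"
    by (rule continuous_on_tendsto_compose[OF f x(2)]) (use x st in \<open>auto intro!: always_eventually less_imp_le\<close>)
  hence lim: "(\<lambda>n. ennreal (f (x n))) \<longlonglongrightarrow> ennreal (f s)" by (rule tendsto_ennrealI)
  have le: "ennreal (f (x n)) \<le> running_sup Y t \<omega>" for n
  proof -
    have "x n \<in> \<rat>" "0 \<le> x n" "x n < t" using x(1)[of n] by auto
    thus ?thesis using running_sup_upper[of "x n" t Y \<omega>] by (simp add: Y)
  qed
  show ?thesis by (rule LIMSEQ_le_const2[OF lim]) (use le in auto)
qed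

lemma running_sup_measurable:
  assumes "\<And>r. 0 \<le> r \<Longrightarrow> r < t \<Longrightarrow> Y r \<in> borel_measurable N"
  shows "running_sup Y t \<in> borel_measurable N"
  unfolding running_sup_eq[abs_def]
  by (rule borel_measurable_SUP) (use assms in \<open>auto intro: countable_subset[OF _ countable_rat]\<close>)

text \<open>The reason for the indicator in the definition of \<open>running_sup\<close>: the index
  set of the supremum does not depend on t, so joint measurability follows from that of each
  member.\<close>

lemma running_sup_joint:
  assumes "\<And>r. 0 \<le> r \<Longrightarrow> Y r \<in> borel_measurable N"
  shows "(\<lambda>x. running_sup Y (fst x) (snd x)) \<in> borel_measurable (borel \<Otimes>\<^sub>M N)"
  unfolding running_sup_def
proof (rule borel_measurable_SUP)
  show "countable (\<rat> \<inter> {0..} :: real set)" by (rule countable_subset[OF _ countable_rat]) auto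
  fix r :: real assume "r \<in> \<rat> \<inter> {0..}"
  hence [measurable]: "Y r \<in> borel_measurable N" using assms by simp
  show "(\<lambda>x. Y r (snd x) * indicator {r<..} (fst x)) \<in> borel_measurable (borel \<Otimes>\<^sub>M N)" by measurable
qed

text \<open>The supremum covers only times strictly before t. This makes the events left-continuous
  in t, as \<open>stopping_events\<close> demands.\<close>

definition not_exceeded :: "'a measure \<Rightarrow> (real \<Rightarrow> 'a \<Rightarrow> real) \<Rightarrow> real \<Rightarrow> real \<Rightarrow> 'a set" where
  "not_exceeded P X N t = {\<omega>\<in>space P. running_sup (\<lambda>r \<omega>. ennreal \<bar>X r \<omega>\<bar>) t \<omega> \<le> ennreal N}"

lemma not_exceededD:
  assumes "\<omega> \<in> not_exceeded P X N t" "0 \<le> N" "r \<in> \<rat>" "0 \<le> r" "r < t"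
  shows "\<bar>X r \<omega>\<bar> \<le> N"
proof -
  have "ennreal \<bar>X r \<omega>\<bar> \<le> running_sup (\<lambda>r \<omega>. ennreal \<bar>X r \<omega>\<bar>) t \<omega>"
    by (rule running_sup_upper) (use assms in auto)
  also have "\<dots> \<le> ennreal N" using assms by (simp add: not_exceeded_def)
  finally have "ennreal \<bar>X r \<omega>\<bar> \<le> ennreal N" .
  thus ?thesis using assms by (simp add: ennreal_le_iff)
qed

text \<open>The gain 1/k is what turns Gronwall steps into contractions once the rate k is
  large.\<close>

lemma nn_integral_exp_le:
  assumes "0 < k" "0 \<le> t" "0 \<le> c"
  shows "(\<integral>\<^sup>+u\<in>{0..t}. ennreal (c * exp (k * u)) \<partial>lborel) \<le> ennreal (c * exp (k * t) / k)"
proof -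
  have "(\<integral>\<^sup>+u\<in>{0..t}. ennreal (c * exp (k * u)) \<partial>lborel) = ennreal (c * exp (k * t) / k - c * exp (k * 0) / k)"
    using assms
    by (intro nn_integral_FTC_Icc) (auto intro!: derivative_eq_intros)
  also have "\<dots> \<le> ennreal (c * exp (k * t) / k)"
    using assms by (intro ennreal_leI) auto
  finally show ?thesis .
qed

text \<open>\<open>weighted_gronwall\<close> with the weight exp (2 L u), for which integrating the
  feedback L \<bar>f\<bar> gives exactly the factor 1/2. The coefficient \<beta> enters through the
  bound \<kappa> of its integral only, so it may be unbounded in time.\<close>

lemma pathwise_gronwall:
  fixes f g :: "real \<Rightarrow> real"
  assumes f: "continuous_on {0..} f" and t: "0 \<le> t" and A: "0 \<le> A" and \<kappa>: "0 \<le> \<kappa>" and L: "0 < L"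
    and \<beta>: "\<beta> \<in> borel_measurable borel" "(\<integral>\<^sup>+u\<in>{0..t}. ennreal (\<beta> u) \<partial>lborel) \<le> ennreal \<kappa>"
    and g: "\<And>u. 0 \<le> u \<Longrightarrow> u \<le> t \<Longrightarrow> \<bar>g u\<bar> \<le> \<beta> u + L * \<bar>f u\<bar>"
    and eq: "\<And>s. 0 \<le> s \<Longrightarrow> s \<le> t \<Longrightarrow> \<bar>f s\<bar> \<le> A + \<bar>LINT u:{0..s}|lborel. g u\<bar>"
    and s: "0 \<le> s" "s \<le> t"
  shows "\<bar>f s\<bar> \<le> 2 * exp (2 * L * t) * (A + \<kappa>)"
proof -
  define w where "w u = exp ((2 * L) * u)" for u
  note [measurable] = \<beta>(1)
  have "compact (f ` {0..t})"
    by (intro compact_continuous_image continuous_on_subset[OF f]) auto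
  then obtain b where b: "\<And>u. 0 \<le> u \<Longrightarrow> u \<le> t \<Longrightarrow> \<bar>f u\<bar> \<le> b"
    by (fastforce dest!: compact_imp_bounded simp: bounded_iff)
  have b0: "0 \<le> b" using b[of 0] t by simp
  have "ennreal \<bar>f s\<bar> \<le> ennreal (2 * (A + \<kappa>) * w s)"
  proof (rule weighted_gronwall[where I="{0..t}" and \<phi>\<^sub>0=b and w=w and a="A + \<kappa>" and t=s and y="\<lambda>u. ennreal \<bar>f u\<bar>"])
    show "ennreal \<bar>f u\<bar> \<le> ennreal (b * w u)" if "u \<in> {0..t}" for u
    proof -
      have "b * 1 \<le> b * w u" using that L b0 by (intro mult_left_mono) (auto simp: w_def)
      thus ?thesis using b[of u] that by (intro ennreal_leI) auto
    qed
    fix \<phi> v assume \<phi>: "0 \<le> \<phi>" and hyp: "\<And>s. s \<in> {0..t} \<Longrightarrow> ennreal \<bar>f s\<bar> \<le> ennreal (\<phi> * w s)" and v: "v \<in> {0..t}"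
    have fle: "\<bar>f u\<bar> \<le> \<phi> * w u" if "u \<in> {0..t}" for u
      using hyp[OF that] \<phi> by (simp add: ennreal_le_iff w_def)
    have "ennreal \<bar>LINT u:{0..v}|lborel. g u\<bar> \<le> (\<integral>\<^sup>+u\<in>{0..v}. ennreal \<bar>g u\<bar> \<partial>lborel)"
    proof (cases "set_integrable lborel {0..v} g")
      case True
      have "ennreal \<bar>LINT u:{0..v}|lborel. g u\<bar> \<le> (\<integral>\<^sup>+u. norm (indicator {0..v} u *\<^sub>R g u) \<partial>lborel)"
        using integral_norm_bound_ennreal[OF True[unfolded set_integrable_def]]
        by (simp add: set_lebesgue_integral_def)
      also have "\<dots> = (\<integral>\<^sup>+u\<in>{0..v}. ennreal \<bar>g u\<bar> \<partial>lborel)"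
        by (intro nn_integral_cong) (auto simp: indicator_def)
      finally show ?thesis .
    next
      \<comment> \<open>An integral that does not exist has the default value 0, and the bound is
        trivial.\<close>
      case False
      thus ?thesis by (simp add: set_lebesgue_integral_def set_integrable_def not_integrable_integral_eq)
    qed
    also have "\<dots> \<le> (\<integral>\<^sup>+u. ennreal (\<beta> u) * indicator {0..t} u + ennreal (L * \<phi> * exp ((2 * L) * u)) * indicator {0..v} u \<partial>lborel)"
    proof (rule nn_integral_mono)
      fix u
      show "ennreal \<bar>g u\<bar> * indicator {0..v} u \<le>
         ennreal (\<beta> u) * indicator {0..t} u + ennreal (L * \<phi> * exp ((2 * L) * u)) * indicator {0..v} u"
      proof (cases "u \<in> {0..v}")
        case True
        hence u: "0 \<le> u" "u \<le> t" using v by auto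
        have "\<bar>g u\<bar> \<le> \<beta> u + L * (\<phi> * w u)"
        proof -
          have "L * \<bar>f u\<bar> \<le> L * (\<phi> * w u)" by (rule mult_left_mono[OF fle]) (use L u in auto)
          thus ?thesis using g[OF u] by linarith
        qed
        \<comment> \<open>Where \<beta> is negative, \<open>ennreal\<close> replaces it by 0, and so
          does the maximum.\<close>
        hence "ennreal \<bar>g u\<bar> \<le> ennreal (max 0 (\<beta> u) + L * \<phi> * exp ((2 * L) * u))"
          by (intro ennreal_leI) (auto simp: w_def mult.assoc)
        also have "\<dots> = ennreal (\<beta> u) + ennreal (L * \<phi> * exp ((2 * L) * u))"
          using \<phi> L by (subst ennreal_plus) (auto simp: max_def ennreal_neg)
        finally show ?thesis using True u by simp
      qed simp
    qed
    also have "\<dots> = (\<integral>\<^sup>+u\<in>{0..t}. ennreal (\<beta> u) \<partial>lborel) + (\<integral>\<^sup>+u\<in>{0..v}. ennreal (L * \<phi> * exp ((2 * L) * u)) \<partial>lborel)"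
      by (rule nn_integral_add) auto
    also have "\<dots> \<le> ennreal \<kappa> + ennreal (L * \<phi> * exp ((2 * L) * v) / (2 * L))"
      using v L \<phi> by (intro add_mono \<beta> nn_integral_exp_le) auto
    also have "\<dots> = ennreal (\<kappa> + \<phi> * w v / 2)"
      using \<kappa> \<phi> L by (subst ennreal_plus[symmetric]) (auto simp: w_def)
    finally have "\<bar>LINT u:{0..v}|lborel. g u\<bar> \<le> \<kappa> + \<phi> * w v / 2"
      by (subst (asm) ennreal_le_iff) (use \<kappa> \<phi> in \<open>auto simp: w_def\<close>)
    hence "\<bar>f v\<bar> \<le> (A + \<kappa>) + \<phi> * w v / 2" using eq[of v] v by simp
    also have "\<dots> \<le> (A + \<kappa>) * w v + \<phi> * w v / 2"
      using A \<kappa> v L mult_left_mono[of 1 "w v" "A + \<kappa>"] by (simp add: w_def)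
    finally show "ennreal \<bar>f v\<bar> \<le> ennreal ((A + \<kappa> + \<phi> / 2) * w v)"
      by (intro ennreal_leI) (simp add: algebra_simps)
  qed (use A \<kappa> b0 s in \<open>auto simp: w_def\<close>)
  moreover have "2 * (A + \<kappa>) * w s \<le> 2 * exp (2 * L * t) * (A + \<kappa>)"
    using s L A \<kappa> mult_left_mono[of "w s" "exp (2 * L * t)" "2 * (A + \<kappa>)"] by (simp add: w_def algebra_simps)
  ultimately show ?thesis using A \<kappa> by (simp add: ennreal_le_iff w_def)
qed

text \<open>The 3 comes from the three summands \<xi>, \<kappa> and J of the path bound, and 2^p
  from splitting the growth bound of the integrand. The rate in the exponential is twice the
  resulting feedback factor plus 1, so that dividing the factor by the rate leaves at most
  1/2.\<close>

definition moment_const :: "real \<Rightarrow> real \<Rightarrow> real \<Rightarrow> real \<Rightarrow> real" where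
  "moment_const p T c L = 2 * (3 * c) powr p * (1 + bdg_const p * T powr (p / 2 - 1) * 2 powr p) *
     exp ((2 * (3 * c) powr p * bdg_const p * T powr (p / 2 - 1) * 2 powr p * L powr p + 1) * T)"

lemma moment_const_nonneg: "2 \<le> p \<Longrightarrow> 0 \<le> moment_const p T c L"
  using bdg_const_nonneg[of p] by (simp add: moment_const_def)

lemma powr_add3_le:
  fixes a b c p :: real
  assumes "0 \<le> a" "0 \<le> b" "0 \<le> c" "0 \<le> p"
  shows "(a + b + c) powr p \<le> 3 powr p * (a powr p + b powr p + c powr p)"
proof -
  define m where "m = max a (max b c)"
  have "(a + b + c) powr p \<le> (3 * m) powr p"
    by (rule powr_mono2) (use assms in \<open>auto simp: m_def\<close>)
  also have "\<dots> = 3 powr p * m powr p"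
    using assms by (simp add: powr_mult m_def)
  also have "m powr p \<le> a powr p + b powr p + c powr p"
    by (auto simp: m_def max_def)
  finally show ?thesis by simp
qed

context brownian_setting
begin

lemma adapted_measurable_P: "adapted F X \<Longrightarrow> 0 \<le> t \<Longrightarrow> X t \<in> borel_measurable P"
  by (auto simp: adapted_def intro: measurable_F_P)

lemma stopping_events_not_exceeded:
  assumes X: "adapted F X"
  shows "stopping_events P F (not_exceeded P X N)"
  unfolding stopping_events_def
proof (intro conjI allI impI)
  let ?R = "running_sup (\<lambda>r \<omega>. ennreal \<bar>X r \<omega>\<bar>)"
  have XF: "X r \<in> borel_measurable (F t)" if "0 \<le> r" "r \<le> t" for r t
    using X that by (auto simp: adapted_def intro: measurable_F_F)
  show "not_exceeded P X N t \<in> sets (F t)" if "0 \<le> t" for t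
  proof -
    have [measurable]: "?R t \<in> borel_measurable (F t)"
      by (rule running_sup_measurable) (use XF in auto)
    have "not_exceeded P X N t = {\<omega>\<in>space (F t). ?R t \<omega> \<le> ennreal N}"
      by (simp add: not_exceeded_def space_F)
    thus ?thesis by simp
  qed
  show "not_exceeded P X N t \<subseteq> not_exceeded P X N s" if "s \<le> t" for s t
    using order_trans[OF running_sup_mono[OF that]] by (auto simp: not_exceeded_def)
  show "\<omega> \<in> not_exceeded P X N t" if t: "0 < t" "\<forall>s<t. \<omega> \<in> not_exceeded P X N s" for t \<omega>
  proof -
    have "\<omega> \<in> space P" using t(2)[rule_format, of 0] t(1) by (simp add: not_exceeded_def)
    moreover have "?R t \<omega> \<le> ennreal N"
    proof (rule running_sup_least)
      fix r assume r: "r \<in> \<rat>" "0 \<le> r" "r < t"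
      have "ennreal \<bar>X r \<omega>\<bar> \<le> ?R ((r + t) / 2) \<omega>" by (rule running_sup_upper) (use r in auto)
      also have "\<dots> \<le> ennreal N" using t(2)[rule_format, of "(r + t) / 2"] r by (simp add: not_exceeded_def)
      finally show "ennreal \<bar>X r \<omega>\<bar> \<le> ennreal N" .
    qed
    ultimately show ?thesis by (simp add: not_exceeded_def)
  qed
  have [measurable]: "(\<lambda>x. ?R (fst x) (snd x)) \<in> borel_measurable (borel \<Otimes>\<^sub>M P)"
    by (rule running_sup_joint) (use adapted_measurable_P[OF X] in auto)
  have "Measurable.pred (borel \<Otimes>\<^sub>M P) (\<lambda>x. snd x \<in> space P \<and> ?R (fst x) (snd x) \<le> ennreal N)"
    by measurable
  thus "Measurable.pred (borel \<Otimes>\<^sub>M P) (\<lambda>(t, \<omega>). \<omega> \<in> not_exceeded P X N t)"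
    by (simp add: not_exceeded_def case_prod_beta')
qed

text \<open>Gronwall's argument for the moments up to the time when \<open>X\<close> exceeds \<open>N\<close>, where they are
  finite a priori; the bound does not depend on \<open>N\<close>.\<close>

lemma moment_bound:
  assumes X: "adapted F X" "continuous_paths P X" and \<xi>: "\<xi> \<in> borel_measurable P"
    and I: "has_ito_integral P F B H I" and I0: "AE \<omega> in P. I 0 \<omega> = 0"
    and p: "2 \<le> p" and t: "0 < t" "t \<le> T" and c: "0 < c" and L: "0 \<le> L" and \<kappa>: "0 \<le> \<kappa>"
    and path: "AE \<omega> in P. \<forall>s J. 0 < s \<longrightarrow> s \<le> t \<longrightarrow> 0 \<le> J \<longrightarrow> (\<forall>r\<in>\<rat> \<inter> {0..<s}. \<bar>I r \<omega>\<bar> \<le> J) \<longrightarrow>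
        (\<forall>r\<in>{0..s}. \<bar>X r \<omega>\<bar> \<le> c * (\<bar>\<xi> \<omega>\<bar> + \<kappa> + J))"
    and \<gamma>: "\<gamma> \<in> borel_measurable borel" "\<And>s. 0 \<le> \<gamma> s"
    and H: "\<And>s \<omega>. 0 \<le> s \<Longrightarrow> s \<le> t \<Longrightarrow> \<omega> \<in> space P \<Longrightarrow> \<bar>H s \<omega>\<bar> \<le> \<gamma> s + L * \<bar>X s \<omega>\<bar>"
    and G: "0 \<le> G" "(\<integral>\<^sup>+s\<in>{0..t}. ennreal (\<gamma> s powr p) \<partial>lborel) \<le> ennreal G"
    and E: "0 \<le> E" "(\<integral>\<^sup>+\<omega>. ennreal (\<bar>\<xi> \<omega>\<bar> powr p) \<partial>P) \<le> ennreal E"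
  shows "(\<integral>\<^sup>+\<omega>. running_sup (\<lambda>r \<omega>. ennreal (\<bar>X r \<omega>\<bar> powr p)) t \<omega> \<partial>P) \<le>
    ennreal (moment_const p T c L * (E + \<kappa> powr p + G))"
proof -
  define R where "R = running_sup (\<lambda>r \<omega>. ennreal (\<bar>X r \<omega>\<bar> powr p))"
  define RI where "RI u \<omega> = (SUP r\<in>\<rat> \<inter> {0..<u}. ennreal (\<bar>I r \<omega> - I 0 \<omega>\<bar> powr p))" for u \<omega>
  define D where "D N = not_exceeded P X N" for N
  define Cb where "Cb = bdg_const p * T powr (p / 2 - 1)"
  define C3 where "C3 = (3 * c) powr p"
  define lam where "lam = 2 * C3 * Cb * 2 powr p * L powr p + 1"
  define a where "a = C3 * (E + \<kappa> powr p + Cb * 2 powr p * G)"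
  have Cb: "0 \<le> Cb" using bdg_const_nonneg[OF p] by (simp add: Cb_def)
  have C3: "0 \<le> C3" by (simp add: C3_def)
  have lam: "1 \<le> lam" using Cb C3 by (simp add: lam_def)
  have a0: "0 \<le> a" using Cb C3 E G by (simp add: a_def)
  have p0: "0 < p" using p by simp
  have DS: "stopping_events P F (D N)" for N unfolding D_def by (rule stopping_events_not_exceeded[OF X(1)])
  have Dm [measurable]: "D N u \<in> sets P" if "0 \<le> u" for N u
    using DS[of N] that sets_F_P by (auto simp: stopping_events_def)
  have DP: "D N u \<subseteq> space P" for N u by (auto simp: D_def not_exceeded_def)
  have Dmono: "D N v \<subseteq> D N u" if "u \<le> v" for N u v using DS[of N] that by (auto simp: stopping_events_def)
  have Xm [measurable]: "X r \<in> borel_measurable P" if "0 \<le> r" for r using adapted_measurable_P[OF X(1) that] .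
  have Im [measurable]: "I r \<in> borel_measurable P" if "0 \<le> r" for r
    using I that by (auto simp: has_ito_integral_def intro: adapted_measurable_P)
  have Rm [measurable]: "R u \<in> borel_measurable P" for u
    unfolding R_def by (rule running_sup_measurable) (use Xm in measurable)
  have cnt: "countable (\<rat> \<inter> {0..<u} :: real set)" for u by (rule countable_subset[OF _ countable_rat]) auto
  have RIm [measurable]: "RI u \<in> borel_measurable P" for u
    unfolding RI_def[abs_def]
    by (intro borel_measurable_SUP cnt) (use Im[of 0] Im in measurable)
  define y where "y N u = (\<integral>\<^sup>+\<omega>. R u \<omega> * indicator (D N u) \<omega> \<partial>P)" for N u
  have X_le_R: "AE \<omega> in P. \<forall>s u. 0 \<le> s \<longrightarrow> s \<le> u \<longrightarrow> 0 < u \<longrightarrow> ennreal (\<bar>X s \<omega>\<bar> powr p) \<le> R u \<omega>"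
    using X(2) unfolding continuous_paths_def
  proof eventually_elim
    case (elim \<omega>)
    have "continuous_on {0..} (\<lambda>s. \<bar>X s \<omega>\<bar> powr p)"
      using elim p0 by (intro continuous_on_powr') (auto intro!: continuous_intros)
    from running_sup_continuous[OF this, where Y="\<lambda>r \<omega>. ennreal (\<bar>X r \<omega>\<bar> powr p)" and \<omega>=\<omega>]
    show ?case unfolding R_def by simp
  qed
  have path': "AE \<omega> in P. \<forall>u. 0 < u \<longrightarrow> u \<le> t \<longrightarrow> R u \<omega> \<le>
      ennreal C3 * (ennreal (\<bar>\<xi> \<omega>\<bar> powr p) + (ennreal (\<kappa> powr p) + RI u \<omega>))"
    using path I0
  proof eventually_elim
    case (elim \<omega>)
    show ?case
    proof (intro allI impI)
      fix u :: real assume u: "0 < u" "u \<le> t"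
      show "R u \<omega> \<le> ennreal C3 * (ennreal (\<bar>\<xi> \<omega>\<bar> powr p) + (ennreal (\<kappa> powr p) + RI u \<omega>))"
      \<comment> \<open>If the supremum for I is finite, its p-th root can serve as J in
        \<open>path\<close>; otherwise the right side is infinite.\<close>
      proof (cases "RI u \<omega>")
        case (real S)
        define J where "J = S powr (1 / p)"
        have JS: "J powr p = S" using real p0 by (simp add: J_def powr_powr)
        have J0: "0 \<le> J" by (simp add: J_def)
        have "\<bar>I r \<omega>\<bar> \<le> J" if r: "r \<in> \<rat> \<inter> {0..<u}" for r
        proof -
          have "ennreal (\<bar>I r \<omega> - I 0 \<omega>\<bar> powr p) \<le> RI u \<omega>" unfolding RI_def by (rule SUP_upper[OF r])
          hence "\<bar>I r \<omega>\<bar> powr p \<le> J powr p" using real elim JS by (simp add: ennreal_le_iff)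
          thus ?thesis using powr_less_mono2[OF p0 J0, of "\<bar>I r \<omega>\<bar>"] by (meson not_le)
        qed
        hence X_le: "\<bar>X r \<omega>\<bar> \<le> c * (\<bar>\<xi> \<omega>\<bar> + \<kappa> + J)" if "r \<in> {0..u}" for r
          using elim(1) u J0 that by blast
        have "R u \<omega> \<le> ennreal (C3 * (\<bar>\<xi> \<omega>\<bar> powr p + \<kappa> powr p + S))"
          unfolding R_def
        proof (intro running_sup_least ennreal_leI)
          fix r assume "r \<in> \<rat>" "0 \<le> r" "r < u"
          hence "\<bar>X r \<omega>\<bar> powr p \<le> (c * (\<bar>\<xi> \<omega>\<bar> + \<kappa> + J)) powr p"
            using X_le[of r] p0 by (intro powr_mono2) auto
          also have "\<dots> = c powr p * (\<bar>\<xi> \<omega>\<bar> + \<kappa> + J) powr p"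
            using c \<kappa> J0 by (simp add: powr_mult)
          also have "\<dots> \<le> c powr p * (3 powr p * (\<bar>\<xi> \<omega>\<bar> powr p + \<kappa> powr p + J powr p))"
            using \<kappa> J0 p0 by (intro mult_left_mono powr_add3_le) auto
          also have "\<dots> = C3 * (\<bar>\<xi> \<omega>\<bar> powr p + \<kappa> powr p + S)"
            using c by (simp add: C3_def powr_mult JS)
          finally show "\<bar>X r \<omega>\<bar> powr p \<le> C3 * (\<bar>\<xi> \<omega>\<bar> powr p + \<kappa> powr p + S)" .
        qed
        also have "\<dots> = ennreal C3 * (ennreal (\<bar>\<xi> \<omega>\<bar> powr p) + (ennreal (\<kappa> powr p) + RI u \<omega>))"
          using real C3 by (simp add: ennreal_mult add.assoc)
        finally show ?thesis .
      next
        case top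
        thus ?thesis using c by (simp add: C3_def ennreal_mult_top)
      qed
    qed
  qed
  \<comment> \<open>The finite bound with which the iteration starts. It is the only place where N
    enters, and it disappears in \<open>weighted_gronwall\<close>.\<close>
  have y_fin: "y N u \<le> ennreal (N powr p)" if "0 \<le> N" for N u
  proof -
    have "y N u \<le> (\<integral>\<^sup>+\<omega>. ennreal (N powr p) \<partial>P)"
      unfolding y_def
    proof (rule nn_integral_mono)
      fix \<omega>
      show "R u \<omega> * indicator (D N u) \<omega> \<le> ennreal (N powr p)"
      proof (cases "\<omega> \<in> D N u")
        case True
        have "R u \<omega> \<le> ennreal (N powr p)"
          unfolding R_def using not_exceededD[OF True[unfolded D_def] that] p0
          by (intro running_sup_least ennreal_leI powr_mono2) auto
        thus ?thesis using True by simp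
      qed simp
    qed
    thus ?thesis by (simp add: emeasure_space_1)
  qed
  have step: "y N u \<le> ennreal ((a + \<phi> / 2) * exp (lam * u))"
    if N: "0 \<le> N" and \<phi>: "0 \<le> \<phi>" and hyp: "\<And>s. s \<in> {0<..t} \<Longrightarrow> y N s \<le> ennreal (\<phi> * exp (lam * s))" and u: "u \<in> {0<..t}"
    for N \<phi> u
  proof -
    have u0: "0 < u" "u \<le> t" using u by auto
    have DmU [measurable]: "D N u \<in> sets P" using u0 by (intro Dm) simp
    have HE: "(\<integral>\<^sup>+\<omega>. ennreal (\<bar>H s \<omega>\<bar> powr p) * indicator (D N s) \<omega> \<partial>P) \<le>
        ennreal (2 powr p) * (ennreal (\<gamma> s powr p) + ennreal (L powr p * \<phi> * exp (lam * s)))"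
      if s: "0 < s" "s \<le> u" for s
    proof -
      have [measurable]: "D N s \<in> sets P" using s by (intro Dm) simp
      have "(\<integral>\<^sup>+\<omega>. ennreal (\<bar>H s \<omega>\<bar> powr p) * indicator (D N s) \<omega> \<partial>P) \<le>
          (\<integral>\<^sup>+\<omega>. ennreal (2 powr p) * (ennreal (\<gamma> s powr p) + ennreal (L powr p) * (R s \<omega> * indicator (D N s) \<omega>)) \<partial>P)"
      proof (rule nn_integral_mono_AE)
        show "AE \<omega> in P. ennreal (\<bar>H s \<omega>\<bar> powr p) * indicator (D N s) \<omega> \<le>
           ennreal (2 powr p) * (ennreal (\<gamma> s powr p) + ennreal (L powr p) * (R s \<omega> * indicator (D N s) \<omega>))"
          using X_le_R AE_space
        proof eventually_elim
          case (elim \<omega>)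
          have "\<bar>H s \<omega>\<bar> powr p \<le> (\<gamma> s + L * \<bar>X s \<omega>\<bar>) powr p"
            using H[of s \<omega>] s u0 elim p0 by (intro powr_mono2) auto
          also have "\<dots> \<le> 2 powr p * (\<gamma> s powr p + (L * \<bar>X s \<omega>\<bar>) powr p)"
            using \<gamma>(2)[of s] L p0 by (intro powr_add_le) auto
          also have "\<dots> = 2 powr p * (\<gamma> s powr p + L powr p * \<bar>X s \<omega>\<bar> powr p)"
            using L by (simp add: powr_mult)
          finally have "ennreal (\<bar>H s \<omega>\<bar> powr p) \<le> ennreal (2 powr p * (\<gamma> s powr p + L powr p * \<bar>X s \<omega>\<bar> powr p))"
            by (rule ennreal_leI)
          also have "\<dots> = ennreal (2 powr p) * (ennreal (\<gamma> s powr p) + ennreal (L powr p) * ennreal (\<bar>X s \<omega>\<bar> powr p))"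
            by (simp add: ennreal_mult)
          also have "\<dots> \<le> ennreal (2 powr p) * (ennreal (\<gamma> s powr p) + ennreal (L powr p) * R s \<omega>)"
            using elim s by (intro mult_left_mono add_left_mono) auto
          finally show ?case by (cases "\<omega> \<in> D N s") auto
        qed
      qed
      also have "\<dots> = ennreal (2 powr p) * (ennreal (\<gamma> s powr p) + ennreal (L powr p) * y N s)"
        by (simp add: nn_integral_cmult nn_integral_add y_def emeasure_space_1)
      also have "\<dots> \<le> ennreal (2 powr p) * (ennreal (\<gamma> s powr p) + ennreal (L powr p) * ennreal (\<phi> * exp (lam * s)))"
        using s u0 by (intro mult_left_mono add_left_mono hyp) auto
      also have "ennreal (L powr p) * ennreal (\<phi> * exp (lam * s)) = ennreal (L powr p * \<phi> * exp (lam * s))"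
        using \<phi> by (simp add: ennreal_mult[symmetric] mult.assoc)
      finally show ?thesis .
    qed
    have "(\<integral>\<^sup>+s\<in>{0..u}. (\<integral>\<^sup>+\<omega>. ennreal (\<bar>H s \<omega>\<bar> powr p) * indicator (D N s) \<omega> \<partial>P) \<partial>lborel) \<le>
       (\<integral>\<^sup>+s. ennreal (2 powr p) * (ennreal (\<gamma> s powr p) * indicator {0..t} s +
          ennreal (L powr p * \<phi> * exp (lam * s)) * indicator {0..u} s) \<partial>lborel)"
    proof (rule nn_integral_mono_AE)
      show "AE s in lborel. (\<integral>\<^sup>+\<omega>. ennreal (\<bar>H s \<omega>\<bar> powr p) * indicator (D N s) \<omega> \<partial>P) * indicator {0..u} s \<le>
          ennreal (2 powr p) * (ennreal (\<gamma> s powr p) * indicator {0..t} s +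
          ennreal (L powr p * \<phi> * exp (lam * s)) * indicator {0..u} s)"
        \<comment> \<open>Time 0 is left out, because the running supremum there is over the empty
          set and bounds nothing.\<close>
        using AE_lborel_singleton[of 0]
      proof eventually_elim
        case (elim s)
        thus ?case using HE[of s] u0 by (cases "s \<in> {0..u}") (auto simp: less_le)
      qed
    qed
    also have "\<dots> = ennreal (2 powr p) * ((\<integral>\<^sup>+s\<in>{0..t}. ennreal (\<gamma> s powr p) \<partial>lborel) +
          (\<integral>\<^sup>+s\<in>{0..u}. ennreal (L powr p * \<phi> * exp (lam * s)) \<partial>lborel))"
      using \<gamma>(1) by (simp add: nn_integral_cmult nn_integral_add)
    also have "\<dots> \<le> ennreal (2 powr p) * (ennreal G + ennreal (L powr p * \<phi> * exp (lam * u) / lam))"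
      using lam u0 \<phi> by (intro mult_left_mono add_mono G(2) nn_integral_exp_le) auto
    also have "\<dots> = ennreal (2 powr p * (G + L powr p * \<phi> * exp (lam * u) / lam))"
      using G(1) \<phi> lam by (simp add: ennreal_mult)
    finally have HI: "(\<integral>\<^sup>+s\<in>{0..u}. (\<integral>\<^sup>+\<omega>. ennreal (\<bar>H s \<omega>\<bar> powr p) * indicator (D N s) \<omega> \<partial>P) \<partial>lborel) \<le>
        ennreal (2 powr p * (G + L powr p * \<phi> * exp (lam * u) / lam))" .
    have "(\<integral>\<^sup>+\<omega>. RI u \<omega> * indicator (D N u) \<omega> \<partial>P) \<le> ennreal (bdg_const p * (u - 0) powr (p / 2 - 1)) *
       (\<integral>\<^sup>+s\<in>{0..u}. (\<integral>\<^sup>+\<omega>. ennreal (\<bar>H s \<omega>\<bar> powr p) * indicator (D N s) \<omega> \<partial>P) \<partial>lborel)"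
      unfolding RI_def by (rule ito_moment[OF I DS _ _ p cnt]) (use u0 in auto)
    also have "\<dots> \<le> ennreal Cb * ennreal (2 powr p * (G + L powr p * \<phi> * exp (lam * u) / lam))"
      unfolding Cb_def using u0 t p bdg_const_nonneg[OF p]
      by (intro mult_mono HI ennreal_leI mult_left_mono powr_mono2) auto
    also have "\<dots> = ennreal (Cb * (2 powr p * (G + L powr p * \<phi> * exp (lam * u) / lam)))"
      by (rule ennreal_mult'[OF Cb, symmetric])
    finally have RI_le: "(\<integral>\<^sup>+\<omega>. RI u \<omega> * indicator (D N u) \<omega> \<partial>P) \<le>
        ennreal (Cb * (2 powr p * (G + L powr p * \<phi> * exp (lam * u) / lam)))" .
    have "y N u \<le> (\<integral>\<^sup>+\<omega>. ennreal C3 * (ennreal (\<bar>\<xi> \<omega>\<bar> powr p) + (ennreal (\<kappa> powr p) + RI u \<omega> * indicator (D N u) \<omega>)) \<partial>P)"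
      unfolding y_def
    proof (rule nn_integral_mono_AE)
      show "AE \<omega> in P. R u \<omega> * indicator (D N u) \<omega> \<le>
          ennreal C3 * (ennreal (\<bar>\<xi> \<omega>\<bar> powr p) + (ennreal (\<kappa> powr p) + RI u \<omega> * indicator (D N u) \<omega>))"
        using path'
      proof eventually_elim
        case (elim \<omega>)
        thus ?case using u0 by (cases "\<omega> \<in> D N u") auto
      qed
    qed
    also have "\<dots> = ennreal C3 * ((\<integral>\<^sup>+\<omega>. ennreal (\<bar>\<xi> \<omega>\<bar> powr p) \<partial>P) +
        (ennreal (\<kappa> powr p) + (\<integral>\<^sup>+\<omega>. RI u \<omega> * indicator (D N u) \<omega> \<partial>P)))"
      using \<xi> by (simp add: nn_integral_cmult nn_integral_add emeasure_space_1)
    also have "\<dots> \<le> ennreal C3 * (ennreal E + (ennreal (\<kappa> powr p) +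
        ennreal (Cb * (2 powr p * (G + L powr p * \<phi> * exp (lam * u) / lam)))))"
      by (intro mult_left_mono add_mono E(2) order_refl RI_le) simp
    also have "\<dots> = ennreal (C3 * (E + (\<kappa> powr p + Cb * (2 powr p * (G + L powr p * \<phi> * exp (lam * u) / lam)))))"
      using C3 E Cb G \<phi> lam by (subst ennreal_mult) (auto intro!: add_nonneg_nonneg mult_nonneg_nonneg)
    also have "\<dots> \<le> ennreal ((a + \<phi> / 2) * exp (lam * u))"
    proof (rule ennreal_leI)
      define ex where "ex = exp (lam * u)"
      have ex: "1 \<le> ex" using lam u0 by (simp add: ex_def)
      have "C3 * (E + (\<kappa> powr p + Cb * (2 powr p * (G + L powr p * \<phi> * ex / lam)))) =
         a + (C3 * Cb * 2 powr p * L powr p / lam) * (\<phi> * ex)"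
        by (simp add: a_def algebra_simps)
      also have "\<dots> \<le> a * ex + 1/2 * (\<phi> * ex)"
      proof (rule add_mono)
        show "a \<le> a * ex" using a0 ex mult_left_mono[of 1 ex a] by simp
        have "C3 * Cb * 2 powr p * L powr p / lam \<le> 1/2"
          using lam by (simp add: lam_def field_simps)
        thus "C3 * Cb * 2 powr p * L powr p / lam * (\<phi> * ex) \<le> 1/2 * (\<phi> * ex)"
          using \<phi> ex by (intro mult_right_mono) auto
      qed
      finally show "C3 * (E + (\<kappa> powr p + Cb * (2 powr p * (G + L powr p * \<phi> * exp (lam * u) / lam)))) \<le> (a + \<phi> / 2) * exp (lam * u)"
        by (simp add: ex_def algebra_simps)
    qed
    finally show ?thesis .
  qed
  have yt: "y (real N) t \<le> ennreal (2 * a * exp (lam * t))" for N :: nat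
  proof (rule weighted_gronwall[where I="{0<..t}" and \<phi>\<^sub>0="real N powr p" and w="\<lambda>u. exp (lam * u)" and a=a and t=t and y="y (real N)"])
    fix u assume u: "u \<in> {0<..t}"
    have "y (real N) u \<le> ennreal (real N powr p)" by (rule y_fin) simp
    also have "\<dots> \<le> ennreal (real N powr p * exp (lam * u))"
      using u lam mult_left_mono[of 1 "exp (lam * u)" "real N powr p"] by (intro ennreal_leI) auto
    finally show "y (real N) u \<le> ennreal (real N powr p * exp (lam * u))" .
  next
    fix \<phi> u assume "0 \<le> \<phi>" "\<And>s. s \<in> {0<..t} \<Longrightarrow> y (real N) s \<le> ennreal (\<phi> * exp (lam * s))" "u \<in> {0<..t}"
    thus "y (real N) u \<le> ennreal ((a + \<phi> / 2) * exp (lam * u))" by (intro step) auto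
  qed (use t a0 in auto)
  \<comment> \<open>Removal of N by Fatou's lemma: a continuous path is bounded on [0, t] and hence
    belongs to the event for all large N.\<close>
  have "(\<integral>\<^sup>+\<omega>. R t \<omega> \<partial>P) \<le> (\<integral>\<^sup>+\<omega>. liminf (\<lambda>N. R t \<omega> * indicator (D (real N) t) \<omega>) \<partial>P)"
  proof (rule nn_integral_mono_AE)
    show "AE \<omega> in P. R t \<omega> \<le> liminf (\<lambda>N. R t \<omega> * indicator (D (real N) t) \<omega>)"
      using X(2)[unfolded continuous_paths_def] AE_space
    proof eventually_elim
      case (elim \<omega>)
      have "compact ((\<lambda>s. X s \<omega>) ` {0..t})"
        by (intro compact_continuous_image continuous_on_subset[OF elim(1)]) auto
      then obtain b where b: "\<And>s. s \<in> {0..t} \<Longrightarrow> \<bar>X s \<omega>\<bar> \<le> b"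
        by (fastforce dest!: compact_imp_bounded simp: bounded_iff)
      obtain m where m: "b \<le> real m" using real_arch_simple by blast
      have "\<omega> \<in> D (real N) t" if "m \<le> N" for N
      proof -
        have "running_sup (\<lambda>r \<omega>. ennreal \<bar>X r \<omega>\<bar>) t \<omega> \<le> ennreal (real N)"
        proof (intro running_sup_least ennreal_leI)
          fix r assume "0 \<le> r" "r < t"
          thus "\<bar>X r \<omega>\<bar> \<le> real N" using b[of r] m that by fastforce
        qed
        thus ?thesis using elim(2) by (simp add: D_def not_exceeded_def)
      qed
      hence "\<forall>\<^sub>F N in sequentially. R t \<omega> \<le> R t \<omega> * indicator (D (real N) t) \<omega>"
        by (intro eventually_sequentiallyI[of m]) auto
      thus ?case by (rule Liminf_bounded)
    qed
  qed
  also have "\<dots> \<le> liminf (\<lambda>N. \<integral>\<^sup>+\<omega>. R t \<omega> * indicator (D (real N) t) \<omega> \<partial>P)"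
  proof (rule nn_integral_liminf)
    fix N :: nat
    have [measurable]: "D (real N) t \<in> sets P" using t by (intro Dm) simp
    show "(\<lambda>\<omega>. R t \<omega> * indicator (D (real N) t) \<omega>) \<in> borel_measurable P" by measurable
  qed
  also have "\<dots> \<le> liminf (\<lambda>N. ennreal (2 * a * exp (lam * t)))"
    unfolding y_def[symmetric] by (intro Liminf_mono always_eventually allI yt)
  also have "\<dots> = ennreal (2 * a * exp (lam * t))" by (intro lim_imp_Liminf tendsto_const) simp
  also have "\<dots> \<le> ennreal (moment_const p T c L * (E + \<kappa> powr p + G))"
  proof (rule ennreal_leI)
    have "2 * a * exp (lam * t) \<le> 2 * (C3 * ((1 + Cb * 2 powr p) * (E + \<kappa> powr p + G))) * exp (lam * T)"
    proof (intro mult_mono)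
      have "E + \<kappa> powr p + Cb * 2 powr p * G \<le> (1 + Cb * 2 powr p) * (E + \<kappa> powr p + G)"
        using Cb E G by (simp add: algebra_simps)
      thus "a \<le> C3 * ((1 + Cb * 2 powr p) * (E + \<kappa> powr p + G))"
        unfolding a_def using C3 by (intro mult_left_mono) auto
      show "exp (lam * t) \<le> exp (lam * T)" using lam t by simp
    qed (use C3 Cb E G a0 in auto)
    also have "\<dots> = moment_const p T c L * (E + \<kappa> powr p + G)"
      by (simp add: moment_const_def C3_def Cb_def lam_def mult.assoc)
    finally show "2 * a * exp (lam * t) \<le> moment_const p T c L * (E + \<kappa> powr p + G)" .
  qed
  finally show ?thesis by (simp add: R_def)
qed

end

section \<open>Flatness and the Wasserstein distance\<close>

abbreviation \<delta>\<^sub>0 :: "real measure" where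
  "\<delta>\<^sub>0 \<equiv> return borel 0"

lemma bdd_below_coupling_costs:
  "bdd_below ((\<lambda>\<pi>. \<integral>z. (fst z - snd z)\<^sup>2 \<partial>\<pi>) ` couplings \<mu> \<nu>)"
  by (rule bdd_belowI[of _ 0]) auto

lemma W2_le:
  assumes "\<pi> \<in> couplings \<mu> \<nu>"
  shows "W2 \<mu> \<nu> \<le> sqrt (\<integral>z. (fst z - snd z)\<^sup>2 \<partial>\<pi>)"
  unfolding W2_def using assms
  by (intro real_sqrt_le_mono cINF_lower bdd_below_coupling_costs)

text \<open>The coupling carried by the graph of f. The identity compares \<mu> with itself, the
  zero map compares it with the Dirac measure at 0.\<close>

lemma distr_coupling:
  assumes \<mu>: "\<mu> \<in> P2" and f: "f \<in> borel_measurable borel"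
  shows "distr \<mu> (borel \<Otimes>\<^sub>M borel) (\<lambda>x. (x, f x)) \<in> couplings \<mu> (distr \<mu> borel f)"
proof -
  interpret prob_space \<mu> using \<mu> by (simp add: P2_def)
  have s [simp, measurable_cong]: "sets \<mu> = sets borel" using \<mu> by (simp add: P2_def)
  note [measurable] = f
  have [measurable]: "(\<lambda>x. (x, f x)) \<in> measurable \<mu> (borel \<Otimes>\<^sub>M borel)" by measurable
  have "distr (distr \<mu> (borel \<Otimes>\<^sub>M borel) (\<lambda>x. (x, f x))) borel fst = \<mu>"
    by (subst distr_distr) (auto simp: comp_def distr_id2)
  moreover have "distr (distr \<mu> (borel \<Otimes>\<^sub>M borel) (\<lambda>x. (x, f x))) borel snd = distr \<mu> borel f"
    by (subst distr_distr) (auto simp: comp_def)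
  ultimately show ?thesis
    by (simp add: couplings_def prob_space_distr)
qed

lemma W2_self_le: "\<mu> \<in> P2 \<Longrightarrow> W2 \<mu> \<mu> \<le> 0"
proof -
  assume \<mu>: "\<mu> \<in> P2"
  have s [simp, measurable_cong]: "sets \<mu> = sets borel" using \<mu> by (simp add: P2_def)
  have "distr \<mu> borel (\<lambda>x. x) = \<mu>" by (rule distr_id2) simp
  with W2_le[OF distr_coupling[OF \<mu>, of "\<lambda>x. x"]]
  have "W2 \<mu> \<mu> \<le> sqrt (\<integral>z. (fst z - snd z)\<^sup>2 \<partial>distr \<mu> (borel \<Otimes>\<^sub>M borel) (\<lambda>x. (x, x)))" by simp
  also have "\<dots> = 0" by (subst integral_distr) auto
  finally show ?thesis .
qed

lemma W2_dirac_le: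
  assumes \<mu>: "\<mu> \<in> P2"
  shows "W2 \<mu> \<delta>\<^sub>0 \<le> sqrt (\<integral>x. x\<^sup>2 \<partial>\<mu>)"
proof -
  interpret prob_space \<mu> using \<mu> by (simp add: P2_def)
  have s [simp, measurable_cong]: "sets \<mu> = sets borel" using \<mu> by (simp add: P2_def)
  have "distr \<mu> borel (\<lambda>x. 0) = \<delta>\<^sub>0"
    by (rule measure_eqI)
       (auto simp: emeasure_distr emeasure_space_1 sets_eq_imp_space_eq[OF s] indicator_def
         split: if_splits)
  with W2_le[OF distr_coupling[OF \<mu>, of "\<lambda>x. 0"]]
  have "W2 \<mu> \<delta>\<^sub>0 \<le> sqrt (\<integral>z. (fst z - snd z)\<^sup>2 \<partial>distr \<mu> (borel \<Otimes>\<^sub>M borel) (\<lambda>x. (x, 0)))" by simp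
  also have "\<dots> = sqrt (\<integral>x. x\<^sup>2 \<partial>\<mu>)" by (subst integral_distr) auto
  finally show ?thesis .
qed

lemma dirac_in_P2: "\<delta>\<^sub>0 \<in> P2"
  by (auto simp: P2_def prob_space_return intro!: integrableI_bounded simp: nn_integral_return)

text \<open>The left end point of the last interval of constancy of \<open>K\<close> before \<open>t\<close> belongs to the support
  of \<open>dK\<close>, where the flatness condition forces \<open>f\<close> to vanish.\<close>

lemma flat_point:
  fixes K f :: "real \<Rightarrow> real"
  assumes mono: "mono_on {0..} K" and cont: "continuous_on {0..} K"
    and f: "continuous_on {0..} f" "\<And>u. 0 \<le> u \<Longrightarrow> 0 \<le> f u"
    and flat: "\<And>u. 0 \<le> u \<Longrightarrow> set_integrable (stieltjes_measure K) {0..u} f \<and>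
        (LINT v:{0..u}|stieltjes_measure K. f v) = 0"
    and st: "0 \<le> s" "s < t" "K s < K t"
  obtains r where "s < r" "r \<le> t" "K r = K t" "f r = 0"
proof -
  define S where "S = {s..t} \<inter> K -` {K t}"
  have "continuous_on {s..t} K" using st by (intro continuous_on_subset[OF cont]) auto
  hence "closed S" unfolding S_def by (intro continuous_closed_preimage) auto
  hence "compact ({s..t} \<inter> S)" by (intro compact_Int_closed) auto
  hence "compact S" by (simp add: S_def Int_assoc[symmetric])
  moreover have "t \<in> S" using st by (simp add: S_def)
  hence "S \<noteq> {}" by blast
  ultimately obtain r where r: "r \<in> S" "\<And>u. u \<in> S \<Longrightarrow> r \<le> u" using compact_attains_inf by metis
  have rst: "s \<le> r" "r \<le> t" "K r = K t" using r(1) by (auto simp: S_def)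
  have "s \<noteq> r" using rst st by auto
  hence sr: "s < r" using rst by simp
  have "f r = 0"
  proof (rule ccontr)
    assume "f r \<noteq> 0"
    hence fr: "0 < f r" using f(2)[of r] st rst by simp
    have "(f \<longlongrightarrow> f r) (at r within {0..})" using f(1) st rst by (simp add: continuous_on_def)
    hence "\<forall>\<^sub>F u in at r within {0..}. 0 < f u" using fr by (rule order_tendstoD)
    then obtain d where d: "0 < d" "\<And>u. 0 \<le> u \<Longrightarrow> u \<noteq> r \<Longrightarrow> dist u r < d \<Longrightarrow> 0 < f u"
      unfolding eventually_at by auto
    \<comment> \<open>So close to r that f is positive on (q, r], but not before s. Minimality of r
      then yields K q < K r, so \<open>dK\<close> charges (q, r], which contradicts the vanishing
      integral of the nonnegative f.\<close>
    define q where "q = max s (r - d / 2)"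
    have q: "s \<le> q" "q < r" "r - d / 2 \<le> q" "0 \<le> q" using d sr st by (auto simp: q_def)
    have fpos: "0 < f u" if "q < u" "u \<le> r" for u
      using d(2)[of u] fr that q d(1) by (cases "u = r") (auto simp: dist_real_def)
    let ?K = "\<lambda>u. K (max 0 u)"
    have Km: "?K u \<le> ?K v" if "u \<le> v" for u v
      using mono_onD[OF mono, of "max 0 u" "max 0 v"] that by auto
    have Kc: "continuous (at_right u) ?K" for u
    proof -
      have "continuous_on UNIV ?K"
        by (rule continuous_on_compose2[OF cont]) (auto intro!: continuous_intros)
      thus ?thesis by (simp add: continuous_on_eq_continuous_within continuous_at_imp_continuous_at_within)
    qed
    have em: "emeasure (stieltjes_measure K) {q<..r} = ennreal (K r - K q)"
      unfolding stieltjes_measure_def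
      using emeasure_interval_measure_Ioc[of q r ?K] Km Kc q by simp
    have "K q < K r"
    proof -
      have "K q \<le> K r" using mono_onD[OF mono, of q r] q by auto
      moreover have "K q \<noteq> K r"
      proof
        assume "K q = K r"
        hence "q \<in> S" using rst q by (auto simp: S_def)
        thus False using r(2)[of q] q by simp
      qed
      ultimately show ?thesis by simp
    qed
    have int: "integrable (stieltjes_measure K) (\<lambda>v. indicator {0..r} v *\<^sub>R f v)"
      and zero: "(\<integral>v. indicator {0..r} v *\<^sub>R f v \<partial>stieltjes_measure K) = 0"
      using flat[of r] st rst by (auto simp: set_integrable_def set_lebesgue_integral_def)
    have "AE v in stieltjes_measure K. indicator {0..r} v *\<^sub>R f v = 0"
      using zero by (subst (asm) integral_nonneg_eq_0_iff_AE[OF int]) (auto simp: indicator_def f(2))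
    hence "AE v in stieltjes_measure K. v \<notin> {q<..r}"
    proof eventually_elim
      case (elim v)
      show ?case
      proof
        assume v: "v \<in> {q<..r}"
        hence "indicator {0..r} v *\<^sub>R f v = f v" using q by simp
        thus False using elim fpos[of v] v by auto
      qed
    qed
    hence "emeasure (stieltjes_measure K) {q<..r} = 0"
      using AE_iff_null_sets[of "{q<..r}" "stieltjes_measure K"]
      by (auto simp: stieltjes_measure_def)
    thus False using em \<open>K q < K r\<close> by (simp add: ennreal_eq_0_iff)
  qed
  thus ?thesis using that[of r] sr rst by blast
qed

text \<open>The Cauchy-Schwarz inequality against 1, in the form of Young's inequality with q chosen
  as the bound of the L^2 norm. This avoids square roots of \<open>ennreal\<close>
  integrals.\<close>

lemma nn_integral_L1_le:
  assumes [measurable]: "f \<in> borel_measurable M" "g \<in> borel_measurable M"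
    and M: "prob_space M" and q: "0 < q"
    and fg: "AE x in M. f x \<le> ennreal (q / 2) + ennreal (1 / (2 * q)) * g x"
    and g: "(\<integral>\<^sup>+x. g x \<partial>M) \<le> ennreal (q\<^sup>2)"
  shows "(\<integral>\<^sup>+x. f x \<partial>M) \<le> ennreal q"
proof -
  interpret prob_space M by fact
  have "(\<integral>\<^sup>+x. f x \<partial>M) \<le> (\<integral>\<^sup>+x. ennreal (q / 2) + ennreal (1 / (2 * q)) * g x \<partial>M)"
    by (rule nn_integral_mono_AE[OF fg])
  also have "\<dots> = ennreal (q / 2) + ennreal (1 / (2 * q)) * (\<integral>\<^sup>+x. g x \<partial>M)"
    by (simp add: nn_integral_add nn_integral_cmult emeasure_space_1)
  also have "\<dots> \<le> ennreal (q / 2) + ennreal (1 / (2 * q)) * ennreal (q\<^sup>2)"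
    by (intro add_left_mono mult_left_mono g) simp
  also have "\<dots> = ennreal (q / 2 + 1 / (2 * q) * q\<^sup>2)"
    using q by (simp add: ennreal_mult[symmetric] del: ennreal_plus flip: ennreal_plus)
  also have "q / 2 + 1 / (2 * q) * q\<^sup>2 = q" using q by (simp add: power2_eq_square)
  finally show ?thesis .
qed

lemma abs_le_square_div:
  fixes x q :: real
  assumes "0 < q"
  shows "\<bar>x\<bar> \<le> q / 2 + 1 / (2 * q) * x\<^sup>2"
proof -
  have "2 * (q * \<bar>x\<bar>) \<le> q\<^sup>2 + x\<^sup>2" using sum_squares_bound[of q "\<bar>x\<bar>"] by (simp add: mult.assoc)
  hence "\<bar>x\<bar> \<le> (q\<^sup>2 + x\<^sup>2) / (2 * q)" using assms by (simp add: field_simps)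
  also have "\<dots> = q / 2 + 1 / (2 * q) * x\<^sup>2" using assms by (simp add: field_simps power2_eq_square)
  finally show ?thesis .
qed

text \<open>\<open>has_ito_integral\<close> does not prescribe the value at time 0. It follows
  because simple integrals vanish there and converge to \<open>I 0\<close> in probability.\<close>

lemma (in brownian_setting) ito_integral_0:
  assumes I: "has_ito_integral P F B H I"
  shows "AE \<omega> in P. I 0 \<omega> = 0"
proof -
  obtain n \<tau> \<eta> where S: "\<And>k. simple_integrand P F (n k) (\<tau> k) (\<eta> k)"
    and null': "\<And>t. 0 \<le> t \<Longrightarrow> null_in_probability P (\<lambda>k \<omega>. ennreal \<bar>simple_ito_integral B (n k) (\<tau> k) (\<eta> k) t \<omega> - I t \<omega>\<bar>)"
    using I unfolding has_ito_integral_def by blast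
  note null = null'[OF order_refl]
  have [measurable]: "I 0 \<in> borel_measurable P"
    using I by (auto simp: has_ito_integral_def adapted_def intro: measurable_F_P)
  have \<tau>0: "0 \<le> \<tau> k j" if "j \<le> n k" for k j
    using that
  proof (induction j)
    case (Suc j)
    thus ?case using S[of k] unfolding simple_integrand_def by (meson Suc_leD Suc_le_lessD order_trans)
  qed (use S[of k] in \<open>simp add: simple_integrand_def\<close>)
  have "simple_ito_integral B (n k) (\<tau> k) (\<eta> k) 0 \<omega> = 0" for k \<omega>
    unfolding simple_ito_integral_def
  proof (intro sum.neutral ballI)
    fix i assume "i \<in> {..<n k}"
    hence "0 \<le> \<tau> k i" "0 \<le> \<tau> k (Suc i)" using \<tau>0[of i k] \<tau>0[of "Suc i" k] by auto
    thus "\<eta> k i \<omega> * (B (min 0 (\<tau> k (Suc i))) \<omega> - B (min 0 (\<tau> k i)) \<omega>) = 0" by (simp add: min_absorb1)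
  qed
  with null have *: "(\<lambda>k. measure P {\<omega>\<in>space P. ennreal \<epsilon> < ennreal \<bar>I 0 \<omega>\<bar>}) \<longlonglongrightarrow> 0" if "0 < \<epsilon>" for \<epsilon>
    using that by (simp add: null_in_probability_def)
  have "AE \<omega> in P. \<bar>I 0 \<omega>\<bar> \<le> 1 / real (Suc j)" for j
  proof -
    have "measure P {\<omega>\<in>space P. ennreal (1 / real (Suc j)) < ennreal \<bar>I 0 \<omega>\<bar>} = 0"
      using LIMSEQ_unique[OF tendsto_const *[of "1 / real (Suc j)"]] by simp
    hence "AE \<omega> in P. \<not> ennreal (1 / real (Suc j)) < ennreal \<bar>I 0 \<omega>\<bar>"
      by (subst AE_iff_measurable[OF _ refl]) (auto simp: emeasure_eq_measure)
    thus ?thesis by eventually_elim (simp add: not_less ennreal_le_iff)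
  qed
  hence "AE \<omega> in P. \<forall>j. \<bar>I 0 \<omega>\<bar> \<le> 1 / real (Suc j)" by (simp add: AE_all_countable)
  thus ?thesis
  proof eventually_elim
    case (elim \<omega>)
    have "(\<lambda>j. 1 / real (Suc j)) \<longlonglongrightarrow> 0" using LIMSEQ_inverse_real_of_nat by (simp add: inverse_eq_divide)
    hence "\<bar>I 0 \<omega>\<bar> \<le> 0" by (rule LIMSEQ_le_const) (use elim in auto)
    thus ?case by simp
  qed
qed

lemma (in brownian_setting) stopping_events_space: "stopping_events P F (\<lambda>_. space P)"
  unfolding stopping_events_def
proof (intro conjI allI impI)
  show "space P \<in> sets (F t)" for t using sets.top[of "F t"] by (simp add: space_F)
  show "Measurable.pred (borel \<Otimes>\<^sub>M P) (\<lambda>(t, \<omega>). \<omega> \<in> space P)"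
    by (simp add: case_prod_beta' space_pair_measure pred_def)
  show "\<omega> \<in> space P" if "0 < t" "\<forall>s<t. \<omega> \<in> space P" for t :: real and \<omega>
    using that by (auto dest: spec[of _ 0])
qed auto

text \<open>The case of \<open>ito_moment\<close> without stopping and with a single observed
  time.\<close>

lemma (in brownian_setting) ito_increment_moment:
  assumes I: "has_ito_integral P F B H I" and s: "0 \<le> s" "s < t" and p: "2 \<le> p"
  shows "(\<integral>\<^sup>+\<omega>. ennreal (\<bar>I t \<omega> - I s \<omega>\<bar> powr p) \<partial>P) \<le>
    ennreal (bdg_const p * (t - s) powr (p / 2 - 1)) *
    (\<integral>\<^sup>+u\<in>{s..t}. (\<integral>\<^sup>+\<omega>. ennreal (\<bar>H u \<omega>\<bar> powr p) \<partial>P) \<partial>lborel)"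
proof -
  have "(\<integral>\<^sup>+\<omega>. ennreal (\<bar>I t \<omega> - I s \<omega>\<bar> powr p) \<partial>P) =
      (\<integral>\<^sup>+\<omega>. (SUP t\<in>{t}. ennreal (\<bar>I t \<omega> - I s \<omega>\<bar> powr p)) * indicator (space P) \<omega> \<partial>P)"
    by (intro nn_integral_cong) simp
  also have "\<dots> \<le> ennreal (bdg_const p * (t - s) powr (p / 2 - 1)) *
    (\<integral>\<^sup>+u\<in>{s..t}. (\<integral>\<^sup>+\<omega>. ennreal (\<bar>H u \<omega>\<bar> powr p) * indicator (space P) \<omega> \<partial>P) \<partial>lborel)"
    by (rule ito_moment[OF I stopping_events_space s p]) (use s in auto)
  also have "(\<lambda>u. \<integral>\<^sup>+\<omega>. ennreal (\<bar>H u \<omega>\<bar> powr p) * indicator (space P) \<omega> \<partial>P) =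
      (\<lambda>u. \<integral>\<^sup>+\<omega>. ennreal (\<bar>H u \<omega>\<bar> powr p) \<partial>P)"
    by (intro ext nn_integral_cong) simp
  finally show ?thesis .
qed

section \<open>The mean reflected equation\<close>

locale mckean_vlasov = brownian_setting P F B
  for P :: "'a measure" and F :: "real \<Rightarrow> 'a measure" and B :: "real \<Rightarrow> 'a \<Rightarrow> real" +
  fixes b \<sigma> :: "real \<Rightarrow> real measure \<Rightarrow> real" and h :: "real \<Rightarrow> real" and L m M :: real
  assumes L_pos: "0 < L" and lipschitz: "lipschitz_coefficients L b \<sigma>"
    and h_mono: "mono h" and m_pos: "0 < m" and m_le_M: "m \<le> M"
    and h_bilipschitz: "\<And>x y. m * \<bar>x - y\<bar> \<le> \<bar>h x - h y\<bar> \<and> \<bar>h x - h y\<bar> \<le> M * \<bar>x - y\<bar>"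
begin

definition b\<^sub>0 :: real where "b\<^sub>0 = \<bar>b 0 \<delta>\<^sub>0\<bar>"
definition s\<^sub>0 :: real where "s\<^sub>0 = \<bar>\<sigma> 0 \<delta>\<^sub>0\<bar>"

lemma b0_nonneg: "0 \<le> b\<^sub>0" and s0_nonneg: "0 \<le> s\<^sub>0"
  by (auto simp: b\<^sub>0_def s\<^sub>0_def)

lemma M_pos: "0 < M"
  using m_pos m_le_M by simp

lemma coefficients_lipschitz:
  assumes "\<mu> \<in> P2"
  shows "\<bar>b x \<mu> - b y \<mu>\<bar> \<le> L * \<bar>x - y\<bar>" "\<bar>\<sigma> x \<mu> - \<sigma> y \<mu>\<bar> \<le> L * \<bar>x - y\<bar>"
proof -
  have "\<bar>b x \<mu> - b y \<mu>\<bar> + \<bar>\<sigma> x \<mu> - \<sigma> y \<mu>\<bar> \<le> L * (\<bar>x - y\<bar> + W2 \<mu> \<mu>)"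
    using lipschitz assms by (auto simp: lipschitz_coefficients_def)
  also have "\<dots> \<le> L * (\<bar>x - y\<bar> + 0)"
    using L_pos W2_self_le[OF assms] by (intro mult_left_mono add_left_mono) auto
  finally show "\<bar>b x \<mu> - b y \<mu>\<bar> \<le> L * \<bar>x - y\<bar>" "\<bar>\<sigma> x \<mu> - \<sigma> y \<mu>\<bar> \<le> L * \<bar>x - y\<bar>" by auto
qed

lemma coefficients_growth:
  assumes "\<mu> \<in> P2"
  shows "\<bar>b x \<mu>\<bar> \<le> b\<^sub>0 + L * sqrt (\<integral>x. x\<^sup>2 \<partial>\<mu>) + L * \<bar>x\<bar>"
    "\<bar>\<sigma> x \<mu>\<bar> \<le> s\<^sub>0 + L * sqrt (\<integral>x. x\<^sup>2 \<partial>\<mu>) + L * \<bar>x\<bar>"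
proof -
  have "\<bar>b x \<mu> - b 0 \<delta>\<^sub>0\<bar> + \<bar>\<sigma> x \<mu> - \<sigma> 0 \<delta>\<^sub>0\<bar> \<le> L * (\<bar>x - 0\<bar> + W2 \<mu> \<delta>\<^sub>0)"
    using lipschitz assms dirac_in_P2 unfolding lipschitz_coefficients_def by blast
  also have "\<dots> \<le> L * (\<bar>x\<bar> + sqrt (\<integral>x. x\<^sup>2 \<partial>\<mu>))"
    using L_pos W2_dirac_le[OF assms] by (intro mult_left_mono add_mono) auto
  finally have "\<bar>b x \<mu> - b 0 \<delta>\<^sub>0\<bar> + \<bar>\<sigma> x \<mu> - \<sigma> 0 \<delta>\<^sub>0\<bar> \<le> L * sqrt (\<integral>x. x\<^sup>2 \<partial>\<mu>) + L * \<bar>x\<bar>"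
    by (simp add: algebra_simps)
  thus "\<bar>b x \<mu>\<bar> \<le> b\<^sub>0 + L * sqrt (\<integral>x. x\<^sup>2 \<partial>\<mu>) + L * \<bar>x\<bar>"
    "\<bar>\<sigma> x \<mu>\<bar> \<le> s\<^sub>0 + L * sqrt (\<integral>x. x\<^sup>2 \<partial>\<mu>) + L * \<bar>x\<bar>"
    by (auto simp: b\<^sub>0_def s\<^sub>0_def)
qed

lemma h_measurable [measurable]: "h \<in> borel_measurable borel"
  by (rule borel_measurable_mono[OF h_mono])

text \<open>The upward shift k raises h by at least m k, and the change v lowers it by at most M
  \<bar>v\<bar>. After taking means, this balance is the origin of the factor M / m.\<close>

lemma h_diff_ge:
  assumes "0 \<le> k"
  shows "h x - M * \<bar>v\<bar> + m * k \<le> h (x + v + k)"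
proof -
  have "m * k \<le> h (x + v + k) - h (x + v)"
    using h_bilipschitz[of "x + v + k" "x + v"] monoD[OF h_mono, of "x + v" "x + v + k"] assms by simp
  moreover have "\<bar>h (x + v) - h x\<bar> \<le> M * \<bar>v\<bar>"
    using h_bilipschitz[of "x + v" x] by simp
  ultimately show ?thesis by linarith
qed

end

text \<open>The stochastic integral, which is existentially quantified in
  \<open>deterministic_flat_solution\<close>, becomes the parameter I, so that all lemmas speak of
  the same version.\<close>

locale mv_solution = mckean_vlasov P F B b \<sigma> h L m M
  for P :: "'a measure" and F :: "real \<Rightarrow> 'a measure" and B :: "real \<Rightarrow> 'a \<Rightarrow> real"
    and b \<sigma> :: "real \<Rightarrow> real measure \<Rightarrow> real" and h :: "real \<Rightarrow> real" and L m M :: real +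
  fixes \<xi> :: "'a \<Rightarrow> real" and X :: "real \<Rightarrow> 'a \<Rightarrow> real" and K :: "real \<Rightarrow> real" and I :: "real \<Rightarrow> 'a \<Rightarrow> real"
  assumes initial: "admissible_initial P F h \<xi>"
    and X_adapted: "adapted F X" and X_continuous: "continuous_paths P X"
    and law_in_P2: "0 \<le> t \<Longrightarrow> law P (X t) \<in> P2"
    and K_mono: "mono_on {0..} K" and K_continuous: "continuous_on {0..} K" and K_0: "K 0 = 0"
    and drift_integrable: "AE \<omega> in P. \<forall>t\<ge>0. set_integrable lborel {0..t} (\<lambda>s. b (X s \<omega>) (law P (X s)))"
    and ito: "has_ito_integral P F B (\<lambda>s \<omega>. \<sigma> (X s \<omega>) (law P (X s))) I"
    and equation: "AE \<omega> in P. \<forall>t\<ge>0. X t \<omega> = \<xi> \<omega> + (LINT s:{0..t}|lborel. b (X s \<omega>) (law P (X s))) + I t \<omega> + K t"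
    and mean_nonneg: "0 \<le> t \<Longrightarrow> 0 \<le> (\<integral>\<omega>. h (X t \<omega>) \<partial>P)"
    and flatness: "0 \<le> t \<Longrightarrow> set_integrable (stieltjes_measure K) {0..t} (\<lambda>s. \<integral>\<omega>. h (X s \<omega>) \<partial>P) \<and>
        (LINT s:{0..t}|stieltjes_measure K. (\<integral>\<omega>. h (X s \<omega>) \<partial>P)) = 0"
begin

definition \<mu> :: "real \<Rightarrow> real measure" where "\<mu> s = law P (X s)"
definition R\<^sub>X :: "real \<Rightarrow> real \<Rightarrow> 'a \<Rightarrow> ennreal" where
  "R\<^sub>X p = running_sup (\<lambda>r \<omega>. ennreal (\<bar>X r \<omega>\<bar> powr p))"

lemma \<xi>_measurable [measurable]: "\<xi> \<in> borel_measurable P"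
  using initial measurable_F_P by (auto simp: admissible_initial_def)

lemma X_measurable [measurable]: "0 \<le> t \<Longrightarrow> X t \<in> borel_measurable P"
  by (rule adapted_measurable_P[OF X_adapted])

lemma I_measurable [measurable]: "0 \<le> t \<Longrightarrow> I t \<in> borel_measurable P"
  using ito by (auto simp: has_ito_integral_def intro: adapted_measurable_P)

lemma R_measurable [measurable]: "R\<^sub>X p t \<in> borel_measurable P"
  unfolding R\<^sub>X_def by (rule running_sup_measurable) (use X_measurable in measurable)

lemma R_joint: "(\<lambda>x. R\<^sub>X p (fst x) (snd x)) \<in> borel_measurable (borel \<Otimes>\<^sub>M P)"
  unfolding R\<^sub>X_def by (rule running_sup_joint) (use X_measurable in measurable)

lemma K_le: "0 \<le> s \<Longrightarrow> s \<le> t \<Longrightarrow> K s \<le> K t"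
  using mono_onD[OF K_mono, of s t] by auto

lemma K_nonneg: "0 \<le> t \<Longrightarrow> 0 \<le> K t"
  using K_le[of 0 t] K_0 by simp

lemma mu_in_P2: "0 \<le> s \<Longrightarrow> \<mu> s \<in> P2"
  unfolding \<mu>_def by (rule law_in_P2)

lemma X_square_integrable: "0 \<le> s \<Longrightarrow> integrable P (\<lambda>\<omega>. (X s \<omega>)\<^sup>2)"
  using law_in_P2[of s] by (simp add: P2_def law_def integrable_distr_eq)

lemma X_integrable: "0 \<le> s \<Longrightarrow> integrable P (X s)"
  using square_integrable_imp_integrable[OF X_measurable X_square_integrable] by simp

lemma h_X_integrable: "0 \<le> s \<Longrightarrow> integrable P (\<lambda>\<omega>. h (X s \<omega>))"
proof (rule Bochner_Integration.integrable_bound)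
  assume s: "0 \<le> s"
  show "integrable P (\<lambda>\<omega>. \<bar>h 0\<bar> + M * \<bar>X s \<omega>\<bar>)"
    using X_integrable[OF s] by auto
  show "(\<lambda>\<omega>. h (X s \<omega>)) \<in> borel_measurable P" using s by measurable
  show "AE \<omega> in P. norm (h (X s \<omega>)) \<le> norm (\<bar>h 0\<bar> + M * \<bar>X s \<omega>\<bar>)"
  proof (rule AE_I2)
    fix \<omega>
    have "\<bar>h (X s \<omega>) - h 0\<bar> \<le> M * \<bar>X s \<omega>\<bar>" using h_bilipschitz[of "X s \<omega>" 0] by simp
    thus "norm (h (X s \<omega>)) \<le> norm (\<bar>h 0\<bar> + M * \<bar>X s \<omega>\<bar>)" by simp
  qed
qed

lemma law_second_moment: "0 \<le> s \<Longrightarrow> (\<integral>x. x\<^sup>2 \<partial>\<mu> s) = (\<integral>\<omega>. (X s \<omega>)\<^sup>2 \<partial>P)"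
  by (simp add: \<mu>_def law_def integral_distr)

lemma sqrt_second_moment_le:
  assumes s: "0 \<le> s" and \<rho>: "0 \<le> \<rho>" and le: "(\<integral>\<^sup>+\<omega>. ennreal ((X s \<omega>)\<^sup>2) \<partial>P) \<le> ennreal (\<rho>\<^sup>2)"
  shows "sqrt (\<integral>x. x\<^sup>2 \<partial>\<mu> s) \<le> \<rho>"
proof -
  have "ennreal (\<integral>\<omega>. (X s \<omega>)\<^sup>2 \<partial>P) \<le> ennreal (\<rho>\<^sup>2)"
    using le nn_integral_eq_integral[OF X_square_integrable[OF s]] by simp
  hence "(\<integral>x. x\<^sup>2 \<partial>\<mu> s) \<le> \<rho>\<^sup>2" using law_second_moment[OF s] by (simp add: ennreal_le_iff)
  thus ?thesis using \<rho> real_le_lsqrt real_sqrt_le_iff by fastforce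
qed

lemma coefficients_bound:
  assumes s: "0 \<le> s" and \<rho>: "0 \<le> \<rho>" and le: "(\<integral>\<^sup>+\<omega>. ennreal ((X s \<omega>)\<^sup>2) \<partial>P) \<le> ennreal (\<rho>\<^sup>2)"
  shows "\<bar>b x (\<mu> s)\<bar> \<le> (b\<^sub>0 + L * \<rho>) + L * \<bar>x\<bar>" "\<bar>\<sigma> x (\<mu> s)\<bar> \<le> (s\<^sub>0 + L * \<rho>) + L * \<bar>x\<bar>"
proof -
  have "L * sqrt (\<integral>x. x\<^sup>2 \<partial>\<mu> s) \<le> L * \<rho>"
    using L_pos by (intro mult_left_mono sqrt_second_moment_le[OF assms]) simp
  thus "\<bar>b x (\<mu> s)\<bar> \<le> (b\<^sub>0 + L * \<rho>) + L * \<bar>x\<bar>" "\<bar>\<sigma> x (\<mu> s)\<bar> \<le> (s\<^sub>0 + L * \<rho>) + L * \<bar>x\<bar>"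
    using coefficients_growth[OF mu_in_P2[OF s], of x] by linarith+
qed

text \<open>The quantifiers stand inside the null set, because the bound is used under integrals
  over time.\<close>

lemma X_le_R: "AE \<omega> in P. \<forall>s t p. 0 < p \<longrightarrow> 0 \<le> s \<longrightarrow> s \<le> t \<longrightarrow> 0 < t \<longrightarrow> ennreal (\<bar>X s \<omega>\<bar> powr p) \<le> R\<^sub>X p t \<omega>"
  using X_continuous[unfolded continuous_paths_def]
proof eventually_elim
  case (elim \<omega>)
  show ?case
  proof (intro allI impI)
    fix s t p :: real assume *: "0 < p" "0 \<le> s" "s \<le> t" "0 < t"
    have "continuous_on {0..} (\<lambda>s. \<bar>X s \<omega>\<bar> powr p)"
      using elim * by (intro continuous_on_powr') (auto intro!: continuous_intros)
    from running_sup_continuous[OF this *(2,3,4), where Y="\<lambda>r \<omega>. ennreal (\<bar>X r \<omega>\<bar> powr p)" and \<omega>=\<omega>]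
    show "ennreal (\<bar>X s \<omega>\<bar> powr p) \<le> R\<^sub>X p t \<omega>" by (simp add: R\<^sub>X_def)
  qed
qed

lemma X_moment_le_R: 
  assumes "0 < p" "0 \<le> s" "s \<le> t" "0 < t"
  shows "(\<integral>\<^sup>+\<omega>. ennreal (\<bar>X s \<omega>\<bar> powr p) \<partial>P) \<le> (\<integral>\<^sup>+\<omega>. R\<^sub>X p t \<omega> \<partial>P)"
  using X_le_R by (intro nn_integral_mono_AE) (use assms in \<open>auto elim!: eventually_mono\<close>)

lemma X_second_moment_le_R: 
  assumes "0 \<le> s" "s \<le> t" "0 < t"
  shows "(\<integral>\<^sup>+\<omega>. ennreal ((X s \<omega>)\<^sup>2) \<partial>P) \<le> (\<integral>\<^sup>+\<omega>. R\<^sub>X 2 t \<omega> \<partial>P)"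
  using X_moment_le_R[OF _ assms, of 2] by simp

text \<open>Supplies the hypothesis \<open>path\<close> of \<open>moment_bound\<close>. On a fixed
  path K is at most K t and I at most J, first at rational times and then, by continuity, at all
  times; \<open>pathwise_gronwall\<close> removes the drift.\<close>

lemma path_bound:
  assumes t: "0 < t" "t \<le> T" and \<beta>: "\<beta> \<in> borel_measurable borel" "(\<integral>\<^sup>+u\<in>{0..t}. ennreal (\<beta> u) \<partial>lborel) \<le> ennreal \<kappa>"
    and \<kappa>: "0 \<le> \<kappa>" and b_le: "\<And>s x. 0 \<le> s \<Longrightarrow> s \<le> t \<Longrightarrow> \<bar>b x (\<mu> s)\<bar> \<le> \<beta> s + L * \<bar>x\<bar>"
  shows "AE \<omega> in P. \<forall>s J. 0 < s \<longrightarrow> s \<le> t \<longrightarrow> 0 \<le> J \<longrightarrow> (\<forall>r\<in>\<rat> \<inter> {0..<s}. \<bar>I r \<omega>\<bar> \<le> J) \<longrightarrow>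
        (\<forall>r\<in>{0..s}. \<bar>X r \<omega>\<bar> \<le> 2 * exp (2 * L * T) * (\<bar>\<xi> \<omega>\<bar> + (K t + \<kappa>) + J))"
proof -
  have "AE \<omega> in P. continuous_on {0..} (\<lambda>t. I t \<omega>)"
    using ito by (simp add: has_ito_integral_def continuous_paths_def)
  with X_continuous[unfolded continuous_paths_def] equation show ?thesis
  proof eventually_elim
    case (elim \<omega>)
    show ?case
    proof (intro allI impI ballI)
      fix s J r assume s: "0 < s" "s \<le> t" and J: "0 \<le> J" "\<forall>r\<in>\<rat> \<inter> {0..<s}. \<bar>I r \<omega>\<bar> \<le> J" and r: "r \<in> {0..s}"
      have I_le: "\<bar>I u \<omega>\<bar> \<le> J" if u: "0 \<le> u" "u \<le> s" for u
      proof -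
        have "continuous_on {0..} (\<lambda>u. \<bar>I u \<omega>\<bar>)" using elim by (intro continuous_intros)
        from running_sup_continuous[OF this u s(1), where Y="\<lambda>r \<omega>. ennreal \<bar>I r \<omega>\<bar>" and \<omega>=\<omega>]
        have "ennreal \<bar>I u \<omega>\<bar> \<le> running_sup (\<lambda>r \<omega>. ennreal \<bar>I r \<omega>\<bar>) s \<omega>" by simp
        also have "\<dots> \<le> ennreal J"
          using J(2) by (intro running_sup_least ennreal_leI) auto
        finally show ?thesis using J by (simp add: ennreal_le_iff)
      qed
      have K0: "0 \<le> K t" using t by (intro K_nonneg) simp
      have "\<bar>X r \<omega>\<bar> \<le> 2 * exp (2 * L * s) * ((\<bar>\<xi> \<omega>\<bar> + K t + J) + \<kappa>)"
      proof (rule pathwise_gronwall[where f="\<lambda>u. X u \<omega>" and g="\<lambda>u. b (X u \<omega>) (\<mu> u)" and \<beta>=\<beta>])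
        have "(\<integral>\<^sup>+u\<in>{0..s}. ennreal (\<beta> u) \<partial>lborel) \<le> (\<integral>\<^sup>+u\<in>{0..t}. ennreal (\<beta> u) \<partial>lborel)"
          using s by (intro nn_integral_mono) (auto simp: indicator_def)
        thus "(\<integral>\<^sup>+u\<in>{0..s}. ennreal (\<beta> u) \<partial>lborel) \<le> ennreal \<kappa>" using \<beta>(2) by (rule order_trans)
        fix u assume u: "0 \<le> u" "u \<le> s"
        show "\<bar>b (X u \<omega>) (\<mu> u)\<bar> \<le> \<beta> u + L * \<bar>X u \<omega>\<bar>" using b_le u s by simp
        have "X u \<omega> = \<xi> \<omega> + (LINT s:{0..u}|lborel. b (X s \<omega>) (\<mu> s)) + I u \<omega> + K u"
          using elim u by (simp add: \<mu>_def)
        moreover have "0 \<le> K u" "K u \<le> K t" using K_nonneg K_le u s by auto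
        ultimately show "\<bar>X u \<omega>\<bar> \<le> \<bar>\<xi> \<omega>\<bar> + K t + J + \<bar>LINT u:{0..u}|lborel. b (X u \<omega>) (\<mu> u)\<bar>"
          using I_le[OF u] by linarith
      qed (use elim s J K0 \<kappa> L_pos \<beta> r in auto)
      also have "\<dots> \<le> 2 * exp (2 * L * T) * ((\<bar>\<xi> \<omega>\<bar> + K t + J) + \<kappa>)"
        using L_pos s t J K0 \<kappa> by (intro mult_right_mono mult_left_mono) auto
      finally show "\<bar>X r \<omega>\<bar> \<le> 2 * exp (2 * L * T) * (\<bar>\<xi> \<omega>\<bar> + (K t + \<kappa>) + J)" by (simp add: algebra_simps)
    qed
  qed
qed

lemma finite_set_nn_integral_continuous:
  fixes f :: "real \<Rightarrow> real"
  assumes f: "continuous_on {0..} f" and f0: "\<And>u. 0 \<le> f u"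
  shows "(\<integral>\<^sup>+u\<in>{0..T}. ennreal (f u) \<partial>lborel) < \<infinity>"
proof -
  have "compact (f ` {0..T})"
    by (intro compact_continuous_image continuous_on_subset[OF f]) auto
  then obtain c where c: "\<And>u. u \<in> {0..T} \<Longrightarrow> \<bar>f u\<bar> \<le> c"
    by (fastforce dest!: compact_imp_bounded simp: bounded_iff)
  have "(\<integral>\<^sup>+u\<in>{0..T}. ennreal (f u) \<partial>lborel) \<le> (\<integral>\<^sup>+u. ennreal c * indicator {0..T} u \<partial>lborel)"
    using c f0 by (intro nn_integral_mono) (auto simp: indicator_def intro!: ennreal_leI)
  also have "\<dots> < \<infinity>"
    by (cases "0 \<le> T") (simp_all add: nn_integral_cmult_indicator ennreal_mult_less_top)
  finally show ?thesis .
qed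

text \<open>The law of \<open>X s\<close> enters the coefficients in an uncontrolled way. It is eliminated by
  comparing with the coefficients along one fixed path \<open>\<omega>\<^sub>0\<close>, which are integrable in time.\<close>

lemma apriori_second_moment:
  assumes T: "0 < T"
  shows "(\<integral>\<^sup>+\<omega>. R\<^sub>X 2 T \<omega> \<partial>P) < \<infinity>"
proof -
  let ?H = "\<lambda>s \<omega>. \<sigma> (X s \<omega>) (\<mu> s)"
  have prog: "progressively_measurable F ?H"
    and Hfin: "AE \<omega> in P. (\<integral>\<^sup>+s\<in>{0..T}. ennreal ((?H s \<omega>)\<^sup>2) \<partial>lborel) < \<infinity>"
    using ito T by (auto simp: has_ito_integral_def \<mu>_def)
  have "AE \<omega> in P. \<omega> \<in> space P \<and> continuous_on {0..} (\<lambda>t. X t \<omega>) \<and>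
      set_integrable lborel {0..T} (\<lambda>s. b (X s \<omega>) (\<mu> s)) \<and> (\<integral>\<^sup>+s\<in>{0..T}. ennreal ((?H s \<omega>)\<^sup>2) \<partial>lborel) < \<infinity>"
    using AE_space X_continuous[unfolded continuous_paths_def] drift_integrable Hfin
    by eventually_elim (use T in \<open>auto simp: \<mu>_def\<close>)
  \<comment> \<open>An almost sure property holds for at least one \<omega>; this provides the fixed
    path.\<close>
  from eventually_happens'[OF ae_filter_bot this] obtain \<omega>0 where \<omega>0: "\<omega>0 \<in> space P"
    and c0: "continuous_on {0..} (\<lambda>t. X t \<omega>0)"
    and b0: "set_integrable lborel {0..T} (\<lambda>s. b (X s \<omega>0) (\<mu> s))"
    and s0: "(\<integral>\<^sup>+s\<in>{0..T}. ennreal ((?H s \<omega>0)\<^sup>2) \<partial>lborel) < \<infinity>" by blast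
  define x where "x u = indicator {0..} u * \<bar>X u \<omega>0\<bar>" for u
  have xm [measurable]: "x \<in> borel_measurable borel"
    using borel_measurable_continuous_on_indicator[of "{0..}" "\<lambda>u. \<bar>X u \<omega>0\<bar>"] c0
    by (simp add: x_def[abs_def] continuous_on_rabs)
  define \<beta> where "\<beta> s = \<bar>indicator {0..T} s * b (X s \<omega>0) (\<mu> s)\<bar> + L * x s" for s
  have bm [measurable]: "(\<lambda>s. indicator {0..T} s * b (X s \<omega>0) (\<mu> s)) \<in> borel_measurable borel"
    using b0 by (auto simp: set_integrable_def dest: borel_measurable_integrable)
  have \<beta>m [measurable]: "\<beta> \<in> borel_measurable borel" unfolding \<beta>_def[abs_def] by measurable
  define Hc where "Hc s = ?H (max 0 (min T s))" for s
  have "(\<lambda>x. Hc (fst x) (snd x)) \<in> borel_measurable (borel \<Otimes>\<^sub>M P)"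
    unfolding Hc_def using progressively_measurable_joint[OF prog, of T] T by simp
  from measurable_compose[OF measurable_Pair2'[OF \<omega>0, of borel] this]
  have [measurable]: "(\<lambda>s. Hc s \<omega>0) \<in> borel_measurable borel" by simp
  define \<gamma> where "\<gamma> s = \<bar>Hc s \<omega>0\<bar> + L * x s" for s
  have \<gamma>m [measurable]: "\<gamma> \<in> borel_measurable borel" unfolding \<gamma>_def[abs_def] by measurable
  have xfin: "(\<integral>\<^sup>+u\<in>{0..T}. ennreal (x u) \<partial>lborel) < \<infinity>" "(\<integral>\<^sup>+u\<in>{0..T}. ennreal ((x u)\<^sup>2) \<partial>lborel) < \<infinity>"
  proof -
    have 1: "(\<integral>\<^sup>+u\<in>{0..T}. ennreal \<bar>X u \<omega>0\<bar> \<partial>lborel) < \<infinity>"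
      by (rule finite_set_nn_integral_continuous) (use c0 in \<open>auto intro!: continuous_intros\<close>)
    have 2: "(\<integral>\<^sup>+u\<in>{0..T}. ennreal ((X u \<omega>0)\<^sup>2) \<partial>lborel) < \<infinity>"
      by (rule finite_set_nn_integral_continuous) (use c0 in \<open>auto intro!: continuous_intros\<close>)
    have "(\<integral>\<^sup>+u\<in>{0..T}. ennreal (x u) \<partial>lborel) = (\<integral>\<^sup>+u\<in>{0..T}. ennreal \<bar>X u \<omega>0\<bar> \<partial>lborel)"
      "(\<integral>\<^sup>+u\<in>{0..T}. ennreal ((x u)\<^sup>2) \<partial>lborel) = (\<integral>\<^sup>+u\<in>{0..T}. ennreal ((X u \<omega>0)\<^sup>2) \<partial>lborel)"
      by (auto intro!: nn_integral_cong simp: x_def indicator_def)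
    thus "(\<integral>\<^sup>+u\<in>{0..T}. ennreal (x u) \<partial>lborel) < \<infinity>" "(\<integral>\<^sup>+u\<in>{0..T}. ennreal ((x u)\<^sup>2) \<partial>lborel) < \<infinity>"
      using 1 2 by simp_all
  qed
  have x0: "0 \<le> x u" for u by (simp add: x_def)
  have "(\<integral>\<^sup>+u\<in>{0..T}. ennreal (\<beta> u) \<partial>lborel) =
     (\<integral>\<^sup>+u. ennreal \<bar>indicator {0..T} u * b (X u \<omega>0) (\<mu> u)\<bar> + ennreal L * (ennreal (x u) * indicator {0..T} u) \<partial>lborel)"
    using L_pos x0 by (intro nn_integral_cong) (auto simp: \<beta>_def indicator_def ennreal_mult)
  also have "\<dots> = (\<integral>\<^sup>+u. ennreal \<bar>indicator {0..T} u * b (X u \<omega>0) (\<mu> u)\<bar> \<partial>lborel) + ennreal L * (\<integral>\<^sup>+u\<in>{0..T}. ennreal (x u) \<partial>lborel)"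
    by (simp add: nn_integral_add nn_integral_cmult)
  also have "\<dots> < \<infinity>"
    using b0 xfin by (auto simp: set_integrable_def integrable_iff_bounded ennreal_mult_less_top)
  finally obtain \<kappa> where \<kappa>: "0 \<le> \<kappa>" "(\<integral>\<^sup>+u\<in>{0..T}. ennreal (\<beta> u) \<partial>lborel) = ennreal \<kappa>"
    by (cases "(\<integral>\<^sup>+u\<in>{0..T}. ennreal (\<beta> u) \<partial>lborel)") auto
  have "(\<integral>\<^sup>+u\<in>{0..T}. ennreal (\<gamma> u powr 2) \<partial>lborel) \<le>
     (\<integral>\<^sup>+u. 2 * (ennreal ((Hc u \<omega>0)\<^sup>2) * indicator {0..T} u) + ennreal (2 * L\<^sup>2) * (ennreal ((x u)\<^sup>2) * indicator {0..T} u) \<partial>lborel)"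
  proof (rule nn_integral_mono)
    fix u
    have "\<gamma> u powr 2 = (\<bar>Hc u \<omega>0\<bar> + L * x u)\<^sup>2" using L_pos x0 by (simp add: \<gamma>_def)
    also have "\<dots> \<le> 2 * (Hc u \<omega>0)\<^sup>2 + 2 * L\<^sup>2 * (x u)\<^sup>2"
      using sum_squares_bound[of "\<bar>Hc u \<omega>0\<bar>" "L * x u"] by (simp add: power2_sum power_mult_distrib)
    finally have "ennreal (\<gamma> u powr 2) \<le> ennreal (2 * (Hc u \<omega>0)\<^sup>2 + 2 * L\<^sup>2 * (x u)\<^sup>2)" by (rule ennreal_leI)
    also have "\<dots> = 2 * ennreal ((Hc u \<omega>0)\<^sup>2) + ennreal (2 * L\<^sup>2) * ennreal ((x u)\<^sup>2)"
      by (simp add: ennreal_mult)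
    finally show "ennreal (\<gamma> u powr 2) * indicator {0..T} u \<le>
       2 * (ennreal ((Hc u \<omega>0)\<^sup>2) * indicator {0..T} u) + ennreal (2 * L\<^sup>2) * (ennreal ((x u)\<^sup>2) * indicator {0..T} u)"
      by (auto simp: indicator_def)
  qed
  also have "\<dots> = 2 * (\<integral>\<^sup>+u\<in>{0..T}. ennreal ((Hc u \<omega>0)\<^sup>2) \<partial>lborel) + ennreal (2 * L\<^sup>2) * (\<integral>\<^sup>+u\<in>{0..T}. ennreal ((x u)\<^sup>2) \<partial>lborel)"
    by (simp add: nn_integral_add nn_integral_cmult)
  also have "(\<integral>\<^sup>+u\<in>{0..T}. ennreal ((Hc u \<omega>0)\<^sup>2) \<partial>lborel) = (\<integral>\<^sup>+s\<in>{0..T}. ennreal ((?H s \<omega>0)\<^sup>2) \<partial>lborel)"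
    by (intro nn_integral_cong) (auto simp: Hc_def indicator_def)
  also have "2 * (\<integral>\<^sup>+s\<in>{0..T}. ennreal ((?H s \<omega>0)\<^sup>2) \<partial>lborel) + ennreal (2 * L\<^sup>2) * (\<integral>\<^sup>+u\<in>{0..T}. ennreal ((x u)\<^sup>2) \<partial>lborel) < \<infinity>"
    using s0 xfin by (auto simp: ennreal_mult_less_top)
  finally obtain G where G: "0 \<le> G" "(\<integral>\<^sup>+u\<in>{0..T}. ennreal (\<gamma> u powr 2) \<partial>lborel) = ennreal G"
    by (cases "(\<integral>\<^sup>+u\<in>{0..T}. ennreal (\<gamma> u powr 2) \<partial>lborel)") auto
  have i\<xi>: "integrable P (\<lambda>\<omega>. (\<xi> \<omega>)\<^sup>2)" using initial by (simp add: admissible_initial_def)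
  have E: "(\<integral>\<^sup>+\<omega>. ennreal (\<bar>\<xi> \<omega>\<bar> powr 2) \<partial>P) = ennreal (\<integral>\<omega>. (\<xi> \<omega>)\<^sup>2 \<partial>P)"
    using nn_integral_eq_integral[OF i\<xi>] by simp
  have K0: "0 \<le> K T" using T by (intro K_nonneg) simp
  have "(\<integral>\<^sup>+\<omega>. R\<^sub>X 2 T \<omega> \<partial>P) \<le>
     ennreal (moment_const 2 T (2 * exp (2 * L * T)) L * ((\<integral>\<omega>. (\<xi> \<omega>)\<^sup>2 \<partial>P) + (K T + \<kappa>) powr 2 + G))"
    unfolding R\<^sub>X_def
  proof (rule moment_bound[OF X_adapted X_continuous \<xi>_measurable ito ito_integral_0[OF ito], where \<gamma>=\<gamma>])
    show "AE \<omega> in P. \<forall>s J. 0 < s \<longrightarrow> s \<le> T \<longrightarrow> 0 \<le> J \<longrightarrow> (\<forall>r\<in>\<rat> \<inter> {0..<s}. \<bar>I r \<omega>\<bar> \<le> J) \<longrightarrow>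
        (\<forall>r\<in>{0..s}. \<bar>X r \<omega>\<bar> \<le> 2 * exp (2 * L * T) * (\<bar>\<xi> \<omega>\<bar> + (K T + \<kappa>) + J))"
    proof (rule path_bound[OF T order_refl \<beta>m])
      \<comment> \<open>Both coefficients are taken at the same law, so the Wasserstein term of the
        Lipschitz condition drops out and only spatial distances remain.\<close>
      fix s y assume s: "0 \<le> s" "s \<le> T"
      have "\<bar>b y (\<mu> s) - b (X s \<omega>0) (\<mu> s)\<bar> \<le> L * \<bar>y - X s \<omega>0\<bar>"
        by (rule coefficients_lipschitz(1)[OF mu_in_P2[OF s(1)]])
      also have "\<dots> \<le> L * (\<bar>y\<bar> + \<bar>X s \<omega>0\<bar>)" using L_pos by (intro mult_left_mono) auto
      finally show "\<bar>b y (\<mu> s)\<bar> \<le> \<beta> s + L * \<bar>y\<bar>"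
        using s by (simp add: \<beta>_def x_def algebra_simps)
    qed (use \<kappa> in auto)
    fix s \<omega> assume s: "0 \<le> s" "s \<le> T"
    have "\<bar>\<sigma> (X s \<omega>) (\<mu> s) - \<sigma> (X s \<omega>0) (\<mu> s)\<bar> \<le> L * \<bar>X s \<omega> - X s \<omega>0\<bar>"
      by (rule coefficients_lipschitz(2)[OF mu_in_P2[OF s(1)]])
    also have "\<dots> \<le> L * (\<bar>X s \<omega>\<bar> + \<bar>X s \<omega>0\<bar>)" using L_pos by (intro mult_left_mono) auto
    finally show "\<bar>\<sigma> (X s \<omega>) (law P (X s))\<bar> \<le> \<gamma> s + L * \<bar>X s \<omega>\<bar>"
      using s by (simp add: \<gamma>_def Hc_def x_def \<mu>_def algebra_simps)
  qed (use T L_pos K0 \<kappa> G E x0 in \<open>auto simp: \<gamma>_def\<close>)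
  also have "\<dots> < \<infinity>" by simp
  finally show ?thesis .
qed

end

section \<open>Increments of the reflection term\<close>

lemma square_add_le:
  fixes x y :: real
  shows "(x + y)\<^sup>2 \<le> 2 * x\<^sup>2 + 2 * y\<^sup>2"
  using sum_squares_bound[of x y] by (simp add: power2_sum)

context mv_solution
begin

text \<open>Dominated convergence: h grows linearly, \<bar>x\<bar> is at most 1 + x^2, and
  \<open>apriori_second_moment\<close> makes the running supremum of X^2 integrable. Continuity
  allows flatness, an integrated condition, to be used at a single time.\<close>

lemma mean_h_continuous: "continuous_on {0..} (\<lambda>u. \<integral>\<omega>. h (X u \<omega>) \<partial>P)"
proof (rule continuous_on_sequentiallyI)
  fix u :: "nat \<Rightarrow> real" and v assume u: "\<forall>n. u n \<in> {0..}" and v: "v \<in> {0..}" and lim: "u \<longlonglongrightarrow> v"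
  have "Bseq u" using lim by (intro convergent_imp_Bseq convergentI)
  then obtain T where T: "0 < T" "\<And>n. norm (u n) \<le> T" by (auto elim: BseqE)
  have uT: "0 \<le> u n" "u n \<le> T" for n using u T(2)[of n] by auto
  have fin: "(\<integral>\<^sup>+\<omega>. R\<^sub>X 2 T \<omega> \<partial>P) < \<infinity>" by (rule apriori_second_moment[OF T(1)])
  hence RAE: "AE \<omega> in P. R\<^sub>X 2 T \<omega> \<noteq> \<infinity>" by (intro nn_integral_PInf_AE) auto
  define w where "w \<omega> = \<bar>h 0\<bar> + M * (1 + enn2real (R\<^sub>X 2 T \<omega>))" for \<omega>
  have iR: "integrable P (\<lambda>\<omega>. enn2real (R\<^sub>X 2 T \<omega>))"
  proof (rule integrableI_bounded)
    have "(\<integral>\<^sup>+\<omega>. ennreal (norm (enn2real (R\<^sub>X 2 T \<omega>))) \<partial>P) \<le> (\<integral>\<^sup>+\<omega>. R\<^sub>X 2 T \<omega> \<partial>P)"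
      by (intro nn_integral_mono) (simp add: ennreal_enn2real_if)
    thus "(\<integral>\<^sup>+\<omega>. ennreal (norm (enn2real (R\<^sub>X 2 T \<omega>))) \<partial>P) < \<infinity>" using fin by (rule le_less_trans)
  qed simp
  show "(\<lambda>n. \<integral>\<omega>. h (X (u n) \<omega>) \<partial>P) \<longlonglongrightarrow> (\<integral>\<omega>. h (X v \<omega>) \<partial>P)"
  proof (rule integral_dominated_convergence[where w=w])
    show "integrable P w" unfolding w_def[abs_def] using iR by simp
    show "(\<lambda>\<omega>. h (X v \<omega>)) \<in> borel_measurable P"
      using v by (intro measurable_compose[OF X_measurable h_measurable]) simp
    show "(\<lambda>\<omega>. h (X (u n) \<omega>)) \<in> borel_measurable P" for n
      by (rule measurable_compose[OF X_measurable[OF uT(1)] h_measurable])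
    show "AE \<omega> in P. (\<lambda>n. h (X (u n) \<omega>)) \<longlonglongrightarrow> h (X v \<omega>)"
      using X_continuous[unfolded continuous_paths_def]
    proof eventually_elim
      case (elim \<omega>)
      have X_lim: "(\<lambda>n. X (u n) \<omega>) \<longlonglongrightarrow> X v \<omega>"
        by (rule continuous_on_tendsto_compose[OF elim lim v]) (use u in auto)
      have "(\<lambda>n. M * \<bar>X (u n) \<omega> - X v \<omega>\<bar>) \<longlonglongrightarrow> M * \<bar>X v \<omega> - X v \<omega>\<bar>"
        by (intro tendsto_intros X_lim)
      hence "(\<lambda>n. M * \<bar>X (u n) \<omega> - X v \<omega>\<bar>) \<longlonglongrightarrow> 0" by simp
      hence "(\<lambda>n. h (X (u n) \<omega>) - h (X v \<omega>)) \<longlonglongrightarrow> 0"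
        by (rule Lim_null_comparison[rotated]) (use h_bilipschitz in auto)
      thus ?case by (simp add: LIM_zero_iff)
    qed
    show "AE \<omega> in P. norm (h (X (u n) \<omega>)) \<le> w \<omega>" for n
      using X_le_R RAE
    proof eventually_elim
      case (elim \<omega>)
      have "ennreal (\<bar>X (u n) \<omega>\<bar> powr 2) \<le> R\<^sub>X 2 T \<omega>"
        by (rule elim(1)[rule_format]) (use uT T(1) in auto)
      hence "(X (u n) \<omega>)\<^sup>2 \<le> enn2real (R\<^sub>X 2 T \<omega>)"
        using elim(2) by (cases "R\<^sub>X 2 T \<omega>") (auto simp: ennreal_le_iff)
      moreover have "\<bar>X (u n) \<omega>\<bar> \<le> 1 + (X (u n) \<omega>)\<^sup>2"
        using abs_le_square_div[of 1 "X (u n) \<omega>"] by simp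
      ultimately have "M * \<bar>X (u n) \<omega>\<bar> \<le> M * (1 + enn2real (R\<^sub>X 2 T \<omega>))"
        using M_pos by (intro mult_left_mono) auto
      moreover have "\<bar>h (X (u n) \<omega>) - h 0\<bar> \<le> M * \<bar>X (u n) \<omega>\<bar>" using h_bilipschitz[of "X (u n) \<omega>" 0] by simp
      ultimately show ?case unfolding w_def by simp
    qed
  qed
qed

text \<open>The hypothesis ranges over all r in (s, t], because \<open>flat_point\<close> does not
  tell where in this interval its point lies.\<close>

lemma K_increment:
  assumes st: "0 \<le> s" "s \<le> t" and c: "0 \<le> c"
    and le: "\<And>r. s < r \<Longrightarrow> r \<le> t \<Longrightarrow> (\<integral>\<^sup>+\<omega>. ennreal \<bar>X r \<omega> - X s \<omega> - (K r - K s)\<bar> \<partial>P) \<le> ennreal c"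
  shows "K t - K s \<le> M / m * c"
proof (cases "K s < K t")
  case True
  hence "s < t" using st by (cases "s = t") auto
  obtain r where r: "s < r" "r \<le> t" "K r = K t" "(\<integral>\<omega>. h (X r \<omega>) \<partial>P) = 0"
    by (rule flat_point[OF K_mono K_continuous mean_h_continuous mean_nonneg flatness st(1) \<open>s < t\<close> True])
  have r0: "0 \<le> r" using st r by simp
  define V where "V \<omega> = X r \<omega> - X s \<omega> - (K r - K s)" for \<omega>
  have iV: "integrable P V"
    unfolding V_def[abs_def] using X_integrable[OF r0] X_integrable[OF st(1)] by auto
  have "ennreal (\<integral>\<omega>. \<bar>V \<omega>\<bar> \<partial>P) \<le> ennreal c"
    using le[OF r(1,2)] nn_integral_eq_integral[OF integrable_abs[OF iV]] by (simp add: V_def)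
  hence EV: "(\<integral>\<omega>. \<bar>V \<omega>\<bar> \<partial>P) \<le> c" using c by (simp add: ennreal_le_iff)
  have "(\<integral>\<omega>. h (X s \<omega>) - M * \<bar>V \<omega>\<bar> + m * (K r - K s) \<partial>P) \<le> (\<integral>\<omega>. h (X r \<omega>) \<partial>P)"
  proof (rule integral_mono)
    show "integrable P (\<lambda>\<omega>. h (X s \<omega>) - M * \<bar>V \<omega>\<bar> + m * (K r - K s))"
      using h_X_integrable[OF st(1)] iV by simp
    fix \<omega>
    have "0 \<le> K r - K s" using K_le[of s r] st r by simp
    from h_diff_ge[OF this, of "X s \<omega>" "V \<omega>"]
    show "h (X s \<omega>) - M * \<bar>V \<omega>\<bar> + m * (K r - K s) \<le> h (X r \<omega>)" by (simp add: V_def)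
  qed (rule h_X_integrable[OF r0])
  also have "(\<integral>\<omega>. h (X s \<omega>) - M * \<bar>V \<omega>\<bar> + m * (K r - K s) \<partial>P) =
      (\<integral>\<omega>. h (X s \<omega>) \<partial>P) - M * (\<integral>\<omega>. \<bar>V \<omega>\<bar> \<partial>P) + m * (K r - K s)"
    using h_X_integrable[OF st(1)] iV by (simp add: prob_space)
  finally have "m * (K t - K s) \<le> M * (\<integral>\<omega>. \<bar>V \<omega>\<bar> \<partial>P)"
    using mean_nonneg[OF st(1)] r by simp
  also have "\<dots> \<le> M * c" using EV M_pos by (intro mult_left_mono) auto
  finally show ?thesis using m_pos by (simp add: field_simps)
next
  case False
  have "0 \<le> M / m * c" using M_pos m_pos c by simp
  thus ?thesis using False by linarith
qed

lemma drift_difference: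
  "AE \<omega> in P. \<forall>s r. 0 \<le> s \<longrightarrow> s \<le> r \<longrightarrow>
     X r \<omega> - X s \<omega> - (K r - K s) = (LINT u:{s<..r}|lborel. b (X u \<omega>) (\<mu> u)) + (I r \<omega> - I s \<omega>) \<and>
     ennreal \<bar>LINT u:{s<..r}|lborel. b (X u \<omega>) (\<mu> u)\<bar> \<le> (\<integral>\<^sup>+u\<in>{s<..r}. ennreal \<bar>b (X u \<omega>) (\<mu> u)\<bar> \<partial>lborel)"
  using equation drift_integrable
proof eventually_elim
  case (elim \<omega>)
  show ?case
  proof (intro allI impI)
    fix s r :: real assume sr: "0 \<le> s" "s \<le> r"
    let ?b = "\<lambda>u. b (X u \<omega>) (\<mu> u)"
    have ir: "set_integrable lborel {0..r} ?b" using elim(2) sr by (simp add: \<mu>_def)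
    have i1: "set_integrable lborel {0..s} ?b" and i2: "set_integrable lborel {s<..r} ?b"
      using sr by (auto intro!: set_integrable_subset[OF ir])
    have "{0..r} = {0..s} \<union> {s<..r}" using sr by auto
    hence "(LINT u:{0..r}|lborel. ?b u) = (LINT u:{0..s}|lborel. ?b u) + (LINT u:{s<..r}|lborel. ?b u)"
      using set_integral_Un[OF _ i1 i2] by (simp add: ivl_disj_int)
    moreover have "ennreal \<bar>LINT u:{s<..r}|lborel. ?b u\<bar> \<le> (\<integral>\<^sup>+u. norm (indicator {s<..r} u *\<^sub>R ?b u) \<partial>lborel)"
      using integral_norm_bound_ennreal[OF i2[unfolded set_integrable_def]]
      by (simp add: set_lebesgue_integral_def)
    moreover have "(\<integral>\<^sup>+u. norm (indicator {s<..r} u *\<^sub>R ?b u) \<partial>lborel) = (\<integral>\<^sup>+u\<in>{s<..r}. ennreal \<bar>?b u\<bar> \<partial>lborel)"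
      by (intro nn_integral_cong) (auto simp: indicator_def)
    ultimately show "X r \<omega> - X s \<omega> - (K r - K s) = (LINT u:{s<..r}|lborel. ?b u) + (I r \<omega> - I s \<omega>) \<and>
       ennreal \<bar>LINT u:{s<..r}|lborel. ?b u\<bar> \<le> (\<integral>\<^sup>+u\<in>{s<..r}. ennreal \<bar>?b u\<bar> \<partial>lborel)"
      using elim(1) sr by (simp add: \<mu>_def)
  qed
qed

lemma mean_sup_le:
  assumes \<rho>: "0 < \<rho>" and le: "(\<integral>\<^sup>+\<omega>. R\<^sub>X 2 u \<omega> \<partial>P) \<le> ennreal (\<rho>\<^sup>2)"
  shows "(\<integral>\<^sup>+\<omega>. R\<^sub>X 1 u \<omega> \<partial>P) \<le> ennreal \<rho>"
proof (rule nn_integral_L1_le[OF _ _ _ \<rho> _ le])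
  show "AE \<omega> in P. R\<^sub>X 1 u \<omega> \<le> ennreal (\<rho> / 2) + ennreal (1 / (2 * \<rho>)) * R\<^sub>X 2 u \<omega>"
  proof (rule AE_I2)
    fix \<omega>
    show "R\<^sub>X 1 u \<omega> \<le> ennreal (\<rho> / 2) + ennreal (1 / (2 * \<rho>)) * R\<^sub>X 2 u \<omega>"
      unfolding R\<^sub>X_def[of 1]
    proof (rule running_sup_least)
      fix r assume r: "r \<in> \<rat>" "0 \<le> r" "r < u"
      have "ennreal (\<bar>X r \<omega>\<bar> powr 1) \<le> ennreal (\<rho> / 2 + 1 / (2 * \<rho>) * (\<bar>X r \<omega>\<bar> powr 2))"
        using abs_le_square_div[OF \<rho>, of "X r \<omega>"] by (intro ennreal_leI) simp
      also have "\<dots> = ennreal (\<rho> / 2) + ennreal (1 / (2 * \<rho>)) * ennreal (\<bar>X r \<omega>\<bar> powr 2)"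
        using \<rho> by (subst ennreal_plus) (auto simp: ennreal_mult[symmetric])
      also have "\<dots> \<le> ennreal (\<rho> / 2) + ennreal (1 / (2 * \<rho>)) * R\<^sub>X 2 u \<omega>"
        unfolding R\<^sub>X_def using running_sup_upper[OF r, of "\<lambda>r \<omega>. ennreal (\<bar>X r \<omega>\<bar> powr 2)"]
        by (intro add_left_mono mult_left_mono) auto
      finally show "ennreal (\<bar>X r \<omega>\<bar> powr 1) \<le> ennreal (\<rho> / 2) + ennreal (1 / (2 * \<rho>)) * R\<^sub>X 2 u \<omega>" .
    qed
  qed
qed (auto intro: prob_space_axioms)

text \<open>The drift is estimated in L^1 through the running supremum, the stochastic integral in
  L^2. The bound \<rho> of the L^2 norm of the running supremum may vary in time: it is exponential
  in the Gronwall step for second moments and constant in the Hoelder estimate.\<close>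

lemma increment_L1:
  assumes sr: "0 \<le> s" "s < r" and \<rho>m [measurable]: "\<rho> \<in> borel_measurable borel" and \<rho>: "\<And>u. 0 < \<rho> u"
    and R2: "\<And>u. 0 < u \<Longrightarrow> u \<le> r \<Longrightarrow> (\<integral>\<^sup>+\<omega>. R\<^sub>X 2 u \<omega> \<partial>P) \<le> ennreal ((\<rho> u)\<^sup>2)"
    and B1: "0 \<le> B1" "(\<integral>\<^sup>+u\<in>{s..r}. ennreal (b\<^sub>0 + 2 * L * \<rho> u) \<partial>lborel) \<le> ennreal B1"
    and B2: "0 < B2" "(\<integral>\<^sup>+u\<in>{s..r}. ennreal (4 * (s\<^sub>0 + L * \<rho> u)\<^sup>2) \<partial>lborel) \<le> ennreal B2"
  shows "(\<integral>\<^sup>+\<omega>. ennreal \<bar>X r \<omega> - X s \<omega> - (K r - K s)\<bar> \<partial>P) \<le> ennreal (B1 + sqrt ((bdg_const 2 + 1) * B2))"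
proof -
  have r0: "0 \<le> r" using sr by simp
  have X2: "(\<integral>\<^sup>+\<omega>. ennreal ((X u \<omega>)\<^sup>2) \<partial>P) \<le> ennreal ((\<rho> u)\<^sup>2)" if "0 < u" "u \<le> r" for u
    using X_second_moment_le_R[of u u] R2[OF that] that by (auto intro: order_trans)
  have coef: "\<bar>b x (\<mu> u)\<bar> \<le> (b\<^sub>0 + L * \<rho> u) + L * \<bar>x\<bar>" "\<bar>\<sigma> x (\<mu> u)\<bar> \<le> (s\<^sub>0 + L * \<rho> u) + L * \<bar>x\<bar>"
    if "0 < u" "u \<le> r" for u x
    using coefficients_bound[OF _ less_imp_le[OF \<rho>] X2[OF that]] that by auto
  \<comment> \<open>A majorant of the drift. Fubini's theorem is applied to it rather than to the
    drift, as its joint measurability comes from \<open>R_joint\<close>.\<close>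
  define D where "D \<omega> = (\<integral>\<^sup>+u. (ennreal (b\<^sub>0 + L * \<rho> u) + ennreal L * R\<^sub>X 1 u \<omega>) * indicator {s<..r} u \<partial>lborel)" for \<omega>
  have Dj: "(\<lambda>x. (ennreal (b\<^sub>0 + L * \<rho> (fst x)) + ennreal L * R\<^sub>X 1 (fst x) (snd x)) * indicator {s<..r} (fst x)) \<in> borel_measurable (borel \<Otimes>\<^sub>M P)"
    using R_joint[of 1] by measurable
  have Dm [measurable]: "D \<in> borel_measurable P"
    unfolding D_def[abs_def] using nn_integral_time_measurable[OF Dj] by simp
  have "(\<integral>\<^sup>+\<omega>. D \<omega> \<partial>P) = (\<integral>\<^sup>+u. (\<integral>\<^sup>+\<omega>. (ennreal (b\<^sub>0 + L * \<rho> u) + ennreal L * R\<^sub>X 1 u \<omega>) * indicator {s<..r} u \<partial>P) \<partial>lborel)"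
    unfolding D_def using nn_fubini[OF Dj] by simp
  also have "\<dots> \<le> (\<integral>\<^sup>+u\<in>{s..r}. ennreal (b\<^sub>0 + 2 * L * \<rho> u) \<partial>lborel)"
  proof (rule nn_integral_mono)
    fix u
    show "(\<integral>\<^sup>+\<omega>. (ennreal (b\<^sub>0 + L * \<rho> u) + ennreal L * R\<^sub>X 1 u \<omega>) * indicator {s<..r} u \<partial>P) \<le>
        ennreal (b\<^sub>0 + 2 * L * \<rho> u) * indicator {s..r} u"
    proof (cases "u \<in> {s<..r}")
      case True
      hence u: "0 < u" "u \<le> r" using sr by auto
      have "(\<integral>\<^sup>+\<omega>. (ennreal (b\<^sub>0 + L * \<rho> u) + ennreal L * R\<^sub>X 1 u \<omega>) * indicator {s<..r} u \<partial>P) =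
         ennreal (b\<^sub>0 + L * \<rho> u) + ennreal L * (\<integral>\<^sup>+\<omega>. R\<^sub>X 1 u \<omega> \<partial>P)"
        using True by (simp add: nn_integral_add nn_integral_cmult emeasure_space_1)
      also have "\<dots> \<le> ennreal (b\<^sub>0 + L * \<rho> u) + ennreal L * ennreal (\<rho> u)"
        by (intro add_left_mono mult_left_mono mean_sup_le[OF \<rho> R2[OF u]]) simp
      also have "\<dots> = ennreal (b\<^sub>0 + 2 * L * \<rho> u)"
        using b0_nonneg L_pos less_imp_le[OF \<rho>[of u]]
        by (subst ennreal_mult[symmetric], simp, simp, subst ennreal_plus[symmetric]) (auto simp: algebra_simps)
      finally show ?thesis using True by simp
    qed simp
  qed
  also note B1(2)
  finally have ED: "(\<integral>\<^sup>+\<omega>. D \<omega> \<partial>P) \<le> ennreal B1" .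
  have "(\<integral>\<^sup>+\<omega>. ennreal ((I r \<omega> - I s \<omega>)\<^sup>2) \<partial>P) = (\<integral>\<^sup>+\<omega>. ennreal (\<bar>I r \<omega> - I s \<omega>\<bar> powr 2) \<partial>P)" by simp
  also have "\<dots> \<le> ennreal (bdg_const 2 * (r - s) powr (2 / 2 - 1)) *
    (\<integral>\<^sup>+u\<in>{s..r}. (\<integral>\<^sup>+\<omega>. ennreal (\<bar>\<sigma> (X u \<omega>) (law P (X u))\<bar> powr 2) \<partial>P) \<partial>lborel)"
    by (rule ito_increment_moment[OF ito sr]) simp
  also have "(r - s) powr (2 / 2 - 1) = 1" using sr by simp
  also have "(\<integral>\<^sup>+u\<in>{s..r}. (\<integral>\<^sup>+\<omega>. ennreal (\<bar>\<sigma> (X u \<omega>) (law P (X u))\<bar> powr 2) \<partial>P) \<partial>lborel) \<le>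
     (\<integral>\<^sup>+u\<in>{s..r}. ennreal (4 * (s\<^sub>0 + L * \<rho> u)\<^sup>2) \<partial>lborel)"
  proof (rule nn_integral_mono_AE)
    show "AE u in lborel. (\<integral>\<^sup>+\<omega>. ennreal (\<bar>\<sigma> (X u \<omega>) (law P (X u))\<bar> powr 2) \<partial>P) * indicator {s..r} u \<le>
       ennreal (4 * (s\<^sub>0 + L * \<rho> u)\<^sup>2) * indicator {s..r} u"
      using AE_lborel_singleton[of 0]
    proof eventually_elim
      case (elim u)
      show ?case
      proof (cases "u \<in> {s..r}")
        case True
        hence u: "0 < u" "u \<le> r" using sr elim by auto
        have u0: "0 \<le> u" using u by simp
        have [measurable]: "X u \<in> borel_measurable P" by (rule X_measurable[OF u0])
        have "(\<integral>\<^sup>+\<omega>. ennreal (\<bar>\<sigma> (X u \<omega>) (law P (X u))\<bar> powr 2) \<partial>P) \<le>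
           (\<integral>\<^sup>+\<omega>. ennreal (2 * (s\<^sub>0 + L * \<rho> u)\<^sup>2) + ennreal (2 * L\<^sup>2) * ennreal ((X u \<omega>)\<^sup>2) \<partial>P)"
        proof (rule nn_integral_mono)
          fix \<omega>
          have "\<bar>\<sigma> (X u \<omega>) (\<mu> u)\<bar> powr 2 \<le> ((s\<^sub>0 + L * \<rho> u) + L * \<bar>X u \<omega>\<bar>) powr 2"
            by (rule powr_mono2) (use coef(2)[OF u, of "X u \<omega>"] in auto)
          also have "\<dots> = ((s\<^sub>0 + L * \<rho> u) + L * \<bar>X u \<omega>\<bar>)\<^sup>2"
            using s0_nonneg L_pos less_imp_le[OF \<rho>[of u]] by (subst powr_numeral) (auto intro!: add_nonneg_nonneg)
          also have "\<dots> \<le> 2 * (s\<^sub>0 + L * \<rho> u)\<^sup>2 + 2 * (L * \<bar>X u \<omega>\<bar>)\<^sup>2"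
            by (rule square_add_le)
          also have "\<dots> = 2 * (s\<^sub>0 + L * \<rho> u)\<^sup>2 + 2 * L\<^sup>2 * (X u \<omega>)\<^sup>2" by (simp add: power_mult_distrib)
          finally have "ennreal (\<bar>\<sigma> (X u \<omega>) (\<mu> u)\<bar> powr 2) \<le> ennreal (2 * (s\<^sub>0 + L * \<rho> u)\<^sup>2 + 2 * L\<^sup>2 * (X u \<omega>)\<^sup>2)"
            by (rule ennreal_leI)
          also have "\<dots> = ennreal (2 * (s\<^sub>0 + L * \<rho> u)\<^sup>2) + ennreal (2 * L\<^sup>2) * ennreal ((X u \<omega>)\<^sup>2)"
            by (subst ennreal_plus) (auto simp: ennreal_mult)
          finally show "ennreal (\<bar>\<sigma> (X u \<omega>) (law P (X u))\<bar> powr 2) \<le> ennreal (2 * (s\<^sub>0 + L * \<rho> u)\<^sup>2) + ennreal (2 * L\<^sup>2) * ennreal ((X u \<omega>)\<^sup>2)"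
            by (simp add: \<mu>_def)
        qed
        also have "\<dots> = ennreal (2 * (s\<^sub>0 + L * \<rho> u)\<^sup>2) + ennreal (2 * L\<^sup>2) * (\<integral>\<^sup>+\<omega>. ennreal ((X u \<omega>)\<^sup>2) \<partial>P)"
          by (simp add: nn_integral_add nn_integral_cmult emeasure_space_1)
        also have "\<dots> \<le> ennreal (2 * (s\<^sub>0 + L * \<rho> u)\<^sup>2) + ennreal (2 * L\<^sup>2) * ennreal ((\<rho> u)\<^sup>2)"
          by (intro add_left_mono mult_left_mono X2[OF u]) simp
        also have "\<dots> = ennreal (2 * (s\<^sub>0 + L * \<rho> u)\<^sup>2 + 2 * L\<^sup>2 * (\<rho> u)\<^sup>2)"
          by (subst ennreal_plus) (auto simp: ennreal_mult)
        also have "\<dots> \<le> ennreal (4 * (s\<^sub>0 + L * \<rho> u)\<^sup>2)"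
        proof (rule ennreal_leI)
          have "(L * \<rho> u)\<^sup>2 \<le> (s\<^sub>0 + L * \<rho> u)\<^sup>2"
            using s0_nonneg L_pos less_imp_le[OF \<rho>[of u]] by (intro power_mono) auto
          thus "2 * (s\<^sub>0 + L * \<rho> u)\<^sup>2 + 2 * L\<^sup>2 * (\<rho> u)\<^sup>2 \<le> 4 * (s\<^sub>0 + L * \<rho> u)\<^sup>2"
            by (simp add: power_mult_distrib)
        qed
        finally show ?thesis using True by simp
      qed simp
    qed
  qed
  also note B2(2)
  \<comment> \<open>Adding 1 to the constant makes \<open>q\<close> below positive, so that it may
    be divided by.\<close>
  also have "ennreal (bdg_const 2 * 1) * ennreal B2 \<le> ennreal ((sqrt ((bdg_const 2 + 1) * B2))\<^sup>2)"
    using B2(1) bdg_const_nonneg[of 2] by (subst ennreal_mult[symmetric]) (auto intro!: ennreal_leI mult_right_mono)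
  finally have EI2: "(\<integral>\<^sup>+\<omega>. ennreal ((I r \<omega> - I s \<omega>)\<^sup>2) \<partial>P) \<le> ennreal ((sqrt ((bdg_const 2 + 1) * B2))\<^sup>2)"
    by (simp add: mult_left_mono)
  define q where "q = sqrt ((bdg_const 2 + 1) * B2)"
  have q: "0 < q" using B2(1) bdg_const_nonneg[of 2] by (simp add: q_def)
  have [measurable]: "I r \<in> borel_measurable P" "I s \<in> borel_measurable P"
    using I_measurable[OF r0] I_measurable[OF sr(1)] by auto
  have EI: "(\<integral>\<^sup>+\<omega>. ennreal \<bar>I r \<omega> - I s \<omega>\<bar> \<partial>P) \<le> ennreal q"
  proof (rule nn_integral_L1_le[OF _ _ _ q _ EI2[folded q_def]])
    show "AE \<omega> in P. ennreal \<bar>I r \<omega> - I s \<omega>\<bar> \<le> ennreal (q / 2) + ennreal (1 / (2 * q)) * ennreal ((I r \<omega> - I s \<omega>)\<^sup>2)"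
    proof (rule AE_I2)
      fix \<omega>
      have "ennreal \<bar>I r \<omega> - I s \<omega>\<bar> \<le> ennreal (q / 2 + 1 / (2 * q) * (I r \<omega> - I s \<omega>)\<^sup>2)"
        by (intro ennreal_leI abs_le_square_div q)
      also have "\<dots> = ennreal (q / 2) + ennreal (1 / (2 * q)) * ennreal ((I r \<omega> - I s \<omega>)\<^sup>2)"
        using q by (subst ennreal_plus) (auto simp: ennreal_mult[symmetric])
      finally show "ennreal \<bar>I r \<omega> - I s \<omega>\<bar> \<le> ennreal (q / 2) + ennreal (1 / (2 * q)) * ennreal ((I r \<omega> - I s \<omega>)\<^sup>2)" .
    qed
  qed (auto intro: prob_space_axioms)
  have "(\<integral>\<^sup>+\<omega>. ennreal \<bar>X r \<omega> - X s \<omega> - (K r - K s)\<bar> \<partial>P) \<le> (\<integral>\<^sup>+\<omega>. D \<omega> + ennreal \<bar>I r \<omega> - I s \<omega>\<bar> \<partial>P)"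
  proof (rule nn_integral_mono_AE)
    show "AE \<omega> in P. ennreal \<bar>X r \<omega> - X s \<omega> - (K r - K s)\<bar> \<le> D \<omega> + ennreal \<bar>I r \<omega> - I s \<omega>\<bar>"
      using drift_difference X_le_R
    proof eventually_elim
      case (elim \<omega>)
      define v where "v = (LINT u:{s<..r}|lborel. b (X u \<omega>) (\<mu> u))"
      have "ennreal \<bar>v\<bar> \<le> (\<integral>\<^sup>+u\<in>{s<..r}. ennreal \<bar>b (X u \<omega>) (\<mu> u)\<bar> \<partial>lborel)"
        unfolding v_def using elim(1) sr by auto
      also have "\<dots> \<le> D \<omega>"
        unfolding D_def
      proof (rule nn_integral_mono)
        fix u
        show "ennreal \<bar>b (X u \<omega>) (\<mu> u)\<bar> * indicator {s<..r} u \<le>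
            (ennreal (b\<^sub>0 + L * \<rho> u) + ennreal L * R\<^sub>X 1 u \<omega>) * indicator {s<..r} u"
        proof (cases "u \<in> {s<..r}")
          case True
          hence u: "0 < u" "u \<le> r" using sr by auto
          have "ennreal \<bar>b (X u \<omega>) (\<mu> u)\<bar> \<le> ennreal ((b\<^sub>0 + L * \<rho> u) + L * \<bar>X u \<omega>\<bar>)"
            by (intro ennreal_leI coef u)
          also have "\<dots> = ennreal (b\<^sub>0 + L * \<rho> u) + ennreal L * ennreal (\<bar>X u \<omega>\<bar> powr 1)"
            using b0_nonneg L_pos less_imp_le[OF \<rho>[of u]] by (subst ennreal_plus) (auto simp: ennreal_mult)
          also have "\<dots> \<le> ennreal (b\<^sub>0 + L * \<rho> u) + ennreal L * R\<^sub>X 1 u \<omega>"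
            using elim(2)[rule_format, of 1 u u] u by (intro add_left_mono mult_left_mono) auto
          finally show ?thesis using True by simp
        qed simp
      qed
      finally have vD: "ennreal \<bar>v\<bar> \<le> D \<omega>" .
      have "X r \<omega> - X s \<omega> - (K r - K s) = v + (I r \<omega> - I s \<omega>)"
        unfolding v_def using elim(1) sr by auto
      hence "ennreal \<bar>X r \<omega> - X s \<omega> - (K r - K s)\<bar> \<le> ennreal (\<bar>v\<bar> + \<bar>I r \<omega> - I s \<omega>\<bar>)"
        by (intro ennreal_leI) simp
      also have "\<dots> = ennreal \<bar>v\<bar> + ennreal \<bar>I r \<omega> - I s \<omega>\<bar>" by simp
      also have "\<dots> \<le> D \<omega> + ennreal \<bar>I r \<omega> - I s \<omega>\<bar>" using vD by (rule add_right_mono)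
      finally show ?case .
    qed
  qed
  also have "\<dots> = (\<integral>\<^sup>+\<omega>. D \<omega> \<partial>P) + (\<integral>\<^sup>+\<omega>. ennreal \<bar>I r \<omega> - I s \<omega>\<bar> \<partial>P)"
    by (rule nn_integral_add) auto
  also have "\<dots> \<le> ennreal B1 + ennreal q" by (rule add_mono[OF ED EI])
  also have "\<dots> = ennreal (B1 + q)" using B1(1) q by simp
  finally show ?thesis by (simp add: q_def)
qed

end

section \<open>Gronwall's argument for second moments\<close>

context mckean_vlasov
begin

text \<open>If \<open>E (sup\<^bsub>r<u\<^esub> \<bar>X r\<bar>\<^sup>2) \<le> \<phi> e\<^bsup>\<lambda>u\<^esup>\<close> for all \<open>u\<close>, then the estimates below bound the left-hand side
  by \<open>gronwall_const\<close> times \<open>E \<xi>\<^sup>2 + source_const + feedback_const (\<phi> + 1) e\<^bsup>\<lambda>u\<^esup> / \<lambda>\<close>; the choice of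
  \<open>\<lambda>\<close> as \<open>gronwall_rate\<close> makes the factor of \<open>\<phi>\<close> at most \<open>1/2\<close>.\<close>

definition gronwall_const :: "real \<Rightarrow> real" where
  "gronwall_const T = moment_const 2 T (2 * exp (2 * L * T)) L"

text \<open>The three summands stem from (K t)^2, from the square of the drift bound \<kappa>, and
  from the bound G of the integrated square of \<sigma>. \<open>feedback_const\<close> is built from
  the same three sources.\<close>

definition source_const :: "real \<Rightarrow> real" where
  "source_const T = 2 * (M / m)\<^sup>2 * (4 * (b\<^sub>0 * T)\<^sup>2 + 16 * (bdg_const 2 + 1) * (s\<^sub>0\<^sup>2 * T)) + 4 * (b\<^sub>0 * T)\<^sup>2 + 2 * (s\<^sub>0\<^sup>2 * T)"

definition feedback_const :: real where
  "feedback_const = 2 * (M / m)\<^sup>2 * (64 * L\<^sup>2 + 16 * (bdg_const 2 + 1) * L\<^sup>2) + 16 * L\<^sup>2 + 2 * L\<^sup>2"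

definition gronwall_rate :: "real \<Rightarrow> real" where
  "gronwall_rate T = 2 * gronwall_const T * feedback_const + 1"

definition second_moment_const :: "real \<Rightarrow> real" where
  "second_moment_const T = 2 * (gronwall_const T * (1 + source_const T) + 1) * exp (gronwall_rate T * T)"

lemma gronwall_const_nonneg: "0 \<le> gronwall_const T"
  by (simp add: gronwall_const_def moment_const_nonneg)

lemma source_const_nonneg: "0 \<le> T \<Longrightarrow> 0 \<le> source_const T"
  using bdg_const_nonneg[of 2] by (simp add: source_const_def)

lemma feedback_const_nonneg: "0 \<le> feedback_const"
  using bdg_const_nonneg[of 2] by (simp add: feedback_const_def)

lemma gronwall_rate_ge_1: "1 \<le> gronwall_rate T"
  using gronwall_const_nonneg feedback_const_nonneg by (simp add: gronwall_rate_def)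

lemma second_moment_const_pos: "0 \<le> T \<Longrightarrow> 0 < second_moment_const T"
  using gronwall_const_nonneg[of T] source_const_nonneg[of T] by (auto simp: second_moment_const_def intro!: mult_pos_pos add_nonneg_pos)

end

context mv_solution
begin

lemma initial_second_moment:
  "(\<integral>\<^sup>+\<omega>. ennreal (\<bar>\<xi> \<omega>\<bar> powr 2) \<partial>P) = ennreal (\<integral>\<omega>. (\<xi> \<omega>)\<^sup>2 \<partial>P)"
  using initial nn_integral_eq_integral[of P "\<lambda>\<omega>. (\<xi> \<omega>)\<^sup>2"] by (simp add: admissible_initial_def)

text \<open>The hypothesis acts three times: it bounds the growth of the drift, that of \<sigma>,
  and, through \<open>increment_L1\<close> and \<open>K_increment\<close>, the value K t. With these
  deterministic bounds \<open>moment_bound\<close> returns an improved bound for the running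
  supremum itself.\<close>

lemma second_moment_step:
  assumes T: "0 < T" and \<phi>: "0 \<le> \<phi>"
    and hyp: "\<And>u. u \<in> {0<..T} \<Longrightarrow> (\<integral>\<^sup>+\<omega>. R\<^sub>X 2 u \<omega> \<partial>P) \<le> ennreal (\<phi> * exp (gronwall_rate T * u))"
    and t: "t \<in> {0<..T}"
  shows "(\<integral>\<^sup>+\<omega>. R\<^sub>X 2 t \<omega> \<partial>P) \<le> ennreal ((gronwall_const T * ((\<integral>\<omega>. (\<xi> \<omega>)\<^sup>2 \<partial>P) + source_const T) + 1 / 2 + \<phi> / 2) * exp (gronwall_rate T * t))"
proof -
  define lam where "lam = gronwall_rate T"
  have lam: "1 \<le> lam" unfolding lam_def by (rule gronwall_rate_ge_1)
  have t0: "0 < t" "t \<le> T" using t by auto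
  \<comment> \<open>\<phi> + 1 in place of \<phi> keeps \<rho> positive even for \<phi> = 0; the
    summand 1/2 in the conclusion is its price.\<close>
  define \<rho> where "\<rho> u = sqrt (\<phi> + 1) * exp (lam / 2 * u)" for u
  have \<rho>m [measurable]: "\<rho> \<in> borel_measurable borel" unfolding \<rho>_def[abs_def] by measurable
  have \<rho>: "0 < \<rho> u" for u using \<phi> by (simp add: \<rho>_def)
  have \<rho>2: "(\<rho> u)\<^sup>2 = (\<phi> + 1) * exp (lam * u)" for u
    using \<phi> by (simp add: \<rho>_def power_mult_distrib exp_double[symmetric])
  have R2: "(\<integral>\<^sup>+\<omega>. R\<^sub>X 2 u \<omega> \<partial>P) \<le> ennreal ((\<rho> u)\<^sup>2)" if "0 < u" "u \<le> T" for u
  proof -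
    have "(\<integral>\<^sup>+\<omega>. R\<^sub>X 2 u \<omega> \<partial>P) \<le> ennreal (\<phi> * exp (lam * u))" using hyp[of u] that by (simp add: lam_def)
    also have "\<dots> \<le> ennreal ((\<rho> u)\<^sup>2)" unfolding \<rho>2 by (intro ennreal_leI mult_right_mono) auto
    finally show ?thesis .
  qed
  \<comment> \<open>\<Psi> bounds the integral of the square of \<rho> over [0, t], and
    \<open>S\<close> that of \<rho>. As the rate is at least 1, S^2 is at most 4 \<Psi>, so
    everything can be expressed by \<Psi>.\<close>
  define \<Psi> where "\<Psi> = (\<phi> + 1) * exp (lam * t) / lam"
  define S where "S = sqrt (\<phi> + 1) * exp (lam / 2 * t) / (lam / 2)"
  have \<Psi>: "0 < \<Psi>" using \<phi> lam by (simp add: \<Psi>_def)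
  have S: "0 \<le> S" using \<phi> lam by (simp add: S_def)
  have S2: "S\<^sup>2 \<le> 4 * \<Psi>"
  proof -
    have "S\<^sup>2 = (\<rho> t)\<^sup>2 / (lam / 2)\<^sup>2" by (simp add: S_def \<rho>_def power_divide)
    also have "\<dots> = 4 * \<Psi> / lam" unfolding \<rho>2 \<Psi>_def using lam by (simp add: power2_eq_square)
    also have "\<dots> \<le> 4 * \<Psi> / 1" using \<Psi> lam by (intro divide_left_mono) auto
    finally show ?thesis by simp
  qed
  have const: "(\<integral>\<^sup>+u\<in>{0..t}. ennreal c \<partial>lborel) \<le> ennreal (c * T)" if "0 \<le> c" for c
  proof -
    have "(\<integral>\<^sup>+u\<in>{0..t}. ennreal c \<partial>lborel) = ennreal (c * t)"
      using t0 that by (subst nn_integral_cmult_indicator) (auto simp: ennreal_mult)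
    also have "\<dots> \<le> ennreal (c * T)" using t0 that by (intro ennreal_leI mult_left_mono) auto
    finally show ?thesis .
  qed
  have I\<rho>: "(\<integral>\<^sup>+u\<in>{0..t}. ennreal (c + k * \<rho> u) \<partial>lborel) \<le> ennreal (c * T + k * S)" if c: "0 \<le> c" "0 \<le> k" for c k
  proof -
    have "(\<integral>\<^sup>+u\<in>{0..t}. ennreal (c + k * \<rho> u) \<partial>lborel) =
        (\<integral>\<^sup>+u. ennreal c * indicator {0..t} u + ennreal ((k * sqrt (\<phi> + 1)) * exp (lam / 2 * u)) * indicator {0..t} u \<partial>lborel)"
      using c \<phi> by (intro nn_integral_cong) (auto simp: indicator_def \<rho>_def mult.assoc)
    also have "\<dots> = (\<integral>\<^sup>+u\<in>{0..t}. ennreal c \<partial>lborel) + (\<integral>\<^sup>+u\<in>{0..t}. ennreal ((k * sqrt (\<phi> + 1)) * exp (lam / 2 * u)) \<partial>lborel)"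
      by (rule nn_integral_add) auto
    also have "\<dots> \<le> ennreal (c * T) + ennreal ((k * sqrt (\<phi> + 1)) * exp (lam / 2 * t) / (lam / 2))"
      by (intro add_mono const nn_integral_exp_le) (use c \<phi> lam t0 in auto)
    also have "(k * sqrt (\<phi> + 1)) * exp (lam / 2 * t) / (lam / 2) = k * S"
      by (simp add: S_def mult.assoc)
    also have "ennreal (c * T) + ennreal (k * S) = ennreal (c * T + k * S)"
      using c T S by simp
    finally show ?thesis .
  qed
  have I\<rho>2: "(\<integral>\<^sup>+u\<in>{0..t}. ennreal (c * (s\<^sub>0 + L * \<rho> u)\<^sup>2) \<partial>lborel) \<le> ennreal (2 * c * (s\<^sub>0\<^sup>2 * T) + 2 * c * (L\<^sup>2 * \<Psi>))"
    if c: "0 \<le> c" for c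
  proof -
    have "(\<integral>\<^sup>+u\<in>{0..t}. ennreal (c * (s\<^sub>0 + L * \<rho> u)\<^sup>2) \<partial>lborel) \<le>
       (\<integral>\<^sup>+u. ennreal (2 * c * s\<^sub>0\<^sup>2) * indicator {0..t} u + ennreal ((2 * c * L\<^sup>2 * (\<phi> + 1)) * exp (lam * u)) * indicator {0..t} u \<partial>lborel)"
    proof (rule nn_integral_mono)
      fix u
      have "c * (s\<^sub>0 + L * \<rho> u)\<^sup>2 \<le> c * (2 * s\<^sub>0\<^sup>2 + 2 * (L * \<rho> u)\<^sup>2)"
        by (intro mult_left_mono square_add_le c)
      also have "\<dots> = 2 * c * s\<^sub>0\<^sup>2 + (2 * c * L\<^sup>2 * (\<phi> + 1)) * exp (lam * u)"
        by (simp add: power_mult_distrib \<rho>2 algebra_simps)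
      finally have "ennreal (c * (s\<^sub>0 + L * \<rho> u)\<^sup>2) \<le> ennreal (2 * c * s\<^sub>0\<^sup>2 + (2 * c * L\<^sup>2 * (\<phi> + 1)) * exp (lam * u))"
        by (rule ennreal_leI)
      also have "\<dots> = ennreal (2 * c * s\<^sub>0\<^sup>2) + ennreal ((2 * c * L\<^sup>2 * (\<phi> + 1)) * exp (lam * u))"
        using c \<phi> by (intro ennreal_plus) auto
      finally show "ennreal (c * (s\<^sub>0 + L * \<rho> u)\<^sup>2) * indicator {0..t} u \<le>
        ennreal (2 * c * s\<^sub>0\<^sup>2) * indicator {0..t} u + ennreal ((2 * c * L\<^sup>2 * (\<phi> + 1)) * exp (lam * u)) * indicator {0..t} u"
        by (cases "u \<in> {0..t}") auto
    qed
    also have "\<dots> = (\<integral>\<^sup>+u\<in>{0..t}. ennreal (2 * c * s\<^sub>0\<^sup>2) \<partial>lborel) + (\<integral>\<^sup>+u\<in>{0..t}. ennreal ((2 * c * L\<^sup>2 * (\<phi> + 1)) * exp (lam * u)) \<partial>lborel)"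
      by (rule nn_integral_add) auto
    also have "\<dots> \<le> ennreal (2 * c * s\<^sub>0\<^sup>2 * T) + ennreal ((2 * c * L\<^sup>2 * (\<phi> + 1)) * exp (lam * t) / lam)"
      by (intro add_mono const nn_integral_exp_le) (use c \<phi> lam t0 in auto)
    also have "\<dots> = ennreal (2 * c * (s\<^sub>0\<^sup>2 * T) + 2 * c * (L\<^sup>2 * \<Psi>))"
      using c T \<phi> lam by (subst ennreal_plus[symmetric]) (auto simp: \<Psi>_def mult.assoc)
    finally show ?thesis .
  qed
  have bd: "0 \<le> bdg_const 2" by (rule bdg_const_nonneg) simp
  define B1 where "B1 = b\<^sub>0 * T + 2 * L * S"
  define B2 where "B2 = 8 * (s\<^sub>0\<^sup>2 * T) + 8 * (L\<^sup>2 * \<Psi>)"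
  define q where "q = sqrt ((bdg_const 2 + 1) * B2)"
  have B1: "0 \<le> B1" using b0_nonneg T L_pos S by (simp add: B1_def)
  have B2: "0 < B2" using T L_pos \<Psi> by (auto simp: B2_def intro!: add_nonneg_pos)
  have q: "0 \<le> q" "q\<^sup>2 = (bdg_const 2 + 1) * B2" using bd B2 by (auto simp: q_def)
  have "K t - K 0 \<le> M / m * (B1 + q)"
  proof (rule K_increment)
    fix r :: real assume r: "0 < r" "r \<le> t"
    have mono: "(\<integral>\<^sup>+u\<in>{0..r}. f u \<partial>lborel) \<le> (\<integral>\<^sup>+u\<in>{0..t}. f u \<partial>lborel)" for f :: "real \<Rightarrow> ennreal"
      using r by (intro nn_integral_mono) (auto simp: indicator_def)
    show "(\<integral>\<^sup>+\<omega>. ennreal \<bar>X r \<omega> - X 0 \<omega> - (K r - K 0)\<bar> \<partial>P) \<le> ennreal (B1 + q)"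
      unfolding q_def
    proof (rule increment_L1[OF order_refl r(1) \<rho>m \<rho> R2 B1 _ B2])
      show "(\<integral>\<^sup>+u\<in>{0..r}. ennreal (b\<^sub>0 + 2 * L * \<rho> u) \<partial>lborel) \<le> ennreal B1"
        using order_trans[OF mono I\<rho>[of b\<^sub>0 "2 * L"]] b0_nonneg L_pos by (simp add: B1_def)
      show "(\<integral>\<^sup>+u\<in>{0..r}. ennreal (4 * (s\<^sub>0 + L * \<rho> u)\<^sup>2) \<partial>lborel) \<le> ennreal B2"
        using order_trans[OF mono I\<rho>2[of 4]] by (simp add: B2_def)
    qed (use r t0 in auto)
  qed (use t0 B1 q in auto)
  hence K: "0 \<le> K t" "K t \<le> M / m * (B1 + q)" using K_0 K_nonneg[of t] t0 by auto
  define \<kappa> where "\<kappa> = b\<^sub>0 * T + L * S"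
  define G where "G = 2 * (s\<^sub>0\<^sup>2 * T) + 2 * (L\<^sup>2 * \<Psi>)"
  have \<kappa>: "0 \<le> \<kappa>" using b0_nonneg T L_pos S by (simp add: \<kappa>_def)
  have G: "0 \<le> G" using T \<Psi> by (simp add: G_def)
  have E: "0 \<le> (\<integral>\<omega>. (\<xi> \<omega>)\<^sup>2 \<partial>P)" by simp
  have X2: "(\<integral>\<^sup>+\<omega>. ennreal ((X u \<omega>)\<^sup>2) \<partial>P) \<le> ennreal ((\<rho> u)\<^sup>2)" if "0 \<le> u" "u \<le> t" for u
  \<comment> \<open>\<open>R2\<close> is available for positive times only. At u = 0 the second
    moment is bounded by the running supremum at small v > 0, and \<rho> is continuous at 0.\<close>
  proof (cases "u = 0")
    case True
    show ?thesis
    proof (rule ennreal_le_epsilon)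
      fix e :: real assume e: "0 < e"
      have "((\<lambda>v. (\<rho> v)\<^sup>2) \<longlongrightarrow> (\<rho> 0)\<^sup>2) (at_right 0)"
        unfolding \<rho>_def by (auto intro!: tendsto_eq_intros)
      hence "\<forall>\<^sub>F v in at_right 0. (\<rho> v)\<^sup>2 < (\<rho> 0)\<^sup>2 + e"
        using e by (intro order_tendstoD(2)) auto
      moreover have "\<forall>\<^sub>F v in at_right 0. v \<in> {0<..<t}"
        using t0 by (intro eventually_at_right_real)
      ultimately have "\<forall>\<^sub>F v in at_right 0. (\<rho> v)\<^sup>2 < (\<rho> 0)\<^sup>2 + e \<and> v \<in> {0<..<t}"
        by eventually_elim auto
      then obtain v where v: "(\<rho> v)\<^sup>2 < (\<rho> 0)\<^sup>2 + e" "0 < v" "v < t"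
        using eventually_happens'[OF trivial_limit_at_right_real] by force
      have "(\<integral>\<^sup>+\<omega>. ennreal ((X u \<omega>)\<^sup>2) \<partial>P) \<le> (\<integral>\<^sup>+\<omega>. R\<^sub>X 2 v \<omega> \<partial>P)"
        using True v by (intro X_second_moment_le_R) auto
      also have "\<dots> \<le> ennreal ((\<rho> v)\<^sup>2)" using v t0 by (intro R2) auto
      also have "\<dots> \<le> ennreal ((\<rho> 0)\<^sup>2 + e)" using v by (intro ennreal_leI) simp
      also have "\<dots> = ennreal ((\<rho> u)\<^sup>2) + ennreal e" using True e by simp
      finally show "(\<integral>\<^sup>+\<omega>. ennreal ((X u \<omega>)\<^sup>2) \<partial>P) \<le> ennreal ((\<rho> u)\<^sup>2) + ennreal e" .
    qed
  next
    case False
    thus ?thesis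
      using X_second_moment_le_R[of u u] R2[of u] that t0 by (auto intro: order_trans)
  qed
  note coef = coefficients_bound[OF _ less_imp_le[OF \<rho>] X2]
  have "(\<integral>\<^sup>+\<omega>. R\<^sub>X 2 t \<omega> \<partial>P) \<le> ennreal (gronwall_const T * ((\<integral>\<omega>. (\<xi> \<omega>)\<^sup>2 \<partial>P) + (K t + \<kappa>) powr 2 + G))"
    unfolding R\<^sub>X_def gronwall_const_def
  proof (rule moment_bound[OF X_adapted X_continuous \<xi>_measurable ito ito_integral_0[OF ito] _ t0, where \<gamma>="\<lambda>u. s\<^sub>0 + L * \<rho> u"])
    show "AE \<omega> in P. \<forall>s J. 0 < s \<longrightarrow> s \<le> t \<longrightarrow> 0 \<le> J \<longrightarrow> (\<forall>r\<in>\<rat> \<inter> {0..<s}. \<bar>I r \<omega>\<bar> \<le> J) \<longrightarrow>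
        (\<forall>r\<in>{0..s}. \<bar>X r \<omega>\<bar> \<le> 2 * exp (2 * L * T) * (\<bar>\<xi> \<omega>\<bar> + (K t + \<kappa>) + J))"
    proof (rule path_bound[OF t0, where \<beta>="\<lambda>u. b\<^sub>0 + L * \<rho> u"])
      show "(\<integral>\<^sup>+u\<in>{0..t}. ennreal (b\<^sub>0 + L * \<rho> u) \<partial>lborel) \<le> ennreal \<kappa>"
        using I\<rho>[of b\<^sub>0 L] b0_nonneg L_pos by (simp add: \<kappa>_def)
    qed (use coef(1) \<kappa> in auto)
    show "\<bar>\<sigma> (X s \<omega>) (law P (X s))\<bar> \<le> s\<^sub>0 + L * \<rho> s + L * \<bar>X s \<omega>\<bar>" if "0 \<le> s" "s \<le> t" for s \<omega>
      using coef(2)[of s "X s \<omega>"] that by (simp add: \<mu>_def)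
    have pos: "0 \<le> s\<^sub>0 + L * \<rho> s" for s using s0_nonneg L_pos less_imp_le[OF \<rho>[of s]] by simp
    show "0 \<le> s\<^sub>0 + L * \<rho> s" for s by (rule pos)
    show "(\<integral>\<^sup>+s\<in>{0..t}. ennreal ((s\<^sub>0 + L * \<rho> s) powr 2) \<partial>lborel) \<le> ennreal G"
      using I\<rho>2[of 1] pos by (simp add: G_def)
  qed (use L_pos K \<kappa> G E initial_second_moment in auto)
  also have "\<dots> \<le> ennreal ((gronwall_const T * ((\<integral>\<omega>. (\<xi> \<omega>)\<^sup>2 \<partial>P) + source_const T) + 1 / 2 + \<phi> / 2) * exp (gronwall_rate T * t))"
  proof (rule ennreal_leI)
    have LS: "(L * S)\<^sup>2 \<le> 4 * (L\<^sup>2 * \<Psi>)"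
      using mult_left_mono[OF S2, of "L\<^sup>2"] by (simp add: power_mult_distrib)
    have B1sq: "B1\<^sup>2 \<le> 2 * (b\<^sub>0 * T)\<^sup>2 + 32 * (L\<^sup>2 * \<Psi>)"
    proof -
      have "B1\<^sup>2 \<le> 2 * (b\<^sub>0 * T)\<^sup>2 + 2 * (2 * L * S)\<^sup>2" unfolding B1_def by (rule square_add_le)
      also have "(2 * L * S)\<^sup>2 = 4 * (L * S)\<^sup>2" by (simp add: power_mult_distrib)
      finally show ?thesis using LS by simp
    qed
    have "(K t)\<^sup>2 \<le> (M / m * (B1 + q))\<^sup>2" using K by (intro power_mono) auto
    also have "\<dots> = (M / m)\<^sup>2 * (B1 + q)\<^sup>2" by (rule power_mult_distrib)
    also have "\<dots> \<le> (M / m)\<^sup>2 * (2 * B1\<^sup>2 + 2 * q\<^sup>2)" by (intro mult_left_mono square_add_le) simp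
    also have "\<dots> \<le> (M / m)\<^sup>2 * (2 * (2 * (b\<^sub>0 * T)\<^sup>2 + 32 * (L\<^sup>2 * \<Psi>)) + 2 * ((bdg_const 2 + 1) * B2))"
      unfolding q(2) by (intro mult_left_mono add_mono order_refl B1sq) auto
    finally have Ksq: "(K t)\<^sup>2 \<le> (M / m)\<^sup>2 * (2 * (2 * (b\<^sub>0 * T)\<^sup>2 + 32 * (L\<^sup>2 * \<Psi>)) + 2 * ((bdg_const 2 + 1) * B2))" .
    have \<kappa>sq: "\<kappa>\<^sup>2 \<le> 2 * (b\<^sub>0 * T)\<^sup>2 + 8 * (L\<^sup>2 * \<Psi>)"
    proof -
      have "\<kappa>\<^sup>2 \<le> 2 * (b\<^sub>0 * T)\<^sup>2 + 2 * (L * S)\<^sup>2" unfolding \<kappa>_def by (rule square_add_le)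
      thus ?thesis using LS by simp
    qed
    have "(K t + \<kappa>) powr 2 = (K t + \<kappa>)\<^sup>2" using K \<kappa> by simp
    also have "\<dots> \<le> 2 * (K t)\<^sup>2 + 2 * \<kappa>\<^sup>2" by (rule square_add_le)
    finally have K\<kappa>: "(K t + \<kappa>) powr 2 \<le> 2 * (K t)\<^sup>2 + 2 * \<kappa>\<^sup>2" .
    \<comment> \<open>Stated for abstract reals, so that linear arithmetic does not have to look
      into the products.\<close>
    have comb: "z + g \<le> 2 * x' + 2 * y' + g" if "z \<le> 2 * x + 2 * y" "x \<le> x'" "y \<le> y'" for x y z x' y' g :: real
      using that by linarith
    have "(K t + \<kappa>) powr 2 + G \<le>
        2 * ((M / m)\<^sup>2 * (2 * (2 * (b\<^sub>0 * T)\<^sup>2 + 32 * (L\<^sup>2 * \<Psi>)) + 2 * ((bdg_const 2 + 1) * B2))) +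
        2 * (2 * (b\<^sub>0 * T)\<^sup>2 + 8 * (L\<^sup>2 * \<Psi>)) + G"
      by (rule comb[OF K\<kappa> Ksq \<kappa>sq])
    also have "\<dots> = source_const T + feedback_const * \<Psi>"
      by (simp add: source_const_def feedback_const_def B2_def G_def algebra_simps)
    finally have "gronwall_const T * ((\<integral>\<omega>. (\<xi> \<omega>)\<^sup>2 \<partial>P) + (K t + \<kappa>) powr 2 + G) \<le>
        gronwall_const T * ((\<integral>\<omega>. (\<xi> \<omega>)\<^sup>2 \<partial>P) + (source_const T + feedback_const * \<Psi>))"
      using gronwall_const_nonneg by (intro mult_left_mono) auto
    also have "\<dots> = gronwall_const T * ((\<integral>\<omega>. (\<xi> \<omega>)\<^sup>2 \<partial>P) + source_const T) + (gronwall_const T * feedback_const / lam) * ((\<phi> + 1) * exp (lam * t))"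
      by (simp add: \<Psi>_def algebra_simps add_divide_distrib)
    also have "\<dots> \<le> gronwall_const T * ((\<integral>\<omega>. (\<xi> \<omega>)\<^sup>2 \<partial>P) + source_const T) * exp (lam * t) + 1 / 2 * ((\<phi> + 1) * exp (lam * t))"
    proof (intro add_mono mult_right_mono)
      have "0 \<le> gronwall_const T * ((\<integral>\<omega>. (\<xi> \<omega>)\<^sup>2 \<partial>P) + source_const T)"
        using gronwall_const_nonneg source_const_nonneg T by (intro mult_nonneg_nonneg add_nonneg_nonneg) auto
      moreover have "1 \<le> exp (lam * t)" using lam t0 by simp
      ultimately show "gronwall_const T * ((\<integral>\<omega>. (\<xi> \<omega>)\<^sup>2 \<partial>P) + source_const T) \<le> gronwall_const T * ((\<integral>\<omega>. (\<xi> \<omega>)\<^sup>2 \<partial>P) + source_const T) * exp (lam * t)"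
        by (metis mult_left_mono mult.right_neutral)
      show "gronwall_const T * feedback_const / lam \<le> 1 / 2" using lam by (simp add: lam_def gronwall_rate_def field_simps)
    qed (use \<phi> in auto)
    also have "\<dots> = (gronwall_const T * ((\<integral>\<omega>. (\<xi> \<omega>)\<^sup>2 \<partial>P) + source_const T) + 1 / 2 + \<phi> / 2) * exp (gronwall_rate T * t)"
      unfolding lam_def by (simp add: algebra_simps)
    finally show "gronwall_const T * ((\<integral>\<omega>. (\<xi> \<omega>)\<^sup>2 \<partial>P) + (K t + \<kappa>) powr 2 + G) \<le>
       (gronwall_const T * ((\<integral>\<omega>. (\<xi> \<omega>)\<^sup>2 \<partial>P) + source_const T) + 1 / 2 + \<phi> / 2) * exp (gronwall_rate T * t)" .
  qed
  finally show ?thesis .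
qed

lemma second_moment_bound:
  assumes T: "0 < T"
  shows "(\<integral>\<^sup>+\<omega>. R\<^sub>X 2 T \<omega> \<partial>P) \<le> ennreal (second_moment_const T * (1 + (\<integral>\<omega>. (\<xi> \<omega>)\<^sup>2 \<partial>P)))"
proof -
  define E where "E = (\<integral>\<omega>. (\<xi> \<omega>)\<^sup>2 \<partial>P)"
  define a where "a = gronwall_const T * (E + source_const T) + 1 / 2"
  have E: "0 \<le> E" by (simp add: E_def)
  have A: "0 \<le> source_const T" using T by (intro source_const_nonneg) simp
  have a0: "0 \<le> a" using gronwall_const_nonneg E A by (simp add: a_def)
  \<comment> \<open>Only finiteness is taken from the a priori bound; its value, which depends on
    the chosen path, is lost in the iteration.\<close>
  obtain \<phi>0 where \<phi>0: "0 \<le> \<phi>0" "(\<integral>\<^sup>+\<omega>. R\<^sub>X 2 T \<omega> \<partial>P) = ennreal \<phi>0"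
    using apriori_second_moment[OF T] by (cases "\<integral>\<^sup>+\<omega>. R\<^sub>X 2 T \<omega> \<partial>P") auto
  have "(\<integral>\<^sup>+\<omega>. R\<^sub>X 2 T \<omega> \<partial>P) \<le> ennreal (2 * a * exp (gronwall_rate T * T))"
  proof (rule weighted_gronwall[where I="{0<..T}" and \<phi>\<^sub>0=\<phi>0 and w="\<lambda>u. exp (gronwall_rate T * u)" and a=a and t=T
        and y="\<lambda>u. \<integral>\<^sup>+\<omega>. R\<^sub>X 2 u \<omega> \<partial>P"])
    fix u assume u: "u \<in> {0<..T}"
    have "(\<integral>\<^sup>+\<omega>. R\<^sub>X 2 u \<omega> \<partial>P) \<le> (\<integral>\<^sup>+\<omega>. R\<^sub>X 2 T \<omega> \<partial>P)"
      unfolding R\<^sub>X_def using u by (intro nn_integral_mono running_sup_mono) auto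
    also have "\<dots> \<le> ennreal (\<phi>0 * exp (gronwall_rate T * u))"
      unfolding \<phi>0(2) using u gronwall_rate_ge_1[of T] \<phi>0(1) mult_left_mono[of 1 "exp (gronwall_rate T * u)" \<phi>0]
      by (intro ennreal_leI) auto
    finally show "(\<integral>\<^sup>+\<omega>. R\<^sub>X 2 u \<omega> \<partial>P) \<le> ennreal (\<phi>0 * exp (gronwall_rate T * u))" .
  next
    fix \<phi> t assume "0 \<le> \<phi>" "\<And>s. s \<in> {0<..T} \<Longrightarrow> (\<integral>\<^sup>+\<omega>. R\<^sub>X 2 s \<omega> \<partial>P) \<le> ennreal (\<phi> * exp (gronwall_rate T * s))" "t \<in> {0<..T}"
    from second_moment_step[OF T this]
    show "(\<integral>\<^sup>+\<omega>. R\<^sub>X 2 t \<omega> \<partial>P) \<le> ennreal ((a + \<phi> / 2) * exp (gronwall_rate T * t))" by (simp add: a_def E_def)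
  qed (use T a0 \<phi>0 in auto)
  also have "\<dots> \<le> ennreal (second_moment_const T * (1 + E))"
  proof (rule ennreal_leI)
    have "a \<le> (gronwall_const T * (1 + source_const T) + 1) * (1 + E)"
      using gronwall_const_nonneg[of T] A E by (simp add: a_def algebra_simps)
    hence "2 * a * exp (gronwall_rate T * T) \<le> 2 * ((gronwall_const T * (1 + source_const T) + 1) * (1 + E)) * exp (gronwall_rate T * T)"
      by (intro mult_right_mono mult_left_mono) auto
    thus "2 * a * exp (gronwall_rate T * T) \<le> second_moment_const T * (1 + E)"
      by (simp add: second_moment_const_def algebra_simps)
  qed
  finally show ?thesis by (simp add: E_def)
qed

end

section \<open>Hoelder continuity of K, and moments of order p\<close>

text \<open>Jensen's inequality for the power p/2, obtained by integrating Young's inequality with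
  the mean e as its second argument.\<close>

lemma (in prob_space) second_moment_powr_le:
  fixes X :: "'a \<Rightarrow> real"
  assumes p: "2 \<le> p" and X2: "integrable M (\<lambda>\<omega>. (X \<omega>)\<^sup>2)" and Xp: "integrable M (\<lambda>\<omega>. \<bar>X \<omega>\<bar> powr p)"
  shows "(\<integral>\<omega>. (X \<omega>)\<^sup>2 \<partial>M) powr (p / 2) \<le> (\<integral>\<omega>. \<bar>X \<omega>\<bar> powr p \<partial>M)"
proof (cases "p = 2")
  case False
  define q where "q = p / 2"
  define e where "e = (\<integral>\<omega>. (X \<omega>)\<^sup>2 \<partial>M)"
  have q: "1 < q" using p False by (simp add: q_def)
  have e: "0 \<le> e" by (simp add: e_def)
  have "(\<integral>\<omega>. (X \<omega>)\<^sup>2 * e powr (q - 1) \<partial>M) \<le> (\<integral>\<omega>. \<bar>X \<omega>\<bar> powr p / q + (q - 1) / q * e powr q \<partial>M)"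
  proof (rule integral_mono)
    fix \<omega>
    have "((X \<omega>)\<^sup>2) powr q = \<bar>X \<omega>\<bar> powr p"
      using powr_powr[of "\<bar>X \<omega>\<bar>" 2 q] by (simp add: q_def)
    thus "(X \<omega>)\<^sup>2 * e powr (q - 1) \<le> \<bar>X \<omega>\<bar> powr p / q + (q - 1) / q * e powr q"
      using young_powr[OF q, of "(X \<omega>)\<^sup>2" e] e by simp
  qed (use X2 Xp in auto)
  hence "e * e powr (q - 1) \<le> (\<integral>\<omega>. \<bar>X \<omega>\<bar> powr p \<partial>M) / q + (q - 1) / q * e powr q"
    using X2 Xp by (simp add: e_def prob_space)
  moreover have "e * e powr (q - 1) = e powr q"
    using e powr_add[of e 1 "q - 1"] q by (cases "e = 0") auto
  moreover have "e powr q = e powr q / q + (q - 1) / q * e powr q"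
    using q by (simp add: field_simps)
  ultimately have "e powr q / q \<le> (\<integral>\<omega>. \<bar>X \<omega>\<bar> powr p \<partial>M) / q" by linarith
  thus ?thesis using q by (simp add: divide_le_cancel e_def q_def)
qed simp

context mckean_vlasov
begin

text \<open>Bounds the L^2 norm of the running supremum up to T whenever e is a bound for the second
  moment of \<xi>.\<close>

definition l2_const :: "real \<Rightarrow> real \<Rightarrow> real" where
  "l2_const T e = sqrt (second_moment_const T * (1 + e))"

text \<open>\<open>K_increment\<close> with constant \<rho>: the drift contributes a multiple of t -
  s, which is at most sqrt T times sqrt (t - s), and the stochastic integral a multiple of sqrt (t -
  s).\<close>

definition hoelder_const :: "real \<Rightarrow> real \<Rightarrow> real" where
  "hoelder_const T e = M / m * ((b\<^sub>0 + 2 * L * l2_const T e) * sqrt T +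
     sqrt (bdg_const 2 + 1) * (2 * (s\<^sub>0 + L * l2_const T e)))"

lemma l2_const_pos: "0 < T \<Longrightarrow> 0 \<le> e \<Longrightarrow> 0 < l2_const T e"
  using second_moment_const_pos[of T] by (auto simp: l2_const_def intro!: mult_pos_pos)

lemma hoelder_const_nonneg: "0 < T \<Longrightarrow> 0 \<le> e \<Longrightarrow> 0 \<le> hoelder_const T e"
  using l2_const_pos[of T e] M_pos m_pos b0_nonneg s0_nonneg L_pos bdg_const_nonneg[of 2]
  by (auto simp: hoelder_const_def intro!: mult_nonneg_nonneg add_nonneg_nonneg divide_nonneg_nonneg)

text \<open>With \<open>l2_const\<close> written as \<Lambda> and the p-th moment of \<xi> as E, the
  sum u + v \<Lambda> bounds K T plus the integrated drift growth, and c (1 + E) bounds \<Lambda>^p.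
  No property of \<xi> enters.\<close>

definition p_moment_const :: "real \<Rightarrow> real \<Rightarrow> real" where
  "p_moment_const T p =
    (let k = sqrt (bdg_const 2 + 1); c = (second_moment_const T * 2) powr (p / 2);
         u = M / m * (b\<^sub>0 * sqrt T + k * (2 * s\<^sub>0)) * sqrt T + b\<^sub>0 * T;
         v = M / m * (2 * L * sqrt T + k * (2 * L)) * sqrt T + L * T
     in moment_const p T (2 * exp (2 * L * T)) L *
        (1 + 2 powr p * (u powr p + v powr p * c) + 2 powr p * (s\<^sub>0 powr p + L powr p * c) * T) + 1)"

end

context mv_solution
begin

lemma R_le_l2_const:
  assumes T: "0 < T" "u \<le> T" and e: "(\<integral>\<omega>. (\<xi> \<omega>)\<^sup>2 \<partial>P) \<le> e"
  shows "(\<integral>\<^sup>+\<omega>. R\<^sub>X 2 u \<omega> \<partial>P) \<le> ennreal ((l2_const T e)\<^sup>2)"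
proof -
  have e0: "0 \<le> (\<integral>\<omega>. (\<xi> \<omega>)\<^sup>2 \<partial>P)" by simp
  have "(\<integral>\<^sup>+\<omega>. R\<^sub>X 2 u \<omega> \<partial>P) \<le> (\<integral>\<^sup>+\<omega>. R\<^sub>X 2 T \<omega> \<partial>P)"
    unfolding R\<^sub>X_def using T by (intro nn_integral_mono running_sup_mono) auto
  also have "\<dots> \<le> ennreal (second_moment_const T * (1 + (\<integral>\<omega>. (\<xi> \<omega>)\<^sup>2 \<partial>P)))"
    by (rule second_moment_bound[OF T(1)])
  also have "\<dots> \<le> ennreal ((l2_const T e)\<^sup>2)"
    unfolding l2_const_def using e order_trans[OF e0 e] second_moment_const_pos[of T] T
    by (subst real_sqrt_pow2) (auto intro!: ennreal_leI mult_left_mono)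
  finally show ?thesis .
qed

lemma K_hoelder:
  assumes T: "0 < T" and e: "(\<integral>\<omega>. (\<xi> \<omega>)\<^sup>2 \<partial>P) \<le> e" and st: "0 \<le> s" "s \<le> t" "t \<le> T"
  shows "\<bar>K t - K s\<bar> \<le> hoelder_const T e * sqrt (t - s)"
proof (cases "s = t")
  case False
  hence st': "s < t" using st by simp
  have e0: "0 \<le> e" using order_trans[OF _ e, of 0] by simp
  define \<Lambda> where "\<Lambda> = l2_const T e"
  have \<Lambda>: "0 < \<Lambda>" unfolding \<Lambda>_def by (rule l2_const_pos[OF T e0])
  have bd: "0 \<le> bdg_const 2" by (rule bdg_const_nonneg) simp
  define B1 where "B1 = (b\<^sub>0 + 2 * L * \<Lambda>) * (t - s)"
  define B2 where "B2 = 4 * (s\<^sub>0 + L * \<Lambda>)\<^sup>2 * (t - s)"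
  have sL: "0 < s\<^sub>0 + L * \<Lambda>" using s0_nonneg L_pos \<Lambda> by (intro add_nonneg_pos) auto
  have bL: "0 \<le> b\<^sub>0 + 2 * L * \<Lambda>" using b0_nonneg L_pos \<Lambda> by simp
  have B1: "0 \<le> B1" using bL st by (simp add: B1_def)
  have B2: "0 < B2" using sL st' by (simp add: B2_def)
  have int: "(\<integral>\<^sup>+u\<in>{s..r}. ennreal c \<partial>lborel) \<le> ennreal (c * (t - s))" if "0 \<le> c" "s < r" "r \<le> t" for c r
  proof -
    have "(\<integral>\<^sup>+u\<in>{s..r}. ennreal c \<partial>lborel) = ennreal (c * (r - s))"
      using that by (subst nn_integral_cmult_indicator) (auto simp: ennreal_mult)
    also have "\<dots> \<le> ennreal (c * (t - s))" using that by (intro ennreal_leI mult_left_mono) auto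
    finally show ?thesis .
  qed
  have "K t - K s \<le> M / m * (B1 + sqrt ((bdg_const 2 + 1) * B2))"
  proof (rule K_increment[OF st(1,2)])
    fix r assume r: "s < r" "r \<le> t"
    show "(\<integral>\<^sup>+\<omega>. ennreal \<bar>X r \<omega> - X s \<omega> - (K r - K s)\<bar> \<partial>P) \<le> ennreal (B1 + sqrt ((bdg_const 2 + 1) * B2))"
    proof (rule increment_L1[OF st(1) r(1), where \<rho>="\<lambda>_. \<Lambda>"])
      show "(\<integral>\<^sup>+\<omega>. R\<^sub>X 2 u \<omega> \<partial>P) \<le> ennreal (\<Lambda>\<^sup>2)" if "u \<le> r" for u
        unfolding \<Lambda>_def using that r st by (intro R_le_l2_const[OF T _ e]) simp
      show "(\<integral>\<^sup>+u\<in>{s..r}. ennreal (b\<^sub>0 + 2 * L * \<Lambda>) \<partial>lborel) \<le> ennreal B1"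
        unfolding B1_def by (rule int[OF bL r])
      show "(\<integral>\<^sup>+u\<in>{s..r}. ennreal (4 * (s\<^sub>0 + L * \<Lambda>)\<^sup>2) \<partial>lborel) \<le> ennreal B2"
        unfolding B2_def by (rule int[OF _ r]) simp
    qed (use \<Lambda> B1 B2 in auto)
  qed (use B1 B2 bd in auto)
  also have "\<dots> \<le> M / m * (((b\<^sub>0 + 2 * L * \<Lambda>) * sqrt T) * sqrt (t - s) +
      (sqrt (bdg_const 2 + 1) * (2 * (s\<^sub>0 + L * \<Lambda>))) * sqrt (t - s))"
  proof (intro mult_left_mono add_mono)
    have "t - s = sqrt (t - s) * sqrt (t - s)" using st by simp
    also have "\<dots> \<le> sqrt T * sqrt (t - s)" using st by (intro mult_right_mono) auto
    finally show "B1 \<le> (b\<^sub>0 + 2 * L * \<Lambda>) * sqrt T * sqrt (t - s)"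
      unfolding B1_def using bL by (simp add: mult.assoc mult_left_mono)
    have "sqrt B2 = 2 * (s\<^sub>0 + L * \<Lambda>) * sqrt (t - s)"
      unfolding B2_def using sL by (simp add: real_sqrt_mult)
    thus "sqrt ((bdg_const 2 + 1) * B2) \<le> sqrt (bdg_const 2 + 1) * (2 * (s\<^sub>0 + L * \<Lambda>)) * sqrt (t - s)"
      by (simp add: real_sqrt_mult mult.assoc)
  qed (use M_pos m_pos in auto)
  also have "\<dots> = hoelder_const T e * sqrt (t - s)"
    by (simp add: hoelder_const_def \<Lambda>_def algebra_simps)
  finally show ?thesis using K_le[OF st(1,2)] by simp
qed simp

lemma coefficients_bound_l2:
  assumes T: "0 < T" and u: "0 \<le> u" "u \<le> T"
  defines "\<Lambda> \<equiv> l2_const T (\<integral>\<omega>. (\<xi> \<omega>)\<^sup>2 \<partial>P)"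
  shows "\<bar>b x (\<mu> u)\<bar> \<le> (b\<^sub>0 + L * \<Lambda>) + L * \<bar>x\<bar>" "\<bar>\<sigma> x (\<mu> u)\<bar> \<le> (s\<^sub>0 + L * \<Lambda>) + L * \<bar>x\<bar>"
proof -
  have \<Lambda>: "0 \<le> \<Lambda>" unfolding \<Lambda>_def using l2_const_pos[OF T] by (simp add: less_imp_le)
  have "(\<integral>\<^sup>+\<omega>. ennreal ((X u \<omega>)\<^sup>2) \<partial>P) \<le> ennreal (\<Lambda>\<^sup>2)"
    unfolding \<Lambda>_def by (rule order_trans[OF X_second_moment_le_R[OF u T] R_le_l2_const[OF T order_refl order_refl]])
  from coefficients_bound[OF u(1) \<Lambda> this]
  show "\<bar>b x (\<mu> u)\<bar> \<le> (b\<^sub>0 + L * \<Lambda>) + L * \<bar>x\<bar>" "\<bar>\<sigma> x (\<mu> u)\<bar> \<le> (s\<^sub>0 + L * \<Lambda>) + L * \<bar>x\<bar>" .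
qed

text \<open>Once second moments are known, the law only contributes the constant \<Lambda> to the
  growth of the coefficients, and \<open>moment_bound\<close> applies at once. As \<Lambda> involves
  the second moment of \<xi>, \<open>second_moment_powr_le\<close> is what makes the final bound
  linear in the p-th moment.\<close>

lemma p_moment_bound:
  assumes T: "0 < T" and p: "2 \<le> p" and ip: "integrable P (\<lambda>\<omega>. \<bar>\<xi> \<omega>\<bar> powr p)"
  shows "(\<integral>\<^sup>+\<omega>. R\<^sub>X p T \<omega> \<partial>P) \<le> ennreal (p_moment_const T p * (1 + (\<integral>\<omega>. \<bar>\<xi> \<omega>\<bar> powr p \<partial>P)))"
proof -
  define E where "E = (\<integral>\<omega>. \<bar>\<xi> \<omega>\<bar> powr p \<partial>P)"
  define e where "e = (\<integral>\<omega>. (\<xi> \<omega>)\<^sup>2 \<partial>P)"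
  define \<Lambda> where "\<Lambda> = l2_const T e"
  have E: "0 \<le> E" and e0: "0 \<le> e" by (auto simp: E_def e_def)
  have i2: "integrable P (\<lambda>\<omega>. (\<xi> \<omega>)\<^sup>2)" using initial by (simp add: admissible_initial_def)
  have eE: "e powr (p / 2) \<le> E" unfolding e_def E_def by (rule second_moment_powr_le[OF p i2 ip])
  have \<Lambda>: "0 < \<Lambda>" unfolding \<Lambda>_def by (rule l2_const_pos[OF T e0])
  define k where "k = sqrt (bdg_const 2 + 1)"
  have k: "0 \<le> k" using bdg_const_nonneg[of 2] by (simp add: k_def)
  define c where "c = (second_moment_const T * 2) powr (p / 2)"
  define u where "u = M / m * (b\<^sub>0 * sqrt T + k * (2 * s\<^sub>0)) * sqrt T + b\<^sub>0 * T"
  define v where "v = M / m * (2 * L * sqrt T + k * (2 * L)) * sqrt T + L * T"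
  have Mm: "0 \<le> M / m" using M_pos m_pos by simp
  have u: "0 \<le> u" and v: "0 \<le> v"
    unfolding u_def v_def
    by (intro add_nonneg_nonneg mult_nonneg_nonneg Mm k b0_nonneg s0_nonneg; use L_pos T in simp)+
  have \<Lambda>p: "\<Lambda> powr p \<le> c * (1 + E)"
  proof -
    have C: "0 < second_moment_const T" using T by (intro second_moment_const_pos) simp
    have "\<Lambda> powr p = (second_moment_const T * (1 + e)) powr (p / 2)"
      unfolding \<Lambda>_def l2_const_def using C e0 by (simp add: powr_half_sqrt[symmetric] powr_powr)
    also have "\<dots> = second_moment_const T powr (p / 2) * (1 + e) powr (p / 2)"
      using C e0 by (simp add: powr_mult)
    also have "\<dots> \<le> second_moment_const T powr (p / 2) * (2 powr (p / 2) * (1 powr (p / 2) + e powr (p / 2)))"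
      using e0 p by (intro mult_left_mono powr_add_le) auto
    also have "\<dots> \<le> second_moment_const T powr (p / 2) * (2 powr (p / 2) * (1 + E))"
      using eE by (intro mult_left_mono) auto
    also have "\<dots> = c * (1 + E)" using C by (simp add: c_def powr_mult)
    finally show ?thesis .
  qed
  define \<kappa> where "\<kappa> = (b\<^sub>0 + L * \<Lambda>) * T"
  define G where "G = (s\<^sub>0 + L * \<Lambda>) powr p * T"
  have \<kappa>: "0 \<le> \<kappa>" using b0_nonneg L_pos \<Lambda> T by (simp add: \<kappa>_def)
  have sL: "0 \<le> s\<^sub>0 + L * \<Lambda>" and bL: "0 \<le> b\<^sub>0 + L * \<Lambda>" using s0_nonneg b0_nonneg L_pos \<Lambda> by auto
  have G: "0 \<le> G" using T by (simp add: G_def)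
  have K0: "0 \<le> K T" using T by (intro K_nonneg) simp
  have int: "(\<integral>\<^sup>+u\<in>{0..T}. ennreal c \<partial>lborel) \<le> ennreal (c * T)" if "0 \<le> c" for c
    using T that by (subst nn_integral_cmult_indicator) (auto simp: ennreal_mult)
  note coef = coefficients_bound_l2[OF T, folded e_def, folded \<Lambda>_def]
  have nE: "(\<integral>\<^sup>+\<omega>. ennreal (\<bar>\<xi> \<omega>\<bar> powr p) \<partial>P) = ennreal E"
    unfolding E_def by (rule nn_integral_eq_integral[OF ip]) simp
  have "(\<integral>\<^sup>+\<omega>. R\<^sub>X p T \<omega> \<partial>P) \<le>
     ennreal (moment_const p T (2 * exp (2 * L * T)) L * (E + (K T + \<kappa>) powr p + G))"
    unfolding R\<^sub>X_def
  proof (rule moment_bound[OF X_adapted X_continuous \<xi>_measurable ito ito_integral_0[OF ito] p T order_refl, where \<gamma>="\<lambda>_. s\<^sub>0 + L * \<Lambda>"])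
    show "AE \<omega> in P. \<forall>s J. 0 < s \<longrightarrow> s \<le> T \<longrightarrow> 0 \<le> J \<longrightarrow> (\<forall>r\<in>\<rat> \<inter> {0..<s}. \<bar>I r \<omega>\<bar> \<le> J) \<longrightarrow>
        (\<forall>r\<in>{0..s}. \<bar>X r \<omega>\<bar> \<le> 2 * exp (2 * L * T) * (\<bar>\<xi> \<omega>\<bar> + (K T + \<kappa>) + J))"
      by (rule path_bound[OF T order_refl, where \<beta>="\<lambda>_. b\<^sub>0 + L * \<Lambda>"])
         (use coef(1) \<kappa> int[OF bL] in \<open>auto simp: \<kappa>_def\<close>)
    show "\<bar>\<sigma> (X s \<omega>) (law P (X s))\<bar> \<le> s\<^sub>0 + L * \<Lambda> + L * \<bar>X s \<omega>\<bar>" if "0 \<le> s" "s \<le> T" for s \<omega>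
      using coef(2)[of s "X s \<omega>"] that by (simp add: \<mu>_def)
    show "(\<integral>\<^sup>+s\<in>{0..T}. ennreal ((s\<^sub>0 + L * \<Lambda>) powr p) \<partial>lborel) \<le> ennreal G"
      unfolding G_def by (rule int) simp
  qed (use L_pos K0 \<kappa> G E nE sL in auto)
  also have "\<dots> \<le> ennreal (p_moment_const T p * (1 + E))"
  proof (rule ennreal_leI)
    have grow: "x \<le> x * (1 + E)" if "0 \<le> x" for x
      using that E by (simp add: distrib_left)
    have "K T \<le> hoelder_const T e * sqrt T"
      using K_hoelder[OF T order_refl order_refl _ order_refl] T K0 by (simp add: K_0 e_def)
    also have "\<dots> = (M / m * ((b\<^sub>0 + 2 * L * \<Lambda>) * sqrt T + k * (2 * (s\<^sub>0 + L * \<Lambda>)))) * sqrt T"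
      unfolding hoelder_const_def k_def \<Lambda>_def ..
    finally have "K T + \<kappa> \<le> u + v * \<Lambda>"
      unfolding \<kappa>_def u_def v_def by (simp add: algebra_simps)
    hence "(K T + \<kappa>) powr p \<le> (u + v * \<Lambda>) powr p"
      using K0 \<kappa> p by (intro powr_mono2) auto
    also have "\<dots> \<le> 2 powr p * (u powr p + (v * \<Lambda>) powr p)"
      using u v \<Lambda> p by (intro powr_add_le) auto
    also have "\<dots> = 2 powr p * (u powr p + v powr p * \<Lambda> powr p)" using v \<Lambda> by (simp add: powr_mult)
    also have "\<dots> \<le> 2 powr p * (u powr p * (1 + E) + v powr p * (c * (1 + E)))"
      using \<Lambda>p E by (intro mult_left_mono add_mono) (auto intro: grow)
    finally have 1: "(K T + \<kappa>) powr p \<le> 2 powr p * (u powr p + v powr p * c) * (1 + E)"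
      by (simp add: algebra_simps)
    have "G \<le> 2 powr p * (s\<^sub>0 powr p + (L * \<Lambda>) powr p) * T"
      unfolding G_def using s0_nonneg L_pos \<Lambda> p T by (intro mult_right_mono powr_add_le) auto
    also have "\<dots> = 2 powr p * (s\<^sub>0 powr p + L powr p * \<Lambda> powr p) * T" using L_pos \<Lambda> by (simp add: powr_mult)
    also have "\<dots> \<le> 2 powr p * (s\<^sub>0 powr p * (1 + E) + L powr p * (c * (1 + E))) * T"
      using \<Lambda>p E T by (intro mult_right_mono mult_left_mono add_mono) (auto intro: grow)
    finally have 2: "G \<le> (2 powr p * (s\<^sub>0 powr p + L powr p * c) * T) * (1 + E)"
      by (simp add: algebra_simps)
    have "E + (K T + \<kappa>) powr p + G \<le>
       (1 + 2 powr p * (u powr p + v powr p * c) + 2 powr p * (s\<^sub>0 powr p + L powr p * c) * T) * (1 + E)"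
      unfolding distrib_right[of _ _ "1 + E"] using 1 2 by simp
    hence "moment_const p T (2 * exp (2 * L * T)) L * (E + (K T + \<kappa>) powr p + G) \<le>
       moment_const p T (2 * exp (2 * L * T)) L * ((1 + 2 powr p * (u powr p + v powr p * c) + 2 powr p * (s\<^sub>0 powr p + L powr p * c) * T) * (1 + E))"
      using moment_const_nonneg[OF p] by (rule mult_left_mono)
    also have "\<dots> \<le> p_moment_const T p * (1 + E)"
      unfolding p_moment_const_def Let_def k_def[symmetric] c_def[symmetric] u_def[symmetric] v_def[symmetric]
      using E by (simp add: distrib_right[of _ 1 "1 + E"] mult.assoc)
    finally show "moment_const p T (2 * exp (2 * L * T)) L * (E + (K T + \<kappa>) powr p + G) \<le> p_moment_const T p * (1 + E)" .
  qed
  finally show ?thesis by (simp add: E_def)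
qed

text \<open>Passes from the uncountable supremum of the final statement to the one over rational
  times, for which the estimates are made.\<close>

lemma SUP_X_le_R:
  assumes "0 < p" "0 < T"
  shows "(\<integral>\<^sup>+\<omega>. (SUP t\<in>{0..T}. ennreal (\<bar>X t \<omega>\<bar> powr p)) \<partial>P) \<le> (\<integral>\<^sup>+\<omega>. R\<^sub>X p T \<omega> \<partial>P)"
  using X_le_R by (intro nn_integral_mono_AE) (auto elim!: eventually_mono intro!: SUP_least simp: assms)

text \<open>With d = t - s, the drift contributes d^p, at most T^(p/2) d^(p/2); the stochastic
  integral contributes d^(p/2 - 1) times an integral over a length d; and K contributes d^(p/2) by
  \<open>K_hoelder\<close>.\<close>

lemma increment_moment:
  assumes T: "0 < T" and p: "2 \<le> p" and ip: "integrable P (\<lambda>\<omega>. \<bar>\<xi> \<omega>\<bar> powr p)"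
  obtains C where "0 < C" "\<And>s t. 0 \<le> s \<Longrightarrow> s \<le> t \<Longrightarrow> t \<le> T \<Longrightarrow>
    (\<integral>\<^sup>+\<omega>. ennreal (\<bar>X t \<omega> - X s \<omega>\<bar> powr p) \<partial>P) \<le> ennreal (C * (t - s) powr (p / 2))"
proof -
  define e where "e = (\<integral>\<omega>. (\<xi> \<omega>)\<^sup>2 \<partial>P)"
  define \<Lambda> where "\<Lambda> = l2_const T e"
  have e0: "0 \<le> e" by (simp add: e_def)
  have \<Lambda>: "0 < \<Lambda>" unfolding \<Lambda>_def by (rule l2_const_pos[OF T e0])
  define S where "S = max 0 (p_moment_const T p * (1 + (\<integral>\<omega>. \<bar>\<xi> \<omega>\<bar> powr p \<partial>P)))"
  have S: "0 \<le> S" by (simp add: S_def)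
  have RS: "(\<integral>\<^sup>+\<omega>. R\<^sub>X p T \<omega> \<partial>P) \<le> ennreal S"
    using p_moment_bound[OF T p ip] by (rule order_trans) (auto simp: S_def intro!: ennreal_leI)
  define A0 where "A0 = b\<^sub>0 + L * \<Lambda>"
  define A1 where "A1 = s\<^sub>0 + L * \<Lambda>"
  have A0: "0 \<le> A0" and A1: "0 \<le> A1" using b0_nonneg s0_nonneg L_pos \<Lambda> by (auto simp: A0_def A1_def)
  note coef = coefficients_bound_l2[OF T, folded e_def, folded \<Lambda>_def, folded A0_def A1_def]
  define c0 where "c0 = 2 powr p * (A0 powr p + L powr p * S)"
  define c1 where "c1 = 2 powr p * (A1 powr p + L powr p * S)"
  define H where "H = hoelder_const T e"
  have H: "0 \<le> H" unfolding H_def by (rule hoelder_const_nonneg[OF T e0])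
  define C where "C = 3 powr p * (T powr (p / 2) * c0 + bdg_const p * c1 + H powr p) + 1"
  have c: "0 \<le> c0" "0 \<le> c1" by (use S in \<open>auto simp: c0_def c1_def\<close>)
  have bp: "0 \<le> bdg_const p" by (rule bdg_const_nonneg[OF p])
  have C: "0 < C" using c bp by (auto simp: C_def intro!: add_nonneg_pos)
  have p0: "0 < p" using p by simp
  have "(\<integral>\<^sup>+\<omega>. ennreal (\<bar>X t \<omega> - X s \<omega>\<bar> powr p) \<partial>P) \<le> ennreal (C * (t - s) powr (p / 2))"
    if st: "0 \<le> s" "s \<le> t" "t \<le> T" for s t
  proof (cases "s = t")
    case False
    hence lt: "s < t" using st by simp
    define d where "d = t - s"
    have d: "0 < d" "d \<le> T" using lt st by (auto simp: d_def)
    have t0: "0 \<le> t" using st by simp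
    define dp where "dp = d powr (p / 2)"
    have dp: "0 \<le> dp" by (simp add: dp_def)
    have [measurable]: "I t \<in> borel_measurable P" "I s \<in> borel_measurable P"
      using I_measurable[OF t0] I_measurable[OF st(1)] by auto
    have HI: "(\<integral>\<^sup>+\<omega>. ennreal (\<bar>I t \<omega> - I s \<omega>\<bar> powr p) \<partial>P) \<le> ennreal (bdg_const p * c1 * dp)"
    proof -
      have "(\<integral>\<^sup>+\<omega>. ennreal (\<bar>I t \<omega> - I s \<omega>\<bar> powr p) \<partial>P) \<le> ennreal (bdg_const p * d powr (p / 2 - 1)) *
        (\<integral>\<^sup>+u\<in>{s..t}. (\<integral>\<^sup>+\<omega>. ennreal (\<bar>\<sigma> (X u \<omega>) (law P (X u))\<bar> powr p) \<partial>P) \<partial>lborel)"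
        unfolding d_def by (rule ito_increment_moment[OF ito st(1) lt p])
      also have "(\<integral>\<^sup>+u\<in>{s..t}. (\<integral>\<^sup>+\<omega>. ennreal (\<bar>\<sigma> (X u \<omega>) (law P (X u))\<bar> powr p) \<partial>P) \<partial>lborel) \<le>
        (\<integral>\<^sup>+u. ennreal c1 * indicator {s..t} u \<partial>lborel)"
      proof (rule nn_integral_mono)
        fix u
        show "(\<integral>\<^sup>+\<omega>. ennreal (\<bar>\<sigma> (X u \<omega>) (law P (X u))\<bar> powr p) \<partial>P) * indicator {s..t} u \<le> ennreal c1 * indicator {s..t} u"
        proof (cases "u \<in> {s..t}")
          case True
          hence u: "0 \<le> u" "u \<le> T" using st by auto
          have "(\<integral>\<^sup>+\<omega>. ennreal (\<bar>\<sigma> (X u \<omega>) (law P (X u))\<bar> powr p) \<partial>P) \<le>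
             (\<integral>\<^sup>+\<omega>. ennreal (2 powr p) * (ennreal (A1 powr p) + ennreal (L powr p) * R\<^sub>X p T \<omega>) \<partial>P)"
          proof (rule nn_integral_mono_AE)
            show "AE \<omega> in P. ennreal (\<bar>\<sigma> (X u \<omega>) (law P (X u))\<bar> powr p) \<le>
               ennreal (2 powr p) * (ennreal (A1 powr p) + ennreal (L powr p) * R\<^sub>X p T \<omega>)"
              using X_le_R
            proof eventually_elim
              case (elim \<omega>)
              have "\<bar>\<sigma> (X u \<omega>) (\<mu> u)\<bar> powr p \<le> (A1 + L * \<bar>X u \<omega>\<bar>) powr p"
                using coef(2)[OF u] p0 by (intro powr_mono2) auto
              also have "\<dots> \<le> 2 powr p * (A1 powr p + (L * \<bar>X u \<omega>\<bar>) powr p)"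
                using A1 L_pos p0 by (intro powr_add_le) auto
              also have "\<dots> = 2 powr p * (A1 powr p + L powr p * \<bar>X u \<omega>\<bar> powr p)"
                using L_pos by (simp add: powr_mult)
              finally have "ennreal (\<bar>\<sigma> (X u \<omega>) (\<mu> u)\<bar> powr p) \<le> ennreal (2 powr p * (A1 powr p + L powr p * \<bar>X u \<omega>\<bar> powr p))"
                by (rule ennreal_leI)
              also have "\<dots> = ennreal (2 powr p) * (ennreal (A1 powr p) + ennreal (L powr p) * ennreal (\<bar>X u \<omega>\<bar> powr p))"
                by (simp add: ennreal_mult)
              also have "\<dots> \<le> ennreal (2 powr p) * (ennreal (A1 powr p) + ennreal (L powr p) * R\<^sub>X p T \<omega>)"
                using elim p0 u T by (intro mult_left_mono add_left_mono) auto
              finally show ?case by (simp add: \<mu>_def)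
            qed
          qed
          also have "\<dots> = ennreal (2 powr p) * (ennreal (A1 powr p) + ennreal (L powr p) * (\<integral>\<^sup>+\<omega>. R\<^sub>X p T \<omega> \<partial>P))"
            by (simp add: nn_integral_add nn_integral_cmult emeasure_space_1)
          also have "\<dots> \<le> ennreal (2 powr p) * (ennreal (A1 powr p) + ennreal (L powr p) * ennreal (S))"
            by (intro mult_left_mono add_left_mono RS) auto
          also have "\<dots> = ennreal c1"
            using S by (simp add: c1_def ennreal_mult)
          finally show ?thesis using True by simp
        qed simp
      qed
      also have "\<dots> = ennreal (c1 * d)"
        using c st by (subst nn_integral_cmult_indicator) (auto simp: d_def ennreal_mult)
      also have "ennreal (bdg_const p * d powr (p / 2 - 1)) * ennreal (c1 * d) = ennreal (bdg_const p * c1 * dp)"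
      proof -
        have "d powr (p / 2 - 1) * d = dp" using d powr_add[of d "p / 2 - 1" 1] by (simp add: dp_def)
        hence eq: "bdg_const p * c1 * dp = bdg_const p * d powr (p / 2 - 1) * (c1 * d)"
          by (simp add: mult_ac flip: \<open>d powr (p / 2 - 1) * d = dp\<close>)
        show ?thesis unfolding eq using bp by (intro ennreal_mult'[symmetric]) simp
      qed
      finally show ?thesis by (simp add: mult_left_mono)
    qed
    have path: "AE \<omega> in P. ennreal (\<bar>X t \<omega> - X s \<omega>\<bar> powr p) \<le>
      ennreal (3 powr p) * (ennreal (d powr p * 2 powr p) * (ennreal (A0 powr p) + ennreal (L powr p) * R\<^sub>X p T \<omega>) +
         (ennreal (\<bar>I t \<omega> - I s \<omega>\<bar> powr p) + ennreal (H powr p * dp)))"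
      using X_le_R drift_difference
    proof eventually_elim
      case (elim \<omega>)
      show ?case
      \<comment> \<open>Where the supremum is finite, its p-th root y bounds the path on [0, T].
        Elsewhere the right side is infinite, as L and d are positive.\<close>
      proof (cases "R\<^sub>X p T \<omega>")
        case (real z)
        define v where "v = (LINT u:{s<..t}|lborel. b (X u \<omega>) (\<mu> u))"
        define y where "y = z powr (1 / p)"
        have y: "0 \<le> y" "y powr p = z" using real p0 by (auto simp: y_def powr_powr)
        have Xy: "\<bar>X u \<omega>\<bar> \<le> y" if u: "0 \<le> u" "u \<le> T" for u
        proof -
          have "ennreal (\<bar>X u \<omega>\<bar> powr p) \<le> R\<^sub>X p T \<omega>" using elim(1) u T p0 by auto
          hence "\<bar>X u \<omega>\<bar> powr p \<le> y powr p" using real y by (simp add: ennreal_le_iff)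
          thus ?thesis using powr_less_mono2[OF p0 y(1), of "\<bar>X u \<omega>\<bar>"] by (meson not_le)
        qed
        have Ay: "0 \<le> A0 + L * y" using A0 L_pos y by simp
        have "ennreal \<bar>v\<bar> \<le> (\<integral>\<^sup>+u\<in>{s<..t}. ennreal \<bar>b (X u \<omega>) (\<mu> u)\<bar> \<partial>lborel)"
          unfolding v_def using elim(2) st by auto
        also have "\<dots> \<le> (\<integral>\<^sup>+u. ennreal (A0 + L * y) * indicator {s<..t} u \<partial>lborel)"
        proof (rule nn_integral_mono)
          fix u
          show "ennreal \<bar>b (X u \<omega>) (\<mu> u)\<bar> * indicator {s<..t} u \<le> ennreal (A0 + L * y) * indicator {s<..t} u"
          proof (cases "u \<in> {s<..t}")
            case True
            hence u: "0 \<le> u" "u \<le> T" using st by auto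
            have "\<bar>b (X u \<omega>) (\<mu> u)\<bar> \<le> A0 + L * \<bar>X u \<omega>\<bar>" by (rule coef(1)[OF u])
            also have "\<dots> \<le> A0 + L * y" using Xy[OF u] L_pos by (intro add_left_mono mult_left_mono) auto
            finally show ?thesis by (intro mult_right_mono ennreal_leI) auto
          qed simp
        qed
        also have "\<dots> = ennreal ((A0 + L * y) * d)"
          using Ay st by (subst nn_integral_cmult_indicator) (auto simp: d_def ennreal_mult)
        finally have v: "\<bar>v\<bar> \<le> (A0 + L * y) * d" using Ay d by (subst (asm) ennreal_le_iff) auto
        have vp: "\<bar>v\<bar> powr p \<le> d powr p * 2 powr p * (A0 powr p + L powr p * z)"
        proof -
          have "\<bar>v\<bar> powr p \<le> ((A0 + L * y) * d) powr p" using v p0 by (intro powr_mono2) auto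
          also have "\<dots> = (A0 + L * y) powr p * d powr p" using Ay d by (simp add: powr_mult)
          also have "\<dots> \<le> (2 powr p * (A0 powr p + (L * y) powr p)) * d powr p"
            using A0 L_pos y p0 by (intro mult_right_mono powr_add_le) auto
          also have "\<dots> = d powr p * 2 powr p * (A0 powr p + L powr p * z)"
            using L_pos y by (simp add: powr_mult mult_ac)
          finally show ?thesis .
        qed
        have K: "\<bar>K t - K s\<bar> powr p \<le> H powr p * dp"
        proof -
          have "\<bar>K t - K s\<bar> \<le> H * sqrt d"
            unfolding H_def d_def by (rule K_hoelder[OF T _ st]) (simp add: e_def)
          hence "\<bar>K t - K s\<bar> powr p \<le> (H * sqrt d) powr p" using p0 by (intro powr_mono2) auto
          also have "\<dots> = H powr p * dp"
            using H d by (simp add: powr_mult dp_def powr_half_sqrt[symmetric] powr_powr)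
          finally show ?thesis .
        qed
        have "X t \<omega> - X s \<omega> = v + (I t \<omega> - I s \<omega>) + (K t - K s)"
        proof -
          have "X t \<omega> - X s \<omega> - (K t - K s) = v + (I t \<omega> - I s \<omega>)"
            unfolding v_def using elim(2) st by auto
          thus ?thesis by simp
        qed
        hence "\<bar>X t \<omega> - X s \<omega>\<bar> powr p \<le> (\<bar>v\<bar> + \<bar>I t \<omega> - I s \<omega>\<bar> + \<bar>K t - K s\<bar>) powr p"
          using p0 by (intro powr_mono2) auto
        also have "\<dots> \<le> 3 powr p * (\<bar>v\<bar> powr p + \<bar>I t \<omega> - I s \<omega>\<bar> powr p + \<bar>K t - K s\<bar> powr p)"
          using p0 by (intro powr_add3_le) auto
        also have "\<dots> \<le> 3 powr p * (d powr p * 2 powr p * (A0 powr p + L powr p * z) +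
            (\<bar>I t \<omega> - I s \<omega>\<bar> powr p + H powr p * dp))"
          using vp K by (intro mult_left_mono) auto
        finally have "ennreal (\<bar>X t \<omega> - X s \<omega>\<bar> powr p) \<le> ennreal (3 powr p * (d powr p * 2 powr p * (A0 powr p + L powr p * z) +
            (\<bar>I t \<omega> - I s \<omega>\<bar> powr p + H powr p * dp)))" by (rule ennreal_leI)
        also have "\<dots> = ennreal (3 powr p) * (ennreal (d powr p * 2 powr p) * (ennreal (A0 powr p) + ennreal (L powr p) * ennreal z) +
            (ennreal (\<bar>I t \<omega> - I s \<omega>\<bar> powr p) + ennreal (H powr p * dp)))"
          using real dp by (simp add: ennreal_mult)
        finally show ?thesis using real by simp
      next
        case top
        have "ennreal (L powr p) * R\<^sub>X p T \<omega> = \<top>" using top L_pos by (simp add: ennreal_mult_top)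
        thus ?thesis using d by (simp add: ennreal_mult_top)
      qed
    qed
    have "(\<integral>\<^sup>+\<omega>. ennreal (\<bar>X t \<omega> - X s \<omega>\<bar> powr p) \<partial>P) \<le>
      (\<integral>\<^sup>+\<omega>. ennreal (3 powr p) * (ennreal (d powr p * 2 powr p) * (ennreal (A0 powr p) + ennreal (L powr p) * R\<^sub>X p T \<omega>) +
         (ennreal (\<bar>I t \<omega> - I s \<omega>\<bar> powr p) + ennreal (H powr p * dp))) \<partial>P)"
      by (rule nn_integral_mono_AE[OF path])
    also have "\<dots> = ennreal (3 powr p) * (ennreal (d powr p * 2 powr p) * (ennreal (A0 powr p) + ennreal (L powr p) * (\<integral>\<^sup>+\<omega>. R\<^sub>X p T \<omega> \<partial>P)) +
         ((\<integral>\<^sup>+\<omega>. ennreal (\<bar>I t \<omega> - I s \<omega>\<bar> powr p) \<partial>P) + ennreal (H powr p * dp)))"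
      by (simp add: nn_integral_add nn_integral_cmult emeasure_space_1)
    also have "\<dots> \<le> ennreal (3 powr p) * (ennreal (d powr p * 2 powr p) * (ennreal (A0 powr p) + ennreal (L powr p) * ennreal (S)) +
         (ennreal (bdg_const p * c1 * dp) + ennreal (H powr p * dp)))"
      by (intro mult_left_mono add_mono order_refl RS HI) auto
    also have "\<dots> = ennreal (3 powr p * (d powr p * c0 + (bdg_const p * c1 * dp + H powr p * dp)))"
      using dp c bp S by (simp add: c0_def ennreal_mult mult.assoc)
    also have "\<dots> \<le> ennreal (C * dp)"
    proof (rule ennreal_leI)
      have "d powr p = d powr (p / 2) * dp" by (simp add: dp_def powr_add[symmetric])
      also have "\<dots> \<le> T powr (p / 2) * dp"
        using d p0 dp by (intro mult_right_mono powr_mono2) auto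
      finally have "d powr p * c0 \<le> T powr (p / 2) * dp * c0" using c by (intro mult_right_mono) auto
      hence "3 powr p * (d powr p * c0 + (bdg_const p * c1 * dp + H powr p * dp)) \<le>
         3 powr p * (T powr (p / 2) * dp * c0 + (bdg_const p * c1 * dp + H powr p * dp))"
        by (intro mult_left_mono) auto
      also have "\<dots> \<le> C * dp" using dp by (simp add: C_def algebra_simps)
      finally show "3 powr p * (d powr p * c0 + (bdg_const p * c1 * dp + H powr p * dp)) \<le> C * dp" .
    qed
    finally show ?thesis by (simp add: dp_def d_def)
  qed (use p in simp)
  with C show ?thesis by (rule that)
qed

text \<open>\<xi> is square integrable, so the case p = 2 is available. Comparing \<bar>y\<bar> with
  its natural size sqrt d shows that \<bar>y\<bar>^p is at most d^(p/2) plus d^(p/2 - 1) y^2, and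
  both terms have mean of order d^(p/2).\<close>

lemma increment_moment_small:
  assumes T: "0 < T" and p: "1 \<le> p" "p < 2"
  obtains C where "0 < C" "\<And>s t. 0 \<le> s \<Longrightarrow> s \<le> t \<Longrightarrow> t \<le> T \<Longrightarrow>
    (\<integral>\<^sup>+\<omega>. ennreal (\<bar>X t \<omega> - X s \<omega>\<bar> powr p) \<partial>P) \<le> ennreal (C * (t - s) powr (p / 2))"
proof -
  have "integrable P (\<lambda>\<omega>. \<bar>\<xi> \<omega>\<bar> powr 2)" using initial by (simp add: admissible_initial_def)
  from increment_moment[OF T order_refl this] obtain C where C: "0 < C"
    "\<And>s t. 0 \<le> s \<Longrightarrow> s \<le> t \<Longrightarrow> t \<le> T \<Longrightarrow>
      (\<integral>\<^sup>+\<omega>. ennreal (\<bar>X t \<omega> - X s \<omega>\<bar> powr 2) \<partial>P) \<le> ennreal (C * (t - s) powr (2 / 2))" by blast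
  have "(\<integral>\<^sup>+\<omega>. ennreal (\<bar>X t \<omega> - X s \<omega>\<bar> powr p) \<partial>P) \<le> ennreal ((1 + C) * (t - s) powr (p / 2))"
    if st: "0 \<le> s" "s \<le> t" "t \<le> T" for s t
  proof (cases "s = t")
    case False
    define d where "d = t - s"
    have d: "0 < d" using st False by (simp add: d_def)
    have t0: "0 \<le> t" using st by simp
    have [measurable]: "X t \<in> borel_measurable P" "X s \<in> borel_measurable P"
      using X_measurable[OF t0] X_measurable[OF st(1)] by auto
    have y_le: "\<bar>y\<bar> powr p \<le> d powr (p / 2) + d powr (p / 2 - 1) * (\<bar>y\<bar> powr 2)" for y :: real
    proof (cases "\<bar>y\<bar> \<le> sqrt d")
      case True
      have "\<bar>y\<bar> powr p \<le> sqrt d powr p" using True p by (intro powr_mono2) auto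
      also have "\<dots> = d powr (p / 2)" using d by (simp add: powr_half_sqrt[symmetric] powr_powr)
      finally show ?thesis by (simp add: add_increasing2)
    next
      case False
      have "0 < sqrt d" using d by simp
      have "\<bar>y\<bar> powr p = \<bar>y\<bar> powr (p - 2) * \<bar>y\<bar> powr 2" by (simp only: powr_add[symmetric]) simp
      also have "\<dots> \<le> sqrt d powr (p - 2) * \<bar>y\<bar> powr 2"
        using False p \<open>0 < sqrt d\<close> by (intro mult_right_mono powr_mono2') auto
      also have "sqrt d powr (p - 2) = d powr (p / 2 - 1)"
        using d by (simp add: powr_half_sqrt[symmetric] powr_powr diff_divide_distrib)
      finally show ?thesis by (simp add: add_increasing)
    qed
    have "(\<integral>\<^sup>+\<omega>. ennreal (\<bar>X t \<omega> - X s \<omega>\<bar> powr p) \<partial>P) \<le>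
      (\<integral>\<^sup>+\<omega>. ennreal (d powr (p / 2)) + ennreal (d powr (p / 2 - 1)) * ennreal (\<bar>X t \<omega> - X s \<omega>\<bar> powr 2) \<partial>P)"
    proof (rule nn_integral_mono)
      fix \<omega>
      have "ennreal (\<bar>X t \<omega> - X s \<omega>\<bar> powr p) \<le> ennreal (d powr (p / 2) + d powr (p / 2 - 1) * (\<bar>X t \<omega> - X s \<omega>\<bar> powr 2))"
        by (intro ennreal_leI y_le)
      also have "\<dots> = ennreal (d powr (p / 2)) + ennreal (d powr (p / 2 - 1)) * ennreal (\<bar>X t \<omega> - X s \<omega>\<bar> powr 2)"
        by (simp add: ennreal_mult)
      finally show "ennreal (\<bar>X t \<omega> - X s \<omega>\<bar> powr p) \<le> ennreal (d powr (p / 2)) + ennreal (d powr (p / 2 - 1)) * ennreal (\<bar>X t \<omega> - X s \<omega>\<bar> powr 2)" .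
    qed
    also have "\<dots> = ennreal (d powr (p / 2)) + ennreal (d powr (p / 2 - 1)) * (\<integral>\<^sup>+\<omega>. ennreal (\<bar>X t \<omega> - X s \<omega>\<bar> powr 2) \<partial>P)"
      by (simp add: nn_integral_add nn_integral_cmult emeasure_space_1)
    also have "\<dots> \<le> ennreal (d powr (p / 2)) + ennreal (d powr (p / 2 - 1)) * ennreal (C * d)"
      using C(2)[OF st] d by (intro add_left_mono mult_left_mono) (auto simp: d_def)
    also have "\<dots> = ennreal ((1 + C) * d powr (p / 2))"
    proof -
      have "d powr (p / 2 - 1) * (C * d) = C * d powr (p / 2)"
        using d powr_add[of d "p / 2 - 1" 1] by simp
      thus ?thesis using C d by (simp add: ennreal_mult'[symmetric] ennreal_plus[symmetric] distrib_right del: ennreal_plus)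
    qed
    finally show ?thesis by (simp add: d_def)
  qed (use p in simp)
  moreover have "0 < 1 + C" using C by simp
  ultimately show ?thesis by (rule that[rotated])
qed

end

section \<open>The final statement\<close>

lemma (in mckean_vlasov) mv_solutionI:
  assumes "admissible_initial P F h \<xi>" "deterministic_flat_solution P F B \<xi> b \<sigma> h X K"
  obtains I where "mv_solution P F B b \<sigma> h L m M \<xi> X K I"
proof -
  obtain I where "has_ito_integral P F B (\<lambda>s \<omega>. \<sigma> (X s \<omega>) (law P (X s))) I"
    "AE \<omega> in P. \<forall>t\<ge>0. X t \<omega> = \<xi> \<omega> + (LINT s:{0..t}|lborel. b (X s \<omega>) (law P (X s))) + I t \<omega> + K t"
    using assms(2) unfolding deterministic_flat_solution_def by blast
  with assms have "mv_solution P F B b \<sigma> h L m M \<xi> X K I"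
    by unfold_locales (simp_all add: deterministic_flat_solution_def)
  thus ?thesis by (rule that)
qed

text \<open>In the first three parts C is quantified before \<xi>, X and K, which expresses that it
  does not depend on them. For p < 2, and for the regularity of K, it depends on a bound R of the
  second moment of \<xi>: the coefficients see the second moment of the law through the Wasserstein
  distance, and neither T, b, \<sigma>, h nor a lower moment of \<xi> controls it. The expectations
  are \<open>ennreal\<close> integrals, so the first part also makes sense when \<xi> has no p-th
  moment.\<close>

theorem proposition3p5:
  fixes P :: "'a measure" and F :: "real \<Rightarrow> 'a measure" and B :: "real \<Rightarrow> 'a \<Rightarrow> real"
    and b \<sigma> :: "real \<Rightarrow> real measure \<Rightarrow> real" and h :: "real \<Rightarrow> real"
    and L m M T :: real
  assumes "complete_filtered_prob_space P F"
    and "brownian_motion P F B"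
    and "0 < L" and "lipschitz_coefficients L b \<sigma>"
    and "mono h" and "0 < m" and "m \<le> M"
    and "\<And>x y. m * \<bar>x - y\<bar> \<le> \<bar>h x - h y\<bar> \<and> \<bar>h x - h y\<bar> \<le> M * \<bar>x - y\<bar>"
    and "0 < T"
  shows
    "(\<forall>p\<ge>2. \<exists>C>0. \<forall>\<xi> X K.
        admissible_initial P F h \<xi> \<longrightarrow> deterministic_flat_solution P F B \<xi> b \<sigma> h X K \<longrightarrow>
        (\<integral>\<^sup>+\<omega>. (SUP t\<in>{0..T}. ennreal (\<bar>X t \<omega>\<bar> powr p)) \<partial>P)
          \<le> ennreal C * (1 + (\<integral>\<^sup>+\<omega>. ennreal (\<bar>\<xi> \<omega>\<bar> powr p) \<partial>P)))
   \<and> (\<forall>p. 0 < p \<longrightarrow> p < 2 \<longrightarrow> (\<forall>R. \<exists>C>0. \<forall>\<xi> X K.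
        admissible_initial P F h \<xi> \<longrightarrow> (\<integral>\<omega>. (\<xi> \<omega>)\<^sup>2 \<partial>P) \<le> R \<longrightarrow>
        deterministic_flat_solution P F B \<xi> b \<sigma> h X K \<longrightarrow>
        (\<integral>\<^sup>+\<omega>. (SUP t\<in>{0..T}. ennreal (\<bar>X t \<omega>\<bar> powr p)) \<partial>P)
          \<le> ennreal C * (1 + (\<integral>\<^sup>+\<omega>. ennreal (\<bar>\<xi> \<omega>\<bar> powr p) \<partial>P))))
   \<and> (\<forall>R. \<exists>C>0. \<forall>\<xi> X K.
        admissible_initial P F h \<xi> \<longrightarrow> (\<integral>\<omega>. (\<xi> \<omega>)\<^sup>2 \<partial>P) \<le> R \<longrightarrow>
        deterministic_flat_solution P F B \<xi> b \<sigma> h X K \<longrightarrow>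
        (\<forall>s t. 0 \<le> s \<longrightarrow> s \<le> t \<longrightarrow> t \<le> T \<longrightarrow> \<bar>K t - K s\<bar> \<le> C * \<bar>t - s\<bar> powr (1 / 2)))
   \<and> (\<forall>\<xi> X K.
        admissible_initial P F h \<xi> \<longrightarrow> deterministic_flat_solution P F B \<xi> b \<sigma> h X K \<longrightarrow>
        (\<forall>p\<ge>1. integrable P (\<lambda>\<omega>. \<bar>\<xi> \<omega>\<bar> powr p) \<longrightarrow>
          (\<exists>C>0. \<forall>s t. 0 \<le> s \<longrightarrow> s \<le> t \<longrightarrow> t \<le> T \<longrightarrow>
            (\<integral>\<^sup>+\<omega>. ennreal (\<bar>X t \<omega> - X s \<omega>\<bar> powr p) \<partial>P) \<le> ennreal (C * \<bar>t - s\<bar> powr (p / 2)))))"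
proof -
  interpret complete_filtered_prob_space P F by fact
  interpret mckean_vlasov P F B b \<sigma> h L m M
    by unfold_locales (use assms in auto)
  have T: "0 < T" by fact
  show ?thesis
  proof (intro conjI allI impI)
    fix p :: real assume p: "2 \<le> p"
    show "\<exists>C>0. \<forall>\<xi> X K. admissible_initial P F h \<xi> \<longrightarrow> deterministic_flat_solution P F B \<xi> b \<sigma> h X K \<longrightarrow>
        (\<integral>\<^sup>+\<omega>. (SUP t\<in>{0..T}. ennreal (\<bar>X t \<omega>\<bar> powr p)) \<partial>P)
          \<le> ennreal C * (1 + (\<integral>\<^sup>+\<omega>. ennreal (\<bar>\<xi> \<omega>\<bar> powr p) \<partial>P))"
    proof (intro exI[of _ "max 1 (p_moment_const T p)"] conjI allI impI)
      fix \<xi> X K assume "admissible_initial P F h \<xi>" "deterministic_flat_solution P F B \<xi> b \<sigma> h X K"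
      then obtain I where "mv_solution P F B b \<sigma> h L m M \<xi> X K I" by (rule mv_solutionI)
      then interpret mv_solution P F B b \<sigma> h L m M \<xi> X K I .
      let ?C = "max 1 (p_moment_const T p)"
      show "(\<integral>\<^sup>+\<omega>. (SUP t\<in>{0..T}. ennreal (\<bar>X t \<omega>\<bar> powr p)) \<partial>P)
          \<le> ennreal ?C * (1 + (\<integral>\<^sup>+\<omega>. ennreal (\<bar>\<xi> \<omega>\<bar> powr p) \<partial>P))"
      proof (cases "(\<integral>\<^sup>+\<omega>. ennreal (\<bar>\<xi> \<omega>\<bar> powr p) \<partial>P) = \<infinity>")
        case True
        have "ennreal ?C * \<top> = \<top>" by (simp add: ennreal_mult_top max_def)
        thus ?thesis using True by simp
      next
        case False
        have ip: "integrable P (\<lambda>\<omega>. \<bar>\<xi> \<omega>\<bar> powr p)"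
          using False by (intro integrableI_bounded) (auto simp: less_top)
        have "(\<integral>\<^sup>+\<omega>. (SUP t\<in>{0..T}. ennreal (\<bar>X t \<omega>\<bar> powr p)) \<partial>P) \<le> (\<integral>\<^sup>+\<omega>. R\<^sub>X p T \<omega> \<partial>P)"
          using p T by (intro SUP_X_le_R) auto
        also have "\<dots> \<le> ennreal (p_moment_const T p * (1 + (\<integral>\<omega>. \<bar>\<xi> \<omega>\<bar> powr p \<partial>P)))"
          by (rule p_moment_bound[OF T p ip])
        also have "\<dots> \<le> ennreal (?C * (1 + (\<integral>\<omega>. \<bar>\<xi> \<omega>\<bar> powr p \<partial>P)))"
          by (intro ennreal_leI mult_right_mono) auto
        also have "\<dots> = ennreal ?C * (1 + (\<integral>\<^sup>+\<omega>. ennreal (\<bar>\<xi> \<omega>\<bar> powr p) \<partial>P))"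
          using nn_integral_eq_integral[OF ip] by (simp add: ennreal_mult)
        finally show ?thesis .
      qed
    qed simp
  next
    fix p R :: real assume p: "0 < p" "p < 2"
    \<comment> \<open>From \<bar>x\<bar>^p \<le> 1 + x^2 for p < 2: the second moment bound with R
      in place of the moment of \<xi> already bounds the left side.\<close>
    define C where "C = 1 + second_moment_const T * (1 + max 0 R)"
    have C: "0 < C" using second_moment_const_pos[of T] T by (auto simp: C_def intro!: add_pos_nonneg mult_nonneg_nonneg)
    show "\<exists>C>0. \<forall>\<xi> X K. admissible_initial P F h \<xi> \<longrightarrow> (\<integral>\<omega>. (\<xi> \<omega>)\<^sup>2 \<partial>P) \<le> R \<longrightarrow>
        deterministic_flat_solution P F B \<xi> b \<sigma> h X K \<longrightarrow>
        (\<integral>\<^sup>+\<omega>. (SUP t\<in>{0..T}. ennreal (\<bar>X t \<omega>\<bar> powr p)) \<partial>P)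
          \<le> ennreal C * (1 + (\<integral>\<^sup>+\<omega>. ennreal (\<bar>\<xi> \<omega>\<bar> powr p) \<partial>P))"
    proof (intro exI[of _ C] conjI allI impI C)
      fix \<xi> X K assume a: "admissible_initial P F h \<xi>" and \<xi>R: "(\<integral>\<omega>. (\<xi> \<omega>)\<^sup>2 \<partial>P) \<le> R"
        and s: "deterministic_flat_solution P F B \<xi> b \<sigma> h X K"
      obtain I where "mv_solution P F B b \<sigma> h L m M \<xi> X K I" using a s by (rule mv_solutionI)
      then interpret mv_solution P F B b \<sigma> h L m M \<xi> X K I .
      have "(\<integral>\<^sup>+\<omega>. (SUP t\<in>{0..T}. ennreal (\<bar>X t \<omega>\<bar> powr p)) \<partial>P) \<le> (\<integral>\<^sup>+\<omega>. 1 + R\<^sub>X 2 T \<omega> \<partial>P)"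
      proof (rule nn_integral_mono_AE)
        show "AE \<omega> in P. (SUP t\<in>{0..T}. ennreal (\<bar>X t \<omega>\<bar> powr p)) \<le> 1 + R\<^sub>X 2 T \<omega>"
          using X_le_R
        proof eventually_elim
          case (elim \<omega>)
          show ?case
          proof (rule SUP_least)
            fix t assume t: "t \<in> {0..T}"
            have "\<bar>X t \<omega>\<bar> powr p \<le> 1 + \<bar>X t \<omega>\<bar> powr 2"
            proof (cases "\<bar>X t \<omega>\<bar> \<le> 1")
              case True
              hence "\<bar>X t \<omega>\<bar> powr p \<le> 1" using powr_mono2[of p "\<bar>X t \<omega>\<bar>" 1] p by simp
              thus ?thesis by (simp add: add_increasing2)
            next
              case False
              hence "\<bar>X t \<omega>\<bar> powr p \<le> \<bar>X t \<omega>\<bar> powr 2" using p by (intro powr_mono) auto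
              thus ?thesis by simp
            qed
            hence "ennreal (\<bar>X t \<omega>\<bar> powr p) \<le> ennreal (1 + \<bar>X t \<omega>\<bar> powr 2)" by (rule ennreal_leI)
            also have "\<dots> = 1 + ennreal (\<bar>X t \<omega>\<bar> powr 2)" by (subst ennreal_plus) auto
            also have "\<dots> \<le> 1 + R\<^sub>X 2 T \<omega>"
              using elim[rule_format, of 2 t T] t T by (intro add_left_mono) auto
            finally show "ennreal (\<bar>X t \<omega>\<bar> powr p) \<le> 1 + R\<^sub>X 2 T \<omega>" .
          qed
        qed
      qed
      also have "\<dots> = 1 + (\<integral>\<^sup>+\<omega>. R\<^sub>X 2 T \<omega> \<partial>P)" by (simp add: nn_integral_add emeasure_space_1)
      also have "\<dots> \<le> 1 + ennreal (second_moment_const T * (1 + max 0 R))"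
      proof (intro add_left_mono)
        have "second_moment_const T * (1 + (\<integral>\<omega>. (\<xi> \<omega>)\<^sup>2 \<partial>P)) \<le> second_moment_const T * (1 + max 0 R)"
          using \<xi>R second_moment_const_pos[of T] T by (intro mult_left_mono) auto
        thus "(\<integral>\<^sup>+\<omega>. R\<^sub>X 2 T \<omega> \<partial>P) \<le> ennreal (second_moment_const T * (1 + max 0 R))"
          by (intro order_trans[OF second_moment_bound[OF T]] ennreal_leI)
      qed
      also have "\<dots> = ennreal C"
        using second_moment_const_pos[of T] T unfolding C_def by (subst ennreal_plus) auto
      also have "\<dots> = ennreal C * 1" by simp
      also have "\<dots> \<le> ennreal C * (1 + (\<integral>\<^sup>+\<omega>. ennreal (\<bar>\<xi> \<omega>\<bar> powr p) \<partial>P))"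
        by (intro mult_left_mono) auto
      finally show "(\<integral>\<^sup>+\<omega>. (SUP t\<in>{0..T}. ennreal (\<bar>X t \<omega>\<bar> powr p)) \<partial>P)
          \<le> ennreal C * (1 + (\<integral>\<^sup>+\<omega>. ennreal (\<bar>\<xi> \<omega>\<bar> powr p) \<partial>P))" .
    qed
  next
    fix R :: real
    define C where "C = hoelder_const T (max 0 R) + 1"
    have C: "0 < C" using hoelder_const_nonneg[OF T, of "max 0 R"] by (simp add: C_def)
    show "\<exists>C>0. \<forall>\<xi> X K. admissible_initial P F h \<xi> \<longrightarrow> (\<integral>\<omega>. (\<xi> \<omega>)\<^sup>2 \<partial>P) \<le> R \<longrightarrow>
        deterministic_flat_solution P F B \<xi> b \<sigma> h X K \<longrightarrow>
        (\<forall>s t. 0 \<le> s \<longrightarrow> s \<le> t \<longrightarrow> t \<le> T \<longrightarrow> \<bar>K t - K s\<bar> \<le> C * \<bar>t - s\<bar> powr (1 / 2))"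
    proof (intro exI[of _ C] conjI allI impI C)
      fix \<xi> X K s t assume a: "admissible_initial P F h \<xi>" and \<xi>R: "(\<integral>\<omega>. (\<xi> \<omega>)\<^sup>2 \<partial>P) \<le> R"
        and sol: "deterministic_flat_solution P F B \<xi> b \<sigma> h X K" and st: "0 \<le> s" "s \<le> t" "t \<le> T"
      obtain I where "mv_solution P F B b \<sigma> h L m M \<xi> X K I" using a sol by (rule mv_solutionI)
      then interpret mv_solution P F B b \<sigma> h L m M \<xi> X K I .
      have "\<bar>K t - K s\<bar> \<le> hoelder_const T (max 0 R) * sqrt (t - s)"
        by (rule K_hoelder[OF T _ st]) (use \<xi>R in simp)
      also have "\<dots> \<le> C * sqrt (t - s)" using st by (intro mult_right_mono) (auto simp: C_def)
      finally show "\<bar>K t - K s\<bar> \<le> C * \<bar>t - s\<bar> powr (1 / 2)" using st by (simp add: powr_half_sqrt)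
    qed
  next
    fix \<xi> X K and p :: real
    assume a: "admissible_initial P F h \<xi>" and sol: "deterministic_flat_solution P F B \<xi> b \<sigma> h X K"
      and p: "1 \<le> p" and ip: "integrable P (\<lambda>\<omega>. \<bar>\<xi> \<omega>\<bar> powr p)"
    obtain I where "mv_solution P F B b \<sigma> h L m M \<xi> X K I" using a sol by (rule mv_solutionI)
    then interpret mv_solution P F B b \<sigma> h L m M \<xi> X K I .
    obtain C where "0 < C" and C: "\<And>s t. 0 \<le> s \<Longrightarrow> s \<le> t \<Longrightarrow> t \<le> T \<Longrightarrow>
      (\<integral>\<^sup>+\<omega>. ennreal (\<bar>X t \<omega> - X s \<omega>\<bar> powr p) \<partial>P) \<le> ennreal (C * (t - s) powr (p / 2))"
    proof (cases "2 \<le> p")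
      case True
      show ?thesis by (rule increment_moment[OF T True ip]) (rule that)
    next
      case False
      hence "p < 2" by simp
      show ?thesis by (rule increment_moment_small[OF T p \<open>p < 2\<close>]) (rule that)
    qed
    thus "\<exists>C>0. \<forall>s t. 0 \<le> s \<longrightarrow> s \<le> t \<longrightarrow> t \<le> T \<longrightarrow>
            (\<integral>\<^sup>+\<omega>. ennreal (\<bar>X t \<omega> - X s \<omega>\<bar> powr p) \<partial>P) \<le> ennreal (C * \<bar>t - s\<bar> powr (p / 2))"
      by (intro exI[of _ C]) simp
  qed
qed

end
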